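(* Let $T$ be an NIP metric theory. $T$ is distal if and only if for every definable predicate $\phi(x_1,\dots,x_n;y)$ and every $\varepsilon>0$, $\phi$ has the uniformly definable $\varepsilon$-strong Erdős–Hajnal property with respect to all tuples of Keisler measures $(\mu_1,\dots,\mu_n)$ with $\mu_i$ generically stable for $i<n$; specifically, there exist definable predicates $\psi_i(x_i;z_i)$ and $\delta>0$ such that if $M\models T$, $\mu_1\in\mathfrak M_{x_1}(M),\dots,\mu_n\in\mathfrak M_{x_n}(M)$ are such that $\mu_i$ is generically stable for $i<n$, and $b\in M^y$, then there are $d_i\in M^{z_i}$ such that the predicates $\psi_i(x_i;d_i)$ are $(\phi(x_1,\dots,x_n;b),\varepsilon)$-homogeneous and $\int_{S_{x_i}(M)}\psi_i(x_i;d_i)\,d\mu_i\ge\delta$ for each $i$. Furthermore, if $T$ is distal, then for every definable predicate $\phi(x_1,\dots,x_n;y)$ and any $\varepsilon>\gamma\ge0$ there are definable predicates $\psi_i(x_i;z_i)$ and $\delta>0$ such that if $M\models T$, $\mu_1\in\mathfrak M_{x_1}(M),\dots,\mu_n\in\mathfrak M_{x_n}(M)$ are such that $\mu_i$ is generically stable for $i<n$, $b\in M^y$, and $\omega$ is a product measure of $\mu_1,\dots,\mu_n$ with $\int_{S_{x_1\dots x_n}(M)}\phi(x_1,\dots,x_n;b)\,d\omega\ge\varepsilon$, then there are $d_i\in M^{z_i}$ such that $\phi(a_1,\dots,a_n;b)\ge\gamma$ whenever $\psi_i(a_i;d_i)>0$ for each $i$, and $\int_{S_{x_i}(M)}\psi_i(x_i;d_i)\,d\mu_i\ge\delta$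 for each $i$.
   Context: $T$ is a complete theory of metric structures in $[0,1]$-valued continuous logic, $\mathcal U$ a monster model. $S_x(M)$ is the space of complete types over $M$; definable predicates are continuous $[0,1]$-valued functions on type spaces (uniform limits of formulas), evaluated at tuples via their types; $\mathfrak M_x(M)$ is the set of Keisler measures (regular Borel probability measures on $S_x(M)$). $T$ is NIP if $\lim_i\phi(a_i;b)$ exists for every formula $\phi(x;y)$, indiscernible $(a_i:i<\omega)$ and $b$. $T$ is distal if whenever $I_1+I_2+I_3$ is indiscernible with each $I_j$ indexed by a dense linear order without endpoints, and $I_1+b_1+I_2+I_3$ and $I_1+I_2+b_2+I_3$ are indiscernible, then $I_1+b_1+I_2+b_2+I_3$ is indiscernible. $\mu\in\mathfrak M_x(M)$ is generically stable if it is the restriction to $M$ of a global Keisler measure that is $M$-invariant, definable over $M$ (for each formula $\phi(x;y)$ over $M$, $\mathrm{tp}(b/M)\mapsto\int\phi(x;b)\,d\mu$ is well defined and continuous on $S_y(M)$) and approximately realized in $M$ (in the weak$^*$ closure of the convex hull of Dirac measures at types of tuples from $M$). Predicates $\psi_i(x_i)$ are $(\phi,\varepsilon)$-homogeneous if $|\phi(a)-\phi(a')|\le\varepsilon$ for all $a,a'$ in the product of their supports $\{a_i\in M^{x_i}:\psi_i(a_i)>0\}$. A measure $\omega\in\mathfrak M_{x_1\dots x_n}(M)$ is a product measure of $\mu_1,\dots,\mu_n$ if $\int\prod_i\psi_i(x_i)\,d\omega=\prod_i\int\psi_i\,d\mu_i$ for all $M$-definable $\psi_i(x_i)$. *)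

theory Defs
  imports "HOL-Probability.Probability" "HOL-Library.More_List"
begin

unbundle cardinal_syntax

section \<open>Continuous logic\<close>

text \<open>
  Languages are many-sorted. A variable is a pair of its sort and an index, so every sort has
  infinitely many variables; a tuple of variables is a finite set of variables, a tuple of elements
  is an (extensional) function on such a set, and the concatenation of tuples of variables is the
  union of disjoint sets. Function and relation symbols carry moduli of uniform continuity.
\<close>

type_synonym 's var = "'s \<times> nat"

record ('s, 'f, 'r) language =
  funs :: "'f set"
  fargs :: "'f \<Rightarrow> 's list"
  fres :: "'f \<Rightarrow> 's"
  fmod :: "'f \<Rightarrow> real \<Rightarrow> real"
  rels :: "'r set"
  rargs :: "'r \<Rightarrow> 's list"
  rmod :: "'r \<Rightarrow> real \<Rightarrow> real"

definition wf_language :: "('s, 'f, 'r) language \<Rightarrow> bool" where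
  "wf_language L \<longleftrightarrow>
     (\<forall>f\<in>funs L. \<forall>\<epsilon>>0. fmod L f \<epsilon> > 0) \<and> (\<forall>r\<in>rels L. \<forall>\<epsilon>>0. rmod L r \<epsilon> > 0)"

record ('s, 'f, 'r, 'a) mstruct =
  univ :: "'s \<Rightarrow> 'a set"
  sdist :: "'s \<Rightarrow> 'a \<Rightarrow> 'a \<Rightarrow> real"
  ifun :: "'f \<Rightarrow> 'a list \<Rightarrow> 'a"
  irel :: "'r \<Rightarrow> 'a list \<Rightarrow> real"

abbreviation sorted_tuple :: "('s, 'f, 'r, 'a) mstruct \<Rightarrow> 's list \<Rightarrow> 'a list \<Rightarrow> bool" where
  "sorted_tuple N ss as \<equiv> list_all2 (\<lambda>a s. a \<in> univ N s) as ss"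

abbreviation close_tuples ::
  "('s, 'f, 'r, 'a) mstruct \<Rightarrow> 's list \<Rightarrow> real \<Rightarrow> 'a list \<Rightarrow> 'a list \<Rightarrow> bool" where
  "close_tuples N ss \<eta> as bs \<equiv> (\<forall>i<length ss. sdist N (ss ! i) (as ! i) (bs ! i) < \<eta>)"

definition metric_structure ::
  "('s, 'f, 'r) language \<Rightarrow> ('s, 'f, 'r, 'a) mstruct \<Rightarrow> bool" where
  "metric_structure L N \<longleftrightarrow>
     (\<forall>s. univ N s \<noteq> {} \<and> Metric_space (univ N s) (sdist N s) \<and>
          Metric_space.mcomplete (univ N s) (sdist N s) \<and>
          (\<forall>a\<in>univ N s. \<forall>b\<in>univ N s. sdist N s a b \<le> 1)) \<and>
     (\<forall>f\<in>funs L. \<forall>as. sorted_tuple N (fargs L f) as \<longrightarrow>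
        ifun N f as \<in> univ N (fres L f) \<and>
        (\<forall>\<epsilon>>0. \<forall>bs. sorted_tuple N (fargs L f) bs \<and>
           close_tuples N (fargs L f) (fmod L f \<epsilon>) as bs \<longrightarrow>
           sdist N (fres L f) (ifun N f as) (ifun N f bs) \<le> \<epsilon>)) \<and>
     (\<forall>r\<in>rels L. \<forall>as. sorted_tuple N (rargs L r) as \<longrightarrow>
        irel N r as \<in> {0..1} \<and>
        (\<forall>\<epsilon>>0. \<forall>bs. sorted_tuple N (rargs L r) bs \<and>
           close_tuples N (rargs L r) (rmod L r \<epsilon>) as bs \<longrightarrow>
           \<bar>irel N r as - irel N r bs\<bar> \<le> \<epsilon>))"

text \<open>
  \<open>Par s a\<close> is a constant symbol naming the element \<open>a\<close> of sort \<open>s\<close>; formulas over a parameter set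
  \<open>A\<close> may use these for \<open>a \<in> A s\<close>.
  The connectives are all continuous functions \<open>[0,1]\<^sup>n \<rightarrow> [0,1]\<close>. An \<open>n\<close>-ary connective is
  represented by a continuous function on sequences, which is applied to the sequence of the \<open>n\<close>
  values of its arguments, continued by zeros.
\<close>

datatype ('s, 'f, 'a) trm =
    Var "'s var"
  | Par 's 'a
  | Fn 'f "('s, 'f, 'a) trm list"

datatype ('s, 'f, 'r, 'a) fml =
    Dst 's "('s, 'f, 'a) trm" "('s, 'f, 'a) trm"
  | Rel 'r "('s, 'f, 'a) trm list"
  | Conn "(nat \<Rightarrow> real) \<Rightarrow> real" "('s, 'f, 'r, 'a) fml list"
  | SupQ "'s var" "('s, 'f, 'r, 'a) fml"
  | InfQ "'s var" "('s, 'f, 'r, 'a) fml"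

definition connective :: "((nat \<Rightarrow> real) \<Rightarrow> real) \<Rightarrow> bool" where
  "connective u \<longleftrightarrow>
     continuous_on {v. \<forall>i. v i \<in> {0..1}} u \<and> (\<forall>v. (\<forall>i. v i \<in> {0..1}) \<longrightarrow> u v \<in> {0..1})"

inductive wf_trm ::
  "('s, 'f, 'r) language \<Rightarrow> ('s \<Rightarrow> 'a set) \<Rightarrow> ('s, 'f, 'a) trm \<Rightarrow> 's \<Rightarrow> bool" for L A where
  "wf_trm L A (Var v) (fst v)"
| "a \<in> A s \<Longrightarrow> wf_trm L A (Par s a) s"
| "f \<in> funs L \<Longrightarrow> list_all2 (wf_trm L A) ts (fargs L f) \<Longrightarrow> wf_trm L A (Fn f ts) (fres L f)"

fun wf_fml ::
  "('s, 'f, 'r) language \<Rightarrow> ('s \<Rightarrow> 'a set) \<Rightarrow> ('s, 'f, 'r, 'a) fml \<Rightarrow> bool" where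
  "wf_fml L A (Dst s t u) \<longleftrightarrow> wf_trm L A t s \<and> wf_trm L A u s"
| "wf_fml L A (Rel r ts) \<longleftrightarrow> r \<in> rels L \<and> list_all2 (wf_trm L A) ts (rargs L r)"
| "wf_fml L A (Conn u \<phi>s) \<longleftrightarrow> connective u \<and> (\<forall>\<phi>\<in>set \<phi>s. wf_fml L A \<phi>)"
| "wf_fml L A (SupQ w \<phi>) \<longleftrightarrow> wf_fml L A \<phi>"
| "wf_fml L A (InfQ w \<phi>) \<longleftrightarrow> wf_fml L A \<phi>"

fun tvars :: "('s, 'f, 'a) trm \<Rightarrow> 's var set" where
  "tvars (Var v) = {v}"
| "tvars (Par s a) = {}"
| "tvars (Fn f ts) = (\<Union>t\<in>set ts. tvars t)"

fun fvars :: "('s, 'f, 'r, 'a) fml \<Rightarrow> 's var set" where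
  "fvars (Dst s t u) = tvars t \<union> tvars u"
| "fvars (Rel r ts) = (\<Union>t\<in>set ts. tvars t)"
| "fvars (Conn u \<phi>s) = (\<Union>\<phi>\<in>set \<phi>s. fvars \<phi>)"
| "fvars (SupQ w \<phi>) = fvars \<phi> - {w}"
| "fvars (InfQ w \<phi>) = fvars \<phi> - {w}"

fun tval :: "('s, 'f, 'r, 'a) mstruct \<Rightarrow> ('s var \<Rightarrow> 'a) \<Rightarrow> ('s, 'f, 'a) trm \<Rightarrow> 'a" where
  "tval N v (Var w) = v w"
| "tval N v (Par s a) = a"
| "tval N v (Fn f ts) = ifun N f (map (tval N v) ts)"

fun fval :: "('s, 'f, 'r, 'a) mstruct \<Rightarrow> ('s var \<Rightarrow> 'a) \<Rightarrow> ('s, 'f, 'r, 'a) fml \<Rightarrow> real" where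
  "fval N v (Dst s t u) = sdist N s (tval N v t) (tval N v u)"
| "fval N v (Rel r ts) = irel N r (map (tval N v) ts)"
| "fval N v (Conn u \<phi>s) = u (nth_default 0 (map (fval N v) \<phi>s))"
| "fval N v (SupQ w \<phi>) = (SUP a\<in>univ N (fst w). fval N (v(w := a)) \<phi>)"
| "fval N v (InfQ w \<phi>) = (INF a\<in>univ N (fst w). fval N (v(w := a)) \<phi>)"

text \<open>\<open>Fml L A x\<close>: the formulas over \<open>A\<close> with free variables in \<open>x\<close>.
  \<open>tuples N x\<close>: the set usually written \<open>N\<^sup>x\<close>.\<close>

definition Fml ::
  "('s, 'f, 'r) language \<Rightarrow> ('s \<Rightarrow> 'a set) \<Rightarrow> 's var set \<Rightarrow> ('s, 'f, 'r, 'a) fml set" where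
  "Fml L A x = {\<phi>. wf_fml L A \<phi> \<and> fvars \<phi> \<subseteq> x}"

abbreviation no_params :: "'s \<Rightarrow> 'a set" where
  "no_params \<equiv> (\<lambda>_. {})"

definition tuples :: "('s, 'f, 'r, 'a) mstruct \<Rightarrow> 's var set \<Rightarrow> ('s var \<Rightarrow> 'a) set" where
  "tuples N x = (\<Pi>\<^sub>E v\<in>x. univ N (fst v))"

text \<open>The theory of \<open>N\<close> is the set of sentences \<open>\<sigma>\<close> such that \<open>\<sigma> = 0\<close> holds in \<open>N\<close>;
  the complete theories are the theories of this form.\<close>

definition Th :: "('s, 'f, 'r) language \<Rightarrow> ('s, 'f, 'r, 'a) mstruct \<Rightarrow> ('s, 'f, 'r, 'a) fml set" where
  "Th L N = {\<sigma> \<in> Fml L no_params {}. fval N undefined \<sigma> = 0}"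

definition models ::
  "('s, 'f, 'r) language \<Rightarrow> ('s, 'f, 'r, 'a) fml set \<Rightarrow> ('s, 'f, 'r, 'a) mstruct \<Rightarrow> bool" where
  "models L T N \<longleftrightarrow> metric_structure L N \<and> (\<forall>\<sigma>\<in>T. fval N undefined \<sigma> = 0)"

definition elementary_substructure ::
  "('s, 'f, 'r) language \<Rightarrow> ('s, 'f, 'r, 'a) mstruct \<Rightarrow> ('s, 'f, 'r, 'a) mstruct \<Rightarrow> bool" where
  "elementary_substructure L M N \<longleftrightarrow>
     metric_structure L M \<and> metric_structure L N \<and>
     (\<forall>s. univ M s \<subseteq> univ N s \<and>
          (\<forall>a\<in>univ M s. \<forall>b\<in>univ M s. sdist M s a b = sdist N s a b)) \<and>
     (\<forall>f\<in>funs L. \<forall>as. sorted_tuple M (fargs L f) as \<longrightarrow> ifun M f as = ifun N f as) \<and>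
     (\<forall>r\<in>rels L. \<forall>as. sorted_tuple M (rargs L r) as \<longrightarrow> irel M r as = irel N r as) \<and>
     (\<forall>x. finite x \<longrightarrow> (\<forall>\<phi>\<in>Fml L no_params x. \<forall>a\<in>tuples M x. fval M a \<phi> = fval N a \<phi>))"


section \<open>Types and definable predicates\<close>

definition tp ::
  "('s, 'f, 'r) language \<Rightarrow> ('s, 'f, 'r, 'a) mstruct \<Rightarrow> ('s \<Rightarrow> 'a set) \<Rightarrow> 's var set \<Rightarrow>
   ('s var \<Rightarrow> 'a) \<Rightarrow> ('s, 'f, 'r, 'a) fml \<Rightarrow> real" where
  "tp L N A x a = (\<lambda>\<phi>\<in>Fml L A x. fval N a \<phi>)"

text \<open>
  A complete type over \<open>A\<close> (a subset of \<open>N\<close>) in the variables \<open>x\<close> assigns a value to every formula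
  over \<open>A\<close> in \<open>x\<close> such that the set of conditions \<open>\<phi>(x) = p \<phi>\<close> is consistent with the elementary
  diagram of \<open>N\<close>, that is, approximately finitely satisfiable in \<open>N\<close>.
  The type space carries the logic topology, the coarsest one making all \<open>p \<mapsto> p \<phi>\<close> continuous.
\<close>

definition types ::
  "('s, 'f, 'r) language \<Rightarrow> ('s, 'f, 'r, 'a) mstruct \<Rightarrow> ('s \<Rightarrow> 'a set) \<Rightarrow> 's var set \<Rightarrow>
   (('s, 'f, 'r, 'a) fml \<Rightarrow> real) set" where
  "types L N A x =
     {p \<in> Fml L A x \<rightarrow>\<^sub>E {0..1}.
        \<forall>F \<epsilon>. finite F \<and> F \<subseteq> Fml L A x \<and> \<epsilon> > 0 \<longrightarrow>
          (\<exists>a\<in>tuples N x. \<forall>\<phi>\<in>F. \<bar>fval N a \<phi> - p \<phi>\<bar> < \<epsilon>)}"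

definition type_space ::
  "('s, 'f, 'r) language \<Rightarrow> ('s, 'f, 'r, 'a) mstruct \<Rightarrow> ('s \<Rightarrow> 'a set) \<Rightarrow> 's var set \<Rightarrow>
   (('s, 'f, 'r, 'a) fml \<Rightarrow> real) topology" where
  "type_space L N A x =
     subtopology (product_topology (\<lambda>_. euclideanreal) (Fml L A x)) (types L N A x)"

definition definable_predicates ::
  "('s, 'f, 'r) language \<Rightarrow> ('s, 'f, 'r, 'a) mstruct \<Rightarrow> ('s \<Rightarrow> 'a set) \<Rightarrow> 's var set \<Rightarrow>
   ((('s, 'f, 'r, 'a) fml \<Rightarrow> real) \<Rightarrow> real) set" where
  "definable_predicates L N A x =
     {P. continuous_map (type_space L N A x) (top_of_set {0..1}) P}"

text \<open>For disjoint \<open>x\<close> and \<open>z\<close>, the concatenation of the tuples \<open>a\<close> (in the variables \<open>x\<close>) and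
  \<open>d\<close> (in the variables \<open>z\<close>) is \<open>override_on d a x\<close>; the value of \<open>P(x;z)\<close> at \<open>(a;d)\<close> is the value
  of \<open>P\<close> at the type of \<open>(a;d)\<close>.\<close>

definition pred_at ::
  "('s, 'f, 'r) language \<Rightarrow> ('s, 'f, 'r, 'a) mstruct \<Rightarrow> 's var set \<Rightarrow> 's var set \<Rightarrow>
   ((('s, 'f, 'r, 'a) fml \<Rightarrow> real) \<Rightarrow> real) \<Rightarrow> ('s var \<Rightarrow> 'a) \<Rightarrow> ('s var \<Rightarrow> 'a) \<Rightarrow> real" where
  "pred_at L N x z P a d = P (tp L N no_params (x \<union> z) (override_on d a x))"

text \<open>\<open>finst z d \<phi>\<close> is the formula \<open>\<phi>(d)\<close> obtained by plugging in the tuple \<open>d\<close> for the variables \<open>z\<close>.\<close>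

fun tinst :: "'s var set \<Rightarrow> ('s var \<Rightarrow> 'a) \<Rightarrow> ('s, 'f, 'a) trm \<Rightarrow> ('s, 'f, 'a) trm" where
  "tinst z d (Var v) = (if v \<in> z then Par (fst v) (d v) else Var v)"
| "tinst z d (Par s a) = Par s a"
| "tinst z d (Fn f ts) = Fn f (map (tinst z d) ts)"

fun finst :: "'s var set \<Rightarrow> ('s var \<Rightarrow> 'a) \<Rightarrow> ('s, 'f, 'r, 'a) fml \<Rightarrow> ('s, 'f, 'r, 'a) fml" where
  "finst z d (Dst s t u) = Dst s (tinst z d t) (tinst z d u)"
| "finst z d (Rel r ts) = Rel r (map (tinst z d) ts)"
| "finst z d (Conn u \<phi>s) = Conn u (map (finst z d) \<phi>s)"
| "finst z d (SupQ w \<phi>) = SupQ w (finst (z - {w}) d \<phi>)"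
| "finst z d (InfQ w \<phi>) = InfQ w (finst (z - {w}) d \<phi>)"

text \<open>The value of \<open>P(x;d)\<close> at a type \<open>p\<close> in the variables \<open>x\<close> over a set containing \<open>d\<close>: the value
  of \<open>P\<close> at the type of \<open>(a;d)\<close> for any realization \<open>a\<close> of \<open>p\<close>.\<close>

definition pred_at_type ::
  "('s, 'f, 'r) language \<Rightarrow> 's var set \<Rightarrow> 's var set \<Rightarrow>
   ((('s, 'f, 'r, 'a) fml \<Rightarrow> real) \<Rightarrow> real) \<Rightarrow> ('s var \<Rightarrow> 'a) \<Rightarrow>
   (('s, 'f, 'r, 'a) fml \<Rightarrow> real) \<Rightarrow> real" where
  "pred_at_type L x z P d p = P (\<lambda>\<phi>\<in>Fml L no_params (x \<union> z). p (finst z d \<phi>))"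

text \<open>The two evaluations agree: the value of \<open>P(x;d)\<close> at the type of \<open>a\<close> over \<open>A\<close> is \<open>P(a;d)\<close>
  (\<open>pred_at_type_tp\<close>).\<close>

lemma tval_tinst: "tval N v (tinst z d t) = tval N (override_on v d z) t"
  by (induction t) (auto simp: override_on_def comp_def cong: map_cong)

lemma fval_finst: "fval N v (finst z d \<phi>) = fval N (override_on v d z) \<phi>"
proof (induction \<phi> arbitrary: v z)
  case (SupQ w \<phi>)
  have "override_on (v(w := a)) d (z - {w}) = (override_on v d z)(w := a)" for a
    by (auto simp: override_on_def)
  then show ?case by (simp only: finst.simps fval.simps SupQ.IH)
next
  case (InfQ w \<phi>)
  have "override_on (v(w := a)) d (z - {w}) = (override_on v d z)(w := a)" for a
    by (auto simp: override_on_def)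
  then show ?case by (simp only: finst.simps fval.simps InfQ.IH)
next
  case (Rel r ts)
  then show ?case by (simp add: tval_tinst comp_def)
next
  case (Conn u ts)
  have "map (\<lambda>p. fval N v (finst z d p)) ts = map (fval N (override_on v d z)) ts"
    using Conn by auto
  then show ?case by (simp add: comp_def del: map_eq_conv)
qed (simp add: tval_tinst)

lemma tval_cong: "(\<And>w. w \<in> tvars t \<Longrightarrow> v w = v' w) \<Longrightarrow> tval N v t = tval N v' t"
proof (induction t)
  case (Fn f ts)
  have "tval N v t = tval N v' t" if "t \<in> set ts" for t
    by (rule Fn.IH[OF that]) (use that Fn.prems in auto)
  then have "map (tval N v) ts = map (tval N v') ts" by simp
  then show ?case by (simp del: map_eq_conv)
qed auto

lemma fval_cong: "(\<And>w. w \<in> fvars \<phi> \<Longrightarrow> v w = v' w) \<Longrightarrow> fval N v \<phi> = fval N v' \<phi>"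
proof (induction \<phi> arbitrary: v v')
  case (Dst s t u) then show ?case using tval_cong[of t v v' N] tval_cong[of u v v' N] by auto
next
  case (Rel r ts)
  have "tval N v t = tval N v' t" if "t \<in> set ts" for t
    by (rule tval_cong) (use that Rel.prems in auto)
  then have "map (tval N v) ts = map (tval N v') ts" by simp
  then show ?case by (simp del: map_eq_conv)
next
  case (Conn u ts)
  have "fval N v p = fval N v' p" if "p \<in> set ts" for p
    by (rule Conn.IH[OF that]) (use that Conn.prems in auto)
  then have "map (fval N v) ts = map (fval N v') ts" by simp
  then show ?case by (simp del: map_eq_conv)
next
  case (SupQ w \<phi>)
  have "fval N (v(w := a)) \<phi> = fval N (v'(w := a)) \<phi>" for a
    by (rule SupQ.IH) (use SupQ.prems in auto)
  then show ?case by simp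
next
  case (InfQ w \<phi>)
  have "fval N (v(w := a)) \<phi> = fval N (v'(w := a)) \<phi>" for a
    by (rule InfQ.IH) (use InfQ.prems in auto)
  then show ?case by simp
qed

lemma wf_tinst:
  assumes "wf_trm L no_params t s" "\<forall>v\<in>z. d v \<in> A (fst v)"
  shows "wf_trm L A (tinst z d t) s"
  using assms(1)
proof (induction rule: wf_trm.induct)
  case (1 v) then show ?case using assms(2) by (auto intro: wf_trm.intros)
next
  case (3 f ts)
  then show ?case by (auto intro!: wf_trm.intros simp: list_all2_conv_all_nth)
qed auto

lemma wf_finst:
  assumes "wf_fml L no_params \<phi>" "\<forall>v\<in>z. d v \<in> A (fst v)"
  shows "wf_fml L A (finst z d \<phi>)"
  using assms
  by (induction \<phi> arbitrary: z) (auto simp: list_all2_conv_all_nth wf_tinst)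

lemma tvars_tinst: "tvars (tinst z d t) = tvars t - z"
  by (induction t) auto
lemma fvars_finst: "fvars (finst z d \<phi>) = fvars \<phi> - z"
  by (induction \<phi> arbitrary: z) (auto simp: tvars_tinst)

lemma pred_at_type_tp:
  assumes "x \<inter> z = {}" "\<forall>v\<in>z. d v \<in> A (fst v)"
  shows "pred_at_type L x z P d (tp L N A x a) = pred_at L N x z P a d"
proof -
  have "tp L N A x a (finst z d \<phi>) = fval N (override_on d a x) \<phi>"
    if \<phi>: "\<phi> \<in> Fml L no_params (x \<union> z)" for \<phi>
  proof -
    have "finst z d \<phi> \<in> Fml L A x"
      using \<phi> assms wf_finst[of L \<phi> z d A] fvars_finst[of z d \<phi>] by (auto simp: Fml_def)
    then have "tp L N A x a (finst z d \<phi>) = fval N (override_on a d z) \<phi>"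
      by (simp add: tp_def fval_finst)
    also have "\<dots> = fval N (override_on d a x) \<phi>"
      by (rule fval_cong) (use \<phi> assms in \<open>auto simp: Fml_def override_on_def\<close>)
    finally show ?thesis .
  qed
  then show ?thesis
    unfolding pred_at_type_def pred_at_def tp_def[of L N no_params]
    by - (rule arg_cong[where f = P], rule restrict_ext)
qed


section \<open>Monster models\<close>

definition small :: "'k rel \<Rightarrow> ('s \<Rightarrow> 'a set) \<Rightarrow> bool" where
  "small \<kappa> A \<longleftrightarrow> |SIGMA s:UNIV. A s| <o \<kappa>"

definition saturated ::
  "('s, 'f, 'r) language \<Rightarrow> 'k rel \<Rightarrow> ('s, 'f, 'r, 'a) mstruct \<Rightarrow> bool" where
  "saturated L \<kappa> U \<longleftrightarrow>
     (\<forall>A x p. (\<forall>s. A s \<subseteq> univ U s) \<and> small \<kappa> A \<and> finite x \<and> p \<in> types L U A x \<longrightarrow>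
        (\<exists>a\<in>tuples U x. tp L U A x a = p))"

definition automorphism ::
  "('s, 'f, 'r) language \<Rightarrow> ('s, 'f, 'r, 'a) mstruct \<Rightarrow> ('s \<Rightarrow> 'a \<Rightarrow> 'a) \<Rightarrow> bool" where
  "automorphism L U g \<longleftrightarrow>
     (\<forall>s. bij_betw (g s) (univ U s) (univ U s) \<and>
          (\<forall>a\<in>univ U s. \<forall>b\<in>univ U s. sdist U s (g s a) (g s b) = sdist U s a b)) \<and>
     (\<forall>f\<in>funs L. \<forall>as. sorted_tuple U (fargs L f) as \<longrightarrow>
        ifun U f (map2 g (fargs L f) as) = g (fres L f) (ifun U f as)) \<and>
     (\<forall>r\<in>rels L. \<forall>as. sorted_tuple U (rargs L r) as \<longrightarrow>
        irel U r (map2 g (rargs L r) as) = irel U r as)"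

definition partial_elementary_map ::
  "('s, 'f, 'r) language \<Rightarrow> ('s, 'f, 'r, 'a) mstruct \<Rightarrow> ('s \<Rightarrow> 'a set) \<Rightarrow>
   ('s \<Rightarrow> 'a \<Rightarrow> 'a) \<Rightarrow> bool" where
  "partial_elementary_map L U A h \<longleftrightarrow>
     (\<forall>s. A s \<subseteq> univ U s \<and> h s ` A s \<subseteq> univ U s) \<and>
     (\<forall>x. finite x \<longrightarrow> (\<forall>\<phi>\<in>Fml L no_params x. \<forall>a. (\<forall>v\<in>x. a v \<in> A (fst v)) \<longrightarrow>
        fval U (\<lambda>v. h (fst v) (a v)) \<phi> = fval U a \<phi>))"

definition strongly_homogeneous ::
  "('s, 'f, 'r) language \<Rightarrow> 'k rel \<Rightarrow> ('s, 'f, 'r, 'a) mstruct \<Rightarrow> bool" where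
  "strongly_homogeneous L \<kappa> U \<longleftrightarrow>
     (\<forall>A h. small \<kappa> A \<and> partial_elementary_map L U A h \<longrightarrow>
        (\<exists>g. automorphism L U g \<and> (\<forall>s. \<forall>a\<in>A s. g s a = h s a)))"

text \<open>
  \<open>U\<close> is a monster model of the complete theory \<open>T\<close>, where \<open>small\<close> means of cardinality less
  than \<open>\<kappa>\<close>. The cardinal \<open>\<kappa>\<close> is large enough for small complete models to exist over every
  countable set of parameters.
\<close>

definition monster_model ::
  "('s, 'f, 'r) language \<Rightarrow> 'k rel \<Rightarrow> ('s, 'f, 'r, 'a) fml set \<Rightarrow>
   ('s, 'f, 'r, 'a) mstruct \<Rightarrow> bool" where
  "monster_model L \<kappa> T U \<longleftrightarrow>
     metric_structure L U \<and> T = Th L U \<and>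
     Card_order \<kappa> \<and> |Pow ((UNIV :: 's var set) <+> (funs L <+> rels L))| <o \<kappa> \<and>
     saturated L \<kappa> U \<and> strongly_homogeneous L \<kappa> U"

text \<open>As usual, models of \<open>T\<close> other than \<open>U\<close> are small elementary substructures of \<open>U\<close>.\<close>

definition small_model ::
  "('s, 'f, 'r) language \<Rightarrow> 'k rel \<Rightarrow> ('s, 'f, 'r, 'a) fml set \<Rightarrow>
   ('s, 'f, 'r, 'a) mstruct \<Rightarrow> ('s, 'f, 'r, 'a) mstruct \<Rightarrow> bool" where
  "small_model L \<kappa> T U M \<longleftrightarrow>
     models L T M \<and> elementary_substructure L M U \<and> small \<kappa> (univ M)"


section \<open>Indiscernible sequences, NIP and distality\<close>

text \<open>A sequence is indexed by a set with a strict linear order.\<close>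

record ('i, 'e) sequence =
  idx :: "'i set"
  lt :: "'i rel"
  entry :: "'i \<Rightarrow> 'e"

definition strict_linear_order :: "('i, 'e) sequence \<Rightarrow> bool" where
  "strict_linear_order I \<longleftrightarrow>
     lt I \<subseteq> idx I \<times> idx I \<and> irrefl (lt I) \<and> trans (lt I) \<and> total_on (idx I) (lt I)"

definition dense_without_endpoints :: "('i, 'e) sequence \<Rightarrow> bool" where
  "dense_without_endpoints I \<longleftrightarrow>
     strict_linear_order I \<and> idx I \<noteq> {} \<and>
     (\<forall>i j. (i, j) \<in> lt I \<longrightarrow> (\<exists>k. (i, k) \<in> lt I \<and> (k, j) \<in> lt I)) \<and>
     (\<forall>i\<in>idx I. (\<exists>j. (j, i) \<in> lt I) \<and> (\<exists>j. (i, j) \<in> lt I))"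

definition single :: "'e \<Rightarrow> ('i, 'e) sequence" where
  "single b = \<lparr>idx = {undefined}, lt = {}, entry = (\<lambda>_. b)\<rparr>"

text \<open>The sum \<open>I\<^sub>0 + I\<^sub>1 + \<dots>\<close> of a list of sequences.\<close>

definition seq_sum :: "('i, 'e) sequence list \<Rightarrow> (nat \<times> 'i, 'e) sequence" where
  "seq_sum Is =
     \<lparr>idx = (SIGMA k:{..<length Is}. idx (Is ! k)),
      lt = {((k, i), (l, j)). k < length Is \<and> l < length Is \<and> i \<in> idx (Is ! k) \<and> j \<in> idx (Is ! l) \<and>
              (k < l \<or> k = l \<and> (i, j) \<in> lt (Is ! k))},
      entry = (\<lambda>(k, i). entry (Is ! k) i)\<rparr>"

text \<open>
  Indiscernibility compares the types of the concatenated tuples at two increasing lists of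
  indices. Since the entries all use the same variables \<open>x\<close>, a formula about the concatenation
  comes with a map \<open>\<rho>\<close> sending each of its free variables to a position in the list and a variable
  of \<open>x\<close> of the same sort.
\<close>

definition indiscernible ::
  "('s, 'f, 'r) language \<Rightarrow> ('s, 'f, 'r, 'a) mstruct \<Rightarrow> 's var set \<Rightarrow>
   ('i, 's var \<Rightarrow> 'a) sequence \<Rightarrow> bool" where
  "indiscernible L U x I \<longleftrightarrow>
     strict_linear_order I \<and> entry I ` idx I \<subseteq> tuples U x \<and>
     (\<forall>is js \<rho> \<phi>.
        set is \<subseteq> idx I \<and> set js \<subseteq> idx I \<and> length is = length js \<and>
        sorted_wrt (\<lambda>i j. (i, j) \<in> lt I) is \<and> sorted_wrt (\<lambda>i j. (i, j) \<in> lt I) js \<and>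
        \<phi> \<in> Fml L no_params {v. fst (\<rho> v) < length is \<and> snd (\<rho> v) \<in> x \<and> fst (snd (\<rho> v)) = fst v} \<longrightarrow>
        fval U (\<lambda>v. entry I (is ! fst (\<rho> v)) (snd (\<rho> v))) \<phi> =
        fval U (\<lambda>v. entry I (js ! fst (\<rho> v)) (snd (\<rho> v))) \<phi>)"

definition NIP :: "('s, 'f, 'r) language \<Rightarrow> ('s, 'f, 'r, 'a) mstruct \<Rightarrow> bool" where
  "NIP L U \<longleftrightarrow>
     (\<forall>x y \<phi> a b. finite x \<and> finite y \<and> x \<inter> y = {} \<and> \<phi> \<in> Fml L no_params (x \<union> y) \<and>
        indiscernible L U x \<lparr>idx = UNIV, lt = {(i, j). i < j}, entry = (a :: nat \<Rightarrow> _)\<rparr> \<and>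
        b \<in> tuples U y \<longrightarrow>
        convergent (\<lambda>i. fval U (override_on b (a i) x) \<phi>))"

text \<open>The dense orders range over all orders on subsets of the type \<open>'i\<close>.\<close>

definition distal ::
  "'i itself \<Rightarrow> ('s, 'f, 'r) language \<Rightarrow> ('s, 'f, 'r, 'a) mstruct \<Rightarrow> bool" where
  "distal _ L U \<longleftrightarrow>
     (\<forall>x (I\<^sub>1 :: ('i, 's var \<Rightarrow> 'a) sequence) I\<^sub>2 I\<^sub>3 b\<^sub>1 b\<^sub>2.
        finite x \<and>
        dense_without_endpoints I\<^sub>1 \<and> dense_without_endpoints I\<^sub>2 \<and> dense_without_endpoints I\<^sub>3 \<and>
        indiscernible L U x (seq_sum [I\<^sub>1, I\<^sub>2, I\<^sub>3]) \<and>
        indiscernible L U x (seq_sum [I\<^sub>1, single b\<^sub>1, I\<^sub>2, I\<^sub>3]) \<and>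
        indiscernible L U x (seq_sum [I\<^sub>1, I\<^sub>2, single b\<^sub>2, I\<^sub>3]) \<longrightarrow>
        indiscernible L U x (seq_sum [I\<^sub>1, single b\<^sub>1, I\<^sub>2, single b\<^sub>2, I\<^sub>3]))"


section \<open>Keisler measures\<close>

definition borel_of_space :: "'b topology \<Rightarrow> 'b measure" where
  "borel_of_space X = sigma (topspace X) {V. openin X V}"

definition regular_borel_probability :: "'b topology \<Rightarrow> 'b measure \<Rightarrow> bool" where
  "regular_borel_probability X \<mu> \<longleftrightarrow>
     prob_space \<mu> \<and> sets \<mu> = sets (borel_of_space X) \<and>
     (\<forall>B\<in>sets \<mu>. \<forall>\<epsilon>>0. \<exists>K V. compactin X K \<and> openin X V \<and> K \<subseteq> B \<and> B \<subseteq> V \<and>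
        measure \<mu> (V - K) < \<epsilon>)"

definition keisler_measures ::
  "('s, 'f, 'r) language \<Rightarrow> ('s, 'f, 'r, 'a) mstruct \<Rightarrow> ('s \<Rightarrow> 'a set) \<Rightarrow> 's var set \<Rightarrow>
   (('s, 'f, 'r, 'a) fml \<Rightarrow> real) measure set" where
  "keisler_measures L U A x = {\<mu>. regular_borel_probability (type_space L U A x) \<mu>}"

definition restrict_measure ::
  "('s, 'f, 'r) language \<Rightarrow> ('s, 'f, 'r, 'a) mstruct \<Rightarrow> ('s \<Rightarrow> 'a set) \<Rightarrow> 's var set \<Rightarrow>
   (('s, 'f, 'r, 'a) fml \<Rightarrow> real) measure \<Rightarrow> (('s, 'f, 'r, 'a) fml \<Rightarrow> real) measure" where
  "restrict_measure L U A x \<nu> =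
     distr \<nu> (borel_of_space (type_space L U A x)) (\<lambda>p. restrict p (Fml L A x))"

definition invariant_measure ::
  "('s, 'f, 'r) language \<Rightarrow> ('s, 'f, 'r, 'a) mstruct \<Rightarrow> ('s \<Rightarrow> 'a set) \<Rightarrow> 's var set \<Rightarrow>
   (('s, 'f, 'r, 'a) fml \<Rightarrow> real) measure \<Rightarrow> bool" where
  "invariant_measure L U A x \<nu> \<longleftrightarrow>
     (\<forall>y. finite y \<and> x \<inter> y = {} \<longrightarrow>
        (\<forall>\<phi>\<in>Fml L A (x \<union> y). \<forall>b\<in>tuples U y. \<forall>b'\<in>tuples U y. tp L U A y b = tp L U A y b' \<longrightarrow>
           (\<integral>p. p (finst y b \<phi>) \<partial>\<nu>) = (\<integral>p. p (finst y b' \<phi>) \<partial>\<nu>)))"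

definition definable_measure ::
  "('s, 'f, 'r) language \<Rightarrow> ('s, 'f, 'r, 'a) mstruct \<Rightarrow> ('s \<Rightarrow> 'a set) \<Rightarrow> 's var set \<Rightarrow>
   (('s, 'f, 'r, 'a) fml \<Rightarrow> real) measure \<Rightarrow> bool" where
  "definable_measure L U A x \<nu> \<longleftrightarrow>
     (\<forall>y. finite y \<and> x \<inter> y = {} \<longrightarrow>
        (\<forall>\<phi>\<in>Fml L A (x \<union> y). \<exists>F. continuous_map (type_space L U A y) euclideanreal F \<and>
           (\<forall>b\<in>tuples U y. F (tp L U A y b) = (\<integral>p. p (finst y b \<phi>) \<partial>\<nu>))))"

definition weak_star_topology ::
  "('s, 'f, 'r) language \<Rightarrow> ('s, 'f, 'r, 'a) mstruct \<Rightarrow> ('s \<Rightarrow> 'a set) \<Rightarrow> 's var set \<Rightarrow>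
   (('s, 'f, 'r, 'a) fml \<Rightarrow> real) measure topology" where
  "weak_star_topology L U A x =
     topology_generated_by
       {{\<mu> \<in> keisler_measures L U A x. (\<integral>p. f p \<partial>\<mu>) \<in> V} | f V.
          continuous_map (type_space L U A x) euclideanreal f \<and> open V}"

text \<open>The convex hull of the Dirac measures (on the type space over \<open>U\<close>) at the types of tuples from \<open>M\<close>.\<close>

definition dirac_hull ::
  "('s, 'f, 'r) language \<Rightarrow> ('s, 'f, 'r, 'a) mstruct \<Rightarrow> ('s, 'f, 'r, 'a) mstruct \<Rightarrow> 's var set \<Rightarrow>
   (('s, 'f, 'r, 'a) fml \<Rightarrow> real) measure set" where
  "dirac_hull L U M x =
     {\<mu> \<in> keisler_measures L U (univ U) x.
        \<exists>F w. finite F \<and> F \<subseteq> tuples M x \<and> (\<forall>a\<in>F. w a \<ge> 0) \<and> sum w F = 1 \<and>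
          (\<forall>B\<in>sets \<mu>. measure \<mu> B = (\<Sum>a\<in>F. w a * indicator B (tp L U (univ U) x a)))}"

definition generically_stable ::
  "('s, 'f, 'r) language \<Rightarrow> ('s, 'f, 'r, 'a) mstruct \<Rightarrow> ('s, 'f, 'r, 'a) mstruct \<Rightarrow> 's var set \<Rightarrow>
   (('s, 'f, 'r, 'a) fml \<Rightarrow> real) measure \<Rightarrow> bool" where
  "generically_stable L U M x \<mu> \<longleftrightarrow>
     (\<exists>\<nu>\<in>keisler_measures L U (univ U) x.
        restrict_measure L U (univ M) x \<nu> = \<mu> \<and>
        invariant_measure L U (univ M) x \<nu> \<and>
        definable_measure L U (univ M) x \<nu> \<and>
        \<nu> \<in> weak_star_topology L U (univ U) x closure_of dirac_hull L U M x)"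

definition product_measure ::
  "('s, 'f, 'r) language \<Rightarrow> ('s, 'f, 'r, 'a) mstruct \<Rightarrow> ('s, 'f, 'r, 'a) mstruct \<Rightarrow>
   nat \<Rightarrow> (nat \<Rightarrow> 's var set) \<Rightarrow> (nat \<Rightarrow> (('s, 'f, 'r, 'a) fml \<Rightarrow> real) measure) \<Rightarrow>
   (('s, 'f, 'r, 'a) fml \<Rightarrow> real) measure \<Rightarrow> bool" where
  "product_measure L U M n x \<mu> \<omega> \<longleftrightarrow>
     \<omega> \<in> keisler_measures L U (univ M) (\<Union>i\<in>{1..n}. x i) \<and>
     (\<forall>\<psi>. (\<forall>i\<in>{1..n}. \<psi> i \<in> definable_predicates L U (univ M) (x i)) \<longrightarrow>
        (\<integral>p. (\<Prod>i\<in>{1..n}. \<psi> i (restrict p (Fml L (univ M) (x i)))) \<partial>\<omega>) =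
        (\<Prod>i\<in>{1..n}. \<integral>p. \<psi> i p \<partial>\<mu> i))"


section \<open>The strong Erdos--Hajnal property\<close>

text \<open>Here \<open>\<phi>\<close> and the \<open>\<psi> i\<close> are predicates on tuples of \<open>M\<close>; \<open>a\<close> and \<open>a'\<close> are concatenations of
  the tuples \<open>restrict a (x i)\<close> and \<open>restrict a' (x i)\<close>.\<close>

definition homogeneous ::
  "('s, 'f, 'r, 'a) mstruct \<Rightarrow> nat \<Rightarrow> (nat \<Rightarrow> 's var set) \<Rightarrow> (('s var \<Rightarrow> 'a) \<Rightarrow> real) \<Rightarrow> real \<Rightarrow>
   (nat \<Rightarrow> ('s var \<Rightarrow> 'a) \<Rightarrow> real) \<Rightarrow> bool" where
  "homogeneous M n x \<phi> \<epsilon> \<psi> \<longleftrightarrow>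
     (\<forall>a\<in>tuples M (\<Union>i\<in>{1..n}. x i). \<forall>a'\<in>tuples M (\<Union>i\<in>{1..n}. x i).
        (\<forall>i\<in>{1..n}. \<psi> i (restrict a (x i)) > 0 \<and> \<psi> i (restrict a' (x i)) > 0) \<longrightarrow>
        \<bar>\<phi> a - \<phi> a'\<bar> \<le> \<epsilon>)"

text \<open>\<open>x\<^sub>1, \<dots>, x\<^sub>n; y\<close> are disjoint finite tuples of variables.\<close>

definition variable_tuples :: "nat \<Rightarrow> (nat \<Rightarrow> 's var set) \<Rightarrow> 's var set \<Rightarrow> bool" where
  "variable_tuples n x y \<longleftrightarrow>
     (\<forall>i\<in>{1..n}. finite (x i)) \<and> finite y \<and>
     disjoint_family_on x {1..n} \<and> (\<forall>i\<in>{1..n}. x i \<inter> y = {})"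

text \<open>\<open>\<psi>\<^sub>i(x\<^sub>i;z\<^sub>i)\<close> are definable predicates (without parameters).\<close>

definition predicate_family ::
  "('s, 'f, 'r) language \<Rightarrow> ('s, 'f, 'r, 'a) mstruct \<Rightarrow> nat \<Rightarrow> (nat \<Rightarrow> 's var set) \<Rightarrow>
   (nat \<Rightarrow> 's var set) \<Rightarrow> (nat \<Rightarrow> (('s, 'f, 'r, 'a) fml \<Rightarrow> real) \<Rightarrow> real) \<Rightarrow> bool" where
  "predicate_family L U n x z \<psi> \<longleftrightarrow>
     (\<forall>i\<in>{1..n}. finite (z i) \<and> x i \<inter> z i = {} \<and>
        \<psi> i \<in> definable_predicates L U no_params (x i \<union> z i))"

text \<open>Tuples of Keisler measures over \<open>M\<close>, all but possibly the last generically stable.\<close>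

definition admissible_measures ::
  "('s, 'f, 'r) language \<Rightarrow> ('s, 'f, 'r, 'a) mstruct \<Rightarrow> ('s, 'f, 'r, 'a) mstruct \<Rightarrow>
   nat \<Rightarrow> (nat \<Rightarrow> 's var set) \<Rightarrow> (nat \<Rightarrow> (('s, 'f, 'r, 'a) fml \<Rightarrow> real) measure) \<Rightarrow> bool" where
  "admissible_measures L U M n x \<mu> \<longleftrightarrow>
     (\<forall>i\<in>{1..n}. \<mu> i \<in> keisler_measures L U (univ M) (x i)) \<and>
     (\<forall>i\<in>{1..<n}. generically_stable L U M (x i) (\<mu> i))"

definition uniformly_definable_strong_EH ::
  "('s, 'f, 'r) language \<Rightarrow> 'k rel \<Rightarrow> ('s, 'f, 'r, 'a) fml set \<Rightarrow> ('s, 'f, 'r, 'a) mstruct \<Rightarrow>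
   nat \<Rightarrow> (nat \<Rightarrow> 's var set) \<Rightarrow> 's var set \<Rightarrow> ((('s, 'f, 'r, 'a) fml \<Rightarrow> real) \<Rightarrow> real) \<Rightarrow>
   real \<Rightarrow> bool" where
  "uniformly_definable_strong_EH L \<kappa> T U n x y \<phi> \<epsilon> \<longleftrightarrow>
     (\<exists>z \<psi> \<delta>. predicate_family L U n x z \<psi> \<and> \<delta> > 0 \<and>
        (\<forall>M \<mu> b. small_model L \<kappa> T U M \<and> admissible_measures L U M n x \<mu> \<and> b \<in> tuples M y \<longrightarrow>
           (\<exists>d. (\<forall>i\<in>{1..n}. d i \<in> tuples M (z i)) \<and>
              homogeneous M n x (\<lambda>a. pred_at L U (\<Union>i\<in>{1..n}. x i) y \<phi> a b) \<epsilon>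
                (\<lambda>i a. pred_at L U (x i) (z i) (\<psi> i) a (d i)) \<and>
              (\<forall>i\<in>{1..n}. (\<integral>p. pred_at_type L (x i) (z i) (\<psi> i) (d i) p \<partial>\<mu> i) \<ge> \<delta>))))"

end

(* If T is distal, sampling, Ramsey's theorem and compactness yield definable partitions of unity
   such that for any weighted finite set of points phi(x;c) is nearly constant on cells carrying a
   fixed fraction of the mass; iterating this makes the remaining fraction small. Generically stable
   measures are replaced by finitely many weighted points (multiplicative weights), and a regularity
   partition for mu_1, ..., mu_n is built by induction on n. One of its good cells is the required box.
   Conversely, a failure of distality gives two points that fill cuts of an indiscernible sequence
   separately but not together. The Erdos-Hajnal property for averages along the sequence allows points
   to be inserted so that a definable predicate alternates arbitrarily often, contradicting NIP. *)
theory Submission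
 imports Defs "HOL-Library.Ramsey"
begin

text \<open>The parameter \<open>d\<close> of a partition is chosen before the values
  \<open>c\<close> of the remaining variables, and one \<open>d\<close> serves all \<open>c\<close>;
  otherwise the other coordinates could not be partitioned afterwards. The supports
  {\<open>h k\<close> > 0} are not definable, so each \<open>h k\<close> comes with a definable
  \<open>p k\<close> equal to 1 on its support, and suprema over a cell are bounded by suprema of
  \<open>min (ph a) (p k a)\<close>. Generically stable measures are compared with finite weights
  from one side only: a small weighted average forces a small integral. The partition scheme with
  exchanged variables bounds the number of tuples in a counterexample, and saturation over
  \<open>M\<close> assembles them into a contradiction with approximate realization. Which cell is
  good depends on the model and the measures, while the predicates are fixed in advance; a single
  predicate selects the cell through distances between extra parameters. In the converse, averages
  have to live on a small complete model. It is obtained by closing under exact solutions of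
  countably many conditions at a time, which yields elementarity and completeness together.\<close>

abbreviation (input) iff_ascii :: "bool => bool => bool" (infixr "<->" 25) where "A <-> B == A = B"

declare split_paired_All [simp del] split_paired_Ex [simp del]

section \<open>Definable functions\<close>

abbreviation (input) "ov == override_on"

text \<open>Assignments are total, so substituting a block of variables is just \<open>ov\<close>;
  the tuples of the theorem are recovered by restriction.\<close>

definition asg :: "('s => 'a set) => ('s var => 'a) set" where "asg B = {a. ALL v. a v : B (fst v)}"

abbreviation (input) "F0 L == Fml L no_params"

abbreviation (input) "AS N == asg (univ N)"

lemma asgD: "a : asg B ==> a v : B (fst v)" unfolding asg_def by blast

lemma asg_upd: "a : asg B ==> u : B (fst w) ==> a(w := u) : asg B" by (auto simp: asg_def)

lemma asg_override: "a : asg B ==> b : asg B ==> ov a b x : asg B" by (auto simp: asg_def override_on_def)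

lemma asg_comp:
 assumes "a : asg B" "!!v. fst (sg v) = fst v"
 shows "a o sg : asg B"
proof -
 have "a (sg v) : B (fst v)" for v using asgD[OF assms(1), of "sg v"] assms(2)[of v] by simp
 thus ?thesis unfolding asg_def comp_def by blast
qed

lemma asg_mono: "(!!s. B s <= C s) ==> asg B <= asg C" by (auto simp: asg_def)

lemma wf_trm_mono: "wf_trm L A t s ==> (!!s. A s <= B s) ==> wf_trm L B t s"
proof (induction rule: wf_trm.induct)
 case (3 f ts)
 hence "list_all2 (wf_trm L B) ts (fargs L f)" by (auto simp: list_all2_conv_all_nth)
 with 3 show ?case by (auto intro: wf_trm.intros)
qed (auto intro: wf_trm.intros)

lemma wf_fml_mono:
 assumes "wf_fml L A ph" and sub: "!!s. A s <= B s"
 shows "wf_fml L B ph" using assms(1) by (induction ph) (auto simp: list_all2_conv_all_nth wf_trm_mono[OF _ sub])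

lemma Fml_mono: "ph : Fml L A x ==> (!!s. A s <= B s) ==> x <= y ==> ph : Fml L B y"
 by (auto simp: Fml_def intro: wf_fml_mono)

lemma finite_tvars: "finite (tvars t)" by (induction t) auto

lemma finite_fvars: "finite (fvars ph)" by (induction ph) (auto simp: finite_tvars)

lemma connectiveD: "connective u ==> (!!i. v i : {0..1}) ==> u v : {0..1}" by (auto simp: connective_def)

section \<open>Values of formulas and functions given by formulas\<close>

locale metric_model =
 fixes L :: "('s, 'f, 'r) language"
  and U :: "('s, 'f, 'r, 'a) mstruct"
 assumes metric: "metric_structure L U"
begin

lemma univ_ne: "univ U s ~= {}" using metric by (auto simp: metric_structure_def)

lemma metric_space_U: "Metric_space (univ U s) (sdist U s)" using metric by (auto simp: metric_structure_def)

lemma sdist_01: "a : univ U s ==> b : univ U s ==> sdist U s a b : {0..1}" using metric Metric_space.nonneg[OF metric_space_U]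
 by (auto simp: metric_structure_def)

lemma ifun_in: "f : funs L ==> sorted_tuple U (fargs L f) as ==> ifun U f as : univ U (fres L f)"
 using metric by (auto simp: metric_structure_def)

lemma irel_01: "r : rels L ==> sorted_tuple U (rargs L r) as ==> irel U r as : {0..1}"
 using metric unfolding metric_structure_def by blast

lemma asg_ne: "AS U ~= {}"
proof -
 have "(%v. SOME u. u : univ U (fst v)) : AS U" unfolding asg_def using univ_ne some_in_eq by blast
 thus ?thesis by blast
qed

lemma tval_in: "wf_trm L A t s ==> (!!s. A s <= univ U s) ==> a : AS U ==> tval U a t : univ U s"
proof (induction rule: wf_trm.induct)
 case (3 f ts)
 hence "sorted_tuple U (fargs L f) (map (tval U a) ts)" by (auto simp: list_all2_conv_all_nth)
 with 3 show ?case by (auto intro: ifun_in)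
qed (auto simp: asg_def)

lemma nth_default_01: "(!!r. r : set rs ==> r : {0..1}) ==> nth_default 0 rs i : {0..1::real}" by (auto simp: nth_default_def)

lemma fval_01: "wf_fml L A ph ==> (!!s. A s <= univ U s) ==> a : AS U ==> fval U a ph : {0..1}"
proof (induction ph arbitrary: a)
 case (Dst s t u)
 thus ?case using tval_in[of A t s a] tval_in[of A u s a] sdist_01 by auto
next
 case (Rel r ts)
 hence "sorted_tuple U (rargs L r) (map (tval U a) ts)" by (auto simp: list_all2_conv_all_nth intro!: tval_in)
 thus ?case using Rel irel_01 by auto
next
 case (Conn u ts)
 have "nth_default 0 (map (fval U a) ts) i : {0..1}" for i by (rule nth_default_01) (use Conn in auto)
 thus ?case using Conn.prems connectiveD[of u] by auto
next
 case (SupQ w ph)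
 have *: "fval U (a(w := u)) ph : {0..1}" if "u : univ U (fst w)" for u using SupQ that by (auto intro!: SupQ.IH asg_upd simp del: atLeastAtMost_iff)
 obtain u where u: "u : univ U (fst w)" using univ_ne by blast
 have "0 <= (SUP u\<in>univ U (fst w). fval U (a(w := u)) ph)"
  by (rule order_trans[OF _ cSUP_upper[OF u]]) (insert * u, auto intro!: bdd_aboveI2[of _ _ 1])
 moreover have "(SUP u\<in>univ U (fst w). fval U (a(w := u)) ph) <= 1" using * univ_ne by (auto intro!: cSUP_least)
 ultimately show ?case by simp
next
 case (InfQ w ph)
 have *: "fval U (a(w := u)) ph : {0..1}" if "u : univ U (fst w)" for u using InfQ that by (auto intro!: InfQ.IH asg_upd simp del: atLeastAtMost_iff)
 obtain u where u: "u : univ U (fst w)" using univ_ne by blast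
 have "(INF u\<in>univ U (fst w). fval U (a(w := u)) ph) <= 1"
  by (rule order_trans[OF cINF_lower[OF _ u]]) (insert * u, auto intro!: bdd_belowI2[of _ 0])
 moreover have "0 <= (INF u\<in>univ U (fst w). fval U (a(w := u)) ph)" using * univ_ne by (auto intro!: cINF_greatest)
 ultimately show ?case by simp
qed

text \<open>Functions of total assignments that are given on \<open>AS U\<close> by a parameter-free
  formula. Arguments about formulas become arguments about real functions, and parameters enter as
  the values of the assignment on some of the variables.\<close>

definition Def :: "'s var set => (('s var => 'a) => real) set" where
 "Def V = {F. EX ph:F0 L V. ALL a:AS U. F a = fval U a ph}"

lemma Def_fval: "ph : F0 L V ==> (%a. fval U a ph) : Def V" by (auto simp: Def_def)

lemma DefE:
 assumes "F : Def V"
 obtains ph where "ph : F0 L V" "!!a. a : AS U ==> F a = fval U a ph" using assms by (auto simp: Def_def)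

lemma Def_01: "F : Def V ==> a : AS U ==> F a : {0..1}"
 by (erule DefE) (auto simp: Fml_def simp del: atLeastAtMost_iff intro!: fval_01[of no_params])

lemma Def_ge0: "F : Def V ==> a : AS U ==> 0 <= F a"
 and Def_le1: "F : Def V ==> a : AS U ==> F a <= 1" using Def_01 by force+

lemma Def_eqI:
 assumes "F : Def V" "!!a. a : AS U ==> G a = F a"
 shows "G : Def V" using assms by (auto simp: Def_def)

lemma Def_cong:
 assumes "F : Def V" "a : AS U" "b : AS U" "!!v. v : V ==> a v = b v"
 shows "F a = F b"
proof -
 obtain ph where ph: "ph : F0 L V" "!!a. a : AS U ==> F a = fval U a ph" using assms(1) unfolding Def_def by blast
 have "fval U a ph = fval U b ph" by (rule fval_cong) (insert ph assms, auto simp: Fml_def)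
 thus ?thesis using ph assms by simp
qed

lemma Def_mono: "F : Def V ==> V <= W ==> F : Def W"
 unfolding Def_def using Fml_mono[of _ L no_params V no_params W] by blast

lemma Def_finite_support:
 assumes "F : Def V"
 obtains W where "finite W" "W <= V" "F : Def W"
proof -
 obtain ph where ph: "ph : F0 L V" "!!a. a : AS U ==> F a = fval U a ph" using assms(1) unfolding Def_def by blast
 hence "F : Def (fvars ph)" by (auto simp: Def_def Fml_def)
 with ph that[of "fvars ph"] finite_fvars show thesis by (auto simp: Fml_def)
qed

lemma Def_conn:
 assumes "connective u" "!!F. F : set Fs ==> F : Def V"
 shows "(%a. u (nth_default 0 (map (%F. F a) Fs))) : Def V"
proof -
 have "EX f. ALL F:set Fs. f F : F0 L V & (ALL a:AS U. F a = fval U a (f F))"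
  by (rule bchoice) (insert assms(2), auto simp: Def_def)
 then obtain f where f: "!!F. F : set Fs ==> f F : F0 L V"
  "!!F a. F : set Fs ==> a : AS U ==> F a = fval U a (f F)" by blast
 have "Conn u (map f Fs) : F0 L V" using assms(1) f(1) by (auto simp: Fml_def)
 moreover have "u (nth_default 0 (map (%F. F a) Fs)) = fval U a (Conn u (map f Fs))"
  if "a : AS U" for a
 proof -
  have "map (%F. F a) Fs = map (fval U a o f) Fs" using f(2) that by auto
  thus ?thesis by (simp del: map_eq_conv)
 qed
 ultimately show ?thesis unfolding Def_def by blast
qed

text \<open>A continuous function on the unit square becomes a connective by reading entries 0 and 1
  of the argument sequence.\<close>

lemma Def_2:
 assumes "continuous_on ({0..1} \<times> {0..1}) (%(p, q). g p q)"
  and "!!p q. p : {0..1} ==> q : {0..1} ==> g p q : {0..1}"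
  and "F : Def V" "G : Def V"
 shows "(%a. g (F a) (G a)) : Def V"
proof -
 have c: "continuous_on {v. ALL i. v i : {0..1}} (%v :: nat => real. (v 0, v 1))"
  by (intro continuous_on_Pair continuous_on_product_coordinates[THEN continuous_on_subset]) auto
 have "continuous_on {v. ALL i. v i : {0..1}} ((%(p, q). g p q) o (%v :: nat => real. (v 0, v 1)))"
  by (rule continuous_on_compose[OF c continuous_on_subset[OF assms(1)]]) auto
 hence "connective (%v. g (v 0) (v 1))" using assms(2) by (auto simp: connective_def comp_def simp del: atLeastAtMost_iff)
 from Def_conn[OF this, of "[F, G]" V] assms(3,4) show ?thesis by (auto simp: nth_default_def)
qed

lemma Def_1:
 assumes "continuous_on {0..1} g" "!!p. p : {0..1} ==> g p : {0..1}" "F : Def V"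
 shows "(%a. g (F a)) : Def V"
proof -
 have "continuous_on ({0..1} \<times> {0..1}) (g o (fst :: real \<times> real => real))"
  by (rule continuous_on_compose[OF _ continuous_on_subset[OF assms(1)]]) (auto intro: continuous_intros)
 hence "continuous_on ({0..1} \<times> {0..1}) (%(p::real, q::real). g p)" by (auto simp: comp_def case_prod_unfold)
 from Def_2[OF this _ assms(3,3)] assms(2) show ?thesis by blast
qed

lemma Def_const: "c : {0..1} ==> (%a. c) : Def V" using Def_conn[of "%_. c" "[]" V] by (auto simp: connective_def)

lemma Def_min: "F : Def V ==> G : Def V ==> (%a. min (F a) (G a)) : Def V"
 by (rule Def_2) (auto simp: case_prod_unfold intro!: continuous_intros)

lemma Def_max: "F : Def V ==> G : Def V ==> (%a. max (F a) (G a)) : Def V"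
 by (rule Def_2) (auto simp: case_prod_unfold intro!: continuous_intros)

lemma Def_mult: "F : Def V ==> G : Def V ==> (%a. F a * G a) : Def V"
 by (rule Def_2) (auto simp: case_prod_unfold mult_le_one intro!: continuous_intros)

lemma Def_absdiff: "F : Def V ==> G : Def V ==> (%a. \<bar>F a - G a\<bar>) : Def V"
 by (rule Def_2) (auto simp: case_prod_unfold intro!: continuous_intros)

lemma Def_diff0: "F : Def V ==> G : Def V ==> (%a. max 0 (F a - G a)) : Def V"
 by (rule Def_2) (auto simp: case_prod_unfold intro!: continuous_intros)

lemma Def_add1: "F : Def V ==> G : Def V ==> (%a. min 1 (F a + G a)) : Def V"
 by (rule Def_2) (auto simp: case_prod_unfold intro!: continuous_intros)

lemma Def_compl: "F : Def V ==> (%a. 1 - F a) : Def V" by (rule Def_1) (auto intro!: continuous_intros)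

lemma Def_clip: "F : Def V ==> (%a. max 0 (min 1 (c * F a + e))) : Def V"
 by (rule Def_1[where g = "%p. max 0 (min 1 (c * p + e))"]) (auto intro!: continuous_intros)

lemma Def_prod: "finite K ==> (!!k. k : K ==> F k : Def V) ==> (%a. PROD k:K. F k a) : Def V"
 by (induction rule: finite_induct) (auto intro: Def_const Def_mult)

lemma Def_MAX:
 assumes "finite K" "!!k. k : K ==> F k : Def V"
 shows "(%a. Max (insert 0 ((%k. F k a) ` K))) : Def V" using assms
proof (induction rule: finite_induct)
 case (insert k K)
 have "(%a. max (F k a) (Max (insert 0 ((%k. F k a) ` K)))) : Def V" using insert by (auto intro: Def_max)
 moreover have "Max (insert 0 ((%k. F k a) ` insert k K)) = max (F k a) (Max (insert 0 ((%k. F k a) ` K)))" for a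
 proof -
  have "Max (insert (F k a) (insert 0 ((%k. F k a) ` K))) = max (F k a) (Max (insert 0 ((%k. F k a) ` K)))" using insert by (intro Max_insert) auto
  thus ?thesis by (simp add: insert_commute)
 qed
 ultimately show ?case by simp
qed (auto intro: Def_const)

text \<open>Truncation at 1 commutes with adding a non-negative term, so the capped sum is built one
  term at a time by \<open>Def_add1\<close>.\<close>

lemma Def_sum1:
 assumes "finite K" "!!k. k : K ==> F k : Def V"
 shows "(%a. min 1 (SUM k:K. F k a)) : Def V" using assms
proof (induction rule: finite_induct)
 case (insert k K)
 have "(%a. min 1 (F k a + min 1 (SUM k:K. F k a))) : Def V" using insert by (auto intro: Def_add1)
 thus ?case
 proof (rule Def_eqI)
  fix a assume "a : AS U"
  hence "0 <= F k a" using insert.prems Def_ge0 by auto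
  thus "min 1 (SUM k:insert k K. F k a) = min 1 (F k a + min 1 (SUM k:K. F k a))" using insert by auto
 qed
qed (auto intro: Def_const)

lemma Def_sum:
 assumes "finite K" "!!k. k : K ==> F k : Def V" "!!a. a : AS U ==> (SUM k:K. F k a) <= 1"
 shows "(%a. SUM k:K. F k a) : Def V" by (rule Def_eqI[OF Def_sum1[OF assms(1,2)]]) (use assms(3) in auto)

lemma Def_dist:
 assumes "fst w = fst v" "v : V" "w : V"
 shows "(%a. sdist U (fst v) (a v) (a w)) : Def V"
proof -
 have "wf_trm L no_params (Var v) (fst v)" "wf_trm L no_params (Var w) (fst v)"
  using wf_trm.intros(1)[of L no_params v] wf_trm.intros(1)[of L no_params w] assms(1) by simp_all
 thus ?thesis using Def_fval[of "Dst (fst v) (Var v) (Var w)" V] assms by (auto simp: Fml_def)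
qed

section \<open>Quantification over tuples of variables\<close>

definition supq :: "'s var set => (('s var => 'a) => real) => ('s var => 'a) => real" where
 "supq x F a = (SUP e\<in>AS U. F (ov a e x))"

text \<open>Defined by duality, so that its bounds and its definability are inherited from
  \<open>supq\<close>.\<close>

definition infq :: "'s var set => (('s var => 'a) => real) => ('s var => 'a) => real" where
 "infq x F a = 1 - supq x (%b. 1 - F b) a"

lemma supq_upper:
 assumes "F : Def V" "a : AS U" "e : AS U"
 shows "F (ov a e x) <= supq x F a" unfolding supq_def using Def_le1[OF assms(1) asg_override[OF assms(2)]] by (intro cSUP_upper[OF assms(3)] bdd_aboveI2[of _ _ 1])

lemma supq_least:
 assumes "!!e. e : AS U ==> F (ov a e x) <= r"
 shows "supq x F a <= r" unfolding supq_def using assms asg_ne by (auto intro!: cSUP_least)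

lemma infq_lower:
 assumes "F : Def V" "a : AS U" "e : AS U"
 shows "infq x F a <= F (ov a e x)" using supq_upper[OF Def_compl[OF assms(1)] assms(2,3), of x] by (simp add: infq_def)

lemma infq_greatest:
 assumes "!!e. e : AS U ==> r <= F (ov a e x)"
 shows "r <= infq x F a" using supq_least[of "%b. 1 - F b" a x "1 - r"] assms by (simp add: infq_def)

lemma infq_witness:
 assumes "infq x F a < r"
 obtains e where "e : AS U" "F (ov a e x) < r" using infq_greatest[of r F a x] assms by (meson not_le)

text \<open>A supremum over a block is an iterated supremum; this reduces \<open>supq\<close> to the
  quantifier \<open>SupQ\<close> for one variable.\<close>

lemma supq_insert:
 assumes "F : Def V" "a : AS U" "w ~: x"
 shows "supq (insert w x) F a = (SUP u\<in>univ U (fst w). supq x F (a(w := u)))"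
proof (rule antisym)
 have bdd: "bdd_above ((%u. supq x F (a(w := u))) ` univ U (fst w))"
  using assms by (auto intro!: bdd_aboveI2[of _ _ 1] supq_least Def_le1[OF assms(1)] asg_override asg_upd)
 show "supq (insert w x) F a <= (SUP u\<in>univ U (fst w). supq x F (a(w := u)))"
 proof (rule supq_least)
  fix e assume e: "e : AS U"
  have "ov a e (insert w x) = ov (a(w := e w)) e x" using assms(3) by (auto simp: override_on_def)
  hence "F (ov a e (insert w x)) <= supq x F (a(w := e w))" using supq_upper[OF assms(1) asg_upd[OF assms(2) asgD[OF e, of w]] e, of x] by simp
  also have "\<dots> <= (SUP u\<in>univ U (fst w). supq x F (a(w := u)))" by (rule cSUP_upper[OF asgD[OF e] bdd])
  finally show "F (ov a e (insert w x)) <= (SUP u\<in>univ U (fst w). supq x F (a(w := u)))" .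
 qed
 show "(SUP u\<in>univ U (fst w). supq x F (a(w := u))) <= supq (insert w x) F a"
 proof (intro cSUP_least supq_least)
  fix u e assume *: "u : univ U (fst w)" "e : AS U"
  have "ov (a(w := u)) e x = ov a (e(w := u)) (insert w x)" using assms(3) by (auto simp: override_on_def)
  thus "F (ov (a(w := u)) e x) <= supq (insert w x) F a" using supq_upper[OF assms(1,2) asg_upd[OF *(2,1)], of "insert w x"] by simp
 qed (rule univ_ne)
qed

lemma Def_SUP1:
 assumes "F : Def V"
 shows "(%a. SUP u\<in>univ U (fst w). F (a(w := u))) : Def (V - {w})"
proof -
 obtain ph where ph: "ph : F0 L V" "!!a. a : AS U ==> F a = fval U a ph" using assms unfolding Def_def by blast
 have "SupQ w ph : F0 L (V - {w})" using ph(1) by (auto simp: Fml_def)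
 thus ?thesis
 proof (rule Def_eqI[OF Def_fval])
  fix a assume a: "a : AS U"
  show "(SUP u\<in>univ U (fst w). F (a(w := u))) = fval U a (SupQ w ph)" unfolding fval.simps by (rule SUP_cong[OF refl ph(2)]) (rule asg_upd[OF a])
 qed
qed

lemma Def_supq:
 assumes "finite x" "F : Def V"
 shows "supq x F : Def (V - x)" using assms
proof (induction x rule: finite_induct)
 case empty
 show ?case by (rule Def_eqI[of F]) (insert empty asg_ne, auto simp: supq_def)
next
 case (insert w x)
 have "(%a. SUP u\<in>univ U (fst w). supq x F (a(w := u))) : Def (V - x - {w})" by (rule Def_SUP1) (rule insert)+
 hence "supq (insert w x) F : Def (V - x - {w})" by (rule Def_eqI) (use supq_insert insert in blast)
 thus ?case by (rule Def_mono) auto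
qed

lemma Def_infq: "finite x ==> F : Def V ==> infq x F : Def (V - x)"
 using Def_compl[OF Def_supq[OF _ Def_compl]] unfolding infq_def[abs_def] .

section \<open>Renaming of variables\<close>

lemma wf_trm_rename:
 assumes "wf_trm L A t s" "!!v. fst (sg v) = fst v"
 shows "EX t'. wf_trm L A t' s & tvars t' = sg ` tvars t & (ALL a. tval U a t' = tval U (a o sg) t)" using assms(1)
proof (induction rule: wf_trm.induct)
 case (1 v)
 show ?case by (rule exI[of _ "Var (sg v)"]) (use wf_trm.intros(1)[of L A "sg v"] assms(2) in auto)
next
 case (2 a s)
 thus ?case by (intro exI[of _ "Par s a"]) (auto intro: wf_trm.intros)
next
 case (3 f ts)
 hence "ALL i. EX t'. i < length ts --> wf_trm L A t' (fargs L f ! i) & tvars t' = sg ` tvars (ts ! i) &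
   (ALL a. tval U a t' = tval U (a o sg) (ts ! i))" unfolding list_all2_conv_all_nth by metis
 then obtain g where g: "!!i. i < length ts ==> wf_trm L A (g i) (fargs L f ! i) & tvars (g i) = sg ` tvars (ts ! i) &
   (ALL a. tval U a (g i) = tval U (a o sg) (ts ! i))" by metis
 let ?t = "Fn f (map g [0..<length ts])"
 have "length ts = length (fargs L f)" using 3 by (simp add: list_all2_lengthD)
 hence "wf_trm L A ?t (fres L f)" using 3 g by (intro wf_trm.intros) (auto simp: list_all2_conv_all_nth)
 moreover have "tvars ?t = sg ` tvars (Fn f ts)"
 proof -
  have set_ts: "set ts = (!) ts ` {..<length ts}" by (auto simp: in_set_conv_nth)
  have "tvars ?t = (UN i<length ts. tvars (g i))" by (simp add: atLeast0LessThan)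
  also have "\<dots> = (UN i<length ts. sg ` tvars (ts ! i))" by (rule SUP_cong) (use g in auto)
  also have "\<dots> = sg ` tvars (Fn f ts)" by (simp add: set_ts image_UN)
  finally show ?thesis .
 qed
 moreover have "tval U a ?t = tval U (a o sg) (Fn f ts)" for a
 proof -
  have "map (tval U a) (map g [0..<length ts]) = map (tval U (a o sg)) ts" by (rule nth_equalityI) (use g in simp_all)
  thus ?thesis by (simp only: tval.simps)
 qed
 ultimately show ?case by blast
qed

lemma wf_trms_rename:
 assumes "list_all2 (wf_trm L A) ts ss" "!!v. fst (sg v) = fst v"
 obtains ts' where "list_all2 (wf_trm L A) ts' ss" "(UN t:set ts'. tvars t) = sg ` (UN t:set ts. tvars t)"
  "!!a. map (tval U a) ts' = map (tval U (a o sg)) ts"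
proof -
 have "EX ts'. list_all2 (wf_trm L A) ts' ss & (UN t:set ts'. tvars t) = sg ` (UN t:set ts. tvars t) &
  (ALL a. map (tval U a) ts' = map (tval U (a o sg)) ts)" using assms(1)
 proof (induction rule: list_all2_induct)
  case (Cons t ts s ss)
  obtain t' where t': "wf_trm L A t' s" "tvars t' = sg ` tvars t" "!!a. tval U a t' = tval U (a o sg) t"
   using wf_trm_rename[OF Cons(1) assms(2)] by blast
  from Cons.IH obtain ts' where "list_all2 (wf_trm L A) ts' ss" "(UN t:set ts'. tvars t) = sg ` (UN t:set ts. tvars t)"
   "!!a. map (tval U a) ts' = map (tval U (a o sg)) ts" by blast
  note ts' = this
  have "map (tval U a) (t' # ts') = map (tval U (a o sg)) (t # ts)" for a unfolding list.map t'(3) ts'(3) ..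
  moreover have "list_all2 (wf_trm L A) (t' # ts') (s # ss)" using t'(1) ts'(1) by simp
  moreover have "(UN t:set (t' # ts'). tvars t) = sg ` (UN t:set (t # ts). tvars t)" using t'(2) ts'(2) by (simp add: image_Un)
  ultimately show ?case by blast
 qed auto
 thus thesis using that by blast
qed

text \<open>The renaming may identify variables or send a free variable to a bound one, so each
  bound variable is first moved to an index that no free variable is sent to. Only finitely many
  indices are hit.\<close>

lemma wf_fml_rename:
 assumes "wf_fml L A ph" "!!v. fst (sg v) = fst v"
 shows "EX ph'. wf_fml L A ph' & fvars ph' <= sg ` fvars ph & (ALL a. fval U a ph' = fval U (a o sg) ph)"
 using assms
proof (induction ph arbitrary: sg)
 case (Dst s t u)
 obtain t' u' where "wf_trm L A t' s" "tvars t' = sg ` tvars t" "!!a. tval U a t' = tval U (a o sg) t"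
   "wf_trm L A u' s" "tvars u' = sg ` tvars u" "!!a. tval U a u' = tval U (a o sg) u"
 proof -
  have "wf_trm L A t s" "wf_trm L A u s" using Dst.prems(1) by simp_all
  from wf_trm_rename[OF this(1) Dst.prems(2)] wf_trm_rename[OF this(2) Dst.prems(2)] that
  show thesis by blast
 qed
 note tu = this
 have "fval U a (Dst s t' u') = fval U (a o sg) (Dst s t u)" for a unfolding fval.simps tu(3) tu(6) ..
 moreover have "wf_fml L A (Dst s t' u')" "fvars (Dst s t' u') <= sg ` fvars (Dst s t u)" using tu by (simp_all add: image_Un)
 ultimately show ?case by blast
next
 case (Rel r ts)
 hence "list_all2 (wf_trm L A) ts (rargs L r)" by simp
 then obtain ts' where ts': "list_all2 (wf_trm L A) ts' (rargs L r)" "(UN t:set ts'. tvars t) = sg ` (UN t:set ts. tvars t)"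
   "!!a. map (tval U a) ts' = map (tval U (a o sg)) ts" using Rel.prems(2) by (rule wf_trms_rename) blast
 have "fval U a (Rel r ts') = fval U (a o sg) (Rel r ts)" for a using ts'(3)[of a] by (simp del: map_eq_conv)
 moreover have "wf_fml L A (Rel r ts')" "fvars (Rel r ts') <= sg ` fvars (Rel r ts)" using ts'(1,2) Rel.prems by simp_all
 ultimately show ?case by blast
next
 case (Conn u ts)
 have "EX ph'. wf_fml L A ph' & fvars ph' <= sg ` fvars ph & (ALL a. fval U a ph' = fval U (a o sg) ph)"
  if "ph : set ts" for ph by (rule Conn.IH[OF that _ Conn.prems(2)]) (use Conn.prems(1) that in simp)
 then obtain g where g: "!!ph. ph : set ts ==> wf_fml L A (g ph) & fvars (g ph) <= sg ` fvars ph & (ALL a. fval U a (g ph) = fval U (a o sg) ph)"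
  by metis
 have "map (fval U a) (map g ts) = map (fval U (a o sg)) ts" for a using g by auto
 hence "fval U a (Conn u (map g ts)) = fval U (a o sg) (Conn u ts)" for a by (simp del: map_eq_conv map_map)
 moreover have "fvars (Conn u (map g ts)) <= sg ` fvars (Conn u ts)" unfolding fvars.simps image_UN set_map using g by (fastforce intro!: UN_mono)
 moreover have "wf_fml L A (Conn u (map g ts))" using g Conn.prems(1) by simp
 ultimately show ?case by blast
next
 case (SupQ w ph)
 obtain n where n: "(fst w, n) ~: sg ` fvars ph"
  using finite_subset[of "range (%n. (fst w, n :: nat))" "sg ` fvars ph"] finite_fvars[of ph]
   range_inj_infinite[of "%n. (fst w, n :: nat)"] by (auto simp: inj_def)
 define w' where "w' = (fst w, n)"
 have "EX ph'. wf_fml L A ph' & fvars ph' <= sg(w := w') ` fvars ph & (ALL a. fval U a ph' = fval U (a o sg(w := w')) ph)"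
  by (rule SupQ.IH) (insert SupQ.prems, auto simp: w'_def)
 then obtain ph' where ph': "wf_fml L A ph'" "fvars ph' <= sg(w := w') ` fvars ph"
  "!!a. fval U a ph' = fval U (a o sg(w := w')) ph" by blast
 have "fval U (a(w' := u)) ph' = fval U ((a o sg)(w := u)) ph" for a u unfolding ph'(3)
 proof (rule fval_cong)
  fix v assume "v : fvars ph"
  hence "sg v ~= w'" using n unfolding w'_def by (metis image_eqI)
  thus "(a(w' := u) o sg(w := w')) v = ((a o sg)(w := u)) v" by simp
 qed
 hence "fval U a (SupQ w' ph') = fval U (a o sg) (SupQ w ph)" for a by (simp add: w'_def)
 moreover have "fvars (SupQ w' ph') <= sg ` fvars (SupQ w ph)" using ph'(2) by (force split: if_splits)
 moreover have "wf_fml L A (SupQ w' ph')" using ph'(1) by simp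
 ultimately show ?case by blast
next
 case (InfQ w ph)
 obtain n where n: "(fst w, n) ~: sg ` fvars ph"
  using finite_subset[of "range (%n. (fst w, n :: nat))" "sg ` fvars ph"] finite_fvars[of ph]
   range_inj_infinite[of "%n. (fst w, n :: nat)"] by (auto simp: inj_def)
 define w' where "w' = (fst w, n)"
 have "EX ph'. wf_fml L A ph' & fvars ph' <= sg(w := w') ` fvars ph & (ALL a. fval U a ph' = fval U (a o sg(w := w')) ph)"
  by (rule InfQ.IH) (insert InfQ.prems, auto simp: w'_def)
 then obtain ph' where ph': "wf_fml L A ph'" "fvars ph' <= sg(w := w') ` fvars ph"
  "!!a. fval U a ph' = fval U (a o sg(w := w')) ph" by blast
 have "fval U (a(w' := u)) ph' = fval U ((a o sg)(w := u)) ph" for a u unfolding ph'(3)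
 proof (rule fval_cong)
  fix v assume "v : fvars ph"
  hence "sg v ~= w'" using n unfolding w'_def by (metis image_eqI)
  thus "(a(w' := u) o sg(w := w')) v = ((a o sg)(w := u)) v" by simp
 qed
 hence "fval U a (InfQ w' ph') = fval U (a o sg) (InfQ w ph)" for a by (simp add: w'_def)
 moreover have "fvars (InfQ w' ph') <= sg ` fvars (InfQ w ph)" using ph'(2) by (force split: if_splits)
 moreover have "wf_fml L A (InfQ w' ph')" using ph'(1) by simp
 ultimately show ?case by blast
qed

lemma Def_rename:
 assumes "F : Def V" "!!v. fst (sg v) = fst v" "sg ` V <= W"
 shows "(%a. F (a o sg)) : Def W"
proof -
 obtain ph where ph: "ph : F0 L V" "!!a. a : AS U ==> F a = fval U a ph" using assms(1) unfolding Def_def by blast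
 obtain ph' where ph': "wf_fml L no_params ph'" "fvars ph' <= sg ` fvars ph" "!!a. fval U a ph' = fval U (a o sg) ph"
  using wf_fml_rename[of no_params ph sg] ph(1) assms(2) by (auto simp: Fml_def)
 have "fvars ph' <= W" using ph'(2) ph(1) assms(3) unfolding Fml_def by blast
 hence "ph' : F0 L W" using ph'(1) by (simp add: Fml_def)
 thus ?thesis by (rule Def_eqI[OF Def_fval]) (use ph(2) ph'(3) asg_comp[OF _ assms(2)] in auto)
qed

end

section \<open>Elementary submodels\<close>

locale elementary_submodel = metric_model L U
 for L :: "('s, 'f, 'r) language" and U :: "('s, 'f, 'r, 'a) mstruct" +
 fixes M :: "('s, 'f, 'r, 'a) mstruct"
 assumes elem: "elementary_substructure L M U"
begin

sublocale M: metric_model L M using elem by unfold_locales (auto simp: elementary_substructure_def)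

lemma univ_sub: "univ M s <= univ U s" using elem by (auto simp: elementary_substructure_def)

lemma asg_sub: "a : AS M ==> a : AS U" using asg_mono[of "univ M" "univ U"] univ_sub by blast

lemma fval_elem:
 assumes "ph : F0 L x" "finite x" "!!v. v : x ==> a v : univ M (fst v)"
 shows "fval M a ph = fval U a ph"
proof -
 have "restrict a x : tuples M x" using assms(3) by (auto simp: tuples_def)
 hence "fval M (restrict a x) ph = fval U (restrict a x) ph" using elem assms(1,2) unfolding elementary_substructure_def by blast
 moreover have "fval N (restrict a x) ph = fval N a ph" for N :: "('s, 'f, 'r, 'a) mstruct"
  by (rule fval_cong) (insert assms(1), auto simp: Fml_def)
 ultimately show ?thesis by simp
qed

text \<open>The formula \<open>InfQ w ph\<close> has the same value in both structures at parameters
  from \<open>M\<close>, so an infimum below \<open>r\<close> in \<open>U\<close> is below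
  \<open>r\<close> in \<open>M\<close>.\<close>

lemma elem_witness1:
 assumes "F : Def V" "a : AS U" "!!v. v : V - {w} ==> a v : univ M (fst v)"
  and "u : univ U (fst w)" "F (a(w := u)) < r"
 shows "EX u':univ M (fst w). F (a(w := u')) < r"
proof -
 obtain W where W: "finite W" "W <= V" "F : Def W" using assms(1) by (rule Def_finite_support)
 obtain ph where ph: "ph : F0 L W" "!!a. a : AS U ==> F a = fval U a ph" using W(3) unfolding Def_def by blast
 have inf: "InfQ w ph : F0 L (W - {w})" using ph(1) by (auto simp: Fml_def)
 have "fval U a (InfQ w ph) <= fval U (a(w := u)) ph" unfolding fval.simps by (rule cINF_lower[OF bdd_belowI2[of _ 0] assms(4)])
    (use Def_ge0[OF W(3) asg_upd[OF assms(2)]] ph(2)[OF asg_upd[OF assms(2)]] in auto)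
 also have "\<dots> < r" using assms(5) ph(2) asg_upd[OF assms(2,4)] by simp
 finally have *: "fval U a (InfQ w ph) < r" .
 have "fval M a (InfQ w ph) = fval U a (InfQ w ph)" by (rule fval_elem[OF inf]) (use W(1,2) assms(3) in blast)+
 with * have "fval M a (InfQ w ph) < r" by simp
 hence "EX u':univ M (fst w). fval M (a(w := u')) ph < r"
  unfolding fval.simps using cINF_greatest[of "univ M (fst w)" r "%u. fval M (a(w := u)) ph"] M.univ_ne by (meson not_le)
 then obtain u' where u': "u' : univ M (fst w)" "fval M (a(w := u')) ph < r" by blast
 have "fval M (a(w := u')) ph = fval U (a(w := u')) ph" by (rule fval_elem[OF ph(1) W(1)]) (use u' assms(3) W(2) in auto)
 moreover have "F (a(w := u')) = fval U (a(w := u')) ph" by (intro ph(2) asg_upd[OF assms(2)]) (use u'(1) univ_sub in blast)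
 ultimately have "F (a(w := u')) < r" using u'(2) by simp
 thus ?thesis using u'(1) by (rule bexI)
qed

text \<open>Tarski-Vaught for a block of variables: a value for one variable is found in
  \<open>M\<close> while \<open>infq\<close> keeps the rest of the block quantified.\<close>

lemma elem_witness:
 assumes "finite x" "F : Def V" "a : AS U" "!!v. v : V - x ==> a v : univ M (fst v)"
  and "e : AS U" "F (ov a e x) < r"
 shows "EX e':AS M. F (ov a e' x) < r" using assms
proof (induction x arbitrary: a e rule: finite_induct)
 case empty
 thus ?case using M.asg_ne by auto
next
 case (insert w x)
 have eq: "ov a e (insert w x) = ov (a(w := e w)) e x" for e using insert.hyps by (auto simp: override_on_def)
 have "infq x F (a(w := e w)) < r" using infq_lower[OF insert.prems(1) asg_upd[OF insert.prems(2) asgD[OF insert.prems(4), of w]] insert.prems(4), of x]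
   insert.prems(5) eq by simp
 note * = this
 have "a v : univ M (fst v)" if "v : V - x - {w}" for v using that insert.prems(3) by blast
 from elem_witness1[OF Def_infq[OF insert.hyps(1) insert.prems(1)] insert.prems(2) this asgD[OF insert.prems(4)] *]
 obtain u where u: "u : univ M (fst w)" "infq x F (a(w := u)) < r" by blast
 from u(2) obtain e1 where e1: "e1 : AS U" "F (ov (a(w := u)) e1 x) < r" by (rule infq_witness)
 have au: "a(w := u) : AS U" by (rule asg_upd[OF insert.prems(2)]) (use u(1) univ_sub in blast)
 obtain e' where e': "e' : AS M" "F (ov (a(w := u)) e' x) < r"
 proof -
  have "(a(w := u)) v : univ M (fst v)" if "v : V - x" for v using that insert.prems(3)[of v] u(1) by (cases "v = w") auto
  from insert.IH[OF insert.prems(1) au this e1] that show thesis by blast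
 qed
 have "ov a (e'(w := u)) (insert w x) = ov (a(w := u)) e' x" using insert.hyps by (auto simp: override_on_def)
 hence "F (ov a (e'(w := u)) (insert w x)) < r" using e'(2) by simp
 thus ?case using asg_upd[OF e'(1) u(1)] by (rule bexI)
qed

end

section \<open>Type spaces and saturation\<close>

lemma Fml_finst:
 assumes "ph : F0 L (x Un z)" "!!v. v : z ==> d v : A (fst v)"
 shows "finst z d ph : Fml L A x" using assms wf_finst[of L ph z d A] fvars_finst[of z d ph] by (auto simp: Fml_def)

context metric_model
begin

lemma tuples_extend:
 assumes "a : tuples U x"
 shows "EX b:AS U. ALL v:x. b v = a v"
proof -
 obtain c where c: "c : AS U" using asg_ne by blast
 have "ov c a x : AS U" unfolding asg_def
 proof (intro CollectI allI)
  fix v show "ov c a x v : univ U (fst v)" using assms asgD[OF c, of v] by (cases "v : x") (auto simp: tuples_def)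
 qed
 thus ?thesis by (rule bexI[rotated]) simp
qed

lemma restrict_tuples: "a : asg B ==> (!!s. B s <= univ N s) ==> restrict a x : tuples N x"
 using asgD[of a B] unfolding tuples_def by (intro restrict_PiE_iff[THEN iffD2]) blast

lemma tp_cong: "(!!v. v : x ==> a v = b v) ==> tp L N A x a = tp L N A x b"
 unfolding tp_def by (intro restrict_ext fval_cong) (auto simp: Fml_def)

lemma tp_restrict [simp]: "tp L N A x (restrict a x) = tp L N A x a" by (rule tp_cong) simp

lemma tp_apply: "ph : Fml L A x ==> tp L N A x a ph = fval N a ph" by (simp add: tp_def)

lemma tp_in_types:
 assumes "!!s. A s <= univ U s" "a : AS U"
 shows "tp L U A x a : types L U A x" unfolding types_def
proof (intro CollectI conjI allI impI)
 show "tp L U A x a : Fml L A x \<rightarrow>\<^sub>E {0..1}" using fval_01[OF _ assms] by (auto simp: tp_def Fml_def)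
 fix F ep assume F: "finite F & F <= Fml L A x & (ep::real) > 0"
 have "\<bar>fval U (restrict a x) ph - tp L U A x a ph\<bar> < ep" if "ph : F" for ph
 proof -
  have ph: "ph : Fml L A x" using that F by blast
  hence "fval U (restrict a x) ph = fval U a ph" by (intro fval_cong) (auto simp: Fml_def)
  thus ?thesis using F ph by (simp add: tp_apply)
 qed
 thus "EX b:tuples U x. ALL ph:F. \<bar>fval U b ph - tp L U A x a ph\<bar> < ep"
  using restrict_tuples[OF assms(2), of U x] by blast
qed

lemma typesD: "p : types L U A x ==> finite F ==> F <= Fml L A x ==> ep > 0 ==>
  EX a:tuples U x. ALL ph:F. \<bar>fval U a ph - p ph\<bar> < ep" by (simp add: types_def)

lemma types_approx:
 assumes "p : types L U A x" "finite F" "F <= Fml L A x" "ep > 0"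
 shows "EX a:AS U. ALL ph:F. \<bar>fval U a ph - p ph\<bar> < ep"
proof -
 obtain b where b: "b : tuples U x" "!!ph. ph : F ==> \<bar>fval U b ph - p ph\<bar> < ep"
  using typesD[OF assms] by blast
 obtain a where a: "a : AS U" "!!v. v : x ==> a v = b v" using tuples_extend[OF b(1)] by blast
 have "fval U a ph = fval U b ph" if "ph : F" for ph by (rule fval_cong) (insert a(2) that assms(3), auto simp: Fml_def)
 thus ?thesis using a(1) b(2) by (intro bexI[of _ a]) simp_all
qed

lemma types_01: "p : types L U A x ==> ph : Fml L A x ==> p ph : {0..1}" unfolding types_def by blast

lemma topspace_type_space: "topspace (type_space L U A x) = types L U A x" unfolding type_space_def by (auto simp: types_def)

lemma continuous_map_eval:
 assumes "ph : Fml L A x"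
 shows "continuous_map (type_space L U A x) euclideanreal (%p. p ph)" unfolding type_space_def
 by (rule continuous_map_from_subtopology[OF continuous_map_product_projection[OF assms]])

text \<open>Tychonoff's theorem for the cube, together with closedness of the set of types: if some
  finite set of conditions is not approximately satisfiable, this persists for all nearby functions
  with half the tolerance.\<close>

lemma compact_type_space: "compact_space (type_space L U A x)"
proof -
 let ?P = "product_topology (%_::('s, 'f, 'r, 'a) fml. euclideanreal) (Fml L A x)"
 let ?C = "Fml L A x \<rightarrow>\<^sub>E {0..1::real}"
 have C: "compactin ?P ?C" by (simp add: compactin_PiE)
 have cl: "closedin (subtopology ?P ?C) (types L U A x)" unfolding closedin_def
 proof
  show sub: "types L U A x <= topspace (subtopology ?P ?C)" by (auto simp: types_def)
  show "openin (subtopology ?P ?C) (topspace (subtopology ?P ?C) - types L U A x)" unfolding openin_subopen[of _ "topspace (subtopology ?P ?C) - types L U A x"]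
  proof
   fix p assume p: "p : topspace (subtopology ?P ?C) - types L U A x"
   hence pC: "p : ?C" by simp
   have "~ (ALL F ep. finite F & F <= Fml L A x & ep > 0 -->
     (EX a:tuples U x. ALL ph:F. \<bar>fval U a ph - p ph\<bar> < ep))"
   proof
    assume "ALL F ep. finite F & F <= Fml L A x & ep > 0 -->
     (EX a:tuples U x. ALL ph:F. \<bar>fval U a ph - p ph\<bar> < ep)"
    hence "p : types L U A x" unfolding types_def using pC by (intro CollectI conjI)
    thus False by (rule DiffD2[OF p])
   qed
   then obtain F and ep :: real where Fe: "finite F & F <= Fml L A x & ep > 0"
    "~ (EX a:tuples U x. ALL ph:F. \<bar>fval U a ph - p ph\<bar> < ep)"
    unfolding not_all not_imp by (elim exE conjE) (rule that, intro conjI)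
   hence F: "finite F" "F <= Fml L A x" "ep > 0" by simp_all
   have no: "EX ph:F. ~ \<bar>fval U a ph - p ph\<bar> < ep" if "a : tuples U x" for a
   proof (rule ccontr)
    assume "~ (EX ph:F. ~ \<bar>fval U a ph - p ph\<bar> < ep)"
    hence "ALL ph:F. \<bar>fval U a ph - p ph\<bar> < ep" by simp
    thus False by (rule notE[OF Fe(2) bexI[OF _ that]])
   qed
   define N where "N = topspace (subtopology ?P ?C) Int
    (INT ph:F. {q : topspace (subtopology ?P ?C). q ph : {p ph - ep/2<..<p ph + ep/2}})"
   have "openin (subtopology ?P ?C) {q : topspace (subtopology ?P ?C). q ph : {p ph - ep/2<..<p ph + ep/2}}"
    if "ph : F" for ph
   proof -
    have "continuous_map (subtopology ?P ?C) euclideanreal (%q. q ph)"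
     by (rule continuous_map_from_subtopology[OF continuous_map_product_projection]) (use that F(2) in blast)
    from openin_continuous_map_preimage[OF this, of "{p ph - ep/2<..<p ph + ep/2}"] show ?thesis by simp
   qed
   note op = this
   have "openin (subtopology ?P ?C) N"
   proof (cases "F = {}")
    case True
    thus ?thesis unfolding N_def by (simp only: image_empty Inter_empty Int_UNIV_right openin_topspace)
   next
    case False
    show ?thesis unfolding N_def by (intro openin_Int openin_topspace openin_Inter) (use F(1) False op in blast)+
   qed
   moreover have "p : N" using p F(3) unfolding N_def by simp
   moreover have "q ~: types L U A x" if q: "q : N" for q
   proof
    assume "q : types L U A x"
    then obtain a where a: "a : tuples U x" "!!ph. ph : F ==> \<bar>fval U a ph - q ph\<bar> < ep/2"
     using typesD[OF _ F(1,2) half_gt_zero[OF F(3)]] by blast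
    obtain ph where ph: "ph : F" "~ \<bar>fval U a ph - p ph\<bar> < ep" using no[OF a(1)] by blast
    have "q ph : {p ph - ep/2<..<p ph + ep/2}" using q ph(1) unfolding N_def by blast
    thus False using a(2)[OF ph(1)] ph(2) by (simp only: greaterThanLessThan_iff abs_less_iff) linarith
   qed
   hence "N <= topspace (subtopology ?P ?C) - types L U A x" unfolding N_def by blast
   ultimately show "EX T. openin (subtopology ?P ?C) T & p : T & T <= topspace (subtopology ?P ?C) - types L U A x" by blast
  qed
 qed
 have "compactin (subtopology ?P ?C) (types L U A x)" by (rule closedin_compact_space[OF _ cl]) (insert C, simp add: compact_space_subtopology)
 hence "compactin ?P (types L U A x)" by (simp add: compactin_subtopology)
 thus ?thesis unfolding type_space_def by (rule compact_space_subtopology)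
qed

text \<open>Compactness in the form used later: finite subfamilies only have to be met by types of
  actual assignments in \<open>U\<close>, and the resulting type can afterwards be realized by
  saturation.\<close>

lemma type_space_fip:
 assumes "!!s. A s <= univ U s" "!!C. C : \<C> ==> closedin (type_space L U A x) C"
  and "!!\<D>. finite \<D> ==> \<D> <= \<C> ==> EX a:AS U. ALL C:\<D>. tp L U A x a : C"
 shows "EX p:types L U A x. ALL C:\<C>. p : C"
proof (cases "\<C> = {}")
 case True
 obtain a where "a : AS U" using asg_ne by blast
 from tp_in_types[OF assms(1) this] True show ?thesis by blast
next
 case False
 have "\<Inter>\<C> ~= {}"
 proof -
  have "\<Inter> \<F> ~= {}" if \<F>: "finite \<F>" "\<F> <= \<C>" for \<F>
  proof -
   obtain a where "!!C. C : \<F> ==> tp L U A x a : C" using assms(3)[OF \<F>] by blast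
   hence "tp L U A x a : \<Inter> \<F>" by (rule InterI)
   thus ?thesis by (metis empty_iff)
  qed
  thus ?thesis using compact_type_space[of A x] assms(2) unfolding compact_space_fip by simp
 qed
 then obtain p where p: "!!C. C : \<C> ==> p : C" by blast
 moreover have "p : types L U A x" using False p closedin_subset[OF assms(2)] by (auto simp: topspace_type_space)
 ultimately show ?thesis by blast
qed

lemma closed_condition:
 assumes "ph : Fml L A x" "closed S"
 shows "closedin (type_space L U A x) {p : types L U A x. p ph : S}"
 using closedin_continuous_map_preimage[OF continuous_map_eval[OF assms(1)], of S] assms(2) by (simp add: topspace_type_space)

end

section \<open>Saturation and compactness in a monster model\<close>

locale monster = metric_model L U
 for L :: "('s, 'f, 'r) language" and U :: "('s, 'f, 'r, 'a) mstruct" +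
 fixes \<kappa> :: "'k rel" and T :: "('s, 'f, 'r, 'a) fml set"
 assumes monster: "monster_model L \<kappa> T U"
begin

text \<open>A countable set injects into the singletons of the variables \<open>(s0, n)\<close>,
  hence into the power set of the symbols, which is smaller than \<kappa>.\<close>

lemma small_countable:
 assumes "countable (SIGMA s:UNIV. A s)"
 shows "small \<kappa> A"
proof -
 have \<kappa>: "|Pow ((UNIV :: 's var set) <+> (funs L <+> rels L))| <o \<kappa>" using monster by (auto simp: monster_model_def)
 obtain f :: "_ => nat" where f: "inj_on f (SIGMA s:UNIV. A s)" using assms unfolding countable_def by blast
 obtain s0 :: 's where True by simp
 let ?g = "%p. {Inl (s0, f p)} :: ('s var + ('f + 'r)) set"
 have "inj_on ?g (SIGMA s:UNIV. A s)" using f by (auto simp: inj_on_def)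
 moreover have "?g ` (SIGMA s:UNIV. A s) <= Pow (UNIV <+> (funs L <+> rels L))" by auto
 ultimately have "|SIGMA s:UNIV. A s| <=o |Pow ((UNIV :: 's var set) <+> (funs L <+> rels L))|" using card_of_ordLeq by blast
 thus ?thesis unfolding small_def using \<kappa> ordLeq_ordLess_trans by blast
qed

lemma saturated_realize:
 assumes "!!s. A s <= univ U s" "small \<kappa> A" "finite x" "p : types L U A x"
 shows "EX a:AS U. tp L U A x a = p"
proof -
 obtain b where b: "b : tuples U x" "tp L U A x b = p"
 proof -
  have "saturated L \<kappa> U" using monster by (simp add: monster_model_def)
  hence "EX a:tuples U x. tp L U A x a = p" unfolding saturated_def using assms by simp
  thus thesis using that by blast
 qed
 obtain a where a: "a : AS U" "!!v. v : x ==> a v = b v" using tuples_extend[OF b(1)] by blast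
 show ?thesis by (rule bexI[OF _ a(1)]) (use tp_cong[of x a b] a b in simp)
qed

lemma realize_over:
 assumes "countable V" "finite x" "x Int V = {}" "a : AS U"
  and Def: "!!F r. (F, r) : \<G> ==> F : Def (V Un x)"
  and approx: "!!\<G>0 et. finite \<G>0 ==> \<G>0 <= \<G> ==> et > 0 ==>
   EX e:AS U. ALL (F, r):\<G>0. \<bar>F (ov a e x) - r\<bar> <= et"
 shows "EX e:AS U. ALL (F, r):\<G>. F (ov a e x) = r"
proof -
 define A where "A s = {a v | v. v : V & fst v = s}" for s
 have A: "A s <= univ U s" for s using asgD[OF assms(4)] by (auto simp: A_def)
 have "(SIGMA s:UNIV. A s) <= (%v. (fst v, a v)) ` V" by (auto simp: A_def)
 hence small: "small \<kappa> A" using assms(1) by (intro small_countable) (blast intro: countable_subset countable_image)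
 have "EX g. ALL F:fst ` \<G>. g F : F0 L (V Un x) & (ALL a:AS U. F a = fval U a (g F))"
 proof (rule bchoice, rule ballI)
  fix F assume "F : fst ` \<G>"
  hence "F : Def (V Un x)" using Def by force
  thus "EX ph. ph : F0 L (V Un x) & (ALL a:AS U. F a = fval U a ph)" unfolding Def_def by blast
 qed
 then obtain g where g: "!!F r. (F, r) : \<G> ==> g F : F0 L (V Un x)"
  "!!F r a. (F, r) : \<G> ==> a : AS U ==> F a = fval U a (g F)" by force
 define h where "h F = finst V a (g F)" for F
 have h: "h F : Fml L A x" if "(F, r) : \<G>" for F r unfolding h_def by (rule Fml_finst) (insert g(1)[OF that], auto simp: A_def Un_commute)
 have hval: "fval U e (h F) = F (ov a e x)" if "(F, r) : \<G>" "e : AS U" for F r e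
 proof -
  have "fval U e (h F) = fval U (ov e a V) (g F)" by (simp add: h_def fval_finst)
  also have "\<dots> = fval U (ov a e x) (g F)" by (rule fval_cong) (insert g(1)[OF that(1)] assms(3), auto simp: Fml_def override_on_def)
  finally show ?thesis using g(2)[OF that(1) asg_override[OF assms(4) that(2)]] by simp
 qed
 define C where "C = (%(F, r, n). {p : types L U A x. p (h F) : cball r (1 / Suc n)})"
 define I where "I = {(F, r, n :: nat) | F r n. (F, r) : \<G>}"
 have "EX p:types L U A x. ALL c:C ` I. p : c"
 proof (rule type_space_fip[OF A])
  fix c assume "c : C ` I"
  then obtain F r n where "(F, r) : \<G>" "c = C (F, r, n)" by (auto simp: I_def)
  thus "closedin (type_space L U A x) c" unfolding C_def prod.case using h by (blast intro: closed_condition closed_cball)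
 next
  fix \<D> assume \<D>: "finite \<D>" "\<D> <= C ` I"
  then obtain J where J: "finite J" "J <= I" "\<D> = C ` J" by (meson finite_subset_image)
  define \<G>0 where "\<G>0 = (%(F, r, n). (F, r)) ` J"
  \<comment> \<open>The largest tolerance index that occurs: one approximation within 1/(m+1) serves
    all conditions of the finite subfamily.\<close>
  define m where "m = Max (insert 0 ((%(F, r, n). n) ` J))"
  have m: "n <= m" if "(F, r, n) : J" for F r n
   unfolding m_def by (rule Max_ge) (insert that J(1), auto simp: image_iff intro!: bexI[of _ "(F, r, n)"])
  have "finite \<G>0" "\<G>0 <= \<G>" using J by (auto simp: \<G>0_def I_def)
  from approx[OF this, of "1 / Suc m"] obtain e where e: "e : AS U"
   "!!F r. (F, r) : \<G>0 ==> \<bar>F (ov a e x) - r\<bar> <= 1 / Suc m" by auto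
  have "tp L U A x e : C j" if j: "j : J" for j
  proof -
   obtain F r n where [simp]: "j = (F, r, n)" and Fr: "(F, r) : \<G>" using j J(2) by (auto simp: I_def)
   have "(F, r) : \<G>0" using j by (force simp: \<G>0_def)
   hence "\<bar>F (ov a e x) - r\<bar> <= 1 / Suc m" by (rule e(2))
   also have "\<dots> <= 1 / Suc n" using m[of F r n] j by (simp add: frac_le)
   finally show ?thesis unfolding C_def using tp_in_types[OF A e(1)] h[OF Fr] hval[OF Fr e(1)] by (simp add: tp_apply dist_real_def abs_minus_commute)
  qed
  thus "EX a:AS U. ALL C:\<D>. tp L U A x a : C" using e(1) J(3) by blast
 qed
 then obtain p where p: "p : types L U A x" "!!j. j : I ==> p : C j" by blast
 obtain e where e: "e : AS U" "tp L U A x e = p" using saturated_realize[OF A small assms(2) p(1)] by blast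
 have "F (ov a e x) = r" if Fr: "(F, r) : \<G>" for F r
 proof -
  have "\<bar>F (ov a e x) - r\<bar> <= 1 / Suc n" for n
  proof -
   have "p : C (F, r, n)" using Fr by (intro p(2)) (auto simp: I_def)
   thus ?thesis using h[OF Fr] hval[OF Fr e(1)] unfolding C_def e(2)[symmetric] by (simp add: tp_apply dist_real_def abs_minus_commute)
  qed
  hence "~ 0 < \<bar>F (ov a e x) - r\<bar>" using nat_approx_posE[of "\<bar>F (ov a e x) - r\<bar>"] by (metis not_less)
  thus "F (ov a e x) = r" by simp
 qed
 thus ?thesis using e(1) by blast
qed

end

lemma override_on_same [simp]: "ov a a x = a" by (auto simp: override_on_def)

context monster
begin

lemma types_sentence:
 assumes "p : types L U A x" "ph : Fml L A x" "b : AS U" "fvars ph = {}"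
 shows "fval U b ph = p ph"
proof -
 have "\<bar>fval U b ph - p ph\<bar> < e" if "e > 0" for e
 proof -
  have "EX a:AS U. ALL \<psi>:{ph}. \<bar>fval U a \<psi> - p \<psi>\<bar> < e" by (rule types_approx[OF assms(1)]) (use assms(2) that in simp_all)
  then obtain a where "\<bar>fval U a ph - p ph\<bar> < e" by blast
  moreover have "fval U a ph = fval U b ph" by (rule fval_cong) (use assms(4) in simp)
  ultimately show ?thesis by simp
 qed
 from this[of "\<bar>fval U b ph - p ph\<bar>"] show ?thesis by force
qed

text \<open>Saturation speaks about finite tuples, so the variables are realized one after another.
  A next value exists because the infimum of the violation of finitely many conditions is itself a
  formula in the earlier variables, whose value \<open>p\<close> prescribes.\<close>

lemma realize_type:
 assumes "countable V" "p : types L U no_params V"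
 shows "EX b:AS U. ALL ph:F0 L V. fval U b ph = p ph"
proof (cases "V = {}")
 case True
 obtain b where b: "b : AS U" using asg_ne by blast
 have "fval U b ph = p ph" if ph: "ph : F0 L V" for ph
  by (rule types_sentence[OF assms(2) ph b]) (insert ph True, simp add: Fml_def)
 thus ?thesis using b by blast
next
 case False
 define f where "f = from_nat_into V"
 have f: "range f = V" unfolding f_def using False assms(1) by (rule range_from_nat_into)
 define W where "W n = f ` {..<n}" for n
 have WV: "W n <= V" for n using f by (auto simp: W_def)
 have finW: "finite (W n)" for n by (simp add: W_def)
 define good where "good n b <-> b : AS U & (ALL ph:F0 L (W n). fval U b ph = p ph)" for n b
 have pD: "ph : F0 L V" if "ph : F0 L (W n)" for n ph using that WV[of n] by (auto simp: Fml_def)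
 have "EX b. good 0 b"
 proof -
  obtain b where b: "b : AS U" using asg_ne by blast
  have "fval U b ph = p ph" if ph: "ph : F0 L (W 0)" for ph
   by (rule types_sentence[OF assms(2) pD[OF ph] b]) (insert ph, simp add: Fml_def W_def)
  thus ?thesis using b unfolding good_def by blast
 qed
 moreover have "EX c. good (Suc n) c & (ALL v:W n. c v = b v)" if gb: "good n b" for n b
 proof -
  define x where "x = {f n} - W n"
  have x: "finite x" "x Int W n = {}" "W (Suc n) = W n Un x" by (auto simp: x_def W_def lessThan_Suc)
  have b: "b : AS U" "!!ph. ph : F0 L (W n) ==> fval U b ph = p ph" using gb unfolding good_def by blast+
  define \<G> where "\<G> = (%ph. (%a. fval U a ph, p ph)) ` F0 L (W (Suc n))"
  have "EX e:AS U. ALL (F, r):\<G>. F (ov b e x) = r"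
  proof (rule realize_over[OF _ x(1,2) b(1)])
   show "countable (W n)" using finW by (rule countable_finite)
   show "F : Def (W n Un x)" if "(F, r) : \<G>" for F r using that Def_fval unfolding \<G>_def x(3) by blast
   fix \<G>0 and et :: real assume \<G>0: "finite \<G>0" "\<G>0 <= \<G>" "et > 0"
   then obtain S where S: "finite S" "S <= F0 L (W (Suc n))"
    "\<G>0 = (%ph. (%a. fval U a ph, p ph)) ` S" unfolding \<G>_def by (meson finite_subset_image)
   \<comment> \<open>The largest violation among the finitely many conditions.
     \<open>infq x D\<close> reads only the variables in \<open>W n\<close>, where \<open>b\<close>
     already agrees with \<open>p\<close>.\<close>
   define D where "D a = Max (insert 0 ((%ph. \<bar>fval U a ph - p ph\<bar>) ` S))" for a
   have SD: "\<bar>fval U a ph - p ph\<bar> <= D a" if "ph : S" for a ph unfolding D_def by (rule Max_ge) (use S(1) that in auto)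
   have "(%a. \<bar>fval U a ph - p ph\<bar>) : Def (W (Suc n))" if "ph : S" for ph
   proof (rule Def_absdiff[OF _ Def_const])
    show "(%a. fval U a ph) : Def (W (Suc n))" using S(2) that by (intro Def_fval) blast
    show "p ph : {0..1}" using types_01[OF assms(2)] pD S(2) that by blast
   qed
   hence D: "D : Def (W (Suc n))" unfolding D_def[abs_def] by (rule Def_MAX[OF S(1)])
   have "infq x D : Def (W (Suc n) - x)" by (rule Def_infq[OF x(1) D])
   hence "infq x D : Def (W n)" by (rule Def_mono) (use x in blast)
   then obtain g where g: "g : F0 L (W n)" "!!a. a : AS U ==> infq x D a = fval U a g" unfolding Def_def by blast
   obtain a where a: "a : AS U" "ALL ph:insert g S. \<bar>fval U a ph - p ph\<bar> < et / 4"
   proof -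
    have "insert g S <= F0 L V" using S(2) g(1) pD by blast
    hence "EX a:AS U. ALL ph:insert g S. \<bar>fval U a ph - p ph\<bar> < et / 4"
     using types_approx[OF assms(2), of "insert g S" "et / 4"] S(1) \<G>0(3) by simp
    thus thesis using that by blast
   qed
   have "D a <= et / 4" unfolding D_def
   proof (rule Max.boundedI)
    fix r assume "r : insert 0 ((%ph. \<bar>fval U a ph - p ph\<bar>) ` S)"
    thus "r <= et / 4" using a(2) \<G>0(3) by force
   qed (use S(1) in auto)
   hence "infq x D a <= et / 4" using infq_lower[OF D a(1) a(1), of x] by simp
   hence "p g <= et / 2" using g(2)[OF a(1)] a(2) by (auto simp: abs_if split: if_splits)
   hence "infq x D b < et" using g(2)[OF b(1)] b(2)[OF g(1)] \<G>0(3) by simp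
   then obtain e where e: "e : AS U" "D (ov b e x) < et" by (rule infq_witness)
   have "\<bar>fval U (ov b e x) ph - p ph\<bar> <= et" if "ph : S" for ph using SD[OF that, of "ov b e x"] e(2) by simp
   thus "EX e:AS U. ALL (F, r):\<G>0. \<bar>F (ov b e x) - r\<bar> <= et" using e(1) unfolding S(3) by auto
  qed
  then obtain e where e: "e : AS U" "ALL (F, r):\<G>. F (ov b e x) = r" by blast
  have "good (Suc n) (ov b e x)" unfolding good_def using asg_override[OF b(1) e(1)] e(2) unfolding \<G>_def by auto
  moreover have "ALL v:W n. ov b e x v = b v" using x(2) by (auto simp: override_on_def)
  ultimately show ?thesis by blast
 qed
 ultimately obtain B where B: "!!n. good n (B n)" "!!n. ALL v:W n. B (Suc n) v = B n v"
  using dependent_nat_choice[of good "%n b c. ALL v:W n. c v = b v"] by metis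
 have mono: "ALL v:W n. B (n + k) v = B n v" for n k
 proof (induction k)
  case (Suc k)
  have "W n <= W (n + k)" by (auto simp: W_def)
  thus ?case using Suc B(2)[of "n + k"] by auto
 qed simp
 \<comment> \<open>The stage at which \<open>v\<close> receives its value; later stages leave it
   alone.\<close>
 define N where "N v = (LEAST n. v : W n)" for v
 define b where "b v = (if v : V then B (N v) v else B 0 v)" for v
 have b: "b v = B n v" if "v : W n" for v n
 proof -
  have "v : W (N v)" "N v <= n" unfolding N_def using that by (auto intro: LeastI Least_le)
  hence "B (N v + (n - N v)) v = B (N v) v" using mono by blast
  thus ?thesis using `N v <= n` WV[of n] that by (auto simp: b_def)
 qed
 have "b : AS U" unfolding asg_def
 proof (intro CollectI allI)
  fix v
  have "B n v : univ U (fst v)" for n using B(1)[of n] asgD unfolding good_def by blast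
  thus "b v : univ U (fst v)" by (simp add: b_def)
 qed
 moreover have "fval U b ph = p ph" if ph: "ph : F0 L V" for ph
 proof -
  have "fvars ph <= range f" using ph f by (simp add: Fml_def)
  then obtain I where I: "finite I" "fvars ph = f ` I" using finite_fvars by (meson finite_subset_image)
  obtain n where "I <= {..<n}" using I(1) finite_nat_iff_bounded by blast
  hence sub: "fvars ph <= W n" using I(2) by (auto simp: W_def)
  have "fval U b ph = fval U (B n) ph" by (rule fval_cong) (use b sub in blast)
  also have "\<dots> = p ph" using B(1)[of n] sub ph by (auto simp: good_def Fml_def)
  finally show ?thesis .
 qed
 ultimately show ?thesis by blast
qed

text \<open>Countability is asked of the variables, while \<Gamma> may be of any size: compactness
  of the type space treats all conditions at once, and only the realization proceeds variable by
  variable.\<close>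

theorem compactness:
 assumes "countable V"
  and Def: "!!F. F : \<Gamma> ==> F : Def V"
  and approx: "!!\<Gamma>0 et. finite \<Gamma>0 ==> \<Gamma>0 <= \<Gamma> ==> et > 0 ==> EX a:AS U. ALL F:\<Gamma>0. F a <= et"
 shows "EX a:AS U. ALL F:\<Gamma>. F a = 0"
proof -
 have "EX g. ALL F:\<Gamma>. g F : F0 L V & (ALL a:AS U. F a = fval U a (g F))"
  by (rule bchoice) (insert Def, force simp: Def_def)
 then obtain g where g: "!!F. F : \<Gamma> ==> g F : F0 L V"
  "!!F a. F : \<Gamma> ==> a : AS U ==> F a = fval U a (g F)" by blast
 define C where "C = (%(F, n). {p : types L U no_params V. p (g F) : {..1 / Suc n}})"
 have "EX p:types L U no_params V. ALL c:C ` (\<Gamma> \<times> UNIV). p : c"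
 proof (rule type_space_fip)
  fix c assume "c : C ` (\<Gamma> \<times> UNIV)"
  then obtain F n where "F : \<Gamma>" "c = C (F, n)" by auto
  thus "closedin (type_space L U no_params V) c" unfolding C_def prod.case using closed_condition[OF g(1) closed_atMost] by blast
 next
  fix \<D> assume \<D>: "finite \<D>" "\<D> <= C ` (\<Gamma> \<times> UNIV)"
  then obtain J where J: "finite J" "J <= \<Gamma> \<times> UNIV" "\<D> = C ` J" by (meson finite_subset_image)
  define m where "m = Max (insert 0 (snd ` J))"
  have m: "n <= m" if "(F, n) : J" for F n unfolding m_def by (rule Max_ge) (insert that J(1), force+)
  have "finite (fst ` J)" "fst ` J <= \<Gamma>" using J by auto
  from approx[OF this, of "1 / Suc m"] obtain a where a: "a : AS U" "!!F. F : fst ` J ==> F a <= 1 / Suc m" by auto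
  have "tp L U no_params V a : C j" if j: "j : J" for j
  proof -
   obtain F n where [simp]: "j = (F, n)" by force
   have F: "F : \<Gamma>" "F : fst ` J" using j J(2) by force+
   have "F a <= 1 / Suc m" by (rule a(2)[OF F(2)])
   also have "\<dots> <= 1 / Suc n" using m[of F n] j by (simp add: frac_le)
   finally show ?thesis unfolding C_def using tp_in_types[of no_params a V] a(1) g(1)[OF F(1)] g(2)[OF F(1) a(1)] by (simp add: tp_apply)
  qed
  thus "EX a:AS U. ALL C:\<D>. tp L U no_params V a : C" using a(1) J(3) by blast
 qed simp
 then obtain p where p: "p : types L U no_params V" "!!F n. F : \<Gamma> ==> p : C (F, n)" by blast
 obtain b where b: "b : AS U" "!!ph. ph : F0 L V ==> fval U b ph = p ph" using realize_type[OF assms(1) p(1)] by blast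
 have "F b = 0" if F: "F : \<Gamma>" for F
 proof -
  have "F b <= 1 / Suc n" for n using p(2)[OF F, of n] b(2)[OF g(1)[OF F]] g(2)[OF F b(1)] unfolding C_def by simp
  hence "~ 0 < F b" using nat_approx_posE[of "F b"] by (metis not_less)
  moreover have "0 <= F b" using Def_ge0[OF Def[OF F] b(1)] .
  ultimately show ?thesis by simp
 qed
 thus ?thesis using b(1) by blast
qed

text \<open>Homogeneity for finite tuples. The conditions satisfied by \<open>e\<close> over
  \<open>a\<close> are finitely satisfiable over \<open>b\<close>, since \<open>infq x D\<close>
  takes the same value at \<open>a\<close> and at \<open>b\<close>.\<close>

lemma extend_equivalent:
 assumes "finite V" "finite x" "x Int V = {}" "a : AS U" "b : AS U" "e : AS U"
  and eq: "!!F. F : Def V ==> F a = F b"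
 shows "EX e':AS U. ALL F:Def (V Un x). F (ov b e' x) = F (ov a e x)"
proof -
 define \<G> where "\<G> = (%F. (F, F (ov a e x))) ` Def (V Un x)"
 have "EX e':AS U. ALL (F, r):\<G>. F (ov b e' x) = r"
 proof (rule realize_over[OF countable_finite[OF assms(1)] assms(2,3,5)])
  show "F : Def (V Un x)" if "(F, r) : \<G>" for F r using that by (auto simp: \<G>_def)
  fix \<G>0 and et :: real assume \<G>0: "finite \<G>0" "\<G>0 <= \<G>" "et > 0"
  then obtain S where S: "finite S" "S <= Def (V Un x)" "\<G>0 = (%F. (F, F (ov a e x))) ` S" unfolding \<G>_def by (meson finite_subset_image)
  define D where "D c = Max (insert 0 ((%F. \<bar>F c - F (ov a e x)\<bar>) ` S))" for c
  have SD: "\<bar>F c - F (ov a e x)\<bar> <= D c" if "F : S" for c F unfolding D_def by (rule Max_ge) (use S(1) that in auto)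
  have "(%c. \<bar>F c - F (ov a e x)\<bar>) : Def (V Un x)" if "F : S" for F
  proof (rule Def_absdiff[OF _ Def_const])
   show "F : Def (V Un x)" using S(2) that by blast
   thus "F (ov a e x) : {0..1}" by (rule Def_01[OF _ asg_override[OF assms(4,6)]])
  qed
  hence D: "D : Def (V Un x)" unfolding D_def[abs_def] by (rule Def_MAX[OF S(1)])
  have "infq x D : Def (V Un x - x)" by (rule Def_infq[OF assms(2) D])
  hence "infq x D : Def V" by (rule Def_mono) blast
  hence "infq x D b = infq x D a" by (rule eq[symmetric])
  also have "\<dots> <= D (ov a e x)" by (rule infq_lower[OF D assms(4,6)])
  also have "\<dots> = 0" unfolding D_def by (cases "S = {}") (simp_all add: image_constant_conv)
  finally have "infq x D b < et" using \<G>0(3) by simp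
  then obtain e' where e': "e' : AS U" "D (ov b e' x) < et" by (rule infq_witness)
  have "\<bar>F (ov b e' x) - F (ov a e x)\<bar> <= et" if "F : S" for F using SD[OF that, of "ov b e' x"] e'(2) by simp
  thus "EX e':AS U. ALL (F, r):\<G>0. \<bar>F (ov b e' x) - r\<bar> <= et" using e'(1) unfolding S(3) by auto
 qed
 thus ?thesis unfolding \<G>_def by auto
qed

end

section \<open>Indiscernible sequences\<close>

definition seq_on :: "'i::linorder set => ('i => 'e) => ('i, 'e) sequence" where
 "seq_on A f = \<lparr>idx = A, lt = {(i, j). i : A & j : A & i < j}, entry = f\<rparr>"

lemma seq_on_simps [simp]: "idx (seq_on A f) = A" "(i, j) : lt (seq_on A f) <-> i : A & j : A & i < j" "entry (seq_on A f) = f"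
 by (auto simp: seq_on_def)

lemma strict_linear_order_seq_on [simp]: "strict_linear_order (seq_on A f)" by (auto simp: strict_linear_order_def irrefl_def trans_def total_on_def)

definition positions :: "('s var => nat \<times> 's var) => nat => 's var set => 's var set" where
 "positions rh k x = {v. fst (rh v) < k & snd (rh v) : x & fst (snd (rh v)) = fst v}"

lemma positionsD:
 assumes "v : positions rh k x"
 shows "fst (rh v) < k" "snd (rh v) : x" "fst (snd (rh v)) = fst v" using assms by (auto simp: positions_def)

lemma single_simps [simp]: "idx (single b) = {undefined}" "lt (single b) = {}" "entry (single b) = (%_. b)" by (auto simp: single_def)

lemma indiscernibleD:
 fixes U :: "('s, 'f, 'r, 'a) mstruct" and ph :: "('s, 'f, 'r, 'a) fml"
 assumes "indiscernible L U x I" "set is <= idx I" "set js <= idx I" "length is = length js"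
  "sorted_wrt (%i j. (i, j) : lt I) is" "sorted_wrt (%i j. (i, j) : lt I) js" "ph : F0 L (positions rh (length is) x)"
 shows "fval U (%v. entry I (is ! fst (rh v)) (snd (rh v))) ph = fval U (%v. entry I (js ! fst (rh v)) (snd (rh v))) ph"
 using assms(1)[unfolded indiscernible_def, THEN conjunct2, THEN conjunct2, THEN spec, THEN spec, THEN spec, THEN spec, THEN mp, of "is" js ph rh] assms(2-)
 unfolding positions_def by blast

text \<open>A strictly increasing map sends increasing index lists to increasing index lists, so
  indiscernibility passes to subsequences and reindexings.\<close>

lemma indiscernible_embed:
 fixes U :: "('s, 'f, 'r, 'a) mstruct"
 assumes ind: "indiscernible L U x I'" and lin: "strict_linear_order I"
  and f: "f ` idx I <= idx I'" "!!i j. (i, j) : lt I ==> (f i, f j) : lt I'"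
  and ent: "!!i. i : idx I ==> entry I i = entry I' (f i)"
 shows "indiscernible L U x I" unfolding indiscernible_def
proof (intro conjI allI impI)
 show "strict_linear_order I" by fact
 show "entry I ` idx I <= tuples U x" using ind f(1) ent unfolding indiscernible_def by force
 fix "is" js rh and ph :: "('s, 'f, 'r, 'a) fml"
 assume H: "set is <= idx I & set js <= idx I & length is = length js &
  sorted_wrt (%i j. (i, j) : lt I) is & sorted_wrt (%i j. (i, j) : lt I) js &
  ph : F0 L {v. fst (rh v) < length is & snd (rh v) : x & fst (snd (rh v)) = fst v}"
 have s: "sorted_wrt (%i j. (i, j) : lt I') (map f ks)" if "sorted_wrt (%i j. (i, j) : lt I) ks" for ks
  using that by (auto simp: sorted_wrt_map intro: sorted_wrt_mono_rel[rotated] f(2))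
 have "fval U (%v. entry I' (map f is ! fst (rh v)) (snd (rh v))) ph =
    fval U (%v. entry I' (map f js ! fst (rh v)) (snd (rh v))) ph"
 proof (rule indiscernibleD[OF ind])
  show "ph : F0 L (positions rh (length (map f is)) x)" using H unfolding positions_def length_map by blast
  show "set (map f is) <= idx I'" "set (map f js) <= idx I'" using H f(1) unfolding set_map by blast+
 qed (use H s in simp_all)
 moreover have "fval U (%v. entry I (ks ! fst (rh v)) (snd (rh v))) ph =
   fval U (%v. entry I' (map f ks ! fst (rh v)) (snd (rh v))) ph"
  if "length ks = length is" "set ks <= idx I" for ks
 proof (rule fval_cong)
  fix v assume "v : fvars ph"
  hence v: "fst (rh v) < length ks" using H that by (auto simp: Fml_def)
  hence "ks ! fst (rh v) : idx I" using that(2) nth_mem by blast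
  thus "entry I (ks ! fst (rh v)) (snd (rh v)) = entry I' (map f ks ! fst (rh v)) (snd (rh v))" using v ent by simp
 qed
 ultimately show "fval U (%v. entry I (is ! fst (rh v)) (snd (rh v))) ph = fval U (%v. entry I (js ! fst (rh v)) (snd (rh v))) ph"
  using H by simp
qed

lemma indiscernible_finite_character:
 fixes U :: "('s, 'f, 'r, 'a) mstruct"
 assumes "entry I ` idx I <= tuples U x" "strict_linear_order I"
  and "!!F. finite F ==> F <= idx I ==> indiscernible L U x (I\<lparr>idx := F, lt := lt I Int F \<times> F\<rparr>)"
 shows "indiscernible L U x I" unfolding indiscernible_def
proof (intro conjI allI impI)
 fix "is" js rh and ph :: "('s, 'f, 'r, 'a) fml"
 assume H: "set is <= idx I & set js <= idx I & length is = length js &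
  sorted_wrt (%i j. (i, j) : lt I) is & sorted_wrt (%i j. (i, j) : lt I) js &
  ph : F0 L {v. fst (rh v) < length is & snd (rh v) : x & fst (snd (rh v)) = fst v}"
 let ?F = "set is Un set js"
 have "sorted_wrt (%i j. (i, j) : lt I Int ?F \<times> ?F) is" "sorted_wrt (%i j. (i, j) : lt I Int ?F \<times> ?F) js"
  using H by (auto intro: sorted_wrt_mono_rel[rotated])
 moreover have "ph : F0 L (positions rh (length is) x)" using H unfolding positions_def by blast
 moreover have "length is = length js" "?F <= idx I" using H by blast+
 ultimately show "fval U (%v. entry I (is ! fst (rh v)) (snd (rh v))) ph = fval U (%v. entry I (js ! fst (rh v)) (snd (rh v))) ph"
  using indiscernibleD[OF assms(3)[of ?F], of "is" js ph rh] by simp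
qed (use assms in auto)

lemma seq_sum_simps [simp]: "(k, i) : idx (seq_sum Is) <-> k < length Is & i : idx (Is ! k)"
 "((k, i), (l, j)) : lt (seq_sum Is) <-> k < length Is & l < length Is & i : idx (Is ! k) &
   j : idx (Is ! l) & (k < l | k = l & (i, j) : lt (Is ! k))" "entry (seq_sum Is) (k, i) = entry (Is ! k) i" by (auto simp: seq_sum_def)

lemma strict_linear_order_single [simp]: "strict_linear_order (single b)" by (auto simp: single_def strict_linear_order_def irrefl_def trans_def total_on_def)

lemma strict_linear_order_seq_sum:
 assumes "!!k. k < length Is ==> strict_linear_order (Is ! k)"
 shows "strict_linear_order (seq_sum Is)" unfolding strict_linear_order_def
proof (intro conjI)
 show "lt (seq_sum Is) <= idx (seq_sum Is) \<times> idx (seq_sum Is)" by auto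
 show "irrefl (lt (seq_sum Is))" using assms by (auto simp: irrefl_def strict_linear_order_def)
 show "trans (lt (seq_sum Is))"
 proof (rule transI)
  fix u v w assume "(u, v) : lt (seq_sum Is)" "(v, w) : lt (seq_sum Is)"
  thus "(u, w) : lt (seq_sum Is)" using assms by (cases u; cases v; cases w) (auto simp: strict_linear_order_def dest: transD)
 qed
 show "total_on (idx (seq_sum Is)) (lt (seq_sum Is))"
 proof (rule total_onI)
  fix u v assume uv: "u : idx (seq_sum Is)" "v : idx (seq_sum Is)" "u ~= v"
  obtain a i b j where [simp]: "u = (a, i)" "v = (b, j)" by force
  have ab: "a < length Is" "i : idx (Is ! a)" "b < length Is" "j : idx (Is ! b)" using uv by auto
  have "a = b ==> (i, j) : lt (Is ! a) | (j, i) : lt (Is ! a)"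
   using assms[OF ab(1)] ab uv(3) unfolding strict_linear_order_def total_on_def by auto
  thus "(u, v) : lt (seq_sum Is) | (v, u) : lt (seq_sum Is)" using ab by (cases a b rule: linorder_cases) auto
 qed
qed

text \<open>The summands are placed into successive sets \<open>Z k\<close> of indices of one
  linearly indexed sequence, and \<open>indiscernible_embed\<close> applies.\<close>

lemma indiscernible_seq_sum:
 assumes "indiscernible L U x (seq_on B ent)"
  and "!!k. k < length Is ==> strict_linear_order (Is ! k)"
  and "!!k i. k < length Is ==> i : idx (Is ! k) ==> F k i : Z k & entry (Is ! k) i = ent (F k i)"
  and "!!k i j. k < length Is ==> (i, j) : lt (Is ! k) ==> F k i < F k j"
  and "!!k. k < length Is ==> Z k <= B"
  and "!!k l p q. k < l ==> l < length Is ==> p : Z k ==> q : Z l ==> p < q"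
 shows "indiscernible L U x (seq_sum Is)"
proof (rule indiscernible_embed[OF assms(1) strict_linear_order_seq_sum[OF assms(2)], where f = "%(k, i). F k i"])
 show "(%(k, i). F k i) ` idx (seq_sum Is) <= idx (seq_on B ent)" using assms(3,5) by (fastforce simp: split_def)
 have le: "F k i < F l j" if "k < l" "l < length Is" "i : idx (Is ! k)" "j : idx (Is ! l)" for k l i j
  using assms(3)[of k i] assms(3)[of l j] assms(6)[OF that(1,2)] that by auto
 have B: "F k i : B" if "k < length Is" "i : idx (Is ! k)" for k i using assms(3)[OF that] assms(5)[OF that(1)] by blast
 show "((%(k, i). F k i) u, (%(k, i). F k i) v) : lt (seq_on B ent)" if "(u, v) : lt (seq_sum Is)" for u v
  using that B le assms(4) by (cases u; cases v) auto
 show "entry (seq_sum Is) u = entry (seq_on B ent) ((%(k, i). F k i) u)" if "u : idx (seq_sum Is)" for u using that assms(3) by (cases u) auto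
qed

text \<open>Distality for two cuts of a sequence indexed by rationals. The definition speaks about
  orders on the type \<open>'i\<close>, so the rational index sets are copied there along an
  injection, which exists because \<open>'i\<close> is infinite.\<close>

lemma distal_two_cuts:
 fixes A :: "rat set" and ent :: "rat => 's var => 'a"
 assumes distal: "distal TYPE('i) L U" and inf: "infinite (UNIV :: 'i set)" and fin: "finite x"
  and m: "m ~: A" "n ~: A" "m < n"
  and dense: "!!p q. p : A ==> q : A ==> p < q ==> EX r:A. p < r & r < q"
   "!!p. EX r:A. r < p" "!!p. EX r:A. p < r" "!!p q. p < q ==> EX r:A. p < r & r < q"
  and I0: "indiscernible L U x (seq_on A ent)"
  and Im: "indiscernible L U x (seq_on (insert m A) ent)"
  and In: "indiscernible L U x (seq_on (insert n A) ent)"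
 shows "indiscernible L U x (seq_on (insert m (insert n A)) ent)"
proof -
 obtain g :: "nat => 'i" where g: "inj g" using inf by (auto simp: infinite_iff_countable_subset)
 define io :: "rat => 'i" where "io = g o to_nat"
 have inj: "inj io" unfolding io_def using g by (simp add: inj_compose)
 define J where "J C = \<lparr>idx = io ` C, lt = {(io p, io q) | p q. p : C & q : C & p < q}, entry = ent o inv io\<rparr>" for C
 have Jlt: "(io p, io q) : lt (J C) <-> p : C & q : C & p < q" for p q C using inj by (auto simp: J_def inj_eq)
 have Jidx: "idx (J C) = io ` C" for C by (simp add: J_def)
 have Jent: "entry (J C) (io p) = ent p" for C p using inj by (simp add: J_def)
 have Jlt_E: "EX p q. i = io p & j = io q & p : C & q : C & p < q" if "(i, j) : lt (J C)" for i j C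
  using that by (auto simp: J_def)
 have slo: "strict_linear_order (J C)" for C using inj by (auto simp: strict_linear_order_def irrefl_def trans_def total_on_def J_def inj_eq)
 \<comment> \<open>The two cuts split \<open>A\<close> into three pieces, each dense and without
   endpoints because \<open>A\<close> meets every open interval and is unbounded.\<close>
 define A1 where "A1 = {p : A. p < m}"
 define A2 where "A2 = {p : A. m < p & p < n}"
 define A3 where "A3 = {p : A. n < p}"
 have dense_J: "dense_without_endpoints (J C)"
  if C: "C ~= {}" "!!p q. p : C ==> q : C ==> p < q ==> EX r:C. p < r & r < q"
   "!!p. p : C ==> EX r:C. r < p" "!!p. p : C ==> EX r:C. p < r" for C
  unfolding dense_without_endpoints_def
 proof (intro conjI allI impI ballI)
  show "idx (J C) ~= {}" using C(1) by (simp add: Jidx)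
  fix i j assume "(i, j) : lt (J C)"
  then obtain p q where "i = io p" "j = io q" "p : C" "q : C" "p < q" using Jlt_E by blast
  thus "EX k. (i, k) : lt (J C) & (k, j) : lt (J C)" using C(2)[of p q] Jlt by blast
 next
  fix i assume "i : idx (J C)"
  then obtain p where p: "p : C" "i = io p" by (auto simp: Jidx)
  show "EX j. (j, i) : lt (J C)" using C(3)[OF p(1)] p Jlt by blast
  show "EX j. (i, j) : lt (J C)" using C(4)[OF p(1)] p Jlt by blast
 qed (rule slo)
 have d: "dense_without_endpoints (J A1)" "dense_without_endpoints (J A2)" "dense_without_endpoints (J A3)"
 proof -
  show "dense_without_endpoints (J A1)"
  proof (rule dense_J)
   show "A1 ~= {}" using dense(2)[of m] by (auto simp: A1_def)
   show "EX r:A1. p < r & r < q" if "p : A1" "q : A1" "p < q" for p q using dense(4)[OF that(3)] that unfolding A1_def by force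
   show "EX r:A1. r < p" if "p : A1" for p using dense(2)[of p] that unfolding A1_def by force
   show "EX r:A1. p < r" if "p : A1" for p using dense(4)[of p m] that unfolding A1_def by force
  qed
  show "dense_without_endpoints (J A2)"
  proof (rule dense_J)
   show "A2 ~= {}" using dense(4)[OF m(3)] by (auto simp: A2_def)
   show "EX r:A2. p < r & r < q" if "p : A2" "q : A2" "p < q" for p q using dense(4)[OF that(3)] that unfolding A2_def by force
   show "EX r:A2. r < p" if "p : A2" for p using dense(4)[of m p] that unfolding A2_def by force
   show "EX r:A2. p < r" if "p : A2" for p using dense(4)[of p n] that unfolding A2_def by force
  qed
  show "dense_without_endpoints (J A3)"
  proof (rule dense_J)
   show "A3 ~= {}" using dense(3)[of n] by (auto simp: A3_def)
   show "EX r:A3. p < r & r < q" if "p : A3" "q : A3" "p < q" for p q using dense(4)[OF that(3)] that unfolding A3_def by force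
   show "EX r:A3. r < p" if "p : A3" for p using dense(4)[of n p] that unfolding A3_def by force
   show "EX r:A3. p < r" if "p : A3" for p using dense(3)[of p] that unfolding A3_def by force
  qed
 qed
 have split: "p : A <-> p : A1 | p : A2 | p : A3" for p using m by (auto simp: A1_def A2_def A3_def not_less le_less)
 have inv_io [simp]: "inv io (io p) = p" for p using inj by simp
 have Jmono: "inv io i < inv io j" if "(i, j) : lt (J C)" for i j C using Jlt_E[OF that] by auto
 have JF: "inv io i : C & entry (J C) i = ent (inv io i)" if "i : idx (J C)" for i C using that by (auto simp: Jidx Jent)
 have sub: "A1 <= A" "A2 <= A" "A3 <= A" by (auto simp: A1_def A2_def A3_def)
 have ord: "p : A1 ==> p < m" "p : A1 ==> p < n" "p : A2 ==> m < p" "p : A2 ==> p < n"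
  "p : A3 ==> n < p" "p : A3 ==> m < p" for p using m(3) by (auto simp: A1_def A2_def A3_def)
 have ord2: "p < q" if "p : A1" "q : A2 | q : A3 | q = m | q = n" for p q using that ord by (meson less_trans)
 have ord3: "p < q" if "p : A2" "q : A3" for p q using that ord by (meson less_trans)
 have S0: "indiscernible L U x (seq_sum [J A1, J A2, J A3])"
  by (rule indiscernible_seq_sum[OF I0, where F = "%k. inv io" and Z = "%k. [A1, A2, A3] ! k"])
    (insert slo sub JF Jmono ord2 ord3, auto simp: less_Suc_eq numeral_eq_Suc)
 have S1: "indiscernible L U x (seq_sum [J A1, single (ent m), J A2, J A3])"
  by (rule indiscernible_seq_sum[OF Im, where F = "%k i. if k = 1 then m else inv io i"
     and Z = "%k. [A1, {m}, A2, A3] ! k"]) (insert slo sub JF Jmono ord ord2 ord3, auto simp: less_Suc_eq numeral_eq_Suc)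
 have S2: "indiscernible L U x (seq_sum [J A1, J A2, single (ent n), J A3])"
  by (rule indiscernible_seq_sum[OF In, where F = "%k i. if k = 2 then n else inv io i"
     and Z = "%k. [A1, A2, {n}, A3] ! k"]) (insert slo sub JF Jmono ord ord2 ord3, auto simp: less_Suc_eq numeral_eq_Suc)
 have S3: "indiscernible L U x (seq_sum [J A1, single (ent m), J A2, single (ent n), J A3])" using distal fin d S0 S1 S2 unfolding distal_def by blast
 show ?thesis by (rule indiscernible_embed[OF S3 strict_linear_order_seq_on,
     where f = "%q. if q < m then (0, io q) else if q = m then (1, undefined) else if q < n then (2, io q)
      else if q = n then (3, undefined) else (4, io q)"]) (insert inj m, auto simp: Jidx Jent numeral_eq_Suc Jlt A1_def A2_def A3_def)
qed

context metric_model
begin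

text \<open>Indiscernibility tested by functions in \<open>Def\<close> on total assignments; the
  base assignment \<open>a\<close> fills the variables outside the tested positions.\<close>

lemma indiscernible_seq_onI:
 fixes A :: "'i::linorder set"
 assumes ent: "!!i. i : A ==> ent i : AS U" and a: "a : AS U"
  and eq: "!!is js rh te. set is <= A ==> set js <= A ==> length is = length js ==> sorted_wrt (<) is ==>
   sorted_wrt (<) js ==> te : Def (positions rh (length is) x) ==>
   te (%v. if v : positions rh (length is) x then ent (is ! fst (rh v)) (snd (rh v)) else a v) =
   te (%v. if v : positions rh (length is) x then ent (js ! fst (rh v)) (snd (rh v)) else a v)"
 shows "indiscernible L U x (seq_on A (%i. restrict (ent i) x))" unfolding indiscernible_def
proof (intro conjI allI impI)
 show "entry (seq_on A (%i. restrict (ent i) x)) ` idx (seq_on A (%i. restrict (ent i) x)) <= tuples U x"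
  using restrict_tuples[OF ent, of _ U x] by auto
 fix "is" js rh and ph :: "('s, 'f, 'r, 'a) fml"
 assume H: "set is <= idx (seq_on A (%i. restrict (ent i) x)) & set js <= idx (seq_on A (%i. restrict (ent i) x)) &
  length is = length js & sorted_wrt (%i j. (i, j) : lt (seq_on A (%i. restrict (ent i) x))) is &
  sorted_wrt (%i j. (i, j) : lt (seq_on A (%i. restrict (ent i) x))) js &
  ph : F0 L {v. fst (rh v) < length is & snd (rh v) : x & fst (snd (rh v)) = fst v}"
 let ?V = "positions rh (length is) x"
 have H': "set is <= A" "set js <= A" "length is = length js" "sorted_wrt (<) is" "sorted_wrt (<) js" "ph : F0 L ?V"
  using H unfolding positions_def by (auto intro: sorted_wrt_mono_rel[rotated])
 have "fval U (%v. if v : ?V then ent (is ! fst (rh v)) (snd (rh v)) else a v) ph =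
   fval U (%v. if v : ?V then ent (js ! fst (rh v)) (snd (rh v)) else a v) ph" using eq[OF H'(1-5) Def_fval[OF H'(6)]] .
 moreover have "fval U (%v. if v : ?V then ent (ks ! fst (rh v)) (snd (rh v)) else a v) ph =
   fval U (%v. entry (seq_on A (%i. restrict (ent i) x)) (ks ! fst (rh v)) (snd (rh v))) ph" for ks
 proof (rule fval_cong)
  fix v assume "v : fvars ph"
  hence "v : ?V" using H'(6) unfolding Fml_def by blast
  thus "(if v : ?V then ent (ks ! fst (rh v)) (snd (rh v)) else a v) =
    entry (seq_on A (%i. restrict (ent i) x)) (ks ! fst (rh v)) (snd (rh v))" using positionsD(2)[of v rh "length is" x] by simp
 qed
 ultimately show "fval U (%v. entry (seq_on A (%i. restrict (ent i) x)) (is ! fst (rh v)) (snd (rh v))) ph =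
   fval U (%v. entry (seq_on A (%i. restrict (ent i) x)) (js ! fst (rh v)) (snd (rh v))) ph" by simp
qed simp

lemma NIP_convergent:
 assumes "NIP L U" "finite x" "finite y" "x Int y = {}" "ph : Def (x Un y)" "c : AS U"
  and "!!i::nat. ent i : AS U"
  and "indiscernible L U x (seq_on UNIV (%i::nat. restrict (ent i) x))"
 shows "convergent (%i. ph (ov c (ent i) x))"
proof -
 obtain f where f: "f : F0 L (x Un y)" "!!a. a : AS U ==> ph a = fval U a f" using assms(5) unfolding Def_def by blast
 have s: "seq_on UNIV (%i::nat. restrict (ent i) x) = \<lparr>idx = UNIV, lt = {(i, j). i < j}, entry = %i. restrict (ent i) x\<rparr>"
  by (simp add: seq_on_def)
 have "restrict c y : tuples U y" by (rule restrict_tuples[OF assms(6)]) simp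
 with assms(1) have "convergent (%i. fval U (ov (restrict c y) (restrict (ent i) x) x) f)" unfolding NIP_def using assms(2-4,8) f(1) unfolding s by blast
 moreover have "fval U (ov (restrict c y) (restrict (ent i) x) x) f = ph (ov c (ent i) x)" for i
 proof -
  have "fval U (ov (restrict c y) (restrict (ent i) x) x) f = fval U (ov c (ent i) x) f"
   by (rule fval_cong) (insert f(1), auto simp: Fml_def override_on_def)
  thus ?thesis using f(2)[OF asg_override[OF assms(6,7)]] by simp
 qed
 ultimately show ?thesis by simp
qed

text \<open>The limits of \<open>s\<close> and \<open>t\<close> are both limits of subsequences of
  the interleaved sequence, hence equal.\<close>

lemma convergent_gap:
 fixes s t :: "nat => real"
 assumes "convergent s" "convergent t" "convergent (%n. if even n then s n else t n)" "ep > 0"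
 shows "EX n. \<bar>s n - t n\<bar> < ep"
proof -
 obtain a b l where a: "s \<longlonglongrightarrow> a" and b: "t \<longlonglongrightarrow> b" and l: "(%n. if even n then s n else t n) \<longlonglongrightarrow> l"
  using assms unfolding convergent_def by blast
 have m: "strict_mono (%n::nat. 2 * n)" "strict_mono (%n::nat. 2 * n + 1)" by (auto simp: strict_mono_def)
 have "(%n. s (2 * n)) \<longlonglongrightarrow> l" using LIMSEQ_subseq_LIMSEQ[OF l m(1)] by (simp add: comp_def)
 moreover have "(%n. s (2 * n)) \<longlonglongrightarrow> a" using LIMSEQ_subseq_LIMSEQ[OF a m(1)] by (simp add: comp_def)
 ultimately have "l = a" by (rule LIMSEQ_unique)
 moreover have "(%n. t (2 * n + 1)) \<longlonglongrightarrow> l" using LIMSEQ_subseq_LIMSEQ[OF l m(2)] by (simp add: comp_def)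
 moreover have "(%n. t (2 * n + 1)) \<longlonglongrightarrow> b" using LIMSEQ_subseq_LIMSEQ[OF b m(2)] by (simp add: comp_def)
 ultimately have "a = b" using LIMSEQ_unique by metis
 hence "(%n. s n - t n) \<longlonglongrightarrow> 0" using tendsto_diff[OF a b] by simp
 from LIMSEQ_D[OF this assms(4)] obtain N where "ALL n>=N. norm (s n - t n - 0) < ep" by blast
 thus ?thesis by (intro exI[of _ N]) simp
qed

text \<open>Every natural number is a cut with two candidates. Distality makes every simultaneous
  choice of candidates indiscernible, so by NIP \<open>ph\<close> converges along each choice.
  Alternating between the larger and the smaller value forces the two together.\<close>

lemma distal_no_oscillation:
 fixes E :: "rat => 's var => 'a" and B :: "nat => bool => 's var => 'a"
 assumes NIP: "NIP L U" and distal: "distal TYPE('i) L U" and inf: "infinite (UNIV :: 'i set)"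
  and fin: "finite x" "finite y" "x Int y = {}" and ph: "ph : Def (x Un y)" and c: "c : AS U"
  and E: "!!q. E q : AS U" and B: "!!n bt. B n bt : AS U"
  and ind: "!!n bt. indiscernible L U x (seq_on (insert (of_nat n) (- \<nat>)) (%q. restrict (if q = of_nat n then B n bt else E q) x))"
  and ep: "ep > 0"
 shows "EX n. \<bar>ph (ov c (B n True) x) - ph (ov c (B n False) x)\<bar> < ep"
proof (rule ccontr)
 assume no: "~ ?thesis"
 define ent where "ent bt q = restrict (if q : \<nat> then B (nat \<lfloor>q\<rfloor>) (bt (nat \<lfloor>q\<rfloor>)) else E q) x"
  for bt :: "nat => bool" and q :: rat
 \<comment> \<open>The rationals outside \<nat> stay dense: a natural number between
   \<open>p\<close> and \<open>q\<close> is moved up by less than 1.\<close>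
 have dense: "EX r:- \<nat>. p < r & r < q" if pq: "p < q" for p q :: rat
 proof -
  obtain r where r: "p < r" "r < q" using Orderings.dense[OF pq] by blast
  show ?thesis
  proof (cases "r : \<nat>")
   case True
   then obtain k where k: "r = of_nat k" by (auto elim: Nats_cases)
   define s where "s = (r + min q (r + 1)) / 2"
   have s: "r < s" "s < r + 1" "s < q" using r(2) by (auto simp: s_def min_def field_simps)
   have "s ~: \<nat>"
   proof
    assume "s : \<nat>"
    then obtain l where "s = of_nat l" by (auto elim: Nats_cases)
    with s k have "k < l" "of_nat l < (of_nat (Suc k) :: rat)" by simp_all
    thus False by (simp only: of_nat_less_iff)
   qed
   with s r show ?thesis by (intro bexI[of _ s]) auto
  qed (use r in auto)
 qed
 have dense_lo: "EX r:- \<nat>. r < p" and dense_hi: "EX r:- \<nat>. p < r" for p :: rat using dense[of "p - 1" p] dense[of p "p + 1"] by auto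
 have ent_nat: "ent bt (of_nat n) = restrict (B n (bt n)) x" for bt n by (simp add: ent_def)
 \<comment> \<open>Induction on the number of filled cuts. The sequences lacking both of two cuts,
   or one of them, are indiscernible, and distality fills both.\<close>
 have fin_ind: "indiscernible L U x (seq_on (of_nat ` F Un - \<nat>) (ent bt))" if "finite F" for F bt using that
 proof (induction "card F" arbitrary: F rule: less_induct)
  case less
  show ?case
  proof (cases "EX m:F. EX n:F. m < n")
   case False
   have "F <= {n}" if "n : F" for n using False that by (auto simp: not_less) (meson le_antisym)
   then obtain n where n: "F <= {n}" by blast
   show ?thesis
   proof (rule indiscernible_embed[OF ind[of n "bt n"] strict_linear_order_seq_on, where f = "%q. q"])
    show "entry (seq_on (of_nat ` F Un - \<nat>) (ent bt)) i =
     entry (seq_on (insert (of_nat n) (- \<nat>)) (%q. restrict (if q = of_nat n then B n (bt n) else E q) x)) i"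
     if "i : idx (seq_on (of_nat ` F Un - \<nat>) (ent bt))" for i using that n by (auto simp: ent_def)
   qed (use n in auto)
  next
   case True
   then obtain m n where mn: "m : F" "n : F" "m < n" by blast
   define A where "A = (of_nat ` (F - {m, n}) Un - \<nat> :: rat set)"
   have cards: "card (F - {m, n}) < card F" "card (F - {n}) < card F" "card (F - {m}) < card F" by (rule psubset_card_mono; use less.prems mn in blast)+
   have eqs: "insert (of_nat m) A = of_nat ` (F - {n}) Un - \<nat>" "insert (of_nat n) A = of_nat ` (F - {m}) Un - \<nat>"
    "insert (of_nat m) (insert (of_nat n) A) = of_nat ` F Un - \<nat>" using mn by (auto simp: A_def)
   have "indiscernible L U x (seq_on (insert (of_nat m) (insert (of_nat n) A)) (ent bt))"
   proof (rule distal_two_cuts[OF distal inf fin(1)])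
    show "of_nat m ~: A" "of_nat n ~: A" "(of_nat m :: rat) < of_nat n" using mn(3) by (auto simp: A_def)
    show "EX r:A. p < r & r < q" if "p < q" for p q using dense[OF that] by (auto simp: A_def)
    thus "EX r:A. p < r & r < q" if "p < q" for p q using that by blast
    show "EX r:A. r < p" for p using dense_lo[of p] by (auto simp: A_def)
    show "EX r:A. p < r" for p using dense_hi[of p] by (auto simp: A_def)
    show "indiscernible L U x (seq_on A (ent bt))" unfolding A_def by (rule less.hyps[OF cards(1)]) (use less.prems in simp)
    show "indiscernible L U x (seq_on (insert (of_nat m) A) (ent bt))" unfolding eqs(1) by (rule less.hyps[OF cards(2)]) (use less.prems in simp)
    show "indiscernible L U x (seq_on (insert (of_nat n) A) (ent bt))" unfolding eqs(2) by (rule less.hyps[OF cards(3)]) (use less.prems in simp)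
   qed
   thus ?thesis unfolding eqs(3) .
  qed
 qed
 have conv: "convergent (%n. ph (ov c (B n (bt n)) x))" for bt
 proof (rule NIP_convergent[OF NIP fin ph c B])
  show "indiscernible L U x (seq_on UNIV (%n::nat. restrict (B n (bt n)) x))"
  proof (rule indiscernible_finite_character)
   show "entry (seq_on UNIV (%n::nat. restrict (B n (bt n)) x)) ` idx (seq_on UNIV (%n::nat. restrict (B n (bt n)) x)) <= tuples U x"
    using restrict_tuples[OF B, where N = U and x = x] by auto
   fix F :: "nat set" assume "finite F"
   show "indiscernible L U x ((seq_on UNIV (%n::nat. restrict (B n (bt n)) x))\<lparr>idx := F,
     lt := lt (seq_on UNIV (%n::nat. restrict (B n (bt n)) x)) Int F \<times> F\<rparr>)"
   proof (rule indiscernible_embed[OF fin_ind[OF `finite F`, of bt], where f = of_nat])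
    show "strict_linear_order ((seq_on UNIV (%n::nat. restrict (B n (bt n)) x))\<lparr>idx := F,
     lt := lt (seq_on UNIV (%n::nat. restrict (B n (bt n)) x)) Int F \<times> F\<rparr>)"
     by (auto simp: strict_linear_order_def irrefl_def trans_def total_on_def)
   qed (auto simp: ent_nat)
  qed simp
 qed
 \<comment> \<open>\<open>bt\<close> picks the candidate with the larger value, its negation the one
   with the smaller value.\<close>
 define bt where "bt n <-> ph (ov c (B n False) x) <= ph (ov c (B n True) x)" for n
 let ?s = "%bt n. ph (ov c (B n (bt n)) x)"
 have "(%n. if even n then ?s bt n else ?s (%n. ~ bt n) n) = ?s (%n. if even n then bt n else ~ bt n)" by auto
 hence "EX n. \<bar>?s bt n - ?s (%n. ~ bt n) n\<bar> < ep"
  using convergent_gap[OF conv[of bt] conv[of "%n. ~ bt n"] _ ep] conv[of "%n. if even n then bt n else ~ bt n"]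
  by simp
 then obtain n where n: "\<bar>?s bt n - ?s (%n. ~ bt n) n\<bar> < ep" by blast
 hence "\<bar>ph (ov c (B n True) x) - ph (ov c (B n False) x)\<bar> < ep" by (cases "bt n") (simp_all add: abs_minus_commute)
 with no show False by blast
qed

end

section \<open>Sampling and partitions of unity\<close>

lemma sum_PiE_insert:
 assumes "x ~: S"
 shows "(SUM g:PiE (insert x S) T. F g) = (SUM y:T x. SUM g:PiE S T. F (g(x := y)))"
proof -
 have "(SUM g:PiE (insert x S) T. F g) = (SUM (y, g):T x \<times> PiE S T. F (g(x := y)))" unfolding PiE_insert_eq
  by (subst sum.reindex[OF inj_combinator[OF assms]]) (simp add: case_prod_unfold)
 thus ?thesis by (simp add: sum.cartesian_product)
qed

text \<open>Draw the entries of \<open>t\<close> independently with probabilities w/W. For fixed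
  \<open>S\<close> and \<open>j\<close> outside \<open>S\<close>, the event
  \<open>P S t (t j)\<close> has probability at most \<open>dl\<close>, and a union bound over at
  most 2^L * L pairs (S, j) leaves a sample that avoids all of them.\<close>

lemma sampling:
 fixes w :: "nat => real" and P :: "nat set => (nat => nat) => nat => bool"
 assumes fin: "finite I" and w: "!!i. i : I ==> 0 <= w i" and W: "W = sum w I" "0 < W"
  and dep: "!!S t t' i. S <= {..<L} ==> S ~= {} ==> (!!l. l : S ==> t l = t' l) ==> P S t i = P S t' i"
  and P: "!!S t. S <= {..<L} ==> S ~= {} ==> t ` S <= I ==> (SUM i:{i : I. P S t i}. w i) <= dl * W"
  and dl: "dl * real L * 2 ^ L < 1" "0 <= dl"
 shows "EX t. t ` {..<L} <= I & (ALL S<={..<L}. S ~= {} --> (ALL j:{..<L} - S. ~ P S t (t j)))"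
proof (rule ccontr)
 assume neg: "~ ?thesis"
 define T where "T = PiE {..<L} (%_. I)"
 \<comment> \<open>The unnormalized probability of the sample \<open>t\<close>; the total is
   \<open>W ^ L\<close>.\<close>
 define m where "m t = (PROD l<L. w (t l))" for t
 define D where "D = (SIGMA S:Pow {..<L} - {{}}. {..<L} - S)"
 have finT: "finite T" unfolding T_def using fin by (intro finite_PiE) auto
 have finD: "finite D" unfolding D_def by (intro finite_SigmaI) auto
 have m0: "0 <= m t" if "t : T" for t unfolding m_def by (intro prod_nonneg) (insert that w, auto simp: T_def)
 have total: "(SUM t:T. m t) = W ^ L" unfolding T_def m_def using prod_sum_PiE[of "{..<L}" "%_. I" "%_. w"] fin W(1) by simp
 have bad: "EX (S, j):D. P S t (t j)" if "t : T" for t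
 proof -
  have "t ` {..<L} <= I" using that by (auto simp: T_def)
  have "~ (ALL S<={..<L}. S ~= {} --> (ALL j:{..<L} - S. ~ P S t (t j)))"
  proof
   assume "ALL S<={..<L}. S ~= {} --> (ALL j:{..<L} - S. ~ P S t (t j))"
   with \<open>t ` {..<L} <= I\<close> show False by (rule notE[OF neg exI, OF conjI])
  qed
  then obtain S j where "S <= {..<L}" "S ~= {}" "j : {..<L} - S" "P S t (t j)" by auto
  thus ?thesis by (intro bexI[of _ "(S, j)"]) (auto simp: D_def)
 qed
 have one: "(SUM t:T. m t * of_bool (P S t (t j))) <= dl * W ^ L" if "(S, j) : D" for S j
 proof -
  have S: "S <= {..<L}" "S ~= {}" "j < L" "j ~: S" using that by (auto simp: D_def)
  define J where "J = {..<L} - {j}"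
  have J: "{..<L} = insert j J" "j ~: J" "finite J" "card J = L - 1" using S(3) by (auto simp: J_def)
  \<comment> \<open>Conditioning on the coordinates other than \<open>j\<close>: since
    \<open>j\<close> is not in \<open>S\<close>, these and the drawn value \<open>i\<close> decide
    the event.\<close>
  have "(SUM t:T. m t * of_bool (P S t (t j))) = (SUM i:I. SUM g:PiE J (%_. I). (PROD l:J. w (g l)) * (w i * of_bool (P S g i)))"
   unfolding T_def J(1) sum_PiE_insert[OF J(2)] m_def
  proof (intro sum.cong refl)
   fix i g
   have "(PROD l:J. w ((g(j := i)) l)) = (PROD l:J. w (g l))" by (rule prod.cong) (use J(2) in auto)
   moreover have "P S (g(j := i)) i = P S g i" by (rule dep[OF S(1,2)]) (use S(4) in auto)
   ultimately show "(PROD l:insert j J. w ((g(j := i)) l)) * of_bool (P S (g(j := i)) ((g(j := i)) j)) = (PROD l:J. w (g l)) * (w i * of_bool (P S g i))"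
    using J by simp
  qed
  also have "\<dots> = (SUM g:PiE J (%_. I). (PROD l:J. w (g l)) * (SUM i:{i : I. P S g i}. w i))"
  proof -
   have "(SUM i:I. (PROD l:J. w (g l)) * (w i * of_bool (P S g i))) = (PROD l:J. w (g l)) * (SUM i:{i : I. P S g i}. w i)" for g
    unfolding sum_distrib_left[symmetric] by (rule arg_cong[where f = "%r. (PROD l:J. w (g l)) * r"])
      (insert fin, auto intro!: sum.mono_neutral_cong_right)
   thus ?thesis by (subst sum.swap) simp
  qed
  also have "\<dots> <= (SUM g:PiE J (%_. I). (PROD l:J. w (g l)) * (dl * W))"
  proof (intro sum_mono mult_left_mono)
   fix g assume g: "g : PiE J (%_. I)"
   have "S <= J" using S by (auto simp: J_def)
   thus "(SUM i:{i : I. P S g i}. w i) <= dl * W" using g by (intro P S(1,2)) auto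
   show "0 <= (PROD l:J. w (g l))" using g w by (intro prod_nonneg) auto
  qed
  also have "\<dots> = (SUM g:PiE J (%_. I). PROD l:J. w (g l)) * (dl * W)" by (simp add: sum_distrib_right)
  also have "(SUM g:PiE J (%_. I). PROD l:J. w (g l)) = W ^ (L - 1)" using prod_sum_PiE[of J "%_. I" "%_. w"] fin W(1) J by simp
  also have "W ^ (L - 1) * (dl * W) = dl * W ^ L" using S(3) by (cases L) auto
  finally show ?thesis .
 qed
 have "W ^ L <= (SUM t:T. SUM (S, j):D. m t * of_bool (P S t (t j)))" unfolding total[symmetric]
 proof (rule sum_mono)
  fix t assume t: "t : T"
  obtain S j where "(S, j) : D" "P S t (t j)" using bad[OF t] by blast
  hence "m t = (case (S, j) of (S, j) => m t * of_bool (P S t (t j)))" by simp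
  also have "\<dots> <= (SUM (S, j):D. m t * of_bool (P S t (t j)))" by (rule member_le_sum[OF `(S, j) : D`]) (use m0[OF t] finD in auto)
  finally show "m t <= (SUM (S, j):D. m t * of_bool (P S t (t j)))" .
 qed
 also have "\<dots> = (SUM (S, j):D. SUM t:T. m t * of_bool (P S t (t j)))" by (subst sum.swap) (simp add: case_prod_unfold)
 also have "\<dots> <= (SUM d:D. dl * W ^ L)" by (rule sum_mono) (use one in auto)
 also have "\<dots> = real (card D) * (dl * W ^ L)" by simp
 also have "\<dots> <= (2 ^ L * real L) * (dl * W ^ L)"
 proof (rule mult_right_mono)
  have "D <= Pow {..<L} \<times> {..<L}" by (auto simp: D_def)
  hence "card D <= card (Pow {..<L} \<times> {..<L})" by (intro card_mono) auto
  also have "\<dots> = 2 ^ L * L" by (simp add: card_cartesian_product card_Pow)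
  finally have "card D <= 2 ^ L * L" .
  hence "real (card D) <= real (2 ^ L * L)" by (simp only: of_nat_le_iff)
  thus "real (card D) <= 2 ^ L * real L" by simp
  show "0 <= dl * W ^ L" using dl(2) W(2) by simp
 qed
 also have "\<dots> = (dl * real L * 2 ^ L) * W ^ L" by (simp add: algebra_simps)
 also have "\<dots> < 1 * W ^ L" by (rule mult_strict_right_mono) (use dl W(2) in auto)
 finally show False by simp
qed

text \<open>Ramsey's theorem for sets of \<open>k\<close> elements, a set being identified with its
  increasing enumeration.\<close>

lemma ramsey_increasing: "EX L. ALL f :: nat list => nat.
   (ALL ys. sorted_wrt (<) ys & set ys <= {..<L} & length ys = k --> f ys < q) -->
   (EX H<={..<L}. card H = s & (ALL ys zs. sorted_wrt (<) ys & set ys <= H & length ys = k &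
         sorted_wrt (<) zs & set zs <= H & length zs = k --> f ys = f zs))"
proof -
 obtain L :: nat where L: "partn_lst {..<L} (replicate q s) k" using ramsey_full by blast
 show ?thesis
 proof (intro exI[of _ L] allI impI)
  fix f :: "nat list => nat"
  assume f: "ALL ys. sorted_wrt (<) ys & set ys <= {..<L} & length ys = k --> f ys < q"
  have col: "(%Y. f (sorted_list_of_set Y)) : nsets {..<L} k \<rightarrow> {..<q}"
  proof
   fix Y assume "Y : nsets {..<L} k"
   hence "Y <= {..<L}" "finite Y" "card Y = k" by (auto simp: nsets_def)
   thus "f (sorted_list_of_set Y) : {..<q}" using f by simp
  qed
  obtain i H where "i < length (replicate q s)" "H : nsets {..<L} (replicate q s ! i)"
   and H: "(%Y. f (sorted_list_of_set Y)) ` nsets H k <= {i}" using partn_lstE[OF L col length_replicate] by metis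
  hence Hs: "H : nsets {..<L} s" by simp
  have "f ys = i" if "sorted_wrt (<) ys" "set ys <= H" "length ys = k" for ys
  proof -
   have "sorted_list_of_set (set ys) = ys" using that(1) by (simp add: strict_sorted_iff sorted_list_of_set.idem_if_sorted_distinct)
   moreover have "set ys : nsets H k" using that strict_sorted_iff[of ys] distinct_card[of ys] by (auto simp: nsets_def)
   ultimately show ?thesis using H by (metis image_subset_iff singletonD)
  qed
  thus "EX H<={..<L}. card H = s & (ALL ys zs. sorted_wrt (<) ys & set ys <= H & length ys = k &
         sorted_wrt (<) zs & set zs <= H & length zs = k --> f ys = f zs)" using Hs by (intro exI[of _ H]) (auto simp: nsets_def)
 qed
qed

text \<open>The piecewise linear partition of unity at the integers: at most the two hats next to
  \<open>s\<close> are nonzero.\<close>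

lemma sum_hats:
 fixes s :: real
 assumes "0 <= s" "s <= real N"
 shows "(SUM g<=N. max 0 (1 - \<bar>s - real g\<bar>)) = 1" using assms
proof (induction N)
 case (Suc N)
 show ?case
 proof (cases "s <= real N")
  case True
  thus ?thesis using Suc by simp
 next
  case False
  have "(SUM g<=Suc N. max 0 (1 - \<bar>s - real g\<bar>)) = (SUM g<N. max 0 (1 - \<bar>s - real g\<bar>)) +
    max 0 (1 - \<bar>s - real N\<bar>) + max 0 (1 - \<bar>s - real (Suc N)\<bar>)" by (simp add: lessThan_Suc_atMost[symmetric])
  also have "(SUM g<N. max 0 (1 - \<bar>s - real g\<bar>)) = 0"
  proof (rule sum.neutral, rule ballI)
   fix g assume "g : {..<N}"
   hence "real g + 1 <= real N" by simp
   thus "max 0 (1 - \<bar>s - real g\<bar>) = 0" using False by simp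
  qed
  finally show ?thesis using False Suc.prems by (simp add: abs_if)
 qed
qed simp

section \<open>Definable partitions of unity\<close>

context metric_model
begin

text \<open>A partition of unity \<open>h\<close> in the variables \<open>x\<close> with parameters
  \<open>z\<close>. The companions \<open>p\<close> stand in for the supports: \<open>p k\<close> is
  definable and equals 1 wherever \<open>h k\<close> is positive, so a formula can bound what
  happens on a cell.\<close>

definition scheme ::
 "'s var set => 's var set => 'j set => ('j => ('s var => 'a) => real) => ('j => ('s var => 'a) => real) => bool" where
 "scheme x z K h p <-> finite z & x Int z = {} & finite K &
   (ALL k:K. h k : Def (x Un z) & p k : Def (x Un z)) &
   (ALL a:AS U. (SUM k:K. h k a) = 1 & (ALL k:K. h k a > 0 --> p k a = 1))"

lemma schemeD:
 assumes "scheme x z K h p"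
 shows "finite z" "x Int z = {}" "finite K" "!!k. k : K ==> h k : Def (x Un z)" "!!k. k : K ==> p k : Def (x Un z)"
  "!!a. a : AS U ==> (SUM k:K. h k a) = 1"
  "!!a k. a : AS U ==> k : K ==> h k a > 0 ==> p k a = 1" using assms by (simp_all add: scheme_def)

lemma scheme_nonneg: "scheme x z K h p ==> k : K ==> a : AS U ==> 0 <= h k a" by (rule Def_ge0[OF schemeD(4)])

lemma scheme_times:
 assumes H: "scheme x z K h p" "scheme x z' K' h' p'"
 shows "scheme x (z Un z') (K \<times> K') (%(k, l) a. h k a * h' l a) (%(k, l) a. min (p k a) (p' l a))" unfolding scheme_def
proof (intro conjI ballI)
 have sub: "x Un z <= x Un (z Un z')" "x Un z' <= x Un (z Un z')" by auto
 show "finite (z Un z')" "x Int (z Un z') = {}" "finite (K \<times> K')" using schemeD(1-3)[OF H(1)] schemeD(1-3)[OF H(2)] by auto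
 fix i assume "i : K \<times> K'"
 then obtain k l where [simp]: "i = (k, l)" and kl: "k : K" "l : K'" by auto
 show "(case i of (k, l) => %a. h k a * h' l a) : Def (x Un (z Un z'))"
  using Def_mult[OF Def_mono[OF schemeD(4)[OF H(1) kl(1)] sub(1)] Def_mono[OF schemeD(4)[OF H(2) kl(2)] sub(2)]] by simp
 show "(case i of (k, l) => %a. min (p k a) (p' l a)) : Def (x Un (z Un z'))"
  using Def_min[OF Def_mono[OF schemeD(5)[OF H(1) kl(1)] sub(1)] Def_mono[OF schemeD(5)[OF H(2) kl(2)] sub(2)]] by simp
next
 fix a assume a: "a : AS U"
 have "(SUM i:K \<times> K'. (case i of (k, l) => %a. h k a * h' l a) a) = (SUM k:K. h k a) * (SUM l:K'. h' l a)"
  unfolding sum_product sum.cartesian_product by (simp add: case_prod_unfold)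
 thus "(SUM i:K \<times> K'. (case i of (k, l) => %a. h k a * h' l a) a) = 1" using schemeD(6)[OF H(1) a] schemeD(6)[OF H(2) a] by simp
 fix i assume "i : K \<times> K'"
 then obtain k l where [simp]: "i = (k, l)" and kl: "k : K" "l : K'" by auto
 show "0 < (case i of (k, l) => %a. h k a * h' l a) a --> (case i of (k, l) => %a. min (p k a) (p' l a)) a = 1"
  using schemeD(7)[OF H(1) a kl(1)] schemeD(7)[OF H(2) a kl(2)] scheme_nonneg[OF H(1) kl(1) a] scheme_nonneg[OF H(2) kl(2) a] by (auto simp: zero_less_mult_iff)
qed

lemma scheme_reindex:
 assumes "scheme x z K h p" "bij_betw f K' K"
 shows "scheme x z K' (h o f) (p o f)"
proof -
 have "finite K'" using bij_betw_finite[OF assms(2)] schemeD(3)[OF assms(1)] by simp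
 moreover have "f k : K" if "k : K'" for k using bij_betwE[OF assms(2)] that by simp
 moreover have "(SUM k:K'. h (f k) a) = (SUM k:K. h k a)" for a by (rule sum.reindex_bij_betw[OF assms(2)])
 ultimately show ?thesis using schemeD[OF assms(1)] unfolding scheme_def by simp
qed

text \<open>The companion is the hat widened by 1: it is 1 on the support of the hat and vanishes
  from distance 2 on.\<close>

lemma scheme_hat:
 assumes "finite z" "x Int z = {}" "te : Def (x Un z)" "N > 0"
 shows "scheme x z {..N} (%g a. max 0 (1 - \<bar>real N * te a - real g\<bar>))
  (%g a. max 0 (min 1 (2 - \<bar>real N * te a - real g\<bar>)))" unfolding scheme_def
proof (intro conjI ballI)
 fix g
 show "(%a. max 0 (1 - \<bar>real N * te a - real g\<bar>)) : Def (x Un z)"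
  by (rule Def_1[OF _ _ assms(3), where g = "%t. max 0 (1 - \<bar>real N * t - real g\<bar>)"]) (auto intro!: continuous_intros)
 show "(%a. max 0 (min 1 (2 - \<bar>real N * te a - real g\<bar>))) : Def (x Un z)"
  by (rule Def_1[OF _ _ assms(3), where g = "%t. max 0 (min 1 (2 - \<bar>real N * t - real g\<bar>))"]) (auto intro!: continuous_intros)
next
 fix a assume "a : AS U"
 hence "te a : {0..1}" using assms(3) Def_01 by blast
 hence "0 <= real N * te a" "real N * te a <= real N" using mult_left_le[of "te a" "real N"] by auto
 thus "(SUM g<=N. max 0 (1 - \<bar>real N * te a - real g\<bar>)) = 1" by (rule sum_hats)
qed (use assms in auto)

text \<open>The common refinement of the hats of all \<open>te\<close>. Where \<open>p k\<close> is
  positive, N * te lies within 2 of a fixed integer, hence the width 4/N. Pairs of indices are coded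
  as natural numbers to keep the type of \<open>K\<close> fixed along the induction.\<close>

lemma scheme_fine:
 assumes "finite \<Delta>" "finite z" "x Int z = {}" "!!te. te : \<Delta> ==> te : Def (x Un z)" "N > 0"
 shows "EX (K :: nat set) h p. scheme x z K h p &
  (ALL k:K. ALL a b. p k a > 0 & p k b > 0 --> (ALL te:\<Delta>. \<bar>te a - te b\<bar> < 4 / real N))"
 using assms(1,4)
proof (induction rule: finite_induct)
 case empty
 have "scheme x z {0 :: nat} (%_ _. 1) (%_ _. 1)" using assms(2,3) by (auto simp: scheme_def intro: Def_const)
 thus ?case by (intro exI[of _ "{0}"] exI conjI) auto
next
 case (insert te \<Delta>)
 then obtain K :: "nat set" and h p where H: "scheme x z K h p"
  and fine: "!!k a b te. k : K ==> p k a > 0 ==> p k b > 0 ==> te : \<Delta> ==> \<bar>te a - te b\<bar> < 4 / real N"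
  by (metis insertCI)
 let ?p = "%g a. max 0 (min 1 (2 - \<bar>real N * te a - real g\<bar>))"
 note H' = scheme_times[OF scheme_hat[OF assms(2,3) _ assms(5)] H, of te]
 have te: "te : Def (x Un z)" using insert.prems by blast
 have "bij_betw prod_decode (prod_encode ` ({..N} \<times> K)) ({..N} \<times> K)" by (rule bij_betw_byWitness[where f' = prod_encode]) auto
 note R = scheme_reindex[OF H'[OF te] this]
 show ?case
 proof (intro exI conjI ballI allI impI)
  show "scheme x z (prod_encode ` ({..N} \<times> K)) ((%(k, l) a. max 0 (1 - \<bar>real N * te a - real k\<bar>) * h l a) o prod_decode)
   ((%(k, l) a. min (?p k a) (p l a)) o prod_decode)" using R by simp
  fix i a b te' assume i: "i : prod_encode ` ({..N} \<times> K)" and te': "te' : insert te \<Delta>"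
   and pos: "0 < ((%(k, l) a. min (?p k a) (p l a)) o prod_decode) i a & 0 < ((%(k, l) a. min (?p k a) (p l a)) o prod_decode) i b"
  from i obtain g k where gk: "i = prod_encode (g, k)" "k : K" by auto
  have "\<bar>real N * te a - real g\<bar> < 2" "\<bar>real N * te b - real g\<bar> < 2" "p k a > 0" "p k b > 0" using pos gk by auto
  show "\<bar>te' a - te' b\<bar> < 4 / real N"
  proof (cases "te' = te")
   case True
   have "\<bar>real N * te a - real N * te b\<bar> < 4"
    using `\<bar>real N * te a - real g\<bar> < 2` `\<bar>real N * te b - real g\<bar> < 2` by linarith
   hence "real N * \<bar>te a - te b\<bar> < 4" by (simp add: abs_mult flip: right_diff_distrib)
   thus ?thesis using True assms(5) by (simp add: field_simps)
  next
   case False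
   with te' have "te' : \<Delta>" by simp
   thus ?thesis by (rule fine[OF gk(2) `p k a > 0` `p k b > 0`])
  qed
 qed
qed

end

lemma asgI: "(!!v. a v : B (fst v)) ==> a : asg B" by (simp add: asg_def)

text \<open>The \<open>i\<close>-th copy of a variable has the same sort and an index of at least
  \<open>b\<close>. With \<open>b\<close> above all indices in use the copies are fresh, and the
  pairing keeps them distinct.\<close>

definition cp :: "nat => nat => 's var => 's var" where "cp b i v = (fst v, b + prod_encode (i, snd v))"

text \<open>\<open>glue b e c\<close> reads the variables of index below \<open>b\<close> in \<open>c\<close> and the \<open>i\<close>-th copy of a variable in \<open>e i\<close>.\<close>

definition glue :: "nat => (nat => 's var => 'a) => ('s var => 'a) => 's var => 'a" where
 "glue b e c v = (if snd v < b then c v else e (fst (prod_decode (snd v - b))) (fst v, snd (prod_decode (snd v - b))))"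

lemma fst_cp [simp]: "fst (cp b i v) = fst v"
 and snd_cp: "b <= snd (cp b i v)" by (simp_all add: cp_def)

lemma glue_cp [simp]: "glue b e c (cp b i v) = e i v" by (simp add: glue_def cp_def)

lemma glue_low: "snd v < b ==> glue b e c v = c v" by (simp add: glue_def)

lemma glue_asg:
 assumes "!!i. e i : asg B" "c : asg B"
 shows "glue b e c : asg B"
proof (rule asgI)
 fix v show "glue b e c v : B (fst v)" using asgD[OF assms(2), of v] asgD[OF assms(1), of "fst (prod_decode (snd v - b))" "(fst v, snd (prod_decode (snd v - b)))"]
  by (simp add: glue_def)
qed

lemma var_index_bound: "finite V ==> EX b. ALL v:V. snd v < (b :: nat)"
proof -
 assume "finite V"
 then obtain b where "snd ` V <= {..<b}" using finite_nat_iff_bounded by blast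
 thus ?thesis by (intro exI[of _ b]) auto
qed

section \<open>Uniform control of the bad cells\<close>

context metric_model
begin

text \<open>The cell is read at \<open>d\<close> and the predicate at \<open>c\<close>. Keeping the
  two assignments apart allows the cell to be fixed before \<open>c\<close> varies.\<close>

definition steady ::
 "'s var set => (('s var => 'a) => real) => real => (('s var => 'a) => real) => ('s var => 'a) => ('s var => 'a) => bool" where
 "steady x ph ep p d c <-> (ALL e:AS U. ALL e':AS U. p (ov d e x) > 0 & p (ov d e' x) > 0 -->
    \<bar>ph (ov c e x) - ph (ov c e' x)\<bar> <= ep)"

text \<open>The parameters of a scheme will be demanded from \<open>asg B\<close> like the points.
  When \<open>B\<close> is the universe of a submodel, they are then elements of that
  submodel.\<close>

definition weighted_points :: "('s => 'a set) => nat set => (nat => 's var => 'a) => (nat => real) => bool" where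
 "weighted_points B I e w <->
   (ALL s. B s ~= {} & B s <= univ U s) & finite I & (ALL i:I. e i : asg B & 0 <= w i)"

lemma weighted_pointsD:
 assumes "weighted_points B I e w"
 shows "asg B <= AS U" "finite I" "!!i. i : I ==> e i : asg B" "!!i. i : I ==> e i : AS U"
  "!!i. i : I ==> 0 <= w i" "0 <= (SUM i:I. w i)"
proof -
 show *: "asg B <= AS U" by (rule asg_mono) (insert assms, simp add: weighted_points_def)
 show **: "e i : asg B" "0 <= w i" if "i : I" for i using assms that by (simp_all add: weighted_points_def)
 show "finite I" using assms by (simp add: weighted_points_def)
 show "e i : AS U" if "i : I" for i using * **(1)[OF that] by blast
 show "0 <= (SUM i:I. w i)" by (rule sum_nonneg) (rule **(2))
qed

definition bad :: "'s var set => (('s var => 'a) => real) => real => 'j set => ('j => ('s var => 'a) => real) =>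
  ('j => ('s var => 'a) => real) => ('s var => 'a) => ('s var => 'a) => ('s var => 'a) => real" where
 "bad x ph ep K h p d c e = (SUM k:{k : K. ~ steady x ph ep (p k) d c}. h k (ov d e x))"

text \<open>The order of quantifiers is the point: the scheme and \<open>q\<close> precede the
  weighted points, and a single \<open>d\<close> serves all \<open>c\<close>.\<close>

definition controls where "controls x ph ep K h p q <-> (ALL B I e w. weighted_points B I e w -->
   (EX d:asg B. ALL c:AS U. (SUM i:I. w i * bad x ph ep K h p d c (e i)) <= q * (SUM i:I. w i)))"

lemma bad_01:
 assumes H: "scheme x z K h p" and d: "d : AS U" and e: "e : AS U"
 shows "0 <= bad x ph ep K h p d c e" "bad x ph ep K h p d c e <= 1"
proof -
 note n = scheme_nonneg[OF H _ asg_override[OF d e]]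
 show "0 <= bad x ph ep K h p d c e" unfolding bad_def by (rule sum_nonneg) (use n in auto)
 have "bad x ph ep K h p d c e <= (SUM k:K. h k (ov d e x))" unfolding bad_def by (rule sum_mono2) (use n schemeD(3)[OF H] in auto)
 thus "bad x ph ep K h p d c e <= 1" using schemeD(6)[OF H asg_override[OF d e]] by simp
qed

text \<open>Two points that the tests \<Delta> hardly distinguish from \<open>f\<close> although
  \<open>ph\<close> separates them at \<open>c\<close>: the two candidates for one cut.\<close>

definition oscillates where
 "oscillates x ph ep \<Delta> et D c f <-> (EX e1:AS U. EX e2:AS U. ep < \<bar>ph (ov c e1 x) - ph (ov c e2 x)\<bar> &
   (ALL te:\<Delta>. \<bar>te (ov D e1 x) - te (ov D f x)\<bar> < et & \<bar>te (ov D e2 x) - te (ov D f x)\<bar> < et))"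

lemma asg_B_ne: "(!!s. B s ~= {}) ==> asg B ~= ({} :: ('s var => 'a) set)"
proof -
 assume "!!s. B s ~= {}"
 hence "(%v. SOME u. u : B (fst v)) : asg B" unfolding asg_def using some_in_eq by blast
 thus ?thesis by blast
qed

text \<open>Samples are drawn from a counterexample to control with the factor 1 - dl. Whatever
  parameters the samples in \<open>S\<close> form, at most a \<open>dl\<close>-fraction of the
  weight sits at points of bad mass 0. Any other point lies in a cell containing two points
  separated by \<open>ph\<close>, and fineness makes both of them \<Delta>-close to it.\<close>

lemma uncontrolled_sample:
 assumes fin: "finite x" and b: "!!v. v : x ==> snd v < b" and ph: "ph : Def (x Un y)"
  and neg: "!!(K :: nat set) h p q m. scheme x (UN i<m. cp b i ` x) K h p ==> q < 1 ==> ~ controls x ph ep K h p q"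
  and \<Delta>: "finite \<Delta>" "!!te. te : \<Delta> ==> te : Def (x Un (UN i<m. cp b i ` x))" and N: "N > 0"
 shows "EX e. (ALL i. e i : AS U) & (ALL S<={..<m}. S ~= {} -->
  (EX D:AS U. EX c:AS U. (ALL i:S. ALL v. D (cp b i v) = e i v) & (ALL j:{..<m} - S. oscillates x ph ep \<Delta> (4 / real N) D c (e j))))"
proof -
 let ?z = "UN i<m. cp b i ` x"
 have z: "finite ?z" "x Int ?z = {}" using fin b snd_cp[of b] by (auto dest!: b simp: cp_def)
 obtain K :: "nat set" and h p where H: "scheme x ?z K h p"
  and fine: "!!k a b. k : K ==> p k a > 0 ==> p k b > 0 ==> ALL te:\<Delta>. \<bar>te a - te b\<bar> < 4 / real N"
  using scheme_fine[OF \<Delta>(1) z \<Delta>(2) N] by blast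
 \<comment> \<open>Small enough for the union bound of \<open>sampling\<close> with \<open>m\<close>
   draws; m + 1 keeps it defined for m = 0.\<close>
 define dl :: real where "dl = 1 / (real (m + 1) * 2 ^ (m + 1))"
 have dl: "0 < dl" by (simp add: dl_def)
 have "real m * 2 ^ m < real (m + 1) * 2 ^ (m + 1)" by (rule mult_strict_mono) simp_all
 hence dlm: "dl * real m * 2 ^ m < 1" by (simp add: dl_def)
 have "~ controls x ph ep K h p (1 - dl)" by (rule neg[OF H]) (use dl in simp)
 then obtain B I e w where wp: "weighted_points B I e w" and no: "~ (EX d:asg B. ALL c:AS U.
   (SUM i:I. w i * bad x ph ep K h p d c (e i)) <= (1 - dl) * (SUM i:I. w i))" unfolding controls_def by blast
 note asgB = subsetD[OF weighted_pointsD(1)[OF wp]] and I = weighted_pointsD(2)[OF wp] and ew = weighted_pointsD(3,5)[OF wp]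
 define W where "W = sum w I"
 have "ALL d:asg B. EX c. c : AS U & (1 - dl) * W < (SUM i:I. w i * bad x ph ep K h p d c (e i))"
  using no by (force simp: W_def not_le)
 from bchoice[OF this] obtain C where C: "!!d. d : asg B ==> C d : AS U"
  "!!d. d : asg B ==> (1 - dl) * W < (SUM i:I. w i * bad x ph ep K h p d (C d) (e i))" by blast
 have Wpos: "0 < W"
 proof (rule ccontr)
  assume "~ 0 < W"
  hence "W = 0" using weighted_pointsD(6)[OF wp] by (simp add: W_def)
  hence "ALL i:I. w i = 0" using I ew(2) by (simp add: W_def sum_nonneg_eq_0_iff)
  moreover obtain d :: "'s var => 'a" where "d : asg B" using asg_B_ne[of B] wp by (auto simp: weighted_points_def)
  ultimately show False using C(2)[of d] `W = 0` by simp
 qed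
 \<comment> \<open>The copies outside \<open>S\<close> are filled with the sample at
   \<open>Min S\<close>, so that the parameters depend on the samples in \<open>S\<close>
   alone.\<close>
 define Dt where "Dt S t = glue b (%l. e (t (if l : S then l else Min S))) (e (t (Min S)))" for S and t :: "nat => nat"
 define P where "P S t i <-> bad x ph ep K h p (Dt S t) (C (Dt S t)) (e i) = 0" for S t i
 have "EX t. t ` {..<m} <= I & (ALL S<={..<m}. S ~= {} --> (ALL j:{..<m} - S. ~ P S t (t j)))"
 proof (rule sampling[OF I ew(2) W_def Wpos _ _ dlm])
  fix S t t' i assume S: "S <= {..<m}" "S ~= {}" and "!!l. l : S ==> t l = (t' l :: nat)"
  moreover have "Min S : S" using S by (intro Min_in) (auto intro: finite_subset)
  ultimately have "Dt S t = Dt S t'" unfolding Dt_def by (intro arg_cong2[where f = "glue b"]) auto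
  thus "P S t i = P S t' i" unfolding P_def by simp
 next
  fix S t assume S: "S <= {..<m}" "S ~= {}" and t: "t ` S <= I"
  have "Min S : S" using S by (intro Min_in) (auto intro: finite_subset)
  hence tI: "t (if l : S then l else Min S) : I" "t (Min S) : I" for l using t by auto
  define d where "d = Dt S t"
  have d: "d : asg B" unfolding d_def Dt_def by (rule glue_asg) (use ew(1) tI in auto)
  define r where "r i = bad x ph ep K h p d (C d) (e i)" for i
  have "r i <= 1" if "i : I" for i unfolding r_def by (rule bad_01(2)[OF H asgB[OF d] asgB[OF ew(1)[OF that]]])
  \<comment> \<open>Markov's inequality for 1 - r: it equals 1 wherever \<open>P\<close>
    holds.\<close>
  hence "(SUM i:{i : I. P S t i}. w i * (1 - r i)) <= (SUM i:I. w i * (1 - r i))" by (intro sum_mono2[OF I]) (use ew(2) in auto)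
  also have "\<dots> = W - (SUM i:I. w i * r i)" by (simp add: W_def right_diff_distrib sum_subtractf)
  also have "\<dots> <= dl * W" using C(2)[OF d] by (simp add: r_def algebra_simps)
  finally show "(SUM i:{i : I. P S t i}. w i) <= dl * W" by (simp add: P_def r_def d_def)
 qed (use less_imp_le[OF dl] in auto)
 then obtain t where t0: "t ` {..<m} <= I & (ALL S<={..<m}. S ~= {} --> (ALL j:{..<m} - S. ~ P S t (t j)))"
  by (rule exE)
 have t: "t ` {..<m} <= I" "~ P S t (t j)" if "S <= {..<m}" "S ~= {}" "j : {..<m} - S" for S j using t0 that by simp_all
 have tI0: "t l : I" if "l < m" for l using t0 that by auto
 obtain a0 where a0: "a0 : AS U" using asg_ne by blast
 define e' where "e' l = (if l < m then e (t l) else a0)" for l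
 have e': "e' i : AS U" for i using a0 asgB[OF ew(1)[OF tI0[of i]]] unfolding e'_def by simp
 show ?thesis
 proof (intro exI[of _ e'] conjI allI impI)
  fix S assume S: "S <= {..<m}" "S ~= {}"
  have Min: "Min S : S" using S by (intro Min_in) (auto intro: finite_subset)
  hence tI: "t (if l : S then l else Min S) : I" "t (Min S) : I" for l using tI0 S by auto
  have dB: "Dt S t : asg B" unfolding Dt_def by (rule glue_asg) (use ew(1) tI in auto)
  show "EX D:AS U. EX c:AS U. (ALL i:S. ALL v. D (cp b i v) = e' i v) &
   (ALL j:{..<m} - S. oscillates x ph ep \<Delta> (4 / real N) D c (e' j))"
  proof (rule bexI[OF _ asgB[OF dB]], rule bexI[OF _ C(1)[OF dB]], intro conjI ballI allI)
   show "Dt S t (cp b i v) = e' i v" if "i : S" for i v using that S(1) by (auto simp: Dt_def e'_def)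
   fix j assume j: "j : {..<m} - S"
   have ej: "e' j = e (t j)" using j by (simp add: e'_def)
   have a: "ov (Dt S t) (e (t j)) x : AS U" using asg_override[OF asgB[OF dB] e'[of j]] ej by simp
   from t(2)[OF S j] obtain k where k: "k : K" "h k (ov (Dt S t) (e (t j)) x) ~= 0" "~ steady x ph ep (p k) (Dt S t) (C (Dt S t))"
    unfolding P_def bad_def by (auto elim!: sum.not_neutral_contains_not_neutral)
   have "h k (ov (Dt S t) (e (t j)) x) > 0" using scheme_nonneg[OF H k(1) a] k(2) by simp
   from k(3) obtain e1 e2 where e12: "e1 : AS U" "e2 : AS U" "p k (ov (Dt S t) e1 x) > 0" "p k (ov (Dt S t) e2 x) > 0"
    "ep < \<bar>ph (ov (C (Dt S t)) e1 x) - ph (ov (C (Dt S t)) e2 x)\<bar>" unfolding steady_def by (auto simp: not_le)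
   have "p k (ov (Dt S t) (e' j) x) > 0" using schemeD(7)[OF H a k(1) `h k _ > 0`] ej by simp
   from fine[OF k(1) e12(3) this] fine[OF k(1) e12(4) this] e12(1,2,5)
   show "oscillates x ph ep \<Delta> (4 / real N) (Dt S t) (C (Dt S t)) (e' j)" unfolding oscillates_def by (intro bexI[of _ e1] bexI[of _ e2]) auto
  qed
 qed (rule e')
qed

end

lemma positions_asg:
 assumes "!!i. g i : asg B" "a : asg B"
 shows "(%v. if v : positions rh k x then g (fst (rh v)) (snd (rh v)) else a v) : asg B"
proof (rule asgI)
 fix v show "(if v : positions rh k x then g (fst (rh v)) (snd (rh v)) else a v) : B (fst v)"
  using asgD[OF assms(1), of "fst (rh v)" "snd (rh v)"] asgD[OF assms(2), of v] positionsD(3)[of v rh k x] by (cases "v : positions rh k x") simp_all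
qed

text \<open>\<open>Q\<close> occupies the lowest elements of \<open>H\<close>. The \<open>k\<close>
  topmost elements are reserved for lengthening index lists to a common length.\<close>

lemma increasing_embedding:
 fixes Q :: "'q::linorder set" and H :: "nat set"
 assumes "finite Q" "card H = card Q + k" "finite H"
 shows "EX io top. strict_mono_on Q io & io ` Q <= H & length top = k & sorted_wrt (<) top & set top <= H &
  (ALL q:Q. ALL t:set top. io q < t)"
proof -
 define l where "l = sorted_list_of_set H"
 have l: "sorted_wrt (<) l" "set l = H" "length l = card Q + k" using assms by (simp_all add: l_def)
 define io where "io q = l ! card {p : Q. p < q}" for q
 have lt: "card {p : Q. p < q} < card Q" if "q : Q" for q by (rule psubset_card_mono) (use that assms(1) in auto)
 have mono: "card {p : Q. p < q} < card {p : Q. p < q'}" if "q : Q" "q < q'" for q q' by (rule psubset_card_mono) (use that assms(1) in auto)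
 show ?thesis
 proof (intro exI[of _ io] exI[of _ "drop (card Q) l"] conjI ballI)
  show "strict_mono_on Q io"
  proof (rule strict_mono_onI)
   fix q q' assume q: "q : Q" "q' : Q" "q < q'"
   show "io q < io q'" unfolding io_def by (rule sorted_wrt_nth_less[OF l(1) mono[OF q(1,3)]]) (use lt[OF q(2)] l(3) in simp)
  qed
  show "io ` Q <= H"
  proof (rule image_subsetI)
   fix q assume "q : Q"
   thus "io q : H" unfolding io_def l(2)[symmetric] using lt[of q] l(3) by (intro nth_mem) simp
  qed
  show "length (drop (card Q) l) = k" using l(3) by simp
  show "sorted_wrt (<) (drop (card Q) l)" using l(1) by (simp add: sorted_wrt_drop)
  show "set (drop (card Q) l) <= H" using set_drop_subset[of "card Q" l] l(2) by simp
  fix q t assume q: "q : Q" and "t : set (drop (card Q) l)"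
  then obtain j where j: "j < k" "t = l ! (card Q + j)" using l(3) by (auto simp: in_set_conv_nth)
  show "io q < t" unfolding io_def j(2) by (rule sorted_wrt_nth_less[OF l(1)]) (use lt[OF q] j(1) l(3) in simp_all)
 qed
qed

lemma floor_nat_eq_close:
 assumes "nat \<lfloor>u\<rfloor> = nat \<lfloor>v\<rfloor>" "0 <= u" "0 <= (v :: real)"
 shows "\<bar>u - v\<bar> < 1"
proof -
 have "\<lfloor>u\<rfloor> = \<lfloor>v\<rfloor>" using assms by (simp add: nat_eq_iff)
 thus ?thesis by linarith
qed

type_synonym ('s, 'a) test = "nat \<times> bool \<times> rat list \<times> rat list \<times> ('s var => nat \<times> 's var) \<times> (('s var => 'a) => real)"

context monster
begin

text \<open>A test \<open>(n, bt, is, js, rh, te)\<close> asks that \<open>te\<close> takes the same value at the increasing index tuples \<open>is\<close> and \<open>js\<close>,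
  where the index \<open>n\<close> carries the tuple with label \<open>bt\<close>.\<close>

theorem exists_controlling_scheme:
 assumes NIP: "NIP L U" and distal: "distal TYPE('i) L U" and inf: "infinite (UNIV :: 'i set)"
  and fin: "finite x" "finite y" "x Int y = {}" and ph: "ph : Def (x Un y)" and ep: "ep > 0" and V: "finite V"
 shows "EX z (K :: nat set) h p q. z Int V = {} & scheme x z K h p & q < 1 & controls x ph ep K h p q"
proof (rule ccontr)
 assume contra: "~ ?thesis"
 obtain b where b: "!!v. v : x Un y Un V ==> snd v < b" using var_index_bound[of "x Un y Un V"] fin V by auto
 have neg: "~ controls x ph ep K h p q" if "scheme x (UN i<m. cp b i ` x) K h p" "q < 1"
  for K :: "nat set" and h p q m
 proof
  assume "controls x ph ep K h p q"
  moreover have "cp b i v ~: V" for i v using b[of "cp b i v"] snd_cp[of b i v] by auto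
  hence "(UN i<m. cp b i ` x) Int V = {}" by auto
  ultimately show False using contra that by blast
 qed
 \<comment> \<open>A rational names a point of the sequence and a pair (n, bt) names a candidate for
   the cut at \<open>n\<close>; the codes number the copies of \<open>x\<close>.\<close>
 define ix :: "rat + nat \<times> bool => nat" where "ix = to_nat"
 have cp_x: "cp b i v ~: x" "cp b i v ~: y" for i v using b[of "cp b i v"] snd_cp[of b i v] by auto
 define VV where "VV = y Un (UN i. cp b i ` x)"
 have cVV: "countable VV" unfolding VV_def using fin by (auto intro: countable_finite)
 define gi :: "nat => bool => rat list => nat => nat" where
  "gi n bt ls pos = ix (if ls ! pos = of_nat n then Inr (n, bt) else Inl (ls ! pos))" for n bt ls pos
 define sg where "sg rh k g v = (if v : positions rh k x then cp b (g (fst (rh v))) (snd (rh v)) else v)"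
  for rh :: "'s var => nat \<times> 's var" and k and g :: "nat => nat" and v
 have sg_sort: "fst (sg rh k g v) = fst v" for rh k g v using positionsD(3)[of v rh k x] by (simp add: sg_def)
 define ta where "ta n bt v = (if v : x then cp b (ix (Inr (n, bt))) v else v)" for n bt and v :: "'s var"
 have ta_sort: "fst (ta n bt v) = fst v" for n bt v by (simp add: ta_def)
 define A :: "('s, 'a) test set" where "A = {(n, bt, is, js, rh, te).
  set is <= insert (of_nat n) (- \<nat> :: rat set) & set js <= insert (of_nat n) (- \<nat> :: rat set) & length is = length js &
  sorted_wrt (<) is & sorted_wrt (<) js & te : Def (positions rh (length is) x)}"
 define cond1 :: "('s, 'a) test => ('s var => 'a) => real" where "cond1 = (%(n, bt, is, js, rh, te) a.
  \<bar>te (a o sg rh (length is) (gi n bt is)) - te (a o sg rh (length is) (gi n bt js))\<bar>)"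
 \<comment> \<open>Zero exactly when the two candidates at \<open>n\<close> are at least
   \<open>ep\<close> apart under \<open>ph\<close>.\<close>
 define cond2 where "cond2 n a = max 0 (min 1 (- 1 * \<bar>ph (a o ta n True) - ph (a o ta n False)\<bar> + ep))" for n a
 define \<Gamma> where "\<Gamma> = case_sum cond1 cond2 ` (A <+> UNIV)"
 have "EX a:AS U. ALL F:\<Gamma>. F a = 0"
 proof (rule compactness[OF cVV])
  fix F assume "F : \<Gamma>"
  then consider al where "al : A" "F = cond1 al" | n where "F = cond2 n" by (auto simp: \<Gamma>_def)
  thus "F : Def VV"
  proof cases
   case 1
   obtain n bt "is" js rh te where al: "al = (n, bt, is, js, rh, te)" by (metis prod.collapse)
   have te: "te : Def (positions rh (length is) x)" using 1(1) unfolding al A_def mem_Collect_eq prod.case by blast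
   have key: "(%a. te (a o sg rh (length is) g)) : Def VV" for g
   proof (rule Def_rename[OF te sg_sort])
    show "sg rh (length is) g ` positions rh (length is) x <= VV"
    proof (rule image_subsetI)
     fix v assume v: "v : positions rh (length is) x"
     thus "sg rh (length is) g v : VV" using positionsD(2)[OF v] by (auto simp: sg_def VV_def)
    qed
   qed
   show ?thesis unfolding 1(2) al cond1_def prod.case by (intro Def_absdiff key)
  next
   case 2
   have key: "(%a. ph (a o ta n bt)) : Def VV" for bt
   proof (rule Def_rename[OF ph ta_sort])
    show "ta n bt ` (x Un y) <= VV" using fin(3) by (auto simp: ta_def VV_def)
   qed
   show ?thesis unfolding 2 cond2_def[abs_def] by (intro Def_clip Def_absdiff key)
  qed
 next
  fix \<Gamma>0 and et :: real assume \<Gamma>0: "finite \<Gamma>0" "\<Gamma>0 <= \<Gamma>" and et: "et > 0"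
  from \<Gamma>0 obtain C where C: "finite C" "C <= A <+> UNIV" "\<Gamma>0 = case_sum cond1 cond2 ` C" unfolding \<Gamma>_def by (meson finite_subset_image)
  define A0 where "A0 = {al. Inl al : C}"
  define T0 where "T0 = {n. Inr n : C}"
  have A0: "finite A0" "A0 <= A" and T0: "finite T0"
   using C(1,2) finite_vimageI[OF C(1), of Inl] finite_vimageI[OF C(1), of Inr] by (auto simp: A0_def T0_def vimage_def)
  define lst1 :: "('s, 'a) test => rat list" where "lst1 = (%(n, bt, is, js, rh, te). is)"
  define lst2 :: "('s, 'a) test => rat list" where "lst2 = (%(n, bt, is, js, rh, te). js)"
  define nn :: "('s, 'a) test => nat" where "nn = (%(n, bt, is, js, rh, te). n)"
  define rr :: "('s, 'a) test => 's var => nat \<times> 's var" where "rr = (%(n, bt, is, js, rh, te). rh)"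
  define tt :: "('s, 'a) test => ('s var => 'a) => real" where "tt = (%(n, bt, is, js, rh, te). te)"
  note sel = lst1_def lst2_def nn_def rr_def tt_def
  have A0D: "set (lst1 al) <= insert (of_nat (nn al)) (- \<nat>)" "set (lst2 al) <= insert (of_nat (nn al)) (- \<nat>)"
   "length (lst1 al) = length (lst2 al)" "sorted_wrt (<) (lst1 al)" "sorted_wrt (<) (lst2 al)"
   "tt al : Def (positions (rr al) (length (lst1 al)) x)" if "al : A0" for al using subsetD[OF A0(2) that] by (auto simp: A_def sel)
  \<comment> \<open>The value 1/2 guarantees an index outside \<nat>, which makes the set
    \<open>S\<close> of parameter samples nonempty.\<close>
  define Q where "Q = insert (1/2) (of_nat ` (T0 Un nn ` A0) Un (UN al:A0. set (lst1 al) Un set (lst2 al)))"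
  have Q: "finite Q" unfolding Q_def using A0(1) T0 by auto
  define k where "k = Max (insert 0 ((%al. length (lst1 al)) ` A0))"
  have k: "length (lst1 al) <= k" if "al : A0" for al unfolding k_def by (rule Max_ge) (use that A0(1) in auto)
  obtain m :: nat where m: "2 / et < real m" using reals_Archimedean2 by blast
  have m0: "m > 0" using m et by (metis divide_pos_pos gr0I less_asym of_nat_0 zero_less_numeral)
  have m1: "2 / real m <= et" using m m0 et by (simp add: field_simps)
  \<comment> \<open>Two comparisons with the sample cost 4/N each and the colouring costs 1/m,
    altogether 2/m.\<close>
  define N where "N = 8 * m"
  have N0: "N > 0" using m0 by (simp add: N_def)
  have "finite (PiE A0 (%_. {..m}))" using A0(1) by (intro finite_PiE) auto
  then obtain enc and q :: nat where enc: "enc ` PiE A0 (%_. {..m}) = {i. i < q}" "inj_on enc (PiE A0 (%_. {..m}))"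
   using finite_imp_inj_to_nat_seg by metis
  obtain M where M: "!!f :: nat list => nat.
    (ALL ys. sorted_wrt (<) ys & set ys <= {..<M} & length ys = k --> f ys < q) ==>
    (EX H<={..<M}. card H = card Q + k & (ALL ys zs. sorted_wrt (<) ys & set ys <= H & length ys = k &
         sorted_wrt (<) zs & set zs <= H & length zs = k --> f ys = f zs))" using ramsey_increasing[of k q "card Q + k"] by blast
  \<comment> \<open>The test \<open>al\<close> with the point at its natural index read from
    \<open>x\<close> and all other points read from the copies chosen by \<open>io\<close>.\<close>
  define \<zeta> where "\<zeta> al ls io v = (if v : positions (rr al) (length (lst1 al)) x then
    (if ls ! fst (rr al v) = of_nat (nn al) then snd (rr al v) else cp b (io (ls ! fst (rr al v))) (snd (rr al v))) else v)"
   for al ls and io :: "rat => nat" and v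
  have \<zeta>_sort: "fst (\<zeta> al ls io v) = fst v" for al ls io v
   using positionsD(3)[of v "rr al" "length (lst1 al)" x] by (simp add: \<zeta>_def)
  define \<Theta> where "\<Theta> al ls io a = tt al (a o \<zeta> al ls io)" for al ls io a
  \<comment> \<open>The map \<open>io\<close> is found only after the sample, so the tests for all
    possible maps are included beforehand.\<close>
  define \<Delta> where "\<Delta> = (%(al, io). \<Theta> al (lst1 al) io) ` (A0 \<times> PiE Q (%_. {..<M})) Un
   (%(al, io). \<Theta> al (lst2 al) io) ` (A0 \<times> PiE Q (%_. {..<M}))"
  have fin\<Delta>: "finite \<Delta>" unfolding \<Delta>_def using A0(1) Q by (intro finite_UnI finite_imageI finite_cartesian_product finite_PiE) auto
  have Def\<Theta>: "\<Theta> al ls io : Def (x Un (UN i<M. cp b i ` x))"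
   if al: "al : A0" and ls: "length ls = length (lst1 al)" "set ls <= Q" and io: "io ` Q <= {..<M}" for al ls io
   unfolding \<Theta>_def[abs_def]
  proof (rule Def_rename[OF A0D(6)[OF al] \<zeta>_sort], rule image_subsetI)
   fix v assume v: "v : positions (rr al) (length (lst1 al)) x"
   note p = positionsD[OF v]
   have "ls ! fst (rr al v) : Q" using p(1) ls by (metis nth_mem subsetD)
   hence "io (ls ! fst (rr al v)) < M" using io by auto
   thus "\<zeta> al ls io v : x Un (UN i<M. cp b i ` x)" using v p(2) by (auto simp: \<zeta>_def)
  qed
  have lstQ: "set (lst1 al) <= Q" "set (lst2 al) <= Q" "of_nat (nn al) : Q" if "al : A0" for al
   using that by (auto simp: Q_def)
  have T0Q: "of_nat n : Q" if "n : T0" for n using that by (auto simp: Q_def)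
  have Def\<Delta>: "te : Def (x Un (UN i<M. cp b i ` x))" if "te : \<Delta>" for te
  proof -
   from that obtain al io where al: "al : A0" "io : PiE Q (%_. {..<M})" "te = \<Theta> al (lst1 al) io | te = \<Theta> al (lst2 al) io"
    unfolding \<Delta>_def by auto
   have "io ` Q <= {..<M}" using al(2) by auto
   thus ?thesis using al(3) Def\<Theta>[OF al(1)] lstQ[OF al(1)] A0D(3)[OF al(1)] by auto
  qed
  have bx: "snd v < b" if "v : x" for v using b that by simp
  have "EX e. (ALL i. e i : AS U) & (ALL S<={..<M}. S ~= {} -->
   (EX D:AS U. EX c:AS U. (ALL i:S. ALL v. D (cp b i v) = e i v) &
    (ALL j:{..<M} - S. oscillates x ph ep \<Delta> (4 / real N) D c (e j))))"
   by (rule uncontrolled_sample[OF fin(1) bx ph neg fin\<Delta> Def\<Delta> N0])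
  then obtain e where e: "!!i. e i : AS U" and e_un: "!!S. S <= {..<M} ==> S ~= {} ==>
   (EX D:AS U. EX c:AS U. (ALL i:S. ALL v. D (cp b i v) = e i v) &
    (ALL j:{..<M} - S. oscillates x ph ep \<Delta> (4 / real N) D c (e j)))" by blast
  obtain a0 where a0: "a0 : AS U" using asg_ne by blast
  define val where "val al ys = tt al (%v. if v : positions (rr al) (length (lst1 al)) x
    then e (ys ! fst (rr al v)) (snd (rr al v)) else a0 v)" for al ys
  have val01: "val al ys : {0..1}" if "al : A0" for al ys
   unfolding val_def by (rule Def_01[OF A0D(6)[OF that]]) (rule positions_asg[where g = "%i. e (ys ! i)", OF e a0])
  \<comment> \<open>The values of all tests on an increasing list, rounded down to multiples of 1/m:
    on a set of constant colour the sample is nearly indiscernible for the tests.\<close>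
  define col where "col ys = (\<lambda>al\<in>A0. nat \<lfloor>real m * val al ys\<rfloor>)" for ys
  have col: "col ys : PiE A0 (%_. {..m})" for ys
  proof -
   have "nat \<lfloor>real m * val al ys\<rfloor> <= m" if "al : A0" for al
   proof -
    have "real m * val al ys <= real m" using val01[OF that, of ys] by (simp add: mult_left_le)
    thus ?thesis by linarith
   qed
   thus ?thesis by (auto simp: col_def)
  qed
  have "enc (col ys) < q" for ys using enc(1) col[of ys] by blast
  with M[of "%ys. enc (col ys)"] obtain H where H: "H <= {..<M}" "card H = card Q + k"
   and Hcol: "!!ys zs. sorted_wrt (<) ys ==> set ys <= H ==> length ys = k ==>
         sorted_wrt (<) zs ==> set zs <= H ==> length zs = k ==> enc (col ys) = enc (col zs)" by blast
  have "finite H" using H(1) finite_subset by blast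
  from increasing_embedding[OF Q H(2) this] obtain io top where io: "strict_mono_on Q io" "io ` Q <= H"
   and top: "length top = k" "sorted_wrt (<) top" "set top <= H" "!!q t. q : Q ==> t : set top ==> io q < t" by blast
  have ioM: "io ` Q <= {..<M}" using io(2) H(1) by blast
  have ioinj: "inj_on io Q" using io(1) by (rule strict_mono_on_imp_inj_on)
  \<comment> \<open>Index lists of different lengths are padded by the top elements of
    \<open>H\<close>, so that one colouring of lists of length \<open>k\<close> handles all
    tests.\<close>
  define ext where "ext ls = map io ls @ take (k - length ls) top" for ls
  have ext: "sorted_wrt (<) (ext ls)" "set (ext ls) <= H" "length (ext ls) = k"
   if ls: "sorted_wrt (<) ls" "set ls <= Q" "length ls <= k" for ls
  proof -
   have "sorted_wrt (%p q. io p < io q) ls" by (rule sorted_wrt_mono_rel[OF _ ls(1)]) (use strict_mono_onD[OF io(1)] ls(2) in blast)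
   moreover have "io p < t" if "p : set ls" "t : set (take (k - length ls) top)" for p t using top(4)[of p t] that ls(2) by (auto dest: in_set_takeD)
   ultimately show "sorted_wrt (<) (ext ls)" unfolding ext_def sorted_wrt_append sorted_wrt_map using sorted_wrt_take[OF top(2)] by auto
   show "set (ext ls) <= H" unfolding ext_def using io(2) ls(2) top(3) set_take_subset[of "k - length ls" top] by auto
   show "length (ext ls) = k" unfolding ext_def using top(1) ls(3) by simp
  qed
  have homog: "\<bar>val al (ext (lst1 al)) - val al (ext (lst2 al))\<bar> <= 1 / real m" if al: "al : A0" for al
  proof -
   have "enc (col (ext (lst1 al))) = enc (col (ext (lst2 al)))"
    using ext[OF A0D(4)[OF al] lstQ(1)[OF al] k[OF al]] ext[OF A0D(5)[OF al] lstQ(2)[OF al]] k[OF al] A0D(3)[OF al]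
    by (intro Hcol) auto
   hence "col (ext (lst1 al)) = col (ext (lst2 al))" using enc(2) col by (meson inj_onD)
   moreover have col_at: "col ys al = nat \<lfloor>real m * val al ys\<rfloor>" for ys using al by (simp add: col_def)
   ultimately have "nat \<lfloor>real m * val al (ext (lst1 al))\<rfloor> = nat \<lfloor>real m * val al (ext (lst2 al))\<rfloor>"
    using col_at[of "ext (lst1 al)"] col_at[of "ext (lst2 al)"] by simp
   hence "\<bar>real m * val al (ext (lst1 al)) - real m * val al (ext (lst2 al))\<bar> < 1"
    using val01[OF al] by (intro floor_nat_eq_close) auto
   hence "real m * \<bar>val al (ext (lst1 al)) - val al (ext (lst2 al))\<bar> < 1" by (simp add: abs_mult flip: right_diff_distrib)
   thus ?thesis using m0 by (simp add: field_simps)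
  qed
  \<comment> \<open>The samples at indices outside \<nat> become parameters. The natural indices are
    mapped outside \<open>S\<close>, so the sample oscillates there.\<close>
  define S where "S = io ` (Q - \<nat>)"
  have "(1/2 :: rat) ~: \<nat>"
  proof
   assume "(1/2 :: rat) : \<nat>"
   then obtain n where "(1/2 :: rat) = of_nat n" by (auto elim: Nats_cases)
   hence "of_nat 1 = (of_nat (2 * n) :: rat)" by simp
   thus False unfolding of_nat_eq_iff by presburger
  qed
  hence S: "S <= {..<M}" "S ~= {}" using ioM by (auto simp: S_def Q_def)
  have ST: "io (of_nat n) : {..<M} - S" if "of_nat n : Q" for n using that ioM ioinj by (auto simp: S_def inj_on_def) (metis of_nat_in_Nats)
  obtain D c where D: "D : AS U" and c: "c : AS U" and De: "!!i v. i : S ==> D (cp b i v) = e i v"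
   and un: "ALL j:{..<M} - S. oscillates x ph ep \<Delta> (4 / real N) D c (e j)" using e_un[OF S] by blast
  have "ALL j:{..<M} - S. EX E. ALL bt. E bt : AS U & (ALL te:\<Delta>. \<bar>te (ov D (E bt) x) - te (ov D (e j) x)\<bar> < 4 / real N) &
   ep < \<bar>ph (ov c (E True) x) - ph (ov c (E False) x)\<bar>"
  proof
   fix j assume "j : {..<M} - S"
   with un obtain e1 e2 where "e1 : AS U" "e2 : AS U" "ep < \<bar>ph (ov c e1 x) - ph (ov c e2 x)\<bar>"
    "ALL te:\<Delta>. \<bar>te (ov D e1 x) - te (ov D (e j) x)\<bar> < 4 / real N &
        \<bar>te (ov D e2 x) - te (ov D (e j) x)\<bar> < 4 / real N" unfolding oscillates_def by blast
   thus "EX E. ALL bt. E bt : AS U & (ALL te:\<Delta>. \<bar>te (ov D (E bt) x) - te (ov D (e j) x)\<bar> < 4 / real N) &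
    ep < \<bar>ph (ov c (E True) x) - ph (ov c (E False) x)\<bar>" by (intro exI[of _ "%bt. if bt then e1 else e2"]) auto
  qed
  then obtain E where E: "!!j bt. j : {..<M} - S ==> E j bt : AS U"
   "!!j bt te. j : {..<M} - S ==> te : \<Delta> ==> \<bar>te (ov D (E j bt) x) - te (ov D (e j) x)\<bar> < 4 / real N"
   "!!j. j : {..<M} - S ==> ep < \<bar>ph (ov c (E j True) x) - ph (ov c (E j False) x)\<bar>" by (metis (no_types, lifting))
  define ee where "ee i = (case from_nat i :: rat + nat \<times> bool of Inl q => e (io q)
   | Inr (n, bt) => if of_nat n : Q then E (io (of_nat n)) bt else a0)" for i
  have ee_asg: "ee i : AS U" for i using e a0 E(1)[OF ST] by (auto simp: ee_def split: sum.split prod.split)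
  have ee_Inl: "ee (ix (Inl q)) = e (io q)" for q by (simp add: ee_def ix_def)
  have ee_Inr: "ee (ix (Inr (n, bt))) = E (io (of_nat n)) bt" if "of_nat n : Q" for n bt using that by (simp add: ee_def ix_def)
  define a where "a = glue b ee c"
  have a: "a : AS U" unfolding a_def by (rule glue_asg[OF ee_asg c])
  have tuple: "\<bar>tt al (a o sg (rr al) (length (lst1 al)) (gi (nn al) bt ls)) - val al (ext ls)\<bar> < 4 / real N"
   if al: "al : A0" and ls: "ls = lst1 al | ls = lst2 al" for al ls bt
  proof -
   have lsQ: "set ls <= Q" "length ls = length (lst1 al)" "set ls <= insert (of_nat (nn al)) (- \<nat>)"
    using ls lstQ[OF al] A0D(1-3)[OF al] by auto
   let ?n = "nn al" and ?V = "positions (rr al) (length (lst1 al)) x"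
   have j: "io (of_nat ?n) : {..<M} - S" by (rule ST[OF lstQ(3)[OF al]])
   define io' where "io' = restrict io Q"
   have io': "io' : PiE Q (%_. {..<M})" using ioM by (auto simp: io'_def)
   have \<Delta>: "\<Theta> al ls io' : \<Delta>" using ls al io' unfolding \<Delta>_def by force
   have pos: "fst (rr al v) < length ls" "ls ! fst (rr al v) : Q" "ls ! fst (rr al v) ~= of_nat ?n ==> io (ls ! fst (rr al v)) : S"
    "snd (rr al v) : x" if "v : ?V" for v
   proof -
    show 1: "fst (rr al v) < length ls" using positionsD(1)[OF that] lsQ(2) by simp
    hence "ls ! fst (rr al v) : set ls" by simp
    thus "ls ! fst (rr al v) : Q" "ls ! fst (rr al v) ~= of_nat ?n ==> io (ls ! fst (rr al v)) : S"
     using lsQ by (auto simp: S_def)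
    show "snd (rr al v) : x" by (rule positionsD(2)[OF that])
   qed
   have ov: "ov D f x o \<zeta> al ls io' : AS U" if "f : AS U" for f by (rule asg_comp[OF asg_override[OF D that] \<zeta>_sort])
   have Ej: "E (io (of_nat ?n)) bt : AS U" by (rule E(1)[OF j])
   have eval: "(ov D f x o \<zeta> al ls io') v =
     (if ls ! fst (rr al v) = of_nat ?n then f (snd (rr al v)) else e (io (ls ! fst (rr al v))) (snd (rr al v)))"
    if v: "v : ?V" for f v using v pos[OF v] De cp_x by (simp add: \<zeta>_def io'_def override_on_def)
   have 1: "tt al (a o sg (rr al) (length (lst1 al)) (gi ?n bt ls)) = \<Theta> al ls io' (ov D (E (io (of_nat ?n)) bt) x)"
    unfolding \<Theta>_def
   proof (rule Def_cong[OF A0D(6)[OF al] asg_comp[OF a sg_sort] ov[OF Ej]])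
    fix v assume v: "v : ?V"
    show "(a o sg (rr al) (length (lst1 al)) (gi ?n bt ls)) v = (ov D (E (io (of_nat ?n)) bt) x o \<zeta> al ls io') v"
     unfolding eval[OF v] using v by (simp add: sg_def a_def gi_def ee_Inl ee_Inr[OF lstQ(3)[OF al]])
   qed
   have 2: "\<Theta> al ls io' (ov D (e (io (of_nat ?n))) x) = val al (ext ls)" unfolding \<Theta>_def val_def
   proof (rule Def_cong[OF A0D(6)[OF al] ov[OF e] positions_asg[where g = "%i. e (ext ls ! i)", OF e a0]])
    fix v assume v: "v : ?V"
    show "(ov D (e (io (of_nat ?n))) x o \<zeta> al ls io') v =
     (if v : ?V then e (ext ls ! fst (rr al v)) (snd (rr al v)) else a0 v)" unfolding eval[OF v] using v pos(1)[OF v] by (simp add: ext_def nth_append)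
   qed
   show ?thesis using E(2)[OF j \<Delta>, of bt] unfolding 1 2 .
  qed
  have c1: "cond1 al a <= et" if al: "al : A0" for al
  proof -
   obtain n bt "is" js rh te where al_eq: "al = (n, bt, is, js, rh, te)" by (metis prod.collapse)
   have "cond1 al a = \<bar>tt al (a o sg (rr al) (length (lst1 al)) (gi (nn al) bt (lst1 al))) -
     tt al (a o sg (rr al) (length (lst1 al)) (gi (nn al) bt (lst2 al)))\<bar>" by (simp add: al_eq cond1_def sel)
   also have "\<dots> <= 4 / real N + 1 / real m + 4 / real N"
    using tuple[OF al disjI1[OF refl], of bt] tuple[OF al disjI2[OF refl], of bt] homog[OF al] by linarith
   also have "\<dots> = 2 / real m" using m0 by (simp add: N_def field_simps)
   finally show ?thesis using m1 by simp
  qed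
  have c2: "cond2 n a <= et" if n: "n : T0" for n
  proof -
   have nQ: "of_nat n : Q" by (rule T0Q[OF n])
   have "ph (a o ta n bt) = ph (ov c (E (io (of_nat n)) bt) x)" for bt
   proof (rule Def_cong[OF ph asg_comp[OF a ta_sort] asg_override[OF c E(1)[OF ST[OF nQ]]]])
    fix v assume v: "v : x Un y"
    show "(a o ta n bt) v = ov c (E (io (of_nat n)) bt) x v"
     using v b[of v] ee_Inr[OF nQ] by (auto simp: ta_def a_def glue_low override_on_def)
   qed
   hence "cond2 n a = 0" using E(3)[OF ST[OF nQ]] by (simp add: cond2_def)
   thus ?thesis using et by simp
  qed
  show "EX a:AS U. ALL F:\<Gamma>0. F a <= et"
  proof (rule bexI[OF _ a], rule ballI)
   fix F assume "F : \<Gamma>0"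
   then obtain i where "i : C" "F = case_sum cond1 cond2 i" unfolding C(3) by blast
   thus "F a <= et" using c1 c2 by (cases i) (auto simp: A0_def T0_def)
  qed
 qed
 then obtain a where a: "a : AS U" and zero: "!!F. F : \<Gamma> ==> F a = 0" by blast
 define E where "E q v = a (cp b (ix (Inl q)) v)" for q v
 define B where "B n bt v = a (cp b (ix (Inr (n, bt))) v)" for n bt v
 have EB: "E q : AS U" "B n bt : AS U" for q n bt using asgD[OF a, of "cp b _ _"] by (auto intro!: asgI simp: E_def B_def)
 have "EX n. \<bar>ph (ov a (B n True) x) - ph (ov a (B n False) x)\<bar> < ep"
 proof (rule distal_no_oscillation[OF NIP distal inf fin ph a EB _ ep])
  fix n bt
  show "indiscernible L U x (seq_on (insert (of_nat n) (- \<nat>)) (%q. restrict (if q = of_nat n then B n bt else E q) x))"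
  proof (rule indiscernible_seq_onI[where a = a])
   fix "is" js rh te
   assume H: "set is <= insert (of_nat n) (- \<nat> :: rat set)" "set js <= insert (of_nat n) (- \<nat> :: rat set)" "length is = length js"
    "sorted_wrt (<) is" "sorted_wrt (<) js" "te : Def (positions rh (length is) x)"
   hence "(n, bt, is, js, rh, te) : A" by (simp add: A_def)
   hence "cond1 (n, bt, is, js, rh, te) : \<Gamma>" unfolding \<Gamma>_def by (intro image_eqI[of _ _ "Inl (n, bt, is, js, rh, te)"]) auto
   from zero[OF this] have "te (a o sg rh (length is) (gi n bt is)) = te (a o sg rh (length is) (gi n bt js))"
    by (simp add: cond1_def)
   moreover have "a o sg rh (length is) (gi n bt ls) = (%v. if v : positions rh (length is) x
     then (if ls ! fst (rh v) = of_nat n then B n bt else E (ls ! fst (rh v))) (snd (rh v)) else a v)" for ls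
    by (auto simp: sg_def gi_def E_def B_def)
   ultimately show "te (%v. if v : positions rh (length is) x
      then (if is ! fst (rh v) = of_nat n then B n bt else E (is ! fst (rh v))) (snd (rh v)) else a v) =
     te (%v. if v : positions rh (length is) x
      then (if js ! fst (rh v) = of_nat n then B n bt else E (js ! fst (rh v))) (snd (rh v)) else a v)" by simp
  qed (use a EB in auto)
 qed
 then obtain n where n: "\<bar>ph (ov a (B n True) x) - ph (ov a (B n False) x)\<bar> < ep" by blast
 have "cond2 n : \<Gamma>" unfolding \<Gamma>_def by (intro image_eqI[of _ _ "Inr n"]) auto
 from zero[OF this] have "ep <= \<bar>ph (a o ta n True) - ph (a o ta n False)\<bar>"
  by (simp add: cond2_def max_def min_def split: if_splits)
 moreover have "a o ta n bt = ov a (B n bt) x" for bt by (auto simp: ta_def B_def override_on_def)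
 ultimately show False using n by simp
qed

end

section \<open>Products and iteration of schemes\<close>

context metric_model
begin

lemma steady_mono:
 assumes "steady x ph ep p d c"
  and "!!e. e : AS U ==> p' (ov d' e x) > 0 ==> p (ov d e x) > 0"
 shows "steady x ph ep p' d' c" using assms unfolding steady_def by simp

lemma steady_cong:
 assumes "!!e. e : AS U ==> p' (ov d' e x) = p (ov d e x)"
 shows "steady x ph ep p' d' c <-> steady x ph ep p d c" using assms unfolding steady_def by simp

text \<open>Moving the parameters to fresh variables, away from \<open>V\<close>, allows several
  schemes to be combined with independently chosen parameters.\<close>

lemma controls_rename:
 assumes fin: "finite x" "finite V" and H: "scheme x z K h p" and C: "controls x ph ep K h p q"
 shows "EX z' h' p'. z' Int V = {} & scheme x z' K h' p' & controls x ph ep K h' p' q"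
proof -
 obtain b where b: "!!v. v : x Un z Un V ==> snd v < b" using var_index_bound[of "x Un z Un V"] fin schemeD(1)[OF H] by auto
 define sg where "sg v = (if v : z then cp b 0 v else v)" for v
 have sg: "fst (sg v) = fst v" for v by (simp add: sg_def)
 define z' where "z' = cp b 0 ` z"
 have cpV: "cp b 0 v ~: x Un V" for v using b[of "cp b 0 v"] snd_cp[of b 0 v] by auto
 have sgim: "sg ` (x Un z) <= x Un z'" using schemeD(2)[OF H] by (auto simp: sg_def z'_def)
 have ren: "F (ov (glue b (%_. d) d) e x o sg) = F (ov d e x)"
  if F: "F : Def (x Un z)" and de: "d : AS U" "e : AS U" for F d e
 proof (rule Def_cong[OF F asg_comp[OF asg_override[OF glue_asg[OF de(1) de(1)] de(2)] sg] asg_override[OF de]])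
  fix v assume "v : x Un z"
  thus "(ov (glue b (%_. d) d) e x o sg) v = ov d e x v"
   using b[of v] schemeD(2)[OF H] cpV[of v] by (auto simp: sg_def override_on_def glue_low)
 qed
 have H': "scheme x z' K (%k a. h k (a o sg)) (%k a. p k (a o sg))" unfolding scheme_def
  proof (intro conjI ballI impI)
   show "finite z'" "finite K" using schemeD(1,3)[OF H] by (simp_all add: z'_def)
   show "x Int z' = {}" using cpV by (auto simp: z'_def)
   show "(%a. h k (a o sg)) : Def (x Un z')" if "k : K" for k by (rule Def_rename[OF schemeD(4)[OF H that] sg sgim])
   show "(%a. p k (a o sg)) : Def (x Un z')" if "k : K" for k by (rule Def_rename[OF schemeD(5)[OF H that] sg sgim])
   fix a assume a: "a : AS U"
   show "(SUM k:K. h k (a o sg)) = 1" by (rule schemeD(6)[OF H asg_comp[OF a sg]])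
   show "p k (a o sg) = 1" if "k : K" "h k (a o sg) > 0" for k by (rule schemeD(7)[OF H asg_comp[OF a sg] that])
  qed
 show ?thesis
 proof (rule exI[of _ z'], rule exI[of _ "%k a. h k (a o sg)"], rule exI[of _ "%k a. p k (a o sg)"], intro conjI)
  show "z' Int V = {}" using cpV by (auto simp: z'_def)
  show "scheme x z' K (%k a. h k (a o sg)) (%k a. p k (a o sg))" by (rule H')
  show "controls x ph ep K (%k a. h k (a o sg)) (%k a. p k (a o sg)) q" unfolding controls_def
  proof (intro allI impI)
   fix B I e w assume wp: "weighted_points B I e w"
   from C wp obtain d where d: "d : asg B" and le: "ALL c:AS U. (SUM i:I. w i * bad x ph ep K h p d c (e i)) <= q * (SUM i:I. w i)"
    unfolding controls_def by blast
   have dU: "d : AS U" using d weighted_pointsD(1)[OF wp] by blast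
   have "bad x ph ep K (%k a. h k (a o sg)) (%k a. p k (a o sg)) (glue b (%_. d) d) c e = bad x ph ep K h p d c e"
    if e: "e : AS U" for c e
   proof -
    have "steady x ph ep (%a. p k (a o sg)) (glue b (%_. d) d) c <-> steady x ph ep (p k) d c" if "k : K" for k
     by (rule steady_cong) (rule ren[OF schemeD(5)[OF H that] dU])
    thus ?thesis unfolding bad_def using ren[OF schemeD(4)[OF H] dU e] by (intro sum.cong) auto
   qed
   thus "EX d:asg B. ALL c:AS U. (SUM i:I. w i * bad x ph ep K (%k a. h k (a o sg)) (%k a. p k (a o sg)) d c (e i)) <= q * (SUM i:I. w i)"
    using le weighted_pointsD(4)[OF wp] by (intro bexI[of _ "glue b (%_. d) d"] glue_asg[OF d d]) simp
  qed
 qed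
qed

text \<open>Cells that are steady for all of \<Phi> contribute at most \<open>Y\<close> to the
  average; the remaining ones contribute at most their mass, which the bad masses cover.\<close>

lemma scheme_average:
 assumes H: "scheme x z K h p" and d: "d : AS U" and e: "e : AS U" and \<Phi>: "finite \<Phi>" and Y: "0 <= Y"
  and X: "!!k. k : K ==> X k <= 1"
   "!!k. k : K ==> h k (ov d e x) > 0 ==> ALL ph:\<Phi>. steady x ph ep (p k) d c ==> X k <= Y"
 shows "(SUM k:K. h k (ov d e x) * X k) <= Y + (SUM ph:\<Phi>. bad x ph ep K h p d c e)"
proof -
 define g where "g k = h k (ov d e x)" for k
 have g: "0 <= g k" if "k : K" for k unfolding g_def by (rule scheme_nonneg[OF H that asg_override[OF d e]])
 have "g k * X k <= g k * Y + (SUM ph:\<Phi>. if steady x ph ep (p k) d c then 0 else g k)" if k: "k : K" for k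
 proof (cases "ALL ph:\<Phi>. steady x ph ep (p k) d c")
  case True
  hence "g k * X k <= g k * Y" using X(2)[OF k] g[OF k] by (cases "g k = 0") (auto simp: g_def intro: mult_left_mono)
  thus ?thesis using True by simp
 next
  case False
  then obtain \<psi> where "\<psi> : \<Phi>" "~ steady x \<psi> ep (p k) d c" by blast
  hence "g k <= (SUM ph:\<Phi>. if steady x ph ep (p k) d c then 0 else g k)"
   using member_le_sum[of \<psi> \<Phi> "%ph. if steady x ph ep (p k) d c then 0 else g k"] \<Phi> g[OF k] by simp
  moreover have "g k * X k <= g k" "0 <= g k * Y" using mult_left_le[OF X(1)[OF k] g[OF k]] g[OF k] Y by simp_all
  ultimately show ?thesis by linarith
 qed
 hence "(SUM k:K. g k * X k) <= (SUM k:K. g k * Y + (SUM ph:\<Phi>. if steady x ph ep (p k) d c then 0 else g k))" by (rule sum_mono)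
 also have "\<dots> = (SUM k:K. g k) * Y + (SUM ph:\<Phi>. SUM k:K. if steady x ph ep (p k) d c then 0 else g k)"
  by (simp add: sum.distrib sum_distrib_right sum.swap[of _ K])
 also have "(%ph. SUM k:K. if steady x ph ep (p k) d c then 0 else g k) = (%ph. bad x ph ep K h p d c e)"
  unfolding bad_def g_def using schemeD(3)[OF H] by (intro ext sum.mono_neutral_cong_right) auto
 finally show ?thesis using schemeD(6)[OF H asg_override[OF d e]] by (simp add: g_def)
qed

lemma bad_reindex: "bij_betw f K' K ==> bad x ph ep K' (h o f) (p o f) d c e = bad x ph ep K h p d c e"
 unfolding bad_def comp_def by (rule sum.reindex_bij_betw) (auto simp: bij_betw_def inj_on_def)

definition "bad_product x z' ep K h p K' h' p' K2 h2 p2 <-> (ALL ph. ALL d:AS U. ALL d':AS U. ALL c. ALL e:AS U.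
  bad x ph ep K2 h2 p2 (ov d d' z') c e <= bad x ph ep K h p d c e * bad x ph ep K' h' p' d' c e)"

text \<open>A product cell lies in both of its factors and is steady as soon as one of them is, so
  the bad cells are contained in the product of the two sets of bad cells.\<close>

lemma product_scheme:
 assumes H: "scheme x z K (h :: nat => _) p" "scheme x z' K' (h' :: nat => _) p'" "z' Int z = {}"
 shows "EX (K2 :: nat set) h2 p2. scheme x (z Un z') K2 h2 p2 & bad_product x z' ep K h p K' h' p' K2 h2 p2"
proof -
 let ?h = "%(k, l) a. h k a * h' l a" and ?p = "%(k, l) a. min (p k a) (p' l a)"
 have f: "bij_betw prod_decode (prod_encode ` (K \<times> K')) (K \<times> K')" by (rule bij_betw_byWitness[where f' = prod_encode]) auto
 have "bad x ph ep (K \<times> K') ?h ?p (ov d d' z') c e <= bad x ph ep K h p d c e * bad x ph ep K' h' p' d' c e"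
  if d: "d : AS U" and d': "d' : AS U" and e: "e : AS U" for ph d d' c e
 proof -
  let ?d = "ov d d' z'"
  have ev: "F (ov ?d e x) = F (ov d e x)" if "F : Def (x Un z)" "e : AS U" for F e
   by (rule Def_cong[OF that(1) asg_override[OF asg_override[OF d d'] that(2)] asg_override[OF d that(2)]])
    (insert H(3) schemeD(2)[OF H(2)], auto simp: override_on_def)
  have ev': "F (ov ?d e x) = F (ov d' e x)" if "F : Def (x Un z')" "e : AS U" for F e
   by (rule Def_cong[OF that(1) asg_override[OF asg_override[OF d d'] that(2)] asg_override[OF d' that(2)]]) (auto simp: override_on_def)
  let ?B = "{k : K. ~ steady x ph ep (p k) d c}" and ?B' = "{k : K'. ~ steady x ph ep (p' k) d' c}"
  have "steady x ph ep (?p (k, l)) ?d c" if "k : K" "l : K'" "steady x ph ep (p k) d c | steady x ph ep (p' l) d' c" for k l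
   using that(3) by (elim disjE; elim steady_mono) (use ev[OF schemeD(5)[OF H(1) that(1)]] ev'[OF schemeD(5)[OF H(2) that(2)]] in auto)
  hence sub: "{kl : K \<times> K'. ~ steady x ph ep (?p kl) ?d c} <= ?B \<times> ?B'" by auto
  have nn: "0 <= ?h kl (ov ?d e x)" if "kl : K \<times> K'" for kl using that scheme_nonneg[OF H(1) _ asg_override[OF asg_override[OF d d'] e]]
    scheme_nonneg[OF H(2) _ asg_override[OF asg_override[OF d d'] e]] by auto
  have "bad x ph ep (K \<times> K') ?h ?p ?d c e <= (SUM kl:?B \<times> ?B'. ?h kl (ov ?d e x))"
   unfolding bad_def by (rule sum_mono2[OF _ sub]) (use nn schemeD(3)[OF H(1)] schemeD(3)[OF H(2)] in auto)
  also have "\<dots> = (SUM (k, l):?B \<times> ?B'. h k (ov d e x) * h' l (ov d' e x))"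
   using ev[OF schemeD(4)[OF H(1)] e] ev'[OF schemeD(4)[OF H(2)] e] by (intro sum.cong) auto
  also have "\<dots> = bad x ph ep K h p d c e * bad x ph ep K' h' p' d' c e" unfolding bad_def by (simp add: sum_product sum.cartesian_product)
  finally show ?thesis .
 qed
 thus ?thesis by (intro exI[of _ "prod_encode ` (K \<times> K')"] exI[of _ "?h o prod_decode"] exI[of _ "?p o prod_decode"])
   (simp add: bad_product_def bad_reindex[OF f] scheme_reindex[OF scheme_times[OF H(1,2)] f] del: comp_apply)
qed

text \<open>Bad masses are at most 1, so the product scheme inherits every bound of either
  factor.\<close>

lemma bad_product_sums:
 assumes H: "scheme x z K h p" "scheme x z' K' h' p'" and le: "bad_product x z' ep K h p K' h' p' K2 h2 p2"
  and wp: "weighted_points B I e w" and d: "d : asg B" "d' : asg B"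
 shows "(SUM i:I. w i * bad x ph ep K2 h2 p2 (ov d d' z') c (e i)) <= (SUM i:I. w i * bad x ph ep K h p d c (e i))"
  "(SUM i:I. w i * bad x ph ep K2 h2 p2 (ov d d' z') c (e i)) <= (SUM i:I. w i * bad x ph ep K' h' p' d' c (e i))"
proof -
 note W = weighted_pointsD[OF wp]
 have dU: "d : AS U" "d' : AS U" using d W(1) by auto
 have "bad x ph ep K2 h2 p2 (ov d d' z') c (e i) <= bad x ph ep K h p d c (e i)"
  "bad x ph ep K2 h2 p2 (ov d d' z') c (e i) <= bad x ph ep K' h' p' d' c (e i)" if i: "i : I" for i
  using le[unfolded bad_product_def, rule_format, OF dU W(4)[OF i], of ph c]
   bad_01[OF H(1) dU(1) W(4)[OF i], of ph ep c] bad_01[OF H(2) dU(2) W(4)[OF i], of ph ep c]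
  by (meson mult_left_le mult_left_le_one_le order_trans)+
 thus "(SUM i:I. w i * bad x ph ep K2 h2 p2 (ov d d' z') c (e i)) <= (SUM i:I. w i * bad x ph ep K h p d c (e i))"
  "(SUM i:I. w i * bad x ph ep K2 h2 p2 (ov d d' z') c (e i)) <= (SUM i:I. w i * bad x ph ep K' h' p' d' c (e i))"
  using W(5) by (auto intro!: sum_mono mult_left_mono)
qed

definition mcontrols where
 "mcontrols r x ph ep K h p q <-> (ALL B I e w. (ALL j<=r :: nat. weighted_points B I e (w j)) -->
   (EX d:asg B. ALL c:AS U. ALL j<=r. (SUM i:I. w j i * bad x ph ep K h p d c (e i)) <= q * (SUM i:I. w j i)))"

text \<open>Several weight functions are controlled at the same time by a product of schemes for a single one.\<close>

lemma multiple_weights: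
 assumes base: "!!V. finite V ==> EX z (K :: nat set) h p. z Int V = {} & scheme x z K h p & controls x ph ep K h p q"
  and V: "finite V"
 shows "EX z (K :: nat set) h p. z Int V = {} & scheme x z K h p & mcontrols r x ph ep K h p q"
proof (induction r)
 case 0
 obtain z and K :: "nat set" and h p where H: "z Int V = {}" "scheme x z K h p" and C: "controls x ph ep K h p q" using base[OF V] by blast
 have "mcontrols 0 x ph ep K h p q" unfolding mcontrols_def using C[unfolded controls_def] by (simp only: le_zero_eq simp_thms) blast
 with H show ?case by blast
next
 case (Suc r)
 then obtain z and K :: "nat set" and h p where z: "z Int V = {}" and H: "scheme x z K h p" and C: "mcontrols r x ph ep K h p q" by blast
 have "finite (V Un z)" using V schemeD(1)[OF H] by simp
 from base[OF this] obtain z' and K' :: "nat set" and h' p' where z': "z' Int (V Un z) = {}"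
  and H': "scheme x z' K' h' p'" and C': "controls x ph ep K' h' p' q" by blast
 from product_scheme[OF H H'] z' obtain K2 :: "nat set" and h2 p2 where H2: "scheme x (z Un z') K2 h2 p2"
  and le: "bad_product x z' ep K h p K' h' p' K2 h2 p2" by blast
 have "mcontrols (Suc r) x ph ep K2 h2 p2 q" unfolding mcontrols_def
 proof (intro allI impI)
  fix B I e w assume wp: "ALL j<=Suc r. weighted_points B I e (w j)"
  hence "ALL j<=r. weighted_points B I e (w j)" by simp
  from C[unfolded mcontrols_def, THEN spec, THEN spec, THEN spec, THEN spec, THEN mp, OF this]
  obtain d where d: "d : asg B" "ALL c:AS U. ALL j<=r. (SUM i:I. w j i * bad x ph ep K h p d c (e i)) <= q * (SUM i:I. w j i)"
   by blast
  obtain d' where d': "d' : asg B" "ALL c:AS U. (SUM i:I. w (Suc r) i * bad x ph ep K' h' p' d' c (e i)) <= q * (SUM i:I. w (Suc r) i)"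
   using C' wp unfolding controls_def by blast
  show "EX d:asg B. ALL c:AS U. ALL j<=Suc r. (SUM i:I. w j i * bad x ph ep K2 h2 p2 d c (e i)) <= q * (SUM i:I. w j i)"
  proof (intro bexI[of _ "ov d d' z'"] ballI allI impI asg_override d d')
   fix c j assume c: "c : AS U" and j: "j <= Suc r"
   show "(SUM i:I. w j i * bad x ph ep K2 h2 p2 (ov d d' z') c (e i)) <= q * (SUM i:I. w j i)"
    using bad_product_sums[OF H H' le wp[rule_format, OF j] d(1) d'(1), of ph c] j d(2) d'(2) c by (cases "j = Suc r") (auto intro: order_trans)
  qed
 qed
 thus ?case using H2 z z' by (intro exI[of _ "z Un z'"] exI[of _ K2] exI[of _ h2] exI[of _ p2]) auto
qed

text \<open>For every set \<open>T\<close> of cells, the weights are restricted to \<open>T\<close> and controlled again; one of these sets consists of the bad cells.\<close>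

lemma iterate_controls:
 assumes base: "!!V. finite V ==> EX z (K :: nat set) h p. z Int V = {} & scheme x z K h p & controls x ph ep K h p q"
  and q: "0 <= q" and V: "finite V"
 shows "EX z (K :: nat set) h p. z Int V = {} & scheme x z K h p & controls x ph ep K h p (q ^ Suc n)"
proof (induction n)
 case 0
 thus ?case using base[OF V] by simp
next
 case (Suc n)
 then obtain z and K :: "nat set" and h p where z: "z Int V = {}" and H: "scheme x z K h p"
  and C: "controls x ph ep K h p (q ^ Suc n)" by blast
 \<comment> \<open>All subsets of \<open>K\<close> are treated together because the set of bad cells
   depends on \<open>c\<close>, which varies only after the second parameters have been
   fixed.\<close>
 obtain f and r :: nat where f: "Pow K = f ` {j. j < r}" using finite_imp_nat_seg_image_inj_on[of "Pow K"] schemeD(3)[OF H] by auto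
 have "finite (V Un z)" using V schemeD(1)[OF H] by simp
 from multiple_weights[OF base this, of r] obtain z' and K' :: "nat set" and h' p' where z': "z' Int (V Un z) = {}"
  and H': "scheme x z' K' h' p'" and C': "mcontrols r x ph ep K' h' p' q" by blast
 from product_scheme[OF H H'] z' obtain K2 :: "nat set" and h2 p2 where H2: "scheme x (z Un z') K2 h2 p2"
  and le: "bad_product x z' ep K h p K' h' p' K2 h2 p2" by blast
 have "controls x ph ep K2 h2 p2 (q ^ Suc (Suc n))" unfolding controls_def
 proof (intro allI impI)
  fix B I e w assume wp: "weighted_points B I e w"
  note W = weighted_pointsD[OF wp]
  from C wp obtain d where d: "d : asg B" "ALL c:AS U. (SUM i:I. w i * bad x ph ep K h p d c (e i)) <= q ^ Suc n * (SUM i:I. w i)"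
   unfolding controls_def by blast
  have dU: "d : AS U" using d W(1) by blast
  define w' where "w' j i = w i * (SUM k:f j Int K. h k (ov d (e i) x))" for j i
  have "0 <= w' j i" if "i : I" for i j
   unfolding w'_def using W(5)[OF that] scheme_nonneg[OF H _ asg_override[OF dU W(4)[OF that]]] by (intro mult_nonneg_nonneg sum_nonneg) auto
  with wp have "ALL j<=r. weighted_points B I e (w' j)" by (simp add: weighted_points_def)
  with C' obtain d' where d': "d' : asg B" "ALL c:AS U. ALL j<=r. (SUM i:I. w' j i * bad x ph ep K' h' p' d' c (e i)) <= q * (SUM i:I. w' j i)"
   unfolding mcontrols_def by blast
  have d'U: "d' : AS U" using d' W(1) by blast
  show "EX d:asg B. ALL c:AS U. (SUM i:I. w i * bad x ph ep K2 h2 p2 d c (e i)) <= q ^ Suc (Suc n) * (SUM i:I. w i)"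
  proof (intro bexI[of _ "ov d d' z'"] ballI asg_override d d')
   fix c assume c: "c : AS U"
   have "{k : K. ~ steady x ph ep (p k) d c} : Pow K" by blast
   then obtain j where j: "j < r" "f j = {k : K. ~ steady x ph ep (p k) d c}" unfolding f by auto
   have w': "w' j i = w i * bad x ph ep K h p d c (e i)" for i unfolding w'_def bad_def j(2) by (simp add: Int_absorb2)
   have "(SUM i:I. w i * bad x ph ep K2 h2 p2 (ov d d' z') c (e i)) <= (SUM i:I. w' j i * bad x ph ep K' h' p' d' c (e i))"
    unfolding w' mult.assoc using le dU d'U W(4,5) unfolding bad_product_def by (intro sum_mono mult_left_mono) auto
   also have "\<dots> <= q * (SUM i:I. w' j i)" using d'(2) c j(1) by auto
   also have "\<dots> <= q * (q ^ Suc n * (SUM i:I. w i))" unfolding w' using d(2) c q by (intro mult_left_mono) auto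
   finally show "(SUM i:I. w i * bad x ph ep K2 h2 p2 (ov d d' z') c (e i)) <= q ^ Suc (Suc n) * (SUM i:I. w i)" by (simp add: mult.assoc)
  qed
 qed
 thus ?case using H2 z z' by (intro exI[of _ "z Un z'"] exI[of _ K2] exI[of _ h2] exI[of _ p2]) auto
qed

end

context monster
begin

text \<open>Iteration turns a factor below 1 into an arbitrarily small one; it is first replaced by
  \<open>max 0 q0\<close>, since the powers should decrease to 0.\<close>

theorem controlling_scheme_small:
 assumes NIP: "NIP L U" and distal: "distal TYPE('i) L U" and inf: "infinite (UNIV :: 'i set)"
  and fin: "finite x" "finite y" "x Int y = {}" and ph: "ph : Def (x Un y)" and ep: "ep > 0" and et: "et > 0" and V: "finite V"
 shows "EX z (K :: nat set) h p. z Int V = {} & scheme x z K h p & controls x ph ep K h p et"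
proof -
 obtain z0 and K0 :: "nat set" and h0 p0 q0 where H0: "scheme x z0 K0 h0 p0" and q0: "q0 < 1" and C0: "controls x ph ep K0 h0 p0 q0"
  using exists_controlling_scheme[OF NIP distal inf fin ph ep V] by blast
 have mono: "controls x ph ep K h p q'" if C: "controls x ph ep K h p q" and "q <= q'" for K :: "nat set" and h p q q' unfolding controls_def
 proof (intro allI impI)
  fix B I e w assume wp: "weighted_points B I e w"
  have "q * (SUM i:I. w i) <= q' * (SUM i:I. w i)" by (rule mult_right_mono[OF that(2) weighted_pointsD(6)[OF wp]])
  with C wp show "EX d:asg B. ALL c:AS U. (SUM i:I. w i * bad x ph ep K h p d c (e i)) <= q' * (SUM i:I. w i)"
   unfolding controls_def by (meson order_trans)
 qed
 define q where "q = max 0 q0"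
 have q: "0 <= q" "q < 1" using q0 by (auto simp: q_def)
 have C: "controls x ph ep K0 h0 p0 q" by (rule mono[OF C0]) (simp add: q_def)
 obtain n where n: "q ^ n < et" using real_arch_pow_inv[OF et q(2)] by blast
 have "q ^ Suc n <= et" using n q power_decreasing[of n "Suc n" q] by simp
 moreover have "EX z (K :: nat set) h p. z Int V = {} & scheme x z K h p & controls x ph ep K h p (q ^ Suc n)"
 proof (rule iterate_controls[OF _ q(1) V])
  fix V :: "'s var set" assume "finite V"
  from controls_rename[OF fin(1) this H0 C]
  show "EX z (K :: nat set) h p. z Int V = {} & scheme x z K h p & controls x ph ep K h p q" by (rule ex_forward) blast
 qed
 ultimately show ?thesis using mono by blast
qed

end

section \<open>Keisler measures\<close>

lemma continuous_on_Max_insert: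
 fixes F :: "'k => 'b :: topological_space => real"
 assumes "finite K" "!!k. k : K ==> continuous_on S (F k)"
 shows "continuous_on S (%v. Max (insert 0 ((%k. F k v) ` K)))" using assms
proof (induction rule: finite_induct)
 case (insert k K)
 have "Max (insert 0 ((%k. F k v) ` insert k K)) = max (F k v) (Max (insert 0 ((%k. F k v) ` K)))" for v
 proof -
  have "Max (insert (F k v) (insert 0 ((%k. F k v) ` K))) = max (F k v) (Max (insert 0 ((%k. F k v) ` K)))" using insert by (intro Max_insert) auto
  thus ?thesis by (simp add: insert_commute)
 qed
 thus ?case using insert by (auto intro!: continuous_on_max)
qed simp

lemma sets_borel_of_space: "sets (borel_of_space X) = sigma_sets (topspace X) {V. openin X V}"
 unfolding borel_of_space_def by (rule sets_measure_of) (auto dest: openin_subset)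

lemma space_borel_of_space: "space (borel_of_space X) = topspace X" unfolding borel_of_space_def by (rule space_measure_of) (auto dest: openin_subset)

lemma borel_measurable_of_continuous_map:
 assumes "continuous_map X euclideanreal f"
 shows "f : borel_measurable (borel_of_space X)"
proof (rule borel_measurableI)
 fix S :: "real set" assume "open S"
 hence "openin X {p : topspace X. f p : S}" by (intro openin_continuous_map_preimage[OF assms]) simp
 hence "{p : topspace X. f p : S} : sets (borel_of_space X)" unfolding sets_borel_of_space by blast
 moreover have "f -` S Int space (borel_of_space X) = {p : topspace X. f p : S}" by (auto simp: space_borel_of_space)
 ultimately show "f -` S Int space (borel_of_space X) : sets (borel_of_space X)" by simp
qed

lemma measurable_of_continuous_map:
 assumes "continuous_map X Y f"
 shows "f : measurable (borel_of_space X) (borel_of_space Y)" unfolding borel_of_space_def[of Y]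
proof (rule measurable_measure_of)
 show "{V. openin Y V} <= Pow (topspace Y)" by (auto dest: openin_subset)
 show "f : space (borel_of_space X) \<rightarrow> topspace Y" using continuous_map_image_subset_topspace[OF assms] by (auto simp: space_borel_of_space)
 fix V assume "V : {V. openin Y V}"
 hence "openin X {p : topspace X. f p : V}" using openin_continuous_map_preimage[OF assms] by simp
 moreover have "f -` V Int space (borel_of_space X) = {p : topspace X. f p : V}" by (auto simp: space_borel_of_space)
 ultimately show "f -` V Int space (borel_of_space X) : sets (borel_of_space X)" unfolding sets_borel_of_space by auto
qed

lemma regular_borel_probabilityD:
 assumes "regular_borel_probability X mu"
 shows "prob_space mu" "sets mu = sets (borel_of_space X)" "space mu = topspace X" using assms sets_eq_imp_space_eq[of mu "borel_of_space X"]
 by (auto simp: regular_borel_probability_def space_borel_of_space)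

lemma integrable_of_continuous_map:
 assumes "regular_borel_probability X mu" "compact_space X" "continuous_map X euclideanreal f"
 shows "integrable mu f"
proof -
 interpret prob_space mu by (rule regular_borel_probabilityD(1)[OF assms(1)])
 have "compactin euclideanreal (f ` topspace X)" using image_compactin[OF _ assms(3), of "topspace X"] assms(2) by (simp add: compact_space_def)
 hence "bounded (f ` topspace X)" by (simp add: compact_imp_bounded)
 then obtain B where B: "!!p. p : topspace X ==> \<bar>f p\<bar> <= B" unfolding bounded_iff by auto
 show ?thesis
 proof (rule integrable_const_bound[of _ B])
  show "f : borel_measurable mu" using borel_measurable_of_continuous_map[OF assms(3)] measurable_cong_sets[OF regular_borel_probabilityD(2)[OF assms(1)] refl]
   by blast
  show "AE p in mu. norm (f p) <= B" by (rule AE_I2) (simp add: B regular_borel_probabilityD(3)[OF assms(1)])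
 qed
qed

context metric_model
begin

lemma Def_inst:
 assumes "F : Def V" "!!v. d v : A (fst v)" "!!s. A s <= univ U s"
 shows "EX \<psi>:Fml L A x. ALL a:AS U. F (ov d a x) = fval U a \<psi>"
proof -
 obtain ph where ph: "ph : F0 L V" "!!a. a : AS U ==> F a = fval U a ph" using assms(1) unfolding Def_def by blast
 have d: "d : AS U" by (rule asgI) (use assms(2,3) in blast)
 show ?thesis
 proof (intro bexI ballI)
  show "finst (V - x) d ph : Fml L A x" by (rule Fml_finst) (insert ph(1) assms(2), auto simp: Fml_def)
  fix a assume a: "a : AS U"
  have "F (ov d a x) = fval U (ov d a x) ph" by (rule ph(2)[OF asg_override[OF d a]])
  also have "\<dots> = fval U (ov a d (V - x)) ph" by (rule fval_cong) (insert ph(1), auto simp: Fml_def override_on_def)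
  finally show "F (ov d a x) = fval U a (finst (V - x) d ph)" by (simp add: fval_finst)
 qed
qed

lemma keislerD:
 assumes "mu : keisler_measures L U A x"
 shows "regular_borel_probability (type_space L U A x) mu" "prob_space mu" "sets mu = sets (borel_of_space (type_space L U A x))" "space mu = types L U A x"
 using assms regular_borel_probabilityD[of "type_space L U A x" mu] by (simp_all add: keisler_measures_def topspace_type_space)

lemma keisler_integrable:
 assumes "mu : keisler_measures L U A x" "continuous_map (type_space L U A x) euclideanreal f"
 shows "integrable mu f" by (rule integrable_of_continuous_map[OF keislerD(1)[OF assms(1)] compact_type_space assms(2)])

lemma restrict_types:
 assumes "A <= B" "p : types L U B x" "y <= x"
 shows "restrict p (Fml L A y) : types L U A y" unfolding types_def
proof (intro CollectI conjI allI impI)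
 have sub: "Fml L A y <= Fml L B x" using wf_fml_mono[of L A _ B] assms(1,3) by (auto simp: Fml_def le_fun_def)
 show "restrict p (Fml L A y) : Fml L A y \<rightarrow>\<^sub>E {0..1}" using types_01[OF assms(2)] sub by auto
 fix F ep assume F: "finite F & F <= Fml L A y & (ep :: real) > 0"
 then obtain a where a: "a : AS U" "!!ph. ph : F ==> \<bar>fval U a ph - p ph\<bar> < ep"
  using types_approx[OF assms(2), of F ep] sub by blast
 have "fval U (restrict a y) ph = fval U a ph" if "ph : F" for ph by (rule fval_cong) (insert F that, auto simp: Fml_def)
 moreover have "restrict p (Fml L A y) ph = p ph" if "ph : F" for ph using F that by auto
 ultimately show "EX a:tuples U y. ALL ph:F. \<bar>fval U a ph - restrict p (Fml L A y) ph\<bar> < ep"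
  using restrict_tuples[OF a(1), of U y] a(2) by (intro bexI[of _ "restrict a y"]) auto
qed

lemma continuous_map_restrict_types:
 assumes "A <= B" "y <= x"
 shows "continuous_map (type_space L U B x) (type_space L U A y) (%p. restrict p (Fml L A y))"
proof -
 have sub: "Fml L A y <= Fml L B x" using wf_fml_mono[of L A _ B] assms by (auto simp: Fml_def le_fun_def)
 have "continuous_map (type_space L U B x) euclideanreal (%p. restrict p (Fml L A y) ph)" if "ph : Fml L A y" for ph
  using continuous_map_eval[of ph B x] that sub by auto
 hence "continuous_map (type_space L U B x) (product_topology (%_. euclideanreal) (Fml L A y)) (%p. restrict p (Fml L A y))"
  by (auto simp: continuous_map_componentwise)
 thus ?thesis unfolding type_space_def[of L U A y] continuous_map_in_subtopology using restrict_types[OF assms(1) _ assms(2)] by (auto simp: topspace_type_space)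
qed

lemma integral_restrict_measure:
 assumes "A <= B" "nu : keisler_measures L U B x" "\<psi> : Fml L A x"
 shows "(\<integral>p. p \<psi> \<partial>restrict_measure L U A x nu) = (\<integral>p. p \<psi> \<partial>nu)"
proof -
 have "(%p. restrict p (Fml L A x)) : measurable (borel_of_space (type_space L U B x)) (borel_of_space (type_space L U A x))"
  by (rule measurable_of_continuous_map[OF continuous_map_restrict_types[OF assms(1) subset_refl]])
 hence "(%p. restrict p (Fml L A x)) : measurable nu (borel_of_space (type_space L U A x))"
  using measurable_cong_sets[OF keislerD(3)[OF assms(2)] refl] by blast
 moreover have "(%p. p \<psi>) : borel_measurable (borel_of_space (type_space L U A x))"
  by (rule borel_measurable_of_continuous_map[OF continuous_map_eval[OF assms(3)]])
 ultimately have "(\<integral>p. p \<psi> \<partial>restrict_measure L U A x nu) = (\<integral>p. restrict p (Fml L A x) \<psi> \<partial>nu)"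
  unfolding restrict_measure_def by (rule integral_distr)
 thus ?thesis using assms(3) by simp
qed

text \<open>The bound holds for convex combinations of Dirac measures at tuples of \<open>M\<close>,
  and a larger integral is a weak-star open condition, so the bound survives in the closure.\<close>

lemma approximately_realized_le:
 assumes nu: "nu : weak_star_topology L U (univ U) x closure_of dirac_hull L U M x"
  and f: "continuous_map (type_space L U (univ U) x) euclideanreal f"
  and le: "!!a. a : tuples M x ==> f (tp L U (univ U) x a) <= r"
 shows "(\<integral>p. f p \<partial>nu) <= r"
proof (rule ccontr)
 assume "~ ?thesis"
 hence gt: "(\<integral>p. f p \<partial>nu) : {r<..}" by simp
 let ?W = "weak_star_topology L U (univ U) x"
 let ?N = "{mu : keisler_measures L U (univ U) x. (\<integral>p. f p \<partial>mu) : {r<..}}"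
 have "openin ?W ?N" unfolding weak_star_topology_def by (rule topology_generated_by_Basis, rule CollectI, rule exI[of _ f], rule exI[of _ "{r<..}"]) (use f in simp)
 moreover have "nu : ?N"
 proof -
  have "nu : topspace ?W" using nu in_closure_of by fastforce
  hence "nu : keisler_measures L U (univ U) x" unfolding weak_star_topology_def topology_generated_by_topspace by blast
  thus ?thesis using gt by blast
 qed
 ultimately have "EX nu'. nu' : dirac_hull L U M x & nu' : ?N" using nu unfolding in_closure_of by (elim conjE allE[of _ ?N]) simp
 then obtain nu' where nu': "nu' : dirac_hull L U M x" "nu' : ?N" by (elim exE conjE) (rule that)
 from nu'(1) obtain F w where F: "finite F" "F <= tuples M x" and K: "nu' : keisler_measures L U (univ U) x"
  and mB: "!!B. B : sets nu' ==> measure nu' B = (SUM a:F. w a * indicator B (tp L U (univ U) x a))" unfolding dirac_hull_def by blast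
 interpret prob_space nu' by (rule keislerD(2)[OF K])
 \<comment> \<open>No type of a tuple from \<open>M\<close> lies in this set, hence the combination
   of Dirac measures gives it mass 0.\<close>
 let ?B = "{p : space nu'. r < f p}"
 have int: "integrable nu' f" by (rule keisler_integrable[OF K f])
 have B: "?B : sets nu'" using borel_measurable_integrable[OF int] by measurable
 have "measure nu' ?B = 0" unfolding mB[OF B] by (rule sum.neutral) (insert le F(2), force simp: indicator_def)
 hence "AE p in nu'. f p <= r" using AE_iff_measurable[OF B, of "%p. f p <= r"] by (auto simp: emeasure_eq_measure not_le)
 hence "(\<integral>p. f p \<partial>nu') <= (\<integral>p. r \<partial>nu')" by (rule integral_mono_AE[OF int integrable_const])
 thus False using nu'(2) by (simp add: prob_space)
qed

text \<open>A basic open set of the product topology constrains finitely many formulas, so one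
  tolerance for a finite set \<Phi> witnesses continuity at \<open>p\<close>.\<close>

lemma type_space_nbhd:
 assumes P: "continuous_map (type_space L U A x) euclideanreal P" and p: "p : types L U A x" and ep: "ep > 0"
 shows "EX \<Phi> dl. finite \<Phi> & \<Phi> <= Fml L A x & dl > 0 &
  (ALL q:types L U A x. (ALL ph:\<Phi>. \<bar>q ph - p ph\<bar> < dl) --> \<bar>P q - P p\<bar> < ep)"
proof -
 have "openin (type_space L U A x) {q : topspace (type_space L U A x). P q : ball (P p) ep}" by (rule openin_continuous_map_preimage[OF P]) simp
 then obtain T where T: "openin (product_topology (%_. euclideanreal) (Fml L A x)) T"
  "{q : types L U A x. P q : ball (P p) ep} = T Int types L U A x" unfolding topspace_type_space unfolding type_space_def openin_subtopology by blast
 have "p : {q : types L U A x. P q : ball (P p) ep}" using p ep by simp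
 hence "p : T" unfolding T(2) by (rule IntD1)
 with T(1) obtain W where W: "finite {ph : Fml L A x. W ph ~= UNIV}" "!!ph. ph : Fml L A x ==> open (W ph)"
  "p : Pi\<^sub>E (Fml L A x) W" "Pi\<^sub>E (Fml L A x) W <= T" unfolding openin_product_topology_alt by (auto simp: topspace_euclidean)
 define \<Phi> where "\<Phi> = {ph : Fml L A x. W ph ~= UNIV}"
 have "EX e>0. ALL r. \<bar>r - p ph\<bar> < e --> r : W ph" if "ph : \<Phi>" for ph
  using W(2)[of ph] PiE_mem[OF W(3), of ph] that unfolding open_dist by (auto simp: \<Phi>_def dist_real_def)
 then obtain e where e: "!!ph. ph : \<Phi> ==> e ph > 0" "!!ph r. ph : \<Phi> ==> \<bar>r - p ph\<bar> < e ph ==> r : W ph" by metis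
 define dl where "dl = Min (insert (1 :: real) (e ` \<Phi>))"
 have fin: "finite \<Phi>" using W(1) by (simp add: \<Phi>_def)
 have dl: "dl > 0" "!!ph. ph : \<Phi> ==> dl <= e ph" using fin e(1) by (auto simp: dl_def)
 have "\<bar>P q - P p\<bar> < ep" if q: "q : types L U A x" "ALL ph:\<Phi>. \<bar>q ph - p ph\<bar> < dl" for q
 proof -
  have qE: "q : extensional (Fml L A x)" using q(1) by (auto simp: types_def PiE_def)
  have "q ph : W ph" if ph: "ph : Fml L A x" for ph
  proof (cases "ph : \<Phi>")
   case True
   show ?thesis by (rule e(2)[OF True]) (use q(2) dl(2)[OF True] True in force)
  qed (insert ph, simp add: \<Phi>_def)
  hence "q : Pi\<^sub>E (Fml L A x) W" using qE by (simp add: PiE_iff)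
  hence "q : {q : types L U A x. P q : ball (P p) ep}" using W(4) T(2) q(1) by blast
  thus ?thesis by (simp add: dist_real_def abs_minus_commute)
 qed
 thus ?thesis using fin dl(1) by (intro exI[of _ \<Phi>] exI[of _ dl]) (auto simp: \<Phi>_def)
qed

text \<open>A finite cover by such neighbourhoods becomes a maximum of bumps of height
  \<open>P p\<close> around the chosen \<open>p\<close>. The whole expression is a single connective
  applied to the finitely many formulas involved.\<close>

lemma continuous_approx_formula:
 assumes A: "!!s. A s <= univ U s" and P: "continuous_map (type_space L U A x) euclideanreal P"
  and P01: "!!p. p : types L U A x ==> P p : {0..1}" and ep: "ep > 0"
 shows "EX \<psi>:Fml L A x. ALL a:AS U. \<bar>P (tp L U A x a) - fval U a \<psi>\<bar> <= ep"
proof -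
 have "EX \<Phi> dl. ALL p:types L U A x. finite (\<Phi> p) & \<Phi> p <= Fml L A x & dl p > 0 &
  (ALL q:types L U A x. (ALL ph:\<Phi> p. \<bar>q ph - p ph\<bar> < dl p) --> \<bar>P q - P p\<bar> < ep)"
  using type_space_nbhd[OF P _ ep] by metis
 then obtain \<Phi> dl where spec: "ALL p:types L U A x. finite (\<Phi> p) & \<Phi> p <= Fml L A x & dl p > 0 &
  (ALL q:types L U A x. (ALL ph:\<Phi> p. \<bar>q ph - p ph\<bar> < dl p) --> \<bar>P q - P p\<bar> < ep)" by (elim exE) (rule that)
 hence \<Phi>: "finite (\<Phi> p)" "\<Phi> p <= Fml L A x" and dl: "dl p > 0" if "p : types L U A x" for p using that by blast+
 have nb: "\<bar>P q - P p\<bar> < ep"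
  if "p : types L U A x" "q : types L U A x" "!!ph. ph : \<Phi> p ==> \<bar>q ph - p ph\<bar> < dl p" for p q
  using bspec[OF spec that(1)] that(2,3) by blast
 \<comment> \<open>Complements of neighbourhoods of half size. If finitely many neighbourhoods never
   sufficed, compactness would give a type outside its own neighbourhood.\<close>
 define C where "C p = (UN ph:\<Phi> p. {q : types L U A x. q ph : {t. dl p / 2 <= \<bar>t - p ph\<bar>}})" for p
 have "EX D. finite D & D <= types L U A x & (ALL a:AS U. EX p:D. tp L U A x a ~: C p)"
 proof (rule ccontr)
  assume no: "~ ?thesis"
  have "EX q:types L U A x. ALL c:C ` types L U A x. q : c"
  proof (rule type_space_fip[OF A])
   fix c assume "c : C ` types L U A x"
   then obtain p where p: "p : types L U A x" "c = C p" by blast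
   have "closed {t. dl p / 2 <= \<bar>t - p ph\<bar>}" for ph by (intro closed_Collect_le continuous_intros)
   hence "closedin (type_space L U A x) {q : types L U A x. q ph : {t. dl p / 2 <= \<bar>t - p ph\<bar>}}" if "ph : \<Phi> p" for ph
    by (rule closed_condition[rotated]) (use \<Phi>[OF p(1)] that in blast)
   thus "closedin (type_space L U A x) c" unfolding p(2) C_def by (intro closedin_Union finite_imageI \<Phi>(1)[OF p(1)]) blast
  next
   fix \<D> assume "finite \<D>" "\<D> <= C ` types L U A x"
   then obtain D where D: "finite D" "D <= types L U A x" "\<D> = C ` D" by (meson finite_subset_image)
   have "~ (ALL a:AS U. EX p:D. tp L U A x a ~: C p)"
   proof
    assume "ALL a:AS U. EX p:D. tp L U A x a ~: C p"
    with D(1,2) have "finite D & D <= types L U A x & (ALL a:AS U. EX p:D. tp L U A x a ~: C p)" by simp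
    thus False by (rule notE[OF no exI])
   qed
   hence "EX a:AS U. ALL p:D. tp L U A x a : C p" by simp
   then obtain a where a: "a : AS U" "ALL p:D. tp L U A x a : C p" by (elim bexE) (rule that)
   show "EX a:AS U. ALL c:\<D>. tp L U A x a : c" by (rule bexI[OF _ a(1)]) (simp add: D(3) a(2))
  qed
  then obtain q where q: "q : types L U A x" "q : C q" by blast
  thus False using dl[OF q(1)] by (auto simp: C_def)
 qed
 then obtain D where D: "finite D" "D <= types L U A x"
  and cover: "!!a. a : AS U ==> EX p:D. tp L U A x a ~: C p" by blast
 have "finite (UN p:D. \<Phi> p)" using D \<Phi>(1) by blast
 then obtain phs where phs: "set phs = (UN p:D. \<Phi> p)" using finite_list by blast
 define J where "J p = {i. i < length phs & phs ! i : \<Phi> p}" for p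
 have J: "finite (J p)" for p by (simp add: J_def)
 define m where "m p v = Max (insert 0 ((%i. \<bar>v i - p (phs ! i)\<bar>) ` J p))" for p and v :: "nat => real"
 define s where "s p v = min (P p) (max 0 (min 1 (2 - 2 / dl p * m p v)))" for p v
 define u where "u v = Max (insert 0 ((%p. s p v) ` D))" for v
 have cont: "continuous_on {v. ALL i. v i : {0..1}} (m p)" for p unfolding m_def[abs_def]
  by (intro continuous_on_Max_insert J continuous_intros continuous_on_product_coordinates[THEN continuous_on_subset]) auto
 have "connective u" unfolding connective_def
 proof (intro conjI allI impI)
  show "continuous_on {v. ALL i. v i : {0..1}} u" unfolding u_def[abs_def] s_def by (intro continuous_on_Max_insert D(1) continuous_intros cont)
  fix v :: "nat => real"
  have "s p v : {0..1}" if "p : D" for p using P01[of p] that D(2) by (auto simp: s_def)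
  thus "u v : {0..1}" unfolding u_def using D(1) by auto
 qed
 moreover have "wf_fml L A ph & fvars ph <= x" if "ph : set phs" for ph using that \<Phi>(2) D(2) unfolding phs Fml_def by blast
 ultimately have "Conn u phs : Fml L A x" by (auto simp: Fml_def)
 moreover have "\<bar>P (tp L U A x a) - fval U a (Conn u phs)\<bar> <= ep" if a: "a : AS U" for a
 proof -
  let ?q = "tp L U A x a"
  have q: "?q : types L U A x" by (rule tp_in_types[OF A a])
  define v where "v = nth_default 0 (map (fval U a) phs)"
  have v: "v i = ?q (phs ! i)" if "i : J p" "p : D" for i p using that \<Phi>(2) D(2) by (force simp: v_def J_def nth_default_def tp_apply)
  have m: "m p v < r <-> (ALL ph:\<Phi> p. \<bar>?q ph - p ph\<bar> < r)" if "p : D" "r > 0" for p r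
  proof -
   have "\<Phi> p <= set phs" using phs that by blast
   hence "\<Phi> p = (!) phs ` J p" by (force simp: J_def in_set_conv_nth)
   thus ?thesis using J[of p] v[OF _ that(1)] that(2) unfolding m_def by (auto simp: Max_less_iff)
  qed
  have le: "s p v <= P ?q + ep" if p: "p : D" for p
  proof (cases "m p v < dl p")
   case True
   hence "\<bar>P ?q - P p\<bar> < ep" using m[OF p] dl[of p] nb[of p ?q] q p D(2) by blast
   thus ?thesis by (simp add: s_def)
  next
   case False
   hence "2 - 2 / dl p * m p v <= 0" using dl[of p] p D(2) by (auto simp: field_simps)
   thus ?thesis using P01[OF q] P01[of p] p D(2) ep by (auto simp: s_def)
  qed
  obtain p where p: "p : D" "?q ~: C p" using cover[OF a] by blast
  have dlp: "dl p > 0" using dl p D(2) by blast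
  have "ALL ph:\<Phi> p. \<bar>?q ph - p ph\<bar> < dl p / 2" using p(2) q by (auto simp: C_def not_le)
  hence mp: "m p v < dl p / 2" using m[OF p(1), of "dl p / 2"] dlp by simp
  hence "m p v < dl p" using dlp by simp
  hence "\<bar>P ?q - P p\<bar> < ep" using m[OF p(1) dlp] nb[of p ?q] q p(1) D(2) by blast
  moreover have "s p v = P p" using mp dlp P01[of p] p(1) D(2) by (auto simp: s_def field_simps min_def max_def)
  moreover have "s p v <= u v" unfolding u_def by (rule Max_ge) (use p(1) D(1) in auto)
  moreover have "u v <= P ?q + ep" unfolding u_def by (rule Max.boundedI) (use D(1) le P01[OF q] ep in auto)
  moreover have "fval U a (Conn u phs) = u v" by (simp add: v_def)
  ultimately show ?thesis unfolding abs_le_iff by linarith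
 qed
 ultimately show ?thesis by blast
qed

end

context monster
begin

text \<open>Saturation for arbitrarily many upper bounds on formulas; it serves to realize
  conditions with all of a small model as parameters.\<close>

lemma realize_conditions:
 assumes "!!s. A s <= univ U s" "small \<kappa> A" "finite x" "fst ` \<Gamma> <= Fml L A x"
  and "!!\<Gamma>0. finite \<Gamma>0 ==> \<Gamma>0 <= \<Gamma> ==> EX a:AS U. ALL (ph, r):\<Gamma>0. fval U a ph <= r"
 shows "EX a:AS U. ALL (ph, r):\<Gamma>. fval U a ph <= r"
proof -
 define C where "C = (%(ph, r). {p : types L U A x. p ph : {..r :: real}})"
 have "EX p:types L U A x. ALL c:C ` \<Gamma>. p : c"
 proof (rule type_space_fip[OF assms(1)])
  fix c assume "c : C ` \<Gamma>"
  thus "closedin (type_space L U A x) c" unfolding C_def using assms(4) by (auto intro!: closed_condition simp del: atMost_iff)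
 next
  fix \<D> assume "finite \<D>" "\<D> <= C ` \<Gamma>"
  then obtain \<Gamma>0 where G: "finite \<Gamma>0" "\<Gamma>0 <= \<Gamma>" "\<D> = C ` \<Gamma>0" by (meson finite_subset_image)
  from assms(5)[OF G(1,2)] obtain a where a: "a : AS U" "!!ph r. (ph, r) : \<Gamma>0 ==> fval U a ph <= r" by blast
  have "tp L U A x a : C g" if "g : \<Gamma>0" for g using that G(2) assms(4) a(2)[of "fst g" "snd g"] tp_in_types[OF assms(1) a(1)]
   by (auto simp: C_def case_prod_unfold intro!: tp_apply[THEN eq_refl, THEN order_trans])
  thus "EX a:AS U. ALL C:\<D>. tp L U A x a : C" using a(1) G(3) by blast
 qed
 then obtain p where p: "p : types L U A x" "!!g. g : \<Gamma> ==> p : C g" by blast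
 obtain a where a: "a : AS U" "tp L U A x a = p" using saturated_realize[OF assms(1-3) p(1)] by blast
 have "fval U a ph <= r" if "(ph, r) : \<Gamma>" for ph r using p(2)[OF that] that assms(4) unfolding a(2)[symmetric] by (force simp: C_def tp_apply)
 thus ?thesis using a(1) by blast
qed

end

text \<open>The multiplicative weights method: the weight of \<open>e\<close> is multiplied by \<open>1 + bt c e w\<close> in every round.\<close>

lemma multiplicative_weights:
 fixes c :: "'e => 'w => real"
 assumes A: "finite A" "A ~= {}" and c: "!!e w. e : A ==> w : W ==> c e w : {0..1}"
  and W: "!!l. (!!e. e : A ==> 0 <= l e) ==> sum l A = 1 ==> EX w:W. (SUM e:A. l e * c e w) <= r"
  and r: "0 <= r" and ta: "0 < ta"
 shows "EX T ws. T > 0 & (ALL t<T. ws t : W) & (ALL e:A. (SUM t<T. c e (ws t)) <= (r + ta) * real T)"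
proof -
 \<comment> \<open>The step size loses at most ta/2 per round to the second-order term; the other
   half of \<open>ta\<close> absorbs the initial ln (card A) once \<open>T\<close> is large.\<close>
 define bt where "bt = min 1 (ta / 2)"
 have bt: "0 < bt" "bt <= 1" "bt <= ta / 2" using ta by (auto simp: bt_def)
 have "EX ws. (ALL t<T. ws t : W) & (SUM e:A. PROD t<T. (1 + bt * c e (ws t))) <= card A * (1 + bt * r) ^ T" for T
 proof (induction T)
  case (Suc T)
  then obtain ws where ws: "!!t. t < T ==> ws t : W"
   "(SUM e:A. PROD t<T. (1 + bt * c e (ws t))) <= card A * (1 + bt * r) ^ T" by blast
  define p where "p e = (PROD t<T. (1 + bt * c e (ws t)))" for e
  define S where "S = sum p A"
  have p: "0 < p e" if "e : A" for e unfolding p_def using c[OF that ws(1)] bt by (intro prod_pos ballI) (simp add: add_pos_nonneg)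
  have S: "0 < S" unfolding S_def by (rule sum_pos[OF A p])
  \<comment> \<open>The next \<open>w\<close> answers the current weights, normalized to a
    probability.\<close>
  obtain w where w: "w : W" "(SUM e:A. p e / S * c e w) <= r"
   using W[of "%e. p e / S"] p S by (auto simp: S_def less_imp_le simp flip: sum_divide_distrib)
  have "(SUM e:A. PROD t<Suc T. (1 + bt * c e ((ws(T := w)) t))) = (SUM e:A. p e * (1 + bt * c e w))" by (simp add: p_def)
  also have "\<dots> = S * (1 + bt * (SUM e:A. p e / S * c e w))" using S by (simp add: S_def algebra_simps sum.distrib sum_distrib_left)
  also have "\<dots> <= (card A * (1 + bt * r) ^ T) * (1 + bt * r)"
  proof (rule mult_mono)
   show "S <= card A * (1 + bt * r) ^ T" using ws(2) by (simp add: S_def p_def)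
   show "1 + bt * (SUM e:A. p e / S * c e w) <= 1 + bt * r" using w(2) bt(1) by simp
   have "0 <= (SUM e:A. p e / S * c e w)" using p S c[OF _ w(1)] by (intro sum_nonneg mult_nonneg_nonneg) (auto simp: less_imp_le)
   thus "0 <= 1 + bt * (SUM e:A. p e / S * c e w)" using bt(1) by simp
  qed (use r bt(1) in auto)
  finally show ?case using ws(1) w(1) by (intro exI[of _ "ws(T := w)"]) (auto simp: less_Suc_eq mult_ac)
 qed simp
 note rounds = this
 obtain T0 :: nat where T0: "2 * ln (card A) / (bt * ta) < T0" using reals_Archimedean2 by blast
 define T where "T = Suc T0"
 obtain ws where ws: "!!t. t < T ==> ws t : W"
  "(SUM e:A. PROD t<T. (1 + bt * c e (ws t))) <= card A * (1 + bt * r) ^ T" using rounds[of T] by blast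
 have cA: "0 < card A" using A by (simp add: card_gt_0_iff)
 have "(SUM t<T. c e (ws t)) <= (r + ta) * real T" if e: "e : A" for e
 proof -
  have c01: "0 <= c e (ws t)" "c e (ws t) <= 1" if "t < T" for t using c[OF e ws(1)[OF that]] by auto
  have pos: "0 < 1 + bt * c e (ws t)" if "t < T" for t using c01[OF that] bt(1) by (simp add: add_pos_nonneg)
  have br: "0 < 1 + bt * r" using bt(1) r by (simp add: add_pos_nonneg)
  have "0 <= (PROD t<T. (1 + bt * c e' (ws t)))" if "e' : A" for e' using c[OF that ws(1)] bt(1) by (intro prod_nonneg) auto
  hence "(PROD t<T. (1 + bt * c e (ws t))) <= (SUM e:A. PROD t<T. (1 + bt * c e (ws t)))" using A(1) e by (intro member_le_sum) auto
  with ws(2) have "(PROD t<T. (1 + bt * c e (ws t))) <= card A * (1 + bt * r) ^ T" by linarith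
  hence "ln (PROD t<T. (1 + bt * c e (ws t))) <= ln (card A * (1 + bt * r) ^ T)"
   by (subst ln_le_cancel_iff) (use prod_pos[of "{..<T}" "%t. 1 + bt * c e (ws t)"] pos br cA in auto)
  also have "\<dots> = ln (card A) + T * ln (1 + bt * r)" using cA br by (subst ln_mult) (auto simp: ln_realpow)
  also have "\<dots> <= ln (card A) + T * (bt * r)" using r bt(1) by (intro add_left_mono mult_left_mono ln_add_one_self_le_self) auto
  finally have "ln (PROD t<T. (1 + bt * c e (ws t))) <= ln (card A) + T * (bt * r)" .
  moreover have "1 + bt * c e (ws t) ~= 0" if "t < T" for t using pos[OF that] by linarith
  hence "ln (PROD t<T. (1 + bt * c e (ws t))) = (SUM t<T. ln (1 + bt * c e (ws t)))" by (intro ln_prod) simp_all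
  \<comment> \<open>From ln (1 + u) >= u - u^2 for u in [0,1], with u at most
    \<open>bt\<close>.\<close>
  moreover have "(SUM t<T. bt * c e (ws t) - bt\<^sup>2) <= (SUM t<T. ln (1 + bt * c e (ws t)))"
  proof (rule sum_mono)
   fix t assume "t : {..<T}"
   hence t: "0 <= c e (ws t)" "c e (ws t) <= 1" using c01 by auto
   have x: "0 <= bt * c e (ws t)" "bt * c e (ws t) <= bt" using t bt by (auto simp: mult_left_le)
   have "(bt * c e (ws t))\<^sup>2 <= bt\<^sup>2" using x by (intro power_mono)
   thus "bt * c e (ws t) - bt\<^sup>2 <= ln (1 + bt * c e (ws t))"
    using ln_one_plus_pos_lower_bound[of "bt * c e (ws t)"] x bt(2) by linarith
  qed
  ultimately have "bt * (SUM t<T. c e (ws t)) - T * bt\<^sup>2 <= ln (card A) + T * (bt * r)" by (simp add: sum_subtractf sum_distrib_left)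
  moreover have "ln (card A) <= bt * (ta / 2 * T)"
  proof -
   have "2 * ln (card A) / (bt * ta) < T" using T0 by (simp add: T_def)
   thus ?thesis using bt(1) ta by (simp add: field_simps)
  qed
  moreover have "T * bt\<^sup>2 <= bt * (ta / 2 * T)"
  proof -
   have "(T * bt) * bt <= (T * bt) * (ta / 2)" using bt by (intro mult_left_mono) auto
   thus ?thesis by (simp add: power2_eq_square mult_ac)
  qed
  ultimately have "bt * (SUM t<T. c e (ws t)) <= bt * ((r + ta) * T)" by (simp add: algebra_simps)
  thus ?thesis using bt(1) by simp
 qed
 thus ?thesis using ws(1) by (intro exI[of _ T] exI[of _ ws]) (simp add: T_def)
qed

section \<open>Integration over the types of a small model\<close>

locale small_submodel = monster L U \<kappa> T + elementary_submodel L U M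
 for L :: "('s, 'f, 'r) language" and U :: "('s, 'f, 'r, 'a) mstruct" and \<kappa> :: "'k rel"
  and T :: "('s, 'f, 'r, 'a) fml set" and M :: "('s, 'f, 'r, 'a) mstruct" +
 assumes small_M: "small \<kappa> (univ M)"
begin

text \<open>Every type over the small model \<open>M\<close> is realized in \<open>U\<close>. This allows us to evaluate functions on
  assignments at types and to integrate them.\<close>

definition realizer :: "'s var set => (('s, 'f, 'r, 'a) fml => real) => 's var => 'a" where
 "realizer x p = (SOME a. a : AS U & tp L U (univ M) x a = p)"

definition mean :: "'s var set => (('s, 'f, 'r, 'a) fml => real) measure =>
  (('s var => 'a) => real) => ('s var => 'a) => real" where
 "mean x mu F d = (\<integral>p. F (ov d (realizer x p) x) \<partial>mu)"

lemma realizer: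
 assumes "finite x" "p : types L U (univ M) x"
 shows "realizer x p : AS U" "tp L U (univ M) x (realizer x p) = p" using someI_ex[OF saturated_realize[OF univ_sub small_M assms, unfolded Bex_def]]
 by (simp_all add: realizer_def)

lemma Def_inst_model:
 assumes x: "finite x" and F: "F : Def V" and d: "d : AS M"
 shows "EX \<psi>:Fml L (univ M) x. (ALL a:AS U. F (ov d a x) = fval U a \<psi>) &
  (ALL p:types L U (univ M) x. F (ov d (realizer x p) x) = p \<psi>)"
proof -
 obtain \<psi> where \<psi>: "\<psi> : Fml L (univ M) x" "!!a. a : AS U ==> F (ov d a x) = fval U a \<psi>"
  using Def_inst[OF F asgD[OF d] univ_sub] by blast
 have "F (ov d (realizer x p) x) = p \<psi>" if p: "p : types L U (univ M) x" for p
  using \<psi>(2)[OF realizer(1)[OF x p]] tp_apply[OF \<psi>(1), of U "realizer x p"] realizer(2)[OF x p] by simp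
 thus ?thesis using \<psi> by blast
qed

lemma mean_formula:
 assumes "finite x" "mu : keisler_measures L U (univ M) x"
  and "!!p. p : types L U (univ M) x ==> F (ov d (realizer x p) x) = p \<psi>"
 shows "mean x mu F d = (\<integral>p. p \<psi> \<partial>mu)"
 unfolding mean_def by (rule Bochner_Integration.integral_cong[OF refl]) (use assms keislerD(4)[OF assms(2)] in auto)

lemma integrable_at_realizer:
 assumes "finite x" "mu : keisler_measures L U (univ M) x" "F : Def V" "d : AS M"
 shows "integrable mu (%p. F (ov d (realizer x p) x))"
proof -
 obtain \<psi> where \<psi>: "\<psi> : Fml L (univ M) x" "!!p. p : types L U (univ M) x ==> F (ov d (realizer x p) x) = p \<psi>"
  using Def_inst_model[OF assms(1,3,4)] by blast
 have "integrable mu (%p. p \<psi>)" by (rule keisler_integrable[OF assms(2) continuous_map_eval[OF \<psi>(1)]])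
 thus ?thesis by (rule Bochner_Integration.integrable_cong[THEN iffD1, rotated -1]) (simp_all add: keislerD(4)[OF assms(2)] \<psi>(2))
qed

text \<open>A violation in \<open>U\<close> would have a witness in \<open>M\<close> by
  elementarity.\<close>

lemma model_dense:
 assumes "finite x" "F : Def V" "d : AS M" "!!a. a : AS M ==> r <= F (ov d a x)"
  and "a : AS U"
 shows "r <= F (ov d a x)"
proof (rule ccontr)
 assume "~ ?thesis"
 hence "F (ov d a x) < r" by simp
 then obtain e where "e : AS M" "F (ov d e x) < r" using elem_witness[OF assms(1,2) asg_sub[OF assms(3)] asgD[OF assms(3)] assms(5)] by blast
 thus False using assms(4)[of e] by simp
qed

context
 fixes x mu assumes x: "finite x" and mu: "mu : keisler_measures L U (univ M) x"
begin

lemma mean_mono: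
 assumes F: "F : Def V" and G: "G : Def W" and d: "d : AS M" and e: "e : AS M"
  and le: "!!a. a : AS U ==> F (ov d a x) <= G (ov e a x)"
 shows "mean x mu F d <= mean x mu G e" unfolding mean_def
 by (rule integral_mono[OF integrable_at_realizer[OF x mu F d] integrable_at_realizer[OF x mu G e]]) (use le realizer(1)[OF x] keislerD(4)[OF mu] in auto)

lemma mean_cong:
 assumes F: "F : Def V" and d: "d : AS M" "e : AS M" "!!v. v : V - x ==> d v = e v"
 shows "mean x mu F d = mean x mu F e"
proof -
 have "F (ov d a x) = F (ov e a x)" if "a : AS U" for a by (rule Def_cong[OF F asg_override[OF asg_sub[OF d(1)] that] asg_override[OF asg_sub[OF d(2)] that]])
   (insert d(3), auto simp: override_on_def)
 thus ?thesis by (intro antisym mean_mono[OF F F]) (use d in auto)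
qed

lemma mean_const: "mean x mu (%a. c) d = c"
proof -
 interpret prob_space mu by (rule keislerD(2)[OF mu])
 show ?thesis by (simp add: mean_def prob_space)
qed

lemma mean_nonneg:
 assumes "F : Def V" "d : AS M"
 shows "0 <= mean x mu F d" using mean_mono[OF Def_const[of 0] assms(1,2,2)] Def_ge0[OF assms(1) asg_override[OF asg_sub[OF assms(2)]]] by (simp add: mean_const)

lemma mean_le_1:
 assumes "F : Def V" "d : AS M"
 shows "mean x mu F d <= 1" using mean_mono[OF assms(1) Def_const[of 1] assms(2,2)] Def_01[OF assms(1) asg_override[OF asg_sub[OF assms(2)]]]
 by (simp add: mean_const)

lemma mean_sum:
 assumes "!!k. k : K ==> F k : Def V" "d : AS M"
 shows "mean x mu (%a. SUM k:K. c k * F k a) d = (SUM k:K. c k * mean x mu (F k) d)"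
proof -
 have "mean x mu (%a. SUM k:K. c k * F k a) d = (SUM k:K. \<integral>p. c k * F k (ov d (realizer x p) x) \<partial>mu)" unfolding mean_def
  by (rule Bochner_Integration.integral_sum) (use integrable_at_realizer[OF x mu assms(1) assms(2)] in simp)
 thus ?thesis by (simp add: mean_def)
qed

end

text \<open>Definability of the global extension \<open>nu\<close> makes the mean a continuous
  function \<open>F\<close> of the type of the parameters over \<open>M\<close>. \<open>F\<close>
  also gives the \<open>nu\<close>-integrals at parameters of \<open>U\<close>, which is what
  remains available after parameters have been found by saturation.\<close>

lemma mean_at_type:
 assumes fin: "finite x" "finite w" "x Int w = {}" and \<xi>: "\<xi> : Def (x Un w)"
  and gs: "generically_stable L U M x mu"
 shows "EX nu:keisler_measures L U (univ U) x. EX F te. nu : weak_star_topology L U (univ U) x closure_of dirac_hull L U M x &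
  continuous_map (type_space L U (univ M) w) euclideanreal F &
  (ALL b:AS U. te b : Fml L (univ U) x & (ALL a:AS U. fval U a (te b) = \<xi> (ov b a x)) &
    F (tp L U (univ M) w b) = (\<integral>p. p (te b) \<partial>nu)) & (ALL d:AS M. mean x mu \<xi> d = F (tp L U (univ M) w d))"
proof -
 obtain nu where nu: "nu : keisler_measures L U (univ U) x" and mu: "restrict_measure L U (univ M) x nu = mu"
  and df: "definable_measure L U (univ M) x nu"
  and ar: "nu : weak_star_topology L U (univ U) x closure_of dirac_hull L U M x" using gs unfolding generically_stable_def by blast
 obtain ph where ph: "ph : F0 L (x Un w)" "!!a. a : AS U ==> \<xi> a = fval U a ph" using \<xi> unfolding Def_def by blast
 have "ph : Fml L (univ M) (x Un w)" by (rule Fml_mono[OF ph(1)]) auto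
 with df fin(2,3) have "EX F. continuous_map (type_space L U (univ M) w) euclideanreal F &
   (ALL b:tuples U w. F (tp L U (univ M) w b) = (\<integral>p. p (finst w b ph) \<partial>nu))" unfolding definable_measure_def by simp
 then obtain F where F: "continuous_map (type_space L U (univ M) w) euclideanreal F"
  and Fb: "!!b. b : tuples U w ==> F (tp L U (univ M) w b) = (\<integral>p. p (finst w b ph) \<partial>nu)" by blast
 define te where "te b = finst w (restrict b w) ph" for b
 have te: "te b : Fml L A x" if "b : asg A" for b A unfolding te_def by (rule Fml_finst[OF ph(1)]) (use asgD[OF that] in auto)
 have val: "fval U a (te b) = \<xi> (ov b a x)" if "a : AS U" "b : AS U" for a b
 proof -
  have "fval U a (te b) = fval U (ov a (restrict b w) w) ph" by (simp add: te_def fval_finst)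
  also have "\<dots> = fval U (ov b a x) ph" by (rule fval_cong) (insert ph(1) fin(3), auto simp: Fml_def override_on_def)
  finally show ?thesis using ph(2)[OF asg_override[OF that(2,1)]] by simp
 qed
 have Fte: "F (tp L U (univ M) w b) = (\<integral>p. p (te b) \<partial>nu)" if "b : AS U" for b
  using Fb[of "restrict b w"] restrict_tuples[OF that, of U w] by (simp add: te_def)
 have "mean x mu \<xi> d = F (tp L U (univ M) w d)" if d: "d : AS M" for d
 proof -
  have "\<xi> (ov d (realizer x p) x) = p (te d)" if p: "p : types L U (univ M) x" for p
   using val[OF realizer(1)[OF fin(1) p] asg_sub[OF d]] tp_apply[OF te[OF d], of U "realizer x p"] realizer(2)[OF fin(1) p] by simp
  moreover have "space mu = types L U (univ M) x" by (simp add: mu[symmetric] restrict_measure_def space_borel_of_space topspace_type_space)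
  ultimately have "mean x mu \<xi> d = (\<integral>p. p (te d) \<partial>mu)" unfolding mean_def by (intro Bochner_Integration.integral_cong refl) simp
  also have "\<dots> = (\<integral>p. p (te d) \<partial>nu)"
   unfolding mu[symmetric] by (rule integral_restrict_measure[OF _ nu te[OF d]]) (simp add: le_fun_def univ_sub)
  finally show ?thesis using Fte[OF asg_sub[OF d]] by simp
 qed
 thus ?thesis using nu ar F te val Fte by (intro bexI[OF _ nu] exI[of _ F] exI[of _ te] conjI) auto
qed

text \<open>The scheme for the predicate with the roles of the variables exchanged bounds, independently of \<open>A\<close>,
  the number of tuples \<open>ws k\<close> that are needed to represent the tuples found by the multiplicative weights method.\<close>

lemma few_representatives:
 assumes fin: "finite x" "finite w" "x Int w = {}" and \<xi>: "\<xi> : Def (x Un w)" and ta: "ta > 0"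
  and H: "scheme w z (K :: nat set) h p" "controls w \<xi> ta K h p ta" and m: "real (card K) <= ta * real m" "m > 0"
  and W: "W <= AS M" and A: "finite A" "A <= AS M" "A ~= {}" and r: "0 <= r"
  and neg: "!!l. (!!e. e : A ==> 0 <= l e) ==> sum l A = 1 ==> EX d:W. (SUM e:A. l e * \<xi> (ov d e x)) <= r"
 shows "EX g:PiE K (%_. {..m}). EX ws. ws ` K <= W & 1 - ta <= (SUM k:K. real (g k) / m) & (SUM k:K. real (g k) / m) <= 1 &
  (ALL e:A. (SUM k:K. real (g k) / m * \<xi> (ov (ws k) e x)) <= r + 3 * ta)"
proof -
 have WU: "d : AS U" if "d : W" for d using asg_sub W that by blast
 have AU: "e : AS U" if "e : A" for e using asg_sub A(2) that by blast
 \<comment> \<open>Every probability on \<open>A\<close> is answered by some element of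
   \<open>W\<close>. Multiplicative weights turns this into a finite family in \<open>W\<close> that
   is good at every \<open>e\<close>, though its size depends on \<open>A\<close>.\<close>
 have "EX T ws. T > 0 & (ALL t<T. ws t : W) & (ALL e:A. (SUM t<T. \<xi> (ov (ws t) e x)) <= (r + ta) * real T)"
  by (rule multiplicative_weights[OF A(1,3) _ neg r ta]) (use Def_01[OF \<xi> asg_override[OF WU AU]] in auto)
 then obtain T :: nat and w0 where T: "T > 0" and w0: "!!t. t < T ==> w0 t : W"
  and avg: "!!e. e : A ==> (SUM t<T. \<xi> (ov (w0 t) e x)) <= (r + ta) * real T" by blast
 have wp: "weighted_points (univ M) {..<T} w0 (%_. 1 / real T)" unfolding weighted_points_def using M.univ_ne univ_sub w0 W by auto
 from H(2) wp obtain d where d: "d : AS M" and un: "!!c. c : AS U ==>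
   (SUM t<T. 1 / real T * bad w \<xi> ta K h p d c (w0 t)) <= ta * (SUM t<T. 1 / real T)" unfolding controls_def by blast
 have dU: "d : AS U" by (rule asg_sub[OF d])
 \<comment> \<open>The mass of the cell \<open>k\<close> under the uniform measure on the family;
   one member of the family in that cell will stand for the whole cell.\<close>
 define al where "al k = (SUM t<T. 1 / real T * h k (ov d (w0 t) w))" for k
 have hge: "0 <= h k (ov d (w0 t) w)" if "k : K" "t < T" for k t by (rule scheme_nonneg[OF H(1) that(1) asg_override[OF dU WU[OF w0[OF that(2)]]]])
 have al0: "0 <= al k" if "k : K" for k unfolding al_def using hge[OF that] by (intro sum_nonneg) auto
 have al1: "(SUM k:K. al k) = 1"
 proof -
  have "(SUM k:K. al k) = (SUM t<T. 1 / real T * (SUM k:K. h k (ov d (w0 t) w)))" unfolding al_def sum_distrib_left by (rule sum.swap)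
  also have "\<dots> = (SUM t<T. 1 / real T)" using schemeD(6)[OF H(1) asg_override[OF dU WU[OF w0]]] by (intro sum.cong) auto
  finally show ?thesis using T by simp
 qed
 have finK: "finite K" by (rule schemeD(3)[OF H(1)])
 define t0 where "t0 k = (if EX t<T. h k (ov d (w0 t) w) > 0 then SOME t. t < T & h k (ov d (w0 t) w) > 0 else 0)" for k
 have t0: "t0 k < T" for k unfolding t0_def using T by (auto intro: someI2_ex)
 have t0h: "h k (ov d (w0 (t0 k)) w) > 0" if "t < T" "h k (ov d (w0 t) w) > 0" for k t
  using someI_ex[of "%t. t < T & h k (ov d (w0 t) w) > 0"] that unfolding t0_def by auto
 define ws where "ws k = w0 (t0 k)" for k
 \<comment> \<open>Rounding down to multiples of 1/m leaves finitely many weight vectors and loses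
   at most card K / m <= ta in total.\<close>
 define g where "g = (\<lambda>k\<in>K. nat \<lfloor>real m * al k\<rfloor>)"
 have alle: "al k <= 1" if "k : K" for k using member_le_sum[of k K al] that al0 al1 finK by auto
 have g: "real (g k) <= real m * al k" "real m * al k - 1 <= real (g k)" if "k : K" for k
 proof -
  have "0 <= real m * al k" using al0[OF that] by simp
  moreover have "g k = nat \<lfloor>real m * al k\<rfloor>" using that by (simp add: g_def)
  ultimately show "real (g k) <= real m * al k" "real m * al k - 1 <= real (g k)" by linarith+
 qed
 have gm: "real (g k) / m <= al k" "al k - 1 / m <= real (g k) / m" if "k : K" for k
 proof -
  show "real (g k) / m <= al k" using g(1)[OF that] m(2) by (simp add: field_simps)
  have "(real m * al k - 1) / m <= real (g k) / m" by (rule divide_right_mono[OF g(2)[OF that]]) simp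
  thus "al k - 1 / m <= real (g k) / m" using m(2) by (simp add: diff_divide_distrib)
 qed
 show ?thesis
 proof (intro bexI[of _ g] exI[of _ ws] conjI ballI)
  have "g k <= m" if "k : K" for k
  proof -
   have "real (g k) <= real m" using g(1)[OF that] mult_left_mono[OF alle[OF that], of "real m"] by simp
   thus ?thesis by simp
  qed
  thus "g : PiE K (%_. {..m})" by (auto simp: g_def)
  show "ws ` K <= W" using w0[OF t0] by (auto simp: ws_def)
  have "(SUM k:K. real (g k) / m) <= (SUM k:K. al k)" by (rule sum_mono[OF gm(1)])
  thus "(SUM k:K. real (g k) / m) <= 1" by (simp add: al1)
  have "(SUM k:K. al k - 1 / m) <= (SUM k:K. real (g k) / m)" by (rule sum_mono[OF gm(2)])
  moreover have "(SUM k:K. al k - 1 / m) = 1 - real (card K) / m" by (simp add: sum_subtractf al1)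
  moreover have "real (card K) / m <= ta" using m by (simp add: field_simps)
  ultimately show "1 - ta <= (SUM k:K. real (g k) / m)" by linarith
  fix e assume e: "e : A"
  have eU: "e : AS U" by (rule AU[OF e])
  have sw: "\<xi> (ov v e x) = \<xi> (ov e v w)" if "v : AS U" for v
   by (rule Def_cong[OF \<xi> asg_override[OF that eU] asg_override[OF eU that]]) (insert fin(3), auto simp: override_on_def)
  have \<xi>01: "0 <= \<xi> (ov v e x)" "\<xi> (ov v e x) <= 1" if "v : AS U" for v using Def_01[OF \<xi> asg_override[OF that eU]] by auto
  have wsU: "ws k : AS U" for k unfolding ws_def by (rule WU[OF w0[OF t0]])
  have "(SUM k:K. real (g k) / m * \<xi> (ov (ws k) e x)) <= (SUM k:K. al k * \<xi> (ov (ws k) e x))"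
   by (intro sum_mono mult_right_mono gm(1) \<xi>01(1)[OF wsU])
  also have "\<dots> = (SUM t<T. 1 / real T * (SUM k:K. h k (ov d (w0 t) w) * \<xi> (ov (ws k) e x)))"
   unfolding al_def sum_distrib_right sum_distrib_left mult.assoc by (rule sum.swap)
  also have "\<dots> <= (SUM t<T. 1 / real T * (\<xi> (ov (w0 t) e x) + ta + bad w \<xi> ta K h p d e (w0 t)))"
  proof (intro sum_mono mult_left_mono)
   fix t assume "t : {..<T}"
   hence t: "t < T" by simp
   hence v: "w0 t : AS U" "w0 (t0 k) : AS U" for k using WU w0 t0 by blast+
   have "\<xi> (ov (ws k) e x) <= \<xi> (ov (w0 t) e x) + ta"
    if k: "k : K" and pos: "h k (ov d (w0 t) w) > 0" and st: "ALL \<psi>:{\<xi>}. steady w \<psi> ta (p k) d e" for k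
   proof -
    have "p k (ov d (w0 t) w) = 1" "p k (ov d (w0 (t0 k)) w) = 1" using schemeD(7)[OF H(1) asg_override[OF dU v(1)] k pos]
      schemeD(7)[OF H(1) asg_override[OF dU v(2)] k t0h[OF t pos]] by simp_all
    hence "\<bar>\<xi> (ov e (w0 (t0 k)) w) - \<xi> (ov e (w0 t) w)\<bar> <= ta" using st v unfolding steady_def by simp
    thus ?thesis using sw[OF v(1)] sw[OF v(2)] by (simp add: ws_def)
   qed
   hence "(SUM k:K. h k (ov d (w0 t) w) * \<xi> (ov (ws k) e x)) <=
     \<xi> (ov (w0 t) e x) + ta + (SUM \<psi>:{\<xi>}. bad w \<psi> ta K h p d e (w0 t))"
    using \<xi>01(1)[OF v(1)] \<xi>01(2)[OF wsU] ta by (intro scheme_average[OF H(1) dU v(1)]) auto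
   thus "(SUM k:K. h k (ov d (w0 t) w) * \<xi> (ov (ws k) e x)) <= \<xi> (ov (w0 t) e x) + ta + bad w \<xi> ta K h p d e (w0 t)" by simp
  qed simp
  also have "\<dots> = 1 / real T * (SUM t<T. \<xi> (ov (w0 t) e x)) + ta + (SUM t<T. 1 / real T * bad w \<xi> ta K h p d e (w0 t))"
   using T by (simp add: distrib_left sum.distrib flip: sum_distrib_left sum_divide_distrib)
  also have "\<dots> <= 1 / real T * ((r + ta) * real T) + ta + ta" using un[OF eU] T by (intro add_mono mult_left_mono avg[OF e] order_refl) simp_all
  \<comment> \<open>The three losses are the error of multiplicative weights, the variation on
    steady cells and the bad mass.\<close>
  also have "\<dots> = r + 3 * ta" using T by simp
  finally show "(SUM k:K. real (g k) / m * \<xi> (ov (ws k) e x)) <= r + 3 * ta" .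
 qed
qed

text \<open>Suppose that all weights fail. For every finite set of points of \<open>M\<close>, few
  parameters with large integrals then have a small weighted average at each point, and the weights
  can be chosen independently of the set. Saturation yields parameters in \<open>U\<close> that are
  good against all of \<open>M\<close>; approximate realization bounds their averaged integral from
  above, while continuity of \<open>F\<close> keeps it large.\<close>

theorem gs_finite_approximation:
 assumes NIP: "NIP L U" and distal: "distal TYPE('i) L U" and inf: "infinite (UNIV :: 'i set)"
  and fin: "finite x" "finite w" "x Int w = {}" and \<xi>: "\<xi> : Def (x Un w)"
  and mu: "mu : keisler_measures L U (univ M) x" and gs: "generically_stable L U M x mu" and et: "et > 0"
 shows "EX I e l. weighted_points (univ M) I e l & sum l I = 1 &
  (ALL d:AS M. (SUM i:I. l i * \<xi> (ov d (e i) x)) <= et / 2 --> mean x mu \<xi> d <= et)"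
proof (rule ccontr)
 assume neg: "~ ?thesis"
 obtain a0 where a0: "a0 : AS M" using M.asg_ne by blast
 have et1: "et < 1"
 proof (rule ccontr)
  assume "~ et < 1"
  hence "mean x mu \<xi> d <= et" if "d : AS M" for d using mean_le_1[OF fin(1) mu \<xi> that] by simp
  moreover have "weighted_points (univ M) {0} (%_. a0) (%_. 1)" using M.univ_ne univ_sub a0 by (simp add: weighted_points_def)
  ultimately show False using neg by (metis (no_types, lifting) sum.insert sum.empty finite.emptyI empty_iff add.right_neutral)
 qed
 obtain nu F te where nu: "nu : keisler_measures L U (univ U) x" "nu : weak_star_topology L U (univ U) x closure_of dirac_hull L U M x"
  and F: "continuous_map (type_space L U (univ M) w) euclideanreal F"
  and te: "!!b. b : AS U ==> te b : Fml L (univ U) x"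
   "!!a b. b : AS U ==> a : AS U ==> fval U a (te b) = \<xi> (ov b a x)"
  and Fte: "!!b. b : AS U ==> F (tp L U (univ M) w b) = (\<integral>p. p (te b) \<partial>nu)"
  and Fm: "!!d. d : AS M ==> mean x mu \<xi> d = F (tp L U (univ M) w d)"
  using mean_at_type[OF fin \<xi> gs] by (elim bexE exE conjE) (rule that, blast+)
 \<comment> \<open>With this value the final inequality et - 3 ta <= et/2 + 3 ta is false.\<close>
 define ta where "ta = et / 16"
 have ta: "ta > 0" using et by (simp add: ta_def)
 have "\<xi> : Def (w Un x)" using \<xi> by (simp add: Un_commute)
 with controlling_scheme_small[OF NIP distal inf fin(2,1) _ this ta ta, of "{}"] fin(3)
 obtain z and K :: "nat set" and h p where H: "scheme w z K h p" "controls w \<xi> ta K h p ta" by (auto simp: Int_commute)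
 have finK: "finite K" by (rule schemeD(3)[OF H(1)])
 obtain m0 :: nat where m0: "real (card K) / ta < m0" using reals_Archimedean2 by blast
 define m where "m = Suc m0"
 have m: "real (card K) <= ta * real m" "m > 0" using m0 ta by (auto simp: m_def field_simps)
 define W where "W = {d : AS M. mean x mu \<xi> d > et}"
 have W: "W <= AS M" by (auto simp: W_def)
 define ok where "ok g A <-> (EX ws. ws ` K <= W & 1 - ta <= (SUM k:K. real (g k) / m) & (SUM k:K. real (g k) / m) <= 1 &
  (ALL e:A. (SUM k:K. real (g k) / m * \<xi> (ov (ws k) e x)) <= et / 2 + 3 * ta))" for g :: "nat => nat" and A
 have ex: "EX g:PiE K (%_. {..m}). ok g A" if A: "finite A" "A <= AS M" "A ~= {}" for A unfolding ok_def
 proof (rule few_representatives[OF fin \<xi> ta H m W A])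
  show "0 <= et / 2" using et by simp
  fix l assume l: "!!e. e : A ==> 0 <= l e" "sum l A = (1 :: real)"
  obtain f and n :: nat where f: "A = f ` {i. i < n}" "inj_on f {i. i < n}" using finite_imp_nat_seg_image_inj_on[OF A(1)] by blast
  have wp: "weighted_points (univ M) {i. i < n} f (l o f)" using M.univ_ne univ_sub A(2) l(1) f(1) by (auto simp: weighted_points_def)
  have re: "(SUM i:{i. i < n}. G (f i)) = sum G A" for G :: "_ => real" unfolding f(1) by (simp add: sum.reindex[OF f(2)])
  have "sum (l o f) {i. i < n} = 1" using re[of l] l(2) by simp
  with wp neg have "~ (ALL d:AS M. (SUM i:{i. i < n}. (l o f) i * \<xi> (ov d (f i) x)) <= et / 2 --> mean x mu \<xi> d <= et)"
   by blast
  then obtain d where "d : W" "(SUM i:{i. i < n}. l (f i) * \<xi> (ov d (f i) x)) <= et / 2" by (force simp: W_def not_le)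
  thus "EX d:W. (SUM e:A. l e * \<xi> (ov d e x)) <= et / 2" unfolding re[of "%e. l e * \<xi> (ov _ e x)"] by blast
 qed
 \<comment> \<open>Pigeonhole: only finitely many \<open>g\<close> are possible, and if each failed
   on some finite set, all would fail on the union.\<close>
 have "EX g:PiE K (%_. {..m}). ALL A. finite A & A <= AS M --> ok g A"
 proof (rule ccontr)
  assume "~ ?thesis"
  then obtain A where A: "!!g. g : PiE K (%_. {..m}) ==> finite (A g) & A g <= AS M & ~ ok g (A g)"
   by (metis (no_types, lifting))
  define A' where "A' = insert a0 (UN g:PiE K (%_. {..m}). A g)"
  have "finite (PiE K (%_. {..m}))" using finK by (intro finite_PiE) auto
  hence "finite A'" "A' <= AS M" "A' ~= {}" using A a0 unfolding A'_def by blast+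
  from ex[OF this] obtain g where g: "g : PiE K (%_. {..m})" "ok g A'" by blast
  have "A g <= A'" using g(1) by (auto simp: A'_def)
  hence "ok g (A g)" using g(2) unfolding ok_def by blast
  thus False using A[OF g(1)] by blast
 qed
 then obtain g where g: "!!A. finite A ==> A <= AS M ==> ok g A" by blast
 define al where "al k = real (g k) / m" for k
 have al0: "0 <= al k" for k by (simp add: al_def)
 have al: "1 - ta <= sum al K" "sum al K <= 1" using g[of "{}"] by (auto simp: ok_def al_def)
 have al1: "al k <= 1" if "k : K" for k using member_le_sum[of k K al] that al0 al(2) finK by auto
 \<comment> \<open>A large integral becomes an upper bound on 1 - F; clipping to [0,1] makes it
   approximable by a formula over \<open>M\<close>.\<close>
 define P where "P p = max 0 (min 1 (1 - F p))" for p
 have P: "continuous_map (type_space L U (univ M) w) euclideanreal P"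
  unfolding P_def by (intro continuous_map_real_max continuous_map_real_min continuous_map_diff F) simp_all
 obtain \<psi> where \<psi>: "\<psi> : Fml L (univ M) w" "!!a. a : AS U ==> \<bar>P (tp L U (univ M) w a) - fval U a \<psi>\<bar> <= ta"
  using continuous_approx_formula[OF univ_sub P _ ta] by (auto simp: P_def)
 obtain b where b: "!!v. v : x Un w ==> snd v < b" using var_index_bound[of "x Un w"] fin by auto
 define sg where "sg k v = (if v : w then cp b k v else v)" for k v
 have sg: "fst (sg k v) = fst v" for k v by (simp add: sg_def)
 define X where "X = (UN k:K. cp b k ` w)"
 have "cp b k v ~: x" for k v using b[of "cp b k v"] snd_cp[of b k v] by auto
 hence X: "finite X" "x Int X = {}" using finK fin(2) by (auto simp: X_def)
 \<comment> \<open>All representatives are held by one finite tuple: the copy \<open>k\<close> of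
   \<open>w\<close> stores the one with weight \<open>al k\<close>.\<close>
 define G where "G a = (SUM k:K. al k * \<xi> (a o sg k))" for a
 have "G : Def (x Un X)" unfolding G_def[abs_def]
 proof (rule Def_sum[OF finK])
  show "(%a. al k * \<xi> (a o sg k)) : Def (x Un X)" if "k : K" for k
   by (intro Def_mult Def_const Def_rename[OF \<xi> sg]) (insert al0 al1 that fin(3), auto simp: sg_def X_def)
  fix a assume "a : AS U"
  hence "(SUM k:K. al k * \<xi> (a o sg k)) <= (SUM k:K. al k)"
   using al0 Def_01[OF \<xi> asg_comp[OF _ sg]] by (intro sum_mono mult_left_le) auto
  thus "(SUM k:K. al k * \<xi> (a o sg k)) <= 1" using al(2) by simp
 qed
 hence "EX \<psi>:Fml L (univ M) X. ALL a:AS U. G (ov e a X) = fval U a \<psi>" if "e : AS M" for e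
  by (rule Def_inst) (use asgD[OF that] univ_sub in auto)
 then obtain \<psi>1 where \<psi>1: "!!e. e : AS M ==> \<psi>1 e : Fml L (univ M) X"
  "!!e a. e : AS M ==> a : AS U ==> G (ov e a X) = fval U a (\<psi>1 e)" by metis
 have "EX \<psi>':Fml L (univ M) X. ALL a. fval U a \<psi>' = fval U (a o sg k) \<psi>" if k: "k : K" for k
 proof -
  obtain \<psi>' where \<psi>': "wf_fml L (univ M) \<psi>'" "fvars \<psi>' <= sg k ` fvars \<psi>" "ALL a. fval U a \<psi>' = fval U (a o sg k) \<psi>"
   using wf_fml_rename[of "univ M" \<psi> "sg k"] \<psi>(1) sg by (auto simp: Fml_def)
  have "sg k ` fvars \<psi> <= X" using \<psi>(1) k by (auto simp: Fml_def sg_def X_def)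
  hence "fvars \<psi>' <= X" using \<psi>'(2) by blast
  thus ?thesis using \<psi>'(1,3) by (intro bexI[of _ \<psi>']) (simp_all add: Fml_def)
 qed
 then obtain \<psi>2 where \<psi>2: "!!k. k : K ==> \<psi>2 k : Fml L (univ M) X" "!!k a. k : K ==> fval U a (\<psi>2 k) = fval U (a o sg k) \<psi>" by metis
 have Gev: "G (ov e a X) = (SUM k:K. al k * \<xi> (ov (a o sg k) e x))" if "e : AS U" "a : AS U" for e a unfolding G_def
 proof (rule sum.cong[OF refl])
  fix k assume k: "k : K"
  have "\<xi> (ov e a X o sg k) = \<xi> (ov (a o sg k) e x)"
   by (rule Def_cong[OF \<xi> asg_comp[OF asg_override[OF that] sg] asg_override[OF asg_comp[OF that(2) sg] that(1)]])
    (insert k X(2) fin(3), auto simp: override_on_def sg_def X_def)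
  thus "al k * \<xi> (ov e a X o sg k) = al k * \<xi> (ov (a o sg k) e x)" by simp
 qed
 \<comment> \<open>The conditions say that the weighted average is small at every \<open>e\<close>
   from \<open>M\<close> and that the integral at each copy stays large. Finitely many of them
   involve a finite set of points, where the representatives are available.\<close>
 have "EX a:AS U. ALL (ph, r):(%e. (\<psi>1 e, et / 2 + 3 * ta)) ` AS M Un (%k. (\<psi>2 k, 1 - et + ta)) ` K. fval U a ph <= r"
 proof (rule realize_conditions[OF univ_sub small_M X(1)])
  show "fst ` ((%e. (\<psi>1 e, et / 2 + 3 * ta)) ` AS M Un (%k. (\<psi>2 k, 1 - et + ta)) ` K) <= Fml L (univ M) X"
   using \<psi>1(1) \<psi>2(1) by auto
  fix \<Gamma>0 assume G0: "finite \<Gamma>0" "\<Gamma>0 <= (%e. (\<psi>1 e, et / 2 + 3 * ta)) ` AS M Un (%k. (\<psi>2 k, 1 - et + ta)) ` K"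
  have "finite (\<Gamma>0 Int (%e. (\<psi>1 e, et / 2 + 3 * ta)) ` AS M)" using G0(1) by simp
  from finite_subset_image[OF this Int_lower2] obtain A where A: "A <= AS M" "finite A"
   "\<Gamma>0 Int (%e. (\<psi>1 e, et / 2 + 3 * ta)) ` AS M = (%e. (\<psi>1 e, et / 2 + 3 * ta)) ` A" by (elim exE conjE) (rule that)
  obtain ws where ws: "ws ` K <= W" and le: "!!e. e : A ==> (SUM k:K. al k * \<xi> (ov (ws k) e x)) <= et / 2 + 3 * ta"
   using g[OF A(2,1)] unfolding ok_def al_def by blast
  define ws' where "ws' k = (if k : K then ws k else a0)" for k
  have ws': "ws' k : AS U" for k using ws W a0 asg_sub by (auto simp: ws'_def)
  define a where "a = glue b ws' a0"
  have a: "a : AS U" unfolding a_def by (rule glue_asg[OF ws' asg_sub[OF a0]])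
  have aw: "(a o sg k) v = ws k v" if "k : K" "v : w" for k v using that by (simp add: a_def sg_def ws'_def)
  have 1: "fval U a (\<psi>1 e) <= et / 2 + 3 * ta" if e: "e : A" for e
  proof -
   have eM: "e : AS M" using e A(1) by blast
   have "fval U a (\<psi>1 e) = (SUM k:K. al k * \<xi> (ov (a o sg k) e x))" using \<psi>1(2)[OF eM a] Gev[OF asg_sub[OF eM] a] by simp
   also have "\<dots> = (SUM k:K. al k * \<xi> (ov (ws k) e x))"
   proof (rule sum.cong[OF refl])
    fix k assume k: "k : K"
    have wk: "ws k : AS U" using ws'[of k] k by (simp add: ws'_def)
    have "\<xi> (ov (a o sg k) e x) = \<xi> (ov (ws k) e x)"
     by (rule Def_cong[OF \<xi> asg_override[OF asg_comp[OF a sg] asg_sub[OF eM]] asg_override[OF wk asg_sub[OF eM]]])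
      (insert aw[OF k], auto simp: override_on_def)
    thus "al k * \<xi> (ov (a o sg k) e x) = al k * \<xi> (ov (ws k) e x)" by simp
   qed
   finally show ?thesis using le[OF e] by simp
  qed
  have 2: "fval U a (\<psi>2 k) <= 1 - et + ta" if k: "k : K" for k
  proof -
   have wk: "ws k : W" using ws k by blast
   have "tp L U (univ M) w (a o sg k) = tp L U (univ M) w (ws k)" by (rule tp_cong) (rule aw[OF k])
   moreover have "F (tp L U (univ M) w (ws k)) > et" using wk Fm[of "ws k"] by (auto simp: W_def)
   ultimately have "P (tp L U (univ M) w (a o sg k)) <= 1 - et" using et1 by (auto simp: P_def)
   moreover have "a o sg k : AS U" by (rule asg_comp[OF a sg])
   ultimately show ?thesis using \<psi>(2)[of "a o sg k"] unfolding \<psi>2(2)[OF k] abs_le_iff by linarith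
  qed
  show "EX a:AS U. ALL (ph, r):\<Gamma>0. fval U a ph <= r"
  proof (rule bexI[OF _ a], rule ballI)
   fix c assume c: "c : \<Gamma>0"
   show "case c of (ph, r) => fval U a ph <= r"
   proof (cases "c : (%e. (\<psi>1 e, et / 2 + 3 * ta)) ` AS M")
    case True
    hence "c : (%e. (\<psi>1 e, et / 2 + 3 * ta)) ` A" using c A(3) by blast
    thus ?thesis using 1 by auto
   next
    case False
    hence "c : (%k. (\<psi>2 k, 1 - et + ta)) ` K" using c G0(2) by blast
    thus ?thesis using 2 by auto
   qed
  qed
 qed
 then obtain a where a: "a : AS U" and a1: "!!e. e : AS M ==> fval U a (\<psi>1 e) <= et / 2 + 3 * ta"
  and a2: "!!k. k : K ==> fval U a (\<psi>2 k) <= 1 - et + ta" by fastforce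
 have ak: "a o sg k : AS U" for k by (rule asg_comp[OF a sg])
 define f where "f q = (SUM k:K. al k * q (te (a o sg k)))" for q
 have cont: "continuous_map (type_space L U (univ U) x) euclideanreal (%q. q (te (a o sg k)))" for k
  by (rule continuous_map_eval[OF te(1)[OF ak]])
 have f: "continuous_map (type_space L U (univ U) x) euclideanreal f" unfolding f_def[abs_def] by (intro continuous_map_sum continuous_map_real_mult cont finK) simp_all
 have "(\<integral>q. f q \<partial>nu) <= et / 2 + 3 * ta"
 proof (rule approximately_realized_le[OF nu(2) f])
  fix e assume "e : tuples M x"
  then obtain e' where e': "e' : AS M" "!!v. v : x ==> e' v = e v" using M.tuples_extend by blast
  have "tp L U (univ U) x e = tp L U (univ U) x e'" by (rule tp_cong) (simp add: e'(2))
  hence "f (tp L U (univ U) x e) = (SUM k:K. al k * \<xi> (ov (a o sg k) e' x))"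
   unfolding f_def using tp_apply[OF te(1)[OF ak]] te(2)[OF ak asg_sub[OF e'(1)]] by simp
  also have "\<dots> = fval U a (\<psi>1 e')" using Gev[OF asg_sub[OF e'(1)] a] \<psi>1(2)[OF e'(1) a] by simp
  finally show "f (tp L U (univ U) x e) <= et / 2 + 3 * ta" using a1[OF e'(1)] by simp
 qed
 moreover have "(\<integral>q. f q \<partial>nu) = (SUM k:K. al k * F (tp L U (univ M) w (a o sg k)))"
  unfolding f_def Fte[OF ak] using keisler_integrable[OF nu(1) cont] by (subst Bochner_Integration.integral_sum) auto
 moreover have "(SUM k:K. al k * (et - 2 * ta)) <= (SUM k:K. al k * F (tp L U (univ M) w (a o sg k)))"
 proof (intro sum_mono mult_left_mono)
  fix k assume k: "k : K"
  have "P (tp L U (univ M) w (a o sg k)) <= 1 - et + 2 * ta"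
   using \<psi>(2)[of "a o sg k", OF ak] a2[OF k] \<psi>2(2)[OF k] by (simp only: abs_le_iff) linarith
  thus "et - 2 * ta <= F (tp L U (univ M) w (a o sg k))" using et by (auto simp: P_def ta_def max_def min_def split: if_splits)
 qed (rule al0)
 moreover have "(1 - ta) * (et - 2 * ta) <= (SUM k:K. al k * (et - 2 * ta))"
  unfolding sum_distrib_right[symmetric] by (rule mult_right_mono[OF al(1)]) (insert et, simp add: ta_def)
 moreover have "et - 3 * ta <= (1 - ta) * (et - 2 * ta)"
 proof -
  have "ta * et <= ta" using ta et1 by (simp add: mult_left_le)
  moreover have "0 <= ta * ta" using ta by simp
  moreover have "(1 - ta) * (et - 2 * ta) = et - 2 * ta - ta * et + 2 * (ta * ta)" by (simp add: algebra_simps)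
  ultimately show ?thesis by linarith
 qed
 ultimately have "et - 3 * ta <= et / 2 + 3 * ta" by linarith
 thus False using et by (simp add: ta_def)
qed

end

section \<open>Oscillation of a predicate on a cell\<close>

context metric_model
begin

text \<open>Combining \<open>ph\<close> with \<open>p k\<close> restricts the supremum to the cell
  without leaving the definable functions. On the support of \<open>h k\<close>,
  \<open>box_sup\<close> and the dual \<open>box_inf\<close> enclose \<open>ph\<close>, and they
  depend on the remaining variables only.\<close>

definition box_sup where "box_sup x p ph k = supq x (%a. min (ph a) (p k a))"
definition box_inf where "box_inf x p ph k = infq x (%a. max (ph a) (1 - p k a))"
definition box_osc where "box_osc x p ph k a = max 0 (box_sup x p ph k a - box_inf x p ph k a)"

lemma box_Def:
 assumes "scheme x z K h p" "finite x" "x Int y = {}" "ph : Def (x Un y)" "k : K"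
 shows "box_sup x p ph k : Def (y Un z)" "box_inf x p ph k : Def (y Un z)" "box_osc x p ph k : Def (y Un z)"
proof -
 have d: "(x Un y Un z) - x = y Un z" using assms(3) schemeD(2)[OF assms(1)] by auto
 have D: "ph : Def (x Un y Un z)" by (rule Def_mono[OF assms(4)]) blast
 have D': "p k : Def (x Un y Un z)" by (rule Def_mono[OF schemeD(5)[OF assms(1,5)]]) blast
 show 1: "box_sup x p ph k : Def (y Un z)" unfolding box_sup_def using Def_supq[OF assms(2) Def_min[OF D D']] unfolding d .
 show 2: "box_inf x p ph k : Def (y Un z)" unfolding box_inf_def using Def_infq[OF assms(2) Def_max[OF D Def_compl[OF D']]] unfolding d .
 show "box_osc x p ph k : Def (y Un z)" unfolding box_osc_def[abs_def] by (rule Def_diff0[OF 1 2])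
qed

lemma box_bounds:
 assumes H: "scheme x z K h p" and ph: "ph : Def V" and k: "k : K" and a: "a : AS U" and h: "h k a > 0"
 shows "box_inf x p ph k a <= ph a" "ph a <= box_sup x p ph k a"
proof -
 have p: "p k a = 1" by (rule schemeD(7)[OF H a k h])
 have D: "ph : Def (V Un (x Un z))" by (rule Def_mono[OF ph]) blast
 have D': "p k : Def (V Un (x Un z))" by (rule Def_mono[OF schemeD(5)[OF H k]]) blast
 note 01 = Def_01[OF ph a]
 show "ph a <= box_sup x p ph k a" using supq_upper[OF Def_min[OF D D'] a a, of x] p 01 by (simp add: box_sup_def)
 show "box_inf x p ph k a <= ph a" using infq_lower[OF Def_max[OF D Def_compl[OF D']] a a, of x] p 01 by (simp add: box_inf_def)
qed

text \<open>Outside the cell the \<open>min\<close> is 0 or the \<open>max\<close> is 1, so only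
  pairs of points inside the cell matter, and for these steadiness applies.\<close>

lemma box_osc_steady:
 assumes H: "scheme x z K h p" and ph: "ph : Def (x Un y)" and k: "k : K" and c: "c : AS U" and d: "d : AS U"
  and cd: "!!v. v : z ==> c v = d v" and st: "steady x ph ep (p k) d c" and ep: "0 <= ep"
 shows "box_osc x p ph k c <= ep"
proof -
 have "min (ph (ov c e x)) (p k (ov c e x)) - ep <= max (ph (ov c e' x)) (1 - p k (ov c e' x))"
  if e: "e : AS U" "e' : AS U" for e e'
 proof -
  have p: "p k (ov c f x) = p k (ov d f x)" if "f : AS U" for f by (rule Def_cong[OF schemeD(5)[OF H k] asg_override[OF c that] asg_override[OF d that]])
    (insert cd, auto simp: override_on_def)
  have p01: "p k (ov c f x) : {0..1}" "ph (ov c f x) : {0..1}" if "f : AS U" for f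
   using Def_01[OF schemeD(5)[OF H k] asg_override[OF c that]] Def_01[OF ph asg_override[OF c that]] by auto
  show ?thesis
  proof (cases "p k (ov c e x) > 0 & p k (ov c e' x) > 0")
   case True
   thus ?thesis using st e p[OF e(1)] p[OF e(2)] unfolding steady_def by fastforce
  next
   case False
   thus ?thesis using p01[OF e(1)] p01[OF e(2)] ep by auto
  qed
 qed
 hence "min (ph (ov c e x)) (p k (ov c e x)) <= box_inf x p ph k c + ep" if "e : AS U" for e
  using infq_greatest[of "min (ph (ov c e x)) (p k (ov c e x)) - ep" "%a. max (ph a) (1 - p k a)" c x] that by (simp add: box_inf_def)
 hence "box_sup x p ph k c <= box_inf x p ph k c + ep" unfolding box_sup_def by (rule supq_least)
 thus ?thesis using ep by (simp add: box_osc_def)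
qed

end

section \<open>Partitions for generically stable measures\<close>

context monster
begin

definition fcontrols where
 "fcontrols x \<Phi> ep K h p et <-> (ALL B I e w. weighted_points B I e w --> (EX d:asg B. ALL ph:\<Phi>. ALL c:AS U.
   (SUM i:I. w i * bad x ph ep K h p d c (e i)) <= et * (SUM i:I. w i)))"

lemma controlling_scheme_family:
 assumes NIP: "NIP L U" and distal: "distal TYPE('i) L U" and inf: "infinite (UNIV :: 'i set)"
  and fin: "finite x" "finite y" "x Int y = {}" and ep: "ep > 0" and et: "et > 0"
  and \<Phi>: "finite \<Phi>" "\<Phi> <= Def (x Un y)" and V: "finite V"
 shows "EX z (K :: nat set) h p. z Int V = {} & scheme x z K h p & fcontrols x \<Phi> ep K h p et" using \<Phi>
proof (induction rule: finite_induct)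
 case empty
 have "scheme x {} {0 :: nat} (%_ _. 1) (%_ _. 1)" by (auto simp: scheme_def intro: Def_const)
 moreover have "EX d. d : asg B" if "weighted_points B I e w" for B :: "_ => 'a set" and I e w
  using asg_B_ne[of B] that unfolding weighted_points_def by blast
 ultimately show ?case by (intro exI[of _ "{}"] exI[of _ "{0}"] exI conjI) (auto simp: fcontrols_def)
next
 case (insert ph \<Phi>)
 then obtain z and K :: "nat set" and h p where z: "z Int V = {}" and H: "scheme x z K h p" and C: "fcontrols x \<Phi> ep K h p et" by auto
 have "finite (V Un z)" "ph : Def (x Un y)" using V schemeD(1)[OF H] insert.prems by auto
 from controlling_scheme_small[OF NIP distal inf fin this(2) ep et this(1)]
 obtain z' and K' :: "nat set" and h' p' where z': "z' Int (V Un z) = {}" and H': "scheme x z' K' h' p'"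
  and C': "controls x ph ep K' h' p' et" by blast
 from product_scheme[OF H H'] z' obtain K2 :: "nat set" and h2 p2 where H2: "scheme x (z Un z') K2 h2 p2"
  and le: "bad_product x z' ep K h p K' h' p' K2 h2 p2" by blast
 have "fcontrols x (insert ph \<Phi>) ep K2 h2 p2 et" unfolding fcontrols_def
 proof (intro allI impI)
  fix B I e w assume wp: "weighted_points B I e w"
  obtain d where d: "d : asg B" "ALL ph:\<Phi>. ALL c:AS U. (SUM i:I. w i * bad x ph ep K h p d c (e i)) <= et * (SUM i:I. w i)"
   using C wp unfolding fcontrols_def by blast
  obtain d' where d': "d' : asg B" "ALL c:AS U. (SUM i:I. w i * bad x ph ep K' h' p' d' c (e i)) <= et * (SUM i:I. w i)"
   using C' wp unfolding controls_def by blast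
  show "EX d:asg B. ALL ph:insert ph \<Phi>. ALL c:AS U. (SUM i:I. w i * bad x ph ep K2 h2 p2 d c (e i)) <= et * (SUM i:I. w i)"
   using d(2) d'(2) order_trans[OF bad_product_sums(1)[OF H H' le wp d(1) d'(1)]] order_trans[OF bad_product_sums(2)[OF H H' le wp d(1) d'(1)]]
   by (intro bexI[of _ "ov d d' z'"] ballI asg_override d(1) d'(1)) (elim insertE; simp)
 qed
 thus ?case using H2 z z' by (intro exI[of _ "z Un z'"] exI[of _ K2] exI[of _ h2] exI[of _ p2]) auto
qed

text \<open>The weighted oscillation is the mean of one definable function \<xi>, the sum of the
  \<open>h k\<close> times the largest oscillation over \<Phi>. The scheme keeps the finite average
  of \<xi> at most et/2 for every \<open>c\<close> that agrees with \<open>d\<close> on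
  \<open>z\<close>, and the one-sided approximation passes this to the integral.\<close>

theorem gs_partition:
 assumes NIP: "NIP L U" and distal: "distal TYPE('i) L U" and inf: "infinite (UNIV :: 'i set)"
  and fin: "finite x" "finite y" "x Int y = {}" and et: "et > 0"
  and \<Phi>: "finite \<Phi>" "\<Phi> <= Def (x Un y)" and V: "finite V"
 shows "EX z (K :: nat set) h p. z Int V = {} & scheme x z K h p &
  (ALL M mu. small_submodel L U \<kappa> T M & mu : keisler_measures L U (univ M) x & generically_stable L U M x mu -->
   (EX d:AS M. ALL c:AS M. (ALL v:z. c v = d v) -->
    (ALL ph:\<Phi>. (SUM k:K. small_submodel.mean L U M x mu (h k) c * box_osc x p ph k c) <= et)))"
proof -
 define ep where "ep = et / 4"
 \<comment> \<open>The bad masses for all predicates in \<Phi> together stay below et/4.\<close>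
 define et' where "et' = et / (4 * real (Suc (card \<Phi>)))"
 have ep: "ep > 0" "et' > 0" using et by (auto simp: ep_def et'_def)
 have "finite (V Un y)" using V fin by simp
 from controlling_scheme_family[OF NIP distal inf fin ep \<Phi> this]
 obtain z and K :: "nat set" and h p where z: "z Int (V Un y) = {}" and H: "scheme x z K h p"
  and C: "fcontrols x \<Phi> ep K h p et'" by blast
 have finK: "finite K" by (rule schemeD(3)[OF H])
 define osc where "osc k a = Max (insert 0 ((%ph. box_osc x p ph k a) ` \<Phi>))" for k a
 have osc: "osc k : Def (y Un z)" if "k : K" for k unfolding osc_def[abs_def] using box_Def(3)[OF H fin(1,3) _ that] \<Phi> by (intro Def_MAX) auto
 define \<xi> where "\<xi> a = (SUM k:K. h k a * osc k a)" for a
 have osc01: "0 <= osc k a" "osc k a <= 1" if "k : K" "a : AS U" for k a using Def_01[OF osc[OF that(1)] that(2)] by auto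
 have \<xi>: "\<xi> : Def (x Un (y Un z))" unfolding \<xi>_def[abs_def]
 proof (rule Def_sum[OF finK])
  show "(%a. h k a * osc k a) : Def (x Un (y Un z))" if "k : K" for k
   by (intro Def_mult Def_mono[OF schemeD(4)[OF H that]] Def_mono[OF osc[OF that]]) auto
  fix a assume a: "a : AS U"
  have "(SUM k:K. h k a * osc k a) <= (SUM k:K. h k a)" using osc01[OF _ a] scheme_nonneg[OF H _ a] by (intro sum_mono mult_left_le) auto
  thus "(SUM k:K. h k a * osc k a) <= 1" using schemeD(6)[OF H a] by simp
 qed
 have osc_x: "osc k (ov c f x) = osc k c" if "k : K" "c : AS U" "f : AS U" for k c f by (rule Def_cong[OF osc[OF that(1)] asg_override[OF that(2,3)] that(2)])
   (insert fin(3) schemeD(2)[OF H], auto simp: override_on_def)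
 have "EX d:AS M. ALL c:AS M. (ALL v:z. c v = d v) -->
    (ALL ph:\<Phi>. (SUM k:K. small_submodel.mean L U M x mu (h k) c * box_osc x p ph k c) <= et)"
  if M: "small_submodel L U \<kappa> T M" and mu: "mu : keisler_measures L U (univ M) x" and gs: "generically_stable L U M x mu" for M mu
 proof -
  interpret S: small_submodel L U \<kappa> T M by (rule M)
  have "finite (y Un z)" "x Int (y Un z) = {}" using fin schemeD(1,2)[OF H] by auto
  from S.gs_finite_approximation[OF NIP distal inf fin(1) this \<xi> mu gs et]
  obtain I e l where wp: "weighted_points (univ M) I e l" and l1: "sum l I = 1"
   and ap: "!!d. d : AS M ==> (SUM i:I. l i * \<xi> (ov d (e i) x)) <= et / 2 ==> S.mean x mu \<xi> d <= et"
   by blast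
  from C wp l1 obtain d where d: "d : AS M" and un: "!!ph c. ph : \<Phi> ==> c : AS U ==>
    (SUM i:I. l i * bad x ph ep K h p d c (e i)) <= et'" unfolding fcontrols_def by force
  have dU: "d : AS U" by (rule S.asg_sub[OF d])
  note eU = weighted_pointsD(4)[OF wp] and l0 = weighted_pointsD(5)[OF wp]
  have "(SUM k:K. S.mean x mu (h k) c * box_osc x p ph k c) <= et"
   if cM: "c : AS M" and cd: "ALL v:z. c v = d v" and ph: "ph : \<Phi>" for c ph
  proof -
   have c: "c : AS U" by (rule S.asg_sub[OF cM])
   have hcd: "h k (ov c f x) = h k (ov d f x)" if "k : K" "f : AS U" for k f
    by (rule Def_cong[OF schemeD(4)[OF H that(1)] asg_override[OF c that(2)] asg_override[OF dU that(2)]]) (insert cd, auto simp: override_on_def)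
   have "(SUM k:K. h k (ov d (e i) x) * osc k c) <= ep + (SUM ph:\<Phi>. bad x ph ep K h p d c (e i))" if i: "i : I" for i
   proof (rule scheme_average[OF H dU eU[OF i] \<Phi>(1)])
    fix k assume k: "k : K" and st: "ALL ph:\<Phi>. steady x ph ep (p k) d c"
    have "box_osc x p ph k c <= ep" if "ph : \<Phi>" for ph
     using box_osc_steady[OF H _ k c dU] cd st that \<Phi>(2) ep(1) by (meson less_imp_le subsetD)
    thus "osc k c <= ep" using \<Phi>(1) ep(1) by (auto simp: osc_def)
   qed (use ep(1) osc01(2) c in auto)
   moreover have "\<xi> (ov c (e i) x) = (SUM k:K. h k (ov d (e i) x) * osc k c)" if "i : I" for i
    unfolding \<xi>_def using osc_x[OF _ c eU[OF that]] hcd[OF _ eU[OF that]] by simp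
   ultimately have "(SUM i:I. l i * \<xi> (ov c (e i) x)) <= (SUM i:I. l i * (ep + (SUM ph:\<Phi>. bad x ph ep K h p d c (e i))))"
    using l0 by (intro sum_mono mult_left_mono) auto
   also have "\<dots> = ep + (SUM ph:\<Phi>. SUM i:I. l i * bad x ph ep K h p d c (e i))"
    by (simp add: distrib_left sum.distrib sum_distrib_left sum.swap[of _ I] l1 flip: sum_distrib_right)
   also have "\<dots> <= ep + (SUM ph:\<Phi>. et')" using un[OF _ c] by (intro add_left_mono sum_mono)
   also have "\<dots> <= et / 2" using et by (simp add: ep_def et'_def field_simps)
   finally have "S.mean x mu \<xi> c <= et" by (intro ap[OF cM]) simp
   moreover have "S.mean x mu \<xi> c = S.mean x mu (%a. SUM k:K. osc k c * h k a) c" unfolding S.mean_def \<xi>_def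
    using S.realizer(1)[OF fin(1)] osc_x[OF _ c] keislerD(4)[OF mu] by (intro Bochner_Integration.integral_cong sum.cong refl) (simp add: mult.commute)
   moreover have "\<dots> = (SUM k:K. osc k c * S.mean x mu (h k) c)" by (rule S.mean_sum[OF fin(1) mu schemeD(4)[OF H] cM])
   moreover have "(SUM k:K. S.mean x mu (h k) c * box_osc x p ph k c) <= (SUM k:K. osc k c * S.mean x mu (h k) c)"
   proof (rule sum_mono)
    fix k assume k: "k : K"
    have "box_osc x p ph k c <= osc k c" unfolding osc_def by (rule Max_ge) (use ph \<Phi>(1) in auto)
    thus "S.mean x mu (h k) c * box_osc x p ph k c <= osc k c * S.mean x mu (h k) c"
     using S.mean_nonneg[OF fin(1) mu schemeD(4)[OF H k] cM] by (simp add: mult.commute mult_right_mono)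
   qed
   ultimately show ?thesis by linarith
  qed
  thus ?thesis by (intro bexI[OF _ d]) blast
 qed
 moreover have "z Int V = {}" using z by blast
 ultimately show ?thesis using H by blast
qed

end

lemma (in metric_model) scheme_mono:
 assumes "scheme x z K h p" "z <= z'" "finite z'" "x Int z' = {}"
 shows "scheme x z' K h p" using assms(1,3,4) Def_mono[of _ "x Un z" "x Un z'"] assms(2) unfolding scheme_def by (metis Un_mono subset_refl)

lemma (in small_submodel) mean_scheme:
 assumes "finite x" "mu : keisler_measures L U (univ M) x" "scheme x z K h p" "d : AS M"
 shows "(SUM k:K. mean x mu (h k) d) = 1"
proof -
 have "(SUM k:K. mean x mu (h k) d) = mean x mu (%a. SUM k:K. 1 * h k a) d"
  using mean_sum[OF assms(1,2) schemeD(4)[OF assms(3)] assms(4), where K = K and c = "%_. 1"] by simp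
 also have "\<dots> = mean x mu (%a. 1) d" unfolding mean_def
  using schemeD(6)[OF assms(3) asg_override[OF asg_sub[OF assms(4)] realizer(1)[OF assms(1)]]] keislerD(4)[OF assms(2)]
  by (intro Bochner_Integration.integral_cong refl) simp
 finally show ?thesis by (simp add: mean_const[OF assms(1,2)])
qed

text \<open>The part of the box \<open>\<Prod>\<^sub>i supp h\<^sub>i\<^sub>,\<^sub>g\<^sub>i\<close> consisting of tuples from \<open>M\<close>, with the parameters \<open>d\<close> for \<open>z\<close>.\<close>

definition cell :: "('s, 'f, 'r, 'a) mstruct => 's var set => 'n set => ('n => nat => ('s var => 'a) => real) =>
  ('s var => 'a) => ('n => nat) => ('s var => 'a) set" where
 "cell M z R h d g = {a : AS M. (ALL v:z. a v = d v) & (ALL i:R. h i (g i) a > 0)}"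

section \<open>Regular partitions for several measures\<close>

context monster
begin

definition mass where "mass M x mu R h d g = (PROD i:R. small_submodel.mean L U M (x i) (mu i) (h i (g i)) d)"

text \<open>\<open>osc\<close> is any bound on the variation, not the exact oscillation; bounds of
  this kind can be added in the induction.\<close>

definition regular where "regular M x mu z R K h d et ph <-> (EX osc. (ALL g:PiE R K. 0 <= osc g &
   (ALL a:cell M z R h d g. ALL a':cell M z R h d g. \<bar>ph a - ph a'\<bar> <= osc g)) &
   (SUM g:PiE R K. mass M x mu R h d g * osc g) <= et)"

text \<open>\<open>r\<close> is the index of the arbitrary measure and \<open>J\<close> contains
  those of the generically stable ones. The values on \<open>y\<close> are prescribed through
  \<open>b\<close>, so parameters that were chosen earlier can be passed on as part of
  \<open>y\<close>.\<close>

definition regular_scheme where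
 "regular_scheme r J x y \<Phi> et z K h p <-> y <= z & (ALL i:insert r J. scheme (x i) z (K i) (h i) (p i)) &
   (ALL M mu b. small_submodel L U \<kappa> T M & (ALL i:insert r J. mu i : keisler_measures L U (univ M) (x i)) &
    (ALL i:J. generically_stable L U M (x i) (mu i)) & b : AS M -->
    (EX d:AS M. (ALL v:y. d v = b v) & (ALL ph:\<Phi>. regular M x mu z (insert r J) K h d et ph)))"

lemma mass_nonneg:
 assumes "small_submodel L U \<kappa> T M" "!!i. i : R ==> finite (x i)" "!!i. i : R ==> mu i : keisler_measures L U (univ M) (x i)"
  and "!!i. i : R ==> scheme (x i) z (K i) (h i) (p i)" "d : AS M" "g : PiE R K"
 shows "0 <= mass M x mu R h d g" unfolding mass_def
proof (rule prod_nonneg)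
 fix i assume i: "i : R"
 show "0 <= small_submodel.mean L U M (x i) (mu i) (h i (g i)) d"
  by (rule small_submodel.mean_nonneg[OF assms(1) assms(2,3)[OF i] schemeD(4)[OF assms(4)[OF i]] assms(5)]) (use assms(6) i in blast)
qed

lemma mass_total:
 assumes "small_submodel L U \<kappa> T M" "finite R" "!!i. i : R ==> finite (x i)" "!!i. i : R ==> mu i : keisler_measures L U (univ M) (x i)"
  and "!!i. i : R ==> scheme (x i) z (K i) (h i) (p i)" "d : AS M"
 shows "(SUM g:PiE R K. mass M x mu R h d g) = 1"
proof -
 have "(SUM g:PiE R K. mass M x mu R h d g) = (PROD i:R. SUM k:K i. small_submodel.mean L U M (x i) (mu i) (h i k) d)"
  unfolding mass_def using schemeD(3)[OF assms(5)] by (intro prod_sum_PiE[OF assms(2), symmetric]) auto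
 also have "\<dots> = 1" using small_submodel.mean_scheme[OF assms(1) assms(3,4) assms(5) assms(6)] by (intro prod.neutral) auto
 finally show ?thesis .
qed

text \<open>Coordinate \<open>j\<close> is partitioned with all others as parameters. On each of its
  cells \<open>ph\<close> lies between \<open>box_sup\<close> and \<open>box_inf\<close>, predicates
  in the other coordinates that the induction hypothesis makes nearly constant. For the last
  coordinate \<open>r\<close> a fine partition is used, whose cells have small variation whatever
  the measure is.\<close>

theorem exists_regular_scheme:
 assumes NIP: "NIP L U" and distal: "distal TYPE('i) L U" and inf: "infinite (UNIV :: 'i set)"
  and J: "finite J" "r ~: J"
  and "!!i. i : insert r J ==> finite (x i)" "disjoint_family_on x (insert r J)"
  and "finite y" "!!i. i : insert r J ==> x i Int y = {}" "finite \<Phi>" "\<Phi> <= Def ((UN i:insert r J. x i) Un y)"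
  and "et > 0" "finite V" "V Int y = {}"
 shows "EX z K h p. z Int V = {} & regular_scheme r J x y \<Phi> et z K h p" using J assms(6-)
proof (induction J arbitrary: y \<Phi> et V rule: finite_induct)
 case empty
 obtain N :: nat where N: "4 / et < N" using reals_Archimedean2 by blast
 have N0: "N > 0" using N `et > 0` by (metis divide_pos_pos gr0I less_asym of_nat_0 zero_less_numeral)
 have Net: "4 / real N <= et" using N N0 `et > 0` by (simp add: field_simps)
 obtain K :: "nat set" and h p where H: "scheme (x r) y K h p"
  and fine: "!!k a b. k : K ==> p k a > 0 ==> p k b > 0 ==> ALL te:\<Phi>. \<bar>te a - te b\<bar> < 4 / real N"
 proof -
  have "te : Def (x r Un y)" if "te : \<Phi>" for te using empty(7) that by auto
  from scheme_fine[OF empty(6,4) empty(5)[of r] this N0] that show thesis by auto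
 qed
 have "regular_scheme r {} x y \<Phi> et y (%_. K) (%_. h) (%_. p)" unfolding regular_scheme_def
 proof (intro conjI allI impI)
  show "y <= y" "ALL i:{r}. scheme (x i) y K h p" using H by auto
  fix M mu b assume *: "small_submodel L U \<kappa> T M & (ALL i:{r}. mu i : keisler_measures L U (univ M) (x i)) &
    (ALL i:{}. generically_stable L U M (x i) (mu i)) & b : AS M"
  interpret S: small_submodel L U \<kappa> T M using * by blast
  have "regular M x mu y {r} (%_. K) (%_. h) b et ph" if ph: "ph : \<Phi>" for ph unfolding regular_def
  proof (intro exI[of _ "%_. et"] conjI ballI)
   fix g a a' assume g: "g : PiE {r} (%_. K)" and a: "a : cell M y {r} (%_. h) b g" "a' : cell M y {r} (%_. h) b g"
   have gr: "g r : K" using g by auto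
   have "p (g r) c = 1" if "c : cell M y {r} (%_. h) b g" for c using that by (intro schemeD(7)[OF H _ gr]) (auto simp: cell_def S.asg_sub)
   thus "\<bar>ph a - ph a'\<bar> <= et" using fine[OF gr, of a a'] a ph Net by fastforce
  next
   have "(SUM g:PiE {r} (%_. K). mass M x mu {r} (%_. h) b g) = 1"
    by (rule mass_total[where z = y and p = "%_. p", OF S.small_submodel_axioms]) (use * empty H in auto)
   thus "(SUM g:PiE {r} (%_. K). mass M x mu {r} (%_. h) b g * et) <= et" by (simp flip: sum_distrib_right)
  qed (use `et > 0` in simp)
  thus "EX d:AS M. (ALL v:y. d v = b v) & (ALL ph:\<Phi>. regular M x mu y {r} (%_. K) (%_. h) d et ph)"
   using * by blast
 qed
 thus ?case by (intro exI conjI) (use empty(10) in auto)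
next
 case (insert j J)
 define R where "R = insert r J"
 have R: "insert r (insert j J) = insert j R" "j ~: R" "finite R" using insert.hyps insert.prems(1) by (auto simp: R_def)
 note prems = insert.prems[unfolded R(1)]
 define Y where "Y = (UN i:R. x i) Un y"
 have xj: "finite (x j)" using prems(2) by simp
 have finY: "finite Y" unfolding Y_def using prems(2,4) R(3) by auto
 have "x i Int x j = {}" if "i : R" for i using prems(3) that R(2) unfolding disjoint_family_on_def by (metis insertCI)
 hence xjY: "x j Int Y = {}" unfolding Y_def using prems(5) by blast
 have \<Phi>: "finite \<Phi>" "\<Phi> <= Def (x j Un Y)" using prems(6,7) by (simp_all add: Y_def Un_assoc)
 have "et / 2 > 0" "finite (V Un Y)" using prems(8,9) finY by auto
 from gs_partition[OF NIP distal inf xj finY xjY this(1) \<Phi> this(2)]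
 obtain z1 and K1 :: "nat set" and h1 p1 where z1: "z1 Int (V Un Y) = {}" and H1: "scheme (x j) z1 K1 h1 p1"
  and G1: "!!M mu. small_submodel L U \<kappa> T M ==> mu : keisler_measures L U (univ M) (x j) ==> generically_stable L U M (x j) mu ==>
   (EX d:AS M. ALL c:AS M. (ALL v:z1. c v = d v) -->
    (ALL ph:\<Phi>. (SUM k:K1. small_submodel.mean L U M (x j) mu (h1 k) c * box_osc (x j) p1 ph k c) <= et / 2))"
  by (elim exE conjE) (rule that, blast+)
 note finz1 = schemeD(1)[OF H1] and finK1 = schemeD(3)[OF H1]
 define \<Phi>' where "\<Phi>' = (UN ph:\<Phi>. UN k:K1. {box_sup (x j) p1 ph k, box_inf (x j) p1 ph k})"
 have "finite \<Phi>'" unfolding \<Phi>'_def using \<Phi>(1) finK1 by auto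
 moreover have "\<Phi>' <= Def ((UN i:R. x i) Un (y Un z1))"
  unfolding \<Phi>'_def using box_Def(1,2)[OF H1 xj xjY] \<Phi>(2) by (auto simp: Y_def Un_assoc)
 moreover have "r ~: J" using insert.prems(1) by simp
 moreover have "finite (x i)" "x i Int (y Un z1) = {}" if "i : R" for i using prems(2,5) that z1 by (auto simp: Y_def)
 moreover have "disjoint_family_on x R" using prems(3) by (rule disjoint_family_on_mono[rotated]) blast
 moreover have "finite (y Un z1)" "et / 4 > 0" "finite (V Un x j)" "(V Un x j) Int (y Un z1) = {}"
  using prems(4,5,8,9,10) finz1 xj z1 schemeD(2)[OF H1] by auto
 ultimately have "EX z K h p. z Int (V Un x j) = {} & regular_scheme r J x (y Un z1) \<Phi>' (et / 4) z K h p"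
  unfolding R_def by (intro insert.IH) auto
 then obtain z K h p where z: "z Int (V Un x j) = {}" and RS: "regular_scheme r J x (y Un z1) \<Phi>' (et / 4) z K h p" by blast
 have yz: "y Un z1 <= z" and H: "!!i. i : R ==> scheme (x i) z (K i) (h i) (p i)"
  using RS unfolding regular_scheme_def R_def by blast+
 have finz: "finite z" using schemeD(1)[OF H[of r]] by (simp add: R_def)
 have H1z: "scheme (x j) z K1 h1 p1" by (rule scheme_mono[OF H1 _ finz]) (use yz z in auto)
 define K' where "K' = K(j := K1)"
 define h' where "h' = h(j := h1)"
 define p' where "p' = p(j := p1)"
 have KR: "PiE R K' = PiE R K" by (rule PiE_cong) (insert R(2), auto simp: K'_def)
 have H': "scheme (x i) z (K' i) (h' i) (p' i)" if "i : insert j R" for i using that H H1z by (auto simp: K'_def h'_def p'_def)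
 have "regular_scheme r (insert j J) x y \<Phi> et z K' h' p'" unfolding regular_scheme_def R(1)
 proof (intro conjI allI impI)
  show "y <= z" using yz by blast
  show "ALL i:insert j R. scheme (x i) z (K' i) (h' i) (p' i)" using H' by blast
  fix M mu b assume *: "small_submodel L U \<kappa> T M & (ALL i:insert j R. mu i : keisler_measures L U (univ M) (x i)) &
    (ALL i:insert j J. generically_stable L U M (x i) (mu i)) & b : AS M"
  interpret S: small_submodel L U \<kappa> T M using * by blast
  have mu: "mu i : keisler_measures L U (univ M) (x i)" if "i : insert j R" for i using * that by blast
  obtain d1 where d1: "d1 : AS M" and G: "!!c ph. c : AS M ==> (ALL v:z1. c v = d1 v) ==> ph : \<Phi> ==>
    (SUM k:K1. S.mean (x j) (mu j) (h1 k) c * box_osc (x j) p1 ph k c) <= et / 2" using G1[OF S.small_submodel_axioms mu[of j]] * by blast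
  \<comment> \<open>The parameters of the partition of \<open>x j\<close> are prescribed to the
    induction hypothesis together with the values on \<open>y\<close>.\<close>
  have "ov b d1 z1 : AS M" using * d1 by (intro asg_override) auto
  with * have "small_submodel L U \<kappa> T M & (ALL i:insert r J. mu i : keisler_measures L U (univ M) (x i)) &
    (ALL i:J. generically_stable L U M (x i) (mu i)) & ov b d1 z1 : AS M" by (simp add: R_def)
  from RS[unfolded regular_scheme_def, THEN conjunct2, THEN conjunct2, rule_format, OF this]
  obtain d where d: "d : AS M" "!!v. v : y Un z1 ==> d v = ov b d1 z1 v"
   and reg: "!!\<psi>. \<psi> : \<Phi>' ==> regular M x mu z R K h d (et / 4) \<psi>"
   by (elim bexE conjE) (rule that, assumption, blast, simp add: R_def)
  have db: "d v = b v" if "v : y" for v using d(2)[of v] that z1 by (auto simp: Y_def override_on_def)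
  have dd1: "d v = d1 v" if "v : z1" for v using d(2)[of v] that by (simp add: override_on_def)
  define P where "P g = mass M x mu R h d g" for g
  define A where "A k = S.mean (x j) (mu j) (h1 k) d" for k
  have A: "0 <= A k" if "k : K1" for k unfolding A_def by (rule S.mean_nonneg[OF xj mu schemeD(4)[OF H1 that] d(1)]) simp
  have A1: "(SUM k:K1. A k) = 1" unfolding A_def by (rule S.mean_scheme[OF xj mu H1 d(1)]) simp
  have P: "0 <= P g" if "g : PiE R K" for g unfolding P_def by (rule mass_nonneg[OF S.small_submodel_axioms _ _ H d(1) that]) (use prems(2) mu in auto)
  have P1: "(SUM g:PiE R K. P g) = 1" unfolding P_def by (rule mass_total[OF S.small_submodel_axioms R(3) _ _ H d(1)]) (use prems(2) mu in auto)
  have "regular M x mu z (insert j R) K' h' d et ph" if ph: "ph : \<Phi>" for ph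
  proof -
   let ?ok = "%\<psi> w. (ALL g:PiE R K. 0 <= w g & (ALL a:cell M z R h d g. ALL a':cell M z R h d g. \<bar>\<psi> a - \<psi> a'\<bar> <= w g)) &
    (SUM g:PiE R K. P g * w g) <= et / 4"
   have "ALL k:K1. EX w. ?ok (box_sup (x j) p1 ph k) w" using reg ph unfolding \<Phi>'_def regular_def P_def by blast
   from bchoice[OF this] obtain oS where "ALL k:K1. ?ok (box_sup (x j) p1 ph k) (oS k)" by (elim exE) (rule that)
   note oS = bspec[OF this]
   have "ALL k:K1. EX w. ?ok (box_inf (x j) p1 ph k) w" using reg ph unfolding \<Phi>'_def regular_def P_def by blast
   from bchoice[OF this] obtain oI where "ALL k:K1. ?ok (box_inf (x j) p1 ph k) (oI k)" by (elim exE) (rule that)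
   note oI = bspec[OF this]
   \<comment> \<open>The gap between upper and lower bound is evaluated at one point of each cell;
     an empty cell contributes 0.\<close>
   define rep where "rep g = (SOME a. a : cell M z R h d g)" for g
   have rep: "rep g : cell M z R h d g" if "cell M z R h d g ~= {}" for g using that unfolding rep_def by (simp add: some_in_eq)
   define e where "e k g = (if cell M z R h d g = {} then 0 else box_osc (x j) p1 ph k (rep g))" for k g
   have e0: "0 <= e k g" for k g by (simp add: e_def box_osc_def)
   \<comment> \<open>The variations of the upper and of the lower bound, and their gap at the
     representative.\<close>
   define os where "os g = oS (g j) (restrict g R) + oI (g j) (restrict g R) + e (g j) (restrict g R)" for g
   show ?thesis unfolding regular_def
   proof (intro exI[of _ os] conjI ballI)
    fix g assume "g : PiE (insert j R) K'"
    hence gj: "g j : K1" and gR: "restrict g R : PiE R K" using R(2) by (auto simp: K'_def PiE_iff split: if_splits)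
    note oS' = oS[OF gj, THEN conjunct1, rule_format, OF gR] and oI' = oI[OF gj, THEN conjunct1, rule_format, OF gR]
    show "0 <= os g" unfolding os_def using oS' oI' e0 by (simp add: add_nonneg_nonneg)
    have *: "ph a - ph a' <= os g" if a: "a : cell M z (insert j R) h' d g" "a' : cell M z (insert j R) h' d g" for a a'
    proof -
     have b: "a : cell M z R h d (restrict g R)" "a' : cell M z R h d (restrict g R)" using a R(2) unfolding cell_def h'_def by (auto split: if_splits)
     hence r: "rep (restrict g R) : cell M z R h d (restrict g R)" by (intro rep) blast
     have c: "c : AS U" "h1 (g j) c > 0" if "c : cell M z (insert j R) h' d g" for c using that S.asg_sub by (auto simp: cell_def h'_def)
     have phD: "ph : Def (x j Un Y)" using ph \<Phi>(2) by blast
     note bb = box_bounds(2)[OF H1 phD gj c[OF a(1)]] box_bounds(1)[OF H1 phD gj c[OF a(2)]]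
     have "\<bar>box_sup (x j) p1 ph (g j) a - box_sup (x j) p1 ph (g j) (rep (restrict g R))\<bar> <= oS (g j) (restrict g R)"
      "\<bar>box_inf (x j) p1 ph (g j) a' - box_inf (x j) p1 ph (g j) (rep (restrict g R))\<bar> <= oI (g j) (restrict g R)" using oS' oI' b r by blast+
     moreover have "box_sup (x j) p1 ph (g j) (rep (restrict g R)) - box_inf (x j) p1 ph (g j) (rep (restrict g R)) <= e (g j) (restrict g R)"
      using r by (auto simp: e_def box_osc_def)
     ultimately show ?thesis using bb unfolding os_def abs_le_iff by linarith
    qed
    fix a a' assume "a : cell M z (insert j R) h' d g" "a' : cell M z (insert j R) h' d g"
    thus "\<bar>ph a - ph a'\<bar> <= os g" using *[of a a'] *[of a' a] by linarith
   next
    have "(SUM g:PiE (insert j R) K'. mass M x mu (insert j R) h' d g * os g) = (SUM k:K1. SUM g:PiE R K. A k * P g * (oS k g + oI k g + e k g))"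
     unfolding sum_PiE_insert[OF R(2)] KR
    proof (intro sum.cong)
     fix k g assume g: "g : PiE R K"
     have "mass M x mu (insert j R) h' d (g(j := k)) = A k * P g" unfolding mass_def P_def A_def using R(2,3) by (auto simp: h'_def intro!: prod.cong)
     moreover have "restrict (g(j := k)) R = g" using g R(2) by (auto simp: fun_eq_iff PiE_def extensional_def)
     ultimately show "mass M x mu (insert j R) h' d (g(j := k)) * os (g(j := k)) = A k * P g * (oS k g + oI k g + e k g)" by (simp add: os_def)
    qed (auto simp: K'_def)
    also have "\<dots> = (SUM k:K1. A k * (SUM g:PiE R K. P g * oS k g)) + (SUM k:K1. A k * (SUM g:PiE R K. P g * oI k g)) +
      (SUM g:PiE R K. P g * (SUM k:K1. A k * e k g))" unfolding sum_distrib_left by (subst (4) sum.swap) (simp add: sum.distrib algebra_simps)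
    also have "(SUM k:K1. A k * (SUM g:PiE R K. P g * oS k g)) <= (SUM k:K1. A k * (et / 4))" using oS A by (intro sum_mono mult_left_mono) auto
    also have "(SUM k:K1. A k * (SUM g:PiE R K. P g * oI k g)) <= (SUM k:K1. A k * (et / 4))" using oI A by (intro sum_mono mult_left_mono) auto
    also have "(SUM g:PiE R K. P g * (SUM k:K1. A k * e k g)) <= (SUM g:PiE R K. P g * (et / 2))"
    proof (intro sum_mono mult_left_mono P)
     fix g assume "g : PiE R K"
     show "(SUM k:K1. A k * e k g) <= et / 2"
     proof (cases "cell M z R h d g = {}")
      case False
      have r: "rep g : AS M" "!!v. v : z ==> rep g v = d v" using rep[OF False] by (auto simp: cell_def)
      \<comment> \<open>The representative agrees with \<open>d\<close> on the parameters, so the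
        masses are the same and the bound of \<open>gs_partition\<close> applies to it.\<close>
      have "A k = S.mean (x j) (mu j) (h1 k) (rep g)" if "k : K1" for k
       unfolding A_def by (rule S.mean_cong[OF xj mu schemeD(4)[OF H1 that] d(1) r(1)]) (use r(2) yz in auto)
      moreover have "ALL v:z1. rep g v = d1 v" using r(2) dd1 yz by auto
      ultimately show ?thesis using G[OF r(1) _ ph] False by (simp add: e_def)
     qed (insert prems(8), simp add: e_def)
    qed
    finally show "(SUM g:PiE (insert j R) K'. mass M x mu (insert j R) h' d g * os g) <= et" unfolding sum_distrib_right[symmetric] A1 P1 by simp
   qed
  qed
  thus "EX d:AS M. (ALL v:y. d v = b v) & (ALL ph:\<Phi>. regular M x mu z (insert j R) K' h' d et ph)"
   using d(1) db by blast
 qed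
 thus ?case using z by blast
qed

end

section \<open>Good cells and the selecting predicate\<close>

context metric_model
begin

lemma formula_predicate:
 assumes "te : Fml L A x" "!!s. A s <= univ U s"
 shows "(%p. p te) : definable_predicates L U A x" unfolding definable_predicates_def using continuous_map_eval[OF assms(1)] types_01[OF _ assms(1)]
 by (auto simp: continuous_map_in_subtopology topspace_type_space)

lemma pred_at_formula:
 assumes "te : F0 L (x Un z)" "a : AS U" "d : AS U"
 shows "pred_at L U x z (%p. p te) (restrict a x) (restrict d z) = fval U (ov d a x) te" unfolding pred_at_def tp_apply[OF assms(1)]
 by (rule fval_cong) (insert assms(1), auto simp: Fml_def override_on_def)

end

lemma (in small_submodel) integral_pred_at_formula:
 assumes x: "finite x" "x Int z = {}" and te: "te : F0 L (x Un z)" and mu: "mu : keisler_measures L U (univ M) x"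
  and d: "d : AS M"
 shows "(\<integral>p. pred_at_type L x z (%p. p te) (restrict d z) p \<partial>mu) = mean x mu (%a. fval U a te) d" unfolding mean_def
proof (rule Bochner_Integration.integral_cong[OF refl])
 fix p assume "p : space mu"
 hence p: "p : types L U (univ M) x" by (simp add: keislerD(4)[OF mu])
 have "pred_at_type L x z (%p. p te) (restrict d z) p = pred_at_type L x z (%p. p te) (restrict d z) (tp L U (univ M) x (realizer x p))"
  by (simp add: realizer(2)[OF x(1) p])
 also have "\<dots> = pred_at L U x z (%p. p te) (realizer x p) (restrict d z)" by (rule pred_at_type_tp[OF x(2)]) (use asgD[OF d] in auto)
 also have "\<dots> = fval U (ov d (realizer x p) x) te" unfolding pred_at_def tp_apply[OF te]
  by (rule fval_cong) (insert te x(2), auto simp: Fml_def override_on_def)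
 finally show "pred_at_type L x z (%p. p te) (restrict d z) p = fval U (ov d (realizer x p) x) te" .
qed

text \<open>The distance of two variables is a formula, so a pair in \<open>U\<close> at distance
  more than \<open>r\<close> forces one in \<open>M\<close>.\<close>

lemma (in elementary_submodel) separated_points:
 assumes "u : univ U s" "v : univ U s" "r < sdist U s u v"
 shows "EX u':univ M s. EX v':univ M s. r < sdist U s u' v'"
proof -
 let ?u = "(s, 0 :: nat)" and ?v = "(s, 1 :: nat)"
 obtain a where a: "a : AS U" using asg_ne by blast
 have D: "(%a. 1 - sdist U s (a ?u) (a ?v)) : Def {?u, ?v}" using Def_compl[OF Def_dist[of ?v ?u "{?u, ?v}"]] by simp
 have e: "a(?u := u, ?v := v) : AS U" by (intro asg_upd a) (use assms in auto)
 obtain e' where "e' : AS M" "1 - sdist U s (ov a e' {?u, ?v} ?u) (ov a e' {?u, ?v} ?v) < 1 - r"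
  using elem_witness[OF _ D a _ e, of "{?u, ?v}" "1 - r"] assms(3) by (auto simp: override_on_def)
 thus ?thesis using asgD[of e' "univ M" ?u] asgD[of e' "univ M" ?v] by (intro bexI[of _ "e' ?u"] bexI[of _ "e' ?v"]) (auto simp: override_on_def)
qed

context monster
begin

text \<open>A single predicate \<open>max\<^sub>k min (h\<^sub>k, d(w\<^sub>k, w'\<^sub>k))\<close> represents all \<open>h\<^sub>k\<close>: the parameters \<open>w\<^sub>k\<close>, \<open>w'\<^sub>k\<close> are
  chosen to be distinct for the intended \<open>k\<close> only.\<close>

lemma selector:
 assumes u: "u : univ U s" "v : univ U s" "0 < rh" "rh < sdist U s u v"
  and x: "finite x" and H: "scheme x z (K :: nat set) h p"
 shows "EX Z te. finite Z & x Int Z = {} & te : F0 L (x Un Z) &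
  (ALL M d. ALL k:K. small_submodel L U \<kappa> T M & d : AS M -->
   (EX e:AS M. (ALL a:AS U. h k (ov d a x) > 0 <-> fval U (ov e a x) te > 0) &
    (ALL mu:keisler_measures L U (univ M) x. rh * small_submodel.mean L U M x mu (h k) d <=
     (\<integral>q. pred_at_type L x Z (%q. q te) (restrict e Z) q \<partial>mu))))"
proof -
 have rh1: "rh <= 1" using sdist_01[OF u(1,2)] u(4) by simp
 obtain b where b: "!!v. v : x Un z ==> snd v < b" using var_index_bound[of "x Un z"] x schemeD(1)[OF H] by auto
 define w where "w k = (s, b + 2 * k)" for k
 define w' where "w' k = (s, Suc (b + 2 * k))" for k
 have w: "w k ~: x Un z" "w' k ~: x Un z" for k using b[of "w k"] b[of "w' k"] by (auto simp: w_def w'_def)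
 have ww: "w k ~= w' l" "w k = w l <-> k = l" "w' k = w' l <-> k = l" for k l
  using Suc_double_not_eq_double[of l k] by (auto simp: w_def w'_def)
 have wfst: "fst (w k) = s" "fst (w' k) = s" for k by (auto simp: w_def w'_def)
 define Z where "Z = z Un (w ` K Un w' ` K)"
 have Z: "finite Z" "x Int Z = {}" using schemeD(1-3)[OF H] w by (auto simp: Z_def)
 define F where "F a = Max (insert 0 ((%k. min (h k a) (sdist U s (a (w k)) (a (w' k)))) ` K))" for a
 have D: "(%a. sdist U s (a (w k)) (a (w' k))) : Def (x Un Z)" if "k : K" for k
  using Def_dist[of "w' k" "w k" "x Un Z"] that by (simp add: wfst Z_def)
 have hD: "h k : Def (x Un Z)" if "k : K" for k by (rule Def_mono[OF schemeD(4)[OF H that]]) (auto simp: Z_def)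
 have F: "F : Def (x Un Z)" unfolding F_def[abs_def] by (intro Def_MAX schemeD(3)[OF H] Def_min D hD)
 then obtain te where te: "te : F0 L (x Un Z)" "!!a. a : AS U ==> F a = fval U a te" unfolding Def_def by blast
 have "EX e:AS M. (ALL a:AS U. h k (ov d a x) > 0 <-> fval U (ov e a x) te > 0) &
    (ALL mu:keisler_measures L U (univ M) x. rh * small_submodel.mean L U M x mu (h k) d <=
     (\<integral>q. pred_at_type L x Z (%q. q te) (restrict e Z) q \<partial>mu))"
  if M: "small_submodel L U \<kappa> T M" and d: "d : AS M" and k: "k : K" for M d k
 proof -
  interpret S: small_submodel L U \<kappa> T M by (rule M)
  obtain u0 v0 where uv: "u0 : univ M s" "v0 : univ M s" "rh < sdist U s u0 v0" using S.separated_points[OF u(1,2,4)] by blast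
  have uvU: "u0 : univ U s" "v0 : univ U s" using uv(1,2) S.univ_sub by blast+
  \<comment> \<open>Only \<open>w' k\<close> receives \<open>v0\<close>; all other distances vanish,
    and the maximum reduces to the term with index \<open>k\<close>.\<close>
  define e where "e v = (if v : w ` K Un w' ` K then if v = w' k then v0 else u0 else d v)" for v
  have e: "e : AS M" by (rule asgI) (insert uv asgD[OF d], auto simp: e_def wfst)
  have Fe: "F (ov e a x) = min (h k (ov d a x)) (sdist U s u0 v0)" if a: "a : AS U" for a
  proof -
   have hd: "h l (ov e a x) = h l (ov d a x)" "0 <= h l (ov d a x)" if "l : K" for l
   proof -
    show "h l (ov e a x) = h l (ov d a x)" by (rule Def_cong[OF schemeD(4)[OF H that] asg_override[OF S.asg_sub[OF e] a] asg_override[OF S.asg_sub[OF d] a]])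
      (insert w, auto simp: e_def override_on_def)
    show "0 <= h l (ov d a x)" by (rule scheme_nonneg[OF H that asg_override[OF S.asg_sub[OF d] a]])
   qed
   have val: "ov e a x (w l) = u0" "ov e a x (w' l) = (if l = k then v0 else u0)" if "l : K" for l using that w[of l] ww by (auto simp: e_def override_on_def)
   have "sdist U s u0 u0 = 0" using Metric_space.mdist_zero[OF metric_space_U uvU(1)] .
   hence *: "min (h l (ov e a x)) (sdist U s (ov e a x (w l)) (ov e a x (w' l))) = (if l = k then min (h k (ov d a x)) (sdist U s u0 v0) else 0)" if "l : K" for l
    using hd[OF that] val[OF that] by auto
   have "(%l. min (h l (ov e a x)) (sdist U s (ov e a x (w l)) (ov e a x (w' l)))) ` K
    = (%l. if l = k then min (h k (ov d a x)) (sdist U s u0 v0) else 0) ` K" by (rule image_cong[OF refl *])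
   moreover have "insert 0 ((%l. if l = k then c else 0) ` K) = {0, c}" for c :: real using k by auto
   moreover have "0 <= min (h k (ov d a x)) (sdist U s u0 v0)" using hd(2)[OF k] sdist_01[OF uvU] by simp
   ultimately show ?thesis unfolding F_def by (simp only:) simp
  qed
  have "rh * S.mean x mu (h k) d <= (\<integral>q. pred_at_type L x Z (%q. q te) (restrict e Z) q \<partial>mu)"
   if mu: "mu : keisler_measures L U (univ M) x" for mu
  proof -
   \<comment> \<open>Since \<open>rh\<close> and \<open>h k\<close> are at most 1 and the distance
     exceeds \<open>rh\<close>, the product rh * h k is below the minimum of \<open>h k\<close> and
     the distance.\<close>
   have "rh * S.mean x mu (h k) d = S.mean x mu (%a. rh * h k a) d" by (simp add: S.mean_def)
   also have "\<dots> <= S.mean x mu (%a. fval U a te) e"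
   proof (rule S.mean_mono[OF x mu _ Def_fval[OF te(1)] d e])
    show "(%a. rh * h k a) : Def (x Un z)" using u(3) rh1 by (intro Def_mult Def_const schemeD(4)[OF H k]) auto
    fix a assume a: "a : AS U"
    have h01: "h k (ov d a x) : {0..1}" by (rule Def_01[OF schemeD(4)[OF H k] asg_override[OF S.asg_sub[OF d] a]])
    hence "rh * h k (ov d a x) <= rh" using u(3) by (simp add: mult_left_le)
    moreover have "rh * h k (ov d a x) <= h k (ov d a x)" using h01 rh1 by (simp add: mult_left_le_one_le u(3) less_imp_le)
    ultimately show "rh * h k (ov d a x) <= fval U (ov e a x) te" using Fe[OF a] te(2)[OF asg_override[OF S.asg_sub[OF e] a]] uv(3) by simp
   qed
   also have "\<dots> = (\<integral>q. pred_at_type L x Z (%q. q te) (restrict e Z) q \<partial>mu)"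
    by (rule S.integral_pred_at_formula[OF x Z(2) te(1) mu e, symmetric])
   finally show ?thesis .
  qed
  moreover have "h k (ov d a x) > 0 <-> fval U (ov e a x) te > 0" if a: "a : AS U" for a
   using Fe[OF a] te(2)[OF asg_override[OF S.asg_sub[OF e] a]] uv(3) u(3) by auto
  ultimately show ?thesis using e by blast
 qed
 thus ?thesis using Z te(1) by (intro exI[of _ Z] exI[of _ te]) auto
qed

text \<open>Markov's inequality bounds the mass of the cells with variation above \<open>ta\<close>
  by bt/2. Every other discarded cell has a factor below \<open>sg\<close>, hence mass below
  \<open>sg\<close>, and the choice of \<open>sg\<close> bounds their total by bt/2 too.\<close>

lemma good_cells:
 assumes NIP: "NIP L U" and distal: "distal TYPE('i) L U" and inf: "infinite (UNIV :: 'i set)"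
  and J: "finite J" "r ~: J" and x': "ALL i:insert r J. finite (x i)" and dj: "disjoint_family_on x (insert r J)"
  and fy: "finite y" and y': "ALL i:insert r J. x i Int y = {}" and f: "f : Def ((UN i:insert r J. x i) Un y)"
  and ta: "ta > 0" and bt: "bt > 0"
 shows "EX z K h p sg. sg > 0 & y <= z & (ALL i:insert r J. scheme (x i) z (K i :: nat set) (h i) (p i)) &
  (ALL M mu b. small_submodel L U \<kappa> T M & (ALL i:insert r J. mu i : keisler_measures L U (univ M) (x i)) &
    (ALL i:J. generically_stable L U M (x i) (mu i)) & b : AS M -->
   (EX d:AS M. (ALL v:y. d v = b v) & (EX G<=PiE (insert r J) K.
    (SUM g:PiE (insert r J) K - G. mass M x mu (insert r J) h d g) <= bt &
    (ALL g:G. (ALL i:insert r J. sg <= small_submodel.mean L U M (x i) (mu i) (h i (g i)) d) &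
     (ALL a:cell M z (insert r J) h d g. ALL a':cell M z (insert r J) h d g. \<bar>f a - f a'\<bar> <= ta)))))"
proof -
 let ?R = "insert r J"
 note x = bspec[OF x'] dj and y = fy bspec[OF y']
 have "ta * bt / 2 > 0" using ta bt by simp
 from exists_regular_scheme[OF NIP distal inf J x y _ _ this, of "{f}" "{}"] f
 obtain z and K :: "_ => nat set" and h p where RS: "regular_scheme r J x y {f} (ta * bt / 2) z K h p" by auto
 have yz: "y <= z" and H: "!!i. i : ?R ==> scheme (x i) z (K i) (h i) (p i)" using RS unfolding regular_scheme_def by blast+
 have finR: "finite ?R" using J by simp
 have finP: "finite (PiE ?R K)" using finR schemeD(3)[OF H] by (intro finite_PiE) auto
 define sg where "sg = bt / (2 * real (Suc (card (PiE ?R K))))"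
 have sg: "sg > 0" using bt by (simp add: sg_def)
 have "EX d:AS M. (ALL v:y. d v = b v) & (EX G<=PiE ?R K. (SUM g:PiE ?R K - G. mass M x mu ?R h d g) <= bt &
    (ALL g:G. (ALL i:?R. sg <= small_submodel.mean L U M (x i) (mu i) (h i (g i)) d) &
     (ALL a:cell M z ?R h d g. ALL a':cell M z ?R h d g. \<bar>f a - f a'\<bar> <= ta)))"
  if *: "small_submodel L U \<kappa> T M & (ALL i:?R. mu i : keisler_measures L U (univ M) (x i)) &
    (ALL i:J. generically_stable L U M (x i) (mu i)) & b : AS M" for M mu b
 proof -
  interpret S: small_submodel L U \<kappa> T M using * by blast
  from RS[unfolded regular_scheme_def, THEN conjunct2, THEN conjunct2, rule_format, OF *]
  obtain d where d: "d : AS M" "ALL v:y. d v = b v" and reg: "regular M x mu z ?R K h d (ta * bt / 2) f" by blast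
  from reg obtain osc where osc: "!!g. g : PiE ?R K ==> 0 <= osc g"
   "!!g. g : PiE ?R K ==> ALL a:cell M z ?R h d g. ALL a':cell M z ?R h d g. \<bar>f a - f a'\<bar> <= osc g"
   and sum: "(SUM g:PiE ?R K. mass M x mu ?R h d g * osc g) <= ta * bt / 2" unfolding regular_def by blast
  define E where "E i k = S.mean (x i) (mu i) (h i k) d" for i k
  have E: "0 <= E i k" "E i k <= 1" if "i : ?R" "k : K i" for i k
   using S.mean_nonneg[OF x(1) _ schemeD(4)[OF H that(2)] d(1)] S.mean_le_1[OF x(1) _ schemeD(4)[OF H that(2)] d(1)] that(1) * by (auto simp: E_def)
  have m0: "0 <= mass M x mu ?R h d g" if "g : PiE ?R K" for g by (rule mass_nonneg[OF S.small_submodel_axioms x(1) _ H d(1) that]) (use * in auto)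
  define G where "G = {g : PiE ?R K. (ALL i:?R. sg <= E i (g i)) & osc g <= ta}"
  have "(SUM g:PiE ?R K - G. mass M x mu ?R h d g) <= (SUM g:PiE ?R K - G. sg + mass M x mu ?R h d g * osc g / ta)"
  proof (rule sum_mono)
   fix g assume g: "g : PiE ?R K - G"
   hence gP: "g : PiE ?R K" by blast
   show "mass M x mu ?R h d g <= sg + mass M x mu ?R h d g * osc g / ta"
   proof (cases "osc g <= ta")
    case True
    then obtain i where i: "i : ?R" "E i (g i) < sg" using g by (auto simp: G_def not_le)
    have "mass M x mu ?R h d g = E i (g i) * (PROD i:?R - {i}. E i (g i))" unfolding mass_def E_def by (rule prod.remove[OF finR i(1)])
    also have "\<dots> <= E i (g i)" using E gP i(1) by (intro mult_left_le prod_le_1) (auto simp: PiE_iff)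
    finally have "mass M x mu ?R h d g <= sg" using i(2) by simp
    moreover have "0 <= mass M x mu ?R h d g * osc g / ta" using m0[OF gP] osc(1)[OF gP] ta by simp
    ultimately show ?thesis by linarith
   next
    case False
    hence "mass M x mu ?R h d g * ta <= mass M x mu ?R h d g * osc g" using m0[OF gP] by (intro mult_left_mono) auto
    thus ?thesis using ta sg by (simp add: field_simps add_increasing)
   qed
  qed
  also have "\<dots> <= (SUM g:PiE ?R K. sg + mass M x mu ?R h d g * osc g / ta)"
   using finP m0 osc(1) ta sg by (intro sum_mono2) (auto intro!: add_nonneg_nonneg)
  also have "\<dots> = real (card (PiE ?R K)) * sg + (SUM g:PiE ?R K. mass M x mu ?R h d g * osc g) / ta" by (simp add: sum.distrib sum_divide_distrib)
  also have "(SUM g:PiE ?R K. mass M x mu ?R h d g * osc g) / ta <= bt / 2" using sum ta by (simp add: field_simps)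
  also have "real (card (PiE ?R K)) * sg <= bt / 2" using bt by (simp add: sg_def field_simps)
  finally have "(SUM g:PiE ?R K - G. mass M x mu ?R h d g) <= bt" by simp
  moreover have "\<bar>f a - f a'\<bar> <= ta" if "g : G" "a : cell M z ?R h d g" "a' : cell M z ?R h d g" for g a a'
  proof -
   have "\<bar>f a - f a'\<bar> <= osc g" using osc(2)[of g] that by (auto simp: G_def)
   thus ?thesis using that(1) by (simp add: G_def)
  qed
  ultimately show ?thesis using d by (intro bexI[OF _ d(1)] conjI exI[of _ G]) (auto simp: G_def E_def)
 qed
 thus ?thesis using sg yz H by (intro exI[of _ z] exI[of _ K] exI[of _ h] exI[of _ p] exI[of _ sg]) auto
qed

end

text \<open>Once the parameters \<open>d\<close> are inserted, each factor is a formula over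
  \<open>M\<close> in the variables of a single \<open>x i\<close>, and the definition of product
  measures applies.\<close>

lemma (in small_submodel) product_mean:
 assumes pm: "product_measure L U M n x mu \<omega>" and fin: "!!i. i : {1..n} ==> finite (x i)"
  and mu: "!!i. i : {1..n} ==> mu i : keisler_measures L U (univ M) (x i)"
  and F: "!!i. i : {1..n} ==> F i : Def (x i Un z)" and z: "!!i. i : {1..n} ==> x i Int z = {}" and d: "d : AS M"
 shows "mean (UN i:{1..n}. x i) \<omega> (%a. PROD i:{1..n}. F i a) d = (PROD i:{1..n}. mean (x i) (mu i) (F i) d)"
proof -
 let ?X = "UN i:{1..n}. x i"
 have finX: "finite ?X" using fin by blast
 have Xz: "?X Int z = {}" using z by blast
 have \<omega>: "\<omega> : keisler_measures L U (univ M) ?X"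
  and prod: "!!\<psi>. (ALL i:{1..n}. \<psi> i : definable_predicates L U (univ M) (x i)) ==>
    (\<integral>p. (PROD i:{1..n}. \<psi> i (restrict p (Fml L (univ M) (x i)))) \<partial>\<omega>) = (PROD i:{1..n}. \<integral>p. \<psi> i p \<partial>mu i)"
  using pm unfolding product_measure_def by blast+
 have "ALL i:{1..n}. EX \<psi>. \<psi> : Fml L (univ M) (x i) & (ALL a:AS U. F i (ov d a (x i)) = fval U a \<psi>) &
   (ALL p:types L U (univ M) (x i). F i (ov d (realizer (x i) p) (x i)) = p \<psi>)" using Def_inst_model[OF fin F d] by blast
 from bchoice[OF this] obtain \<psi> where "ALL i:{1..n}. \<psi> i : Fml L (univ M) (x i) & (ALL a:AS U. F i (ov d a (x i)) = fval U a (\<psi> i)) &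
   (ALL p:types L U (univ M) (x i). F i (ov d (realizer (x i) p) (x i)) = p (\<psi> i))" by (elim exE) (rule that)
 hence \<psi>: "\<psi> i : Fml L (univ M) (x i)" "!!a. a : AS U ==> F i (ov d a (x i)) = fval U a (\<psi> i)"
  "!!p. p : types L U (univ M) (x i) ==> F i (ov d (realizer (x i) p) (x i)) = p (\<psi> i)" if "i : {1..n}" for i using that by blast+
 have "mean ?X \<omega> (%a. PROD i:{1..n}. F i a) d = (\<integral>p. (PROD i:{1..n}. (restrict p (Fml L (univ M) (x i))) (\<psi> i)) \<partial>\<omega>)"
  unfolding mean_def
 proof (intro Bochner_Integration.integral_cong prod.cong refl)
  fix p i assume "p : space \<omega>" and i: "i : {1..n}"
  hence p: "p : types L U (univ M) ?X" by (simp add: keislerD(4)[OF \<omega>])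
  note r = realizer[OF finX p]
  have "F i (ov d (realizer ?X p) ?X) = F i (ov d (realizer ?X p) (x i))"
   by (rule Def_cong[OF F[OF i] asg_override[OF asg_sub[OF d] r(1)] asg_override[OF asg_sub[OF d] r(1)]]) (insert i Xz, auto simp: override_on_def)
  also have "\<dots> = fval U (realizer ?X p) (\<psi> i)" by (rule \<psi>(2)[OF i r(1)])
  also have "\<dots> = p (\<psi> i)"
  proof -
   have "\<psi> i : Fml L (univ M) ?X" by (rule Fml_mono[OF \<psi>(1)[OF i]]) (use i in auto)
   from tp_apply[OF this, of U "realizer ?X p"] show ?thesis using r(2) by simp
  qed
  finally show "F i (ov d (realizer ?X p) ?X) = restrict p (Fml L (univ M) (x i)) (\<psi> i)" using \<psi>(1)[OF i] by simp
 qed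
 also have "\<dots> = (PROD i:{1..n}. \<integral>p. p (\<psi> i) \<partial>mu i)"
  by (rule prod[of "%i p. p (\<psi> i)"]) (use formula_predicate[OF \<psi>(1) univ_sub] in blast)
 also have "\<dots> = (PROD i:{1..n}. mean (x i) (mu i) (F i) d)" using mean_formula[OF fin mu \<psi>(3)] by (intro prod.cong refl) auto
 finally show ?thesis .
qed

section \<open>The strong Erdos-Hajnal property in distal theories\<close>

context monster
begin

lemma small_modelD: "small_model L \<kappa> T U M ==> small_submodel L U \<kappa> T M" by unfold_locales (auto simp: small_model_def)

text \<open>If every sort is a single point there are no distances for a selecting predicate, but
  then there is only one tuple and every predicate is constant.\<close>

lemma strong_EH_trivial:
 assumes triv: "ALL s. ALL u:univ U s. ALL v:univ U s. u = v"
  and fin: "finite X" "X Int y = {}" and M: "small_submodel L U \<kappa> T M" and b: "b : tuples M y" and a: "a : tuples M X"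
 shows "a' : tuples M X ==> a = a'"
  and "\<omega> : keisler_measures L U (univ M) X ==> (\<integral>p. pred_at_type L X y ph b p \<partial>\<omega>) = pred_at L U X y ph a b"
proof -
 interpret S: small_submodel L U \<kappa> T M by (rule M)
 have trivM: "u = v" if "u : univ M s" "v : univ M s" for u v s using triv that S.univ_sub by blast
 show "a = a'" if "a' : tuples M X" using PiE_ext[of a X "%v. univ M (fst v)" a'] a that trivM unfolding tuples_def by (meson PiE_mem)
 assume \<omega>: "\<omega> : keisler_measures L U (univ M) X"
 interpret prob_space \<omega> by (rule keislerD(2)[OF \<omega>])
 have eq: "pred_at_type L X y ph b p = pred_at L U X y ph a b" if "p : space \<omega>" for p
 proof -
  have p: "p : types L U (univ M) X" using that by (simp add: keislerD(4)[OF \<omega>])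
  have "pred_at_type L X y ph b p = pred_at L U X y ph (S.realizer X p) b"
   using pred_at_type_tp[OF fin(2), of b "univ M" L ph U "S.realizer X p"] b S.realizer(2)[OF fin(1) p] by (auto simp: tuples_def)
  also have "\<dots> = pred_at L U X y ph a b" unfolding pred_at_def
  proof (rule arg_cong[of _ _ ph], rule tp_cong)
   fix v assume v: "v : X Un y"
   show "ov b (S.realizer X p) X v = ov b a X v"
   proof (cases "v : X")
    case True
    hence "a v : univ U (fst v)" using a S.univ_sub unfolding tuples_def by blast
    thus ?thesis using triv asgD[OF S.realizer(1)[OF fin(1) p], of v] True by simp
   qed (simp add: override_on_def)
  qed
  finally show ?thesis .
 qed
 have "(\<integral>p. pred_at_type L X y ph b p \<partial>\<omega>) = (\<integral>p. pred_at L U X y ph a b \<partial>\<omega>)"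
  by (rule Bochner_Integration.integral_cong[OF refl eq])
 thus "(\<integral>p. pred_at_type L X y ph b p \<partial>\<omega>) = pred_at L U X y ph a b" by (simp add: prob_space)
qed

text \<open>A common source for both conclusions: \<open>t\<close> = 0 gives homogeneity and
  \<open>t\<close> = \<gamma> the density statement. If for t > 0 every good cell had a point with
  \<open>f\<close> below t + ta, then \<open>f\<close> would be at most t + 2 ta plus the weight of
  the discarded cells, and the integral would be too small.\<close>

theorem strong_EH:
 assumes NIP: "NIP L U" and distal: "distal TYPE('i) L U" and inf: "infinite (UNIV :: 'i set)"
  and n: "n >= 1" and vt: "variable_tuples n x y"
  and ph: "ph : definable_predicates L U no_params ((UN i:{1..n}. x i) Un y)" and ta: "ta > 0"
 shows "EX Z \<psi> dl. predicate_family L U n x Z \<psi> & dl > 0 &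
  (ALL M mu b t. small_model L \<kappa> T U M & admissible_measures L U M n x mu & b : tuples M y &
   (t <= 0 | (EX \<omega>. product_measure L U M n x mu \<omega> & (\<integral>p. pred_at_type L (UN i:{1..n}. x i) y ph b p \<partial>\<omega>) >= t + 8 * ta)) -->
   (EX d. (ALL i:{1..n}. d i : tuples M (Z i)) &
    homogeneous M n x (%a. pred_at L U (UN i:{1..n}. x i) y ph a b) (4 * ta) (%i a. pred_at L U (x i) (Z i) (\<psi> i) a (d i)) &
    (ALL a:tuples M (UN i:{1..n}. x i). (ALL i:{1..n}. pred_at L U (x i) (Z i) (\<psi> i) (restrict a (x i)) (d i) > 0) -->
      pred_at L U (UN i:{1..n}. x i) y ph a b >= t) &
    (ALL i:{1..n}. (\<integral>p. pred_at_type L (x i) (Z i) (\<psi> i) (d i) p \<partial>mu i) >= dl)))"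
proof -
 let ?X = "UN i:{1..n}. x i"
 define R where "R = {1..n}"
 have R: "insert n {1..<n} = R" using n by (auto simp: R_def)
 have fx: "finite (x i)" "x i Int y = {}" if "i : R" for i using vt that by (auto simp: variable_tuples_def R_def)
 have fy: "finite y" and dj: "disjoint_family_on x R" using vt by (auto simp: variable_tuples_def R_def)
 have finX: "finite ?X" and Xy: "?X Int y = {}" using fx unfolding R_def by blast+
 have phc: "continuous_map (type_space L U no_params (?X Un y)) euclideanreal ph"
  and ph01: "!!p. p : types L U no_params (?X Un y) ==> ph p : {0..1}"
  using ph unfolding definable_predicates_def continuous_map_in_subtopology by (auto simp: topspace_type_space)
 have pha: "ph (tp L U no_params (?X Un y) a) : {0..1}" if "a : AS U" for a by (rule ph01[OF tp_in_types[OF _ that]]) simp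
 show ?thesis
 proof (cases "ALL s. ALL u:univ U s. ALL v:univ U s. u = v")
  case True
  show ?thesis
  proof (intro exI[of _ "%_. {}"] exI[of _ "%_ _. 1"] exI[of _ 1] conjI allI impI, goal_cases)
   case 1
   show ?case by (auto simp: predicate_family_def definable_predicates_def)
  next
   case (3 M mu b t)
   have M: "small_submodel L U \<kappa> T M" by (rule small_modelD) (use 3 in blast)
   interpret S: small_submodel L U \<kappa> T M by (rule M)
   note tr = strong_EH_trivial[OF True finX Xy M, where b = b]
   have b: "b : tuples M y" using 3 by blast
   have "t <= pred_at L U ?X y ph a b" if a: "a : tuples M ?X" for a
   proof (cases "t <= 0")
    case t: True
    obtain a' where a': "a' : AS M" "ALL v:?X. a' v = a v" using S.M.tuples_extend[OF a] by blast
    obtain b' where b': "b' : AS M" "ALL v:y. b' v = b v" using S.M.tuples_extend[OF b] by blast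
    have "pred_at L U ?X y ph a b = ph (tp L U no_params (?X Un y) (ov b' a' ?X))"
     unfolding pred_at_def by (intro arg_cong[of _ _ ph] tp_cong) (insert a' b', auto simp: override_on_def)
    thus ?thesis using pha[OF asg_override[OF S.asg_sub[OF b'(1)] S.asg_sub[OF a'(1)], of ?X]] order_trans[OF t] by simp
   next
    case False
    then obtain \<omega> where "product_measure L U M n x mu \<omega>" "(\<integral>p. pred_at_type L ?X y ph b p \<partial>\<omega>) >= t + 8 * ta" using 3 by blast
    thus ?thesis using tr(2)[OF b a, of \<omega> ph] ta by (simp add: product_measure_def)
   qed
   moreover have "homogeneous M n x (%a. pred_at L U ?X y ph a b) (4 * ta) (%i a. pred_at L U (x i) {} (%_. 1) a (%_. undefined))"
    unfolding homogeneous_def using tr(1)[OF b] ta by fastforce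
   moreover have "(\<integral>p. pred_at_type L (x i) {} (%_. 1) (%_. undefined) p \<partial>mu i) >= 1" if "i : {1..n}" for i
   proof -
    have "mu i : keisler_measures L U (univ M) (x i)" using 3 that by (auto simp: admissible_measures_def)
    then interpret prob_space "mu i" by (rule keislerD(2))
    show ?thesis by (simp add: pred_at_type_def prob_space)
   qed
   ultimately show ?case by (intro exI[of _ "%_ _. undefined"]) (auto simp: tuples_def)
  qed simp
 next
  case False
  then obtain s u v where uv: "u : univ U s" "v : univ U s" "u ~= v" by blast
  define rh where "rh = sdist U s u v / 2"
  have "sdist U s u v > 0" using Metric_space.mdist_pos_less[OF metric_space_U uv(3,1,2)] .
  hence rh: "0 < rh" "rh < sdist U s u v" by (auto simp: rh_def)
  obtain tef where tef: "tef : F0 L (?X Un y)"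
   "!!a. a : AS U ==> \<bar>ph (tp L U no_params (?X Un y) a) - fval U a tef\<bar> <= ta"
   using continuous_approx_formula[OF _ phc ph01 ta] by auto
  define f where "f a = fval U a tef" for a
  have f: "f : Def (?X Un y)" unfolding f_def[abs_def] by (rule Def_fval[OF tef(1)])
  \<comment> \<open>Below 1, so that not all cells are discarded, and at most \<open>ta\<close>, so
    that the discarded cells add at most \<open>ta\<close> to the integral.\<close>
  define bt where "bt = min ta (1 / 2)"
  have bt: "bt > 0" "bt <= ta" "bt < 1" using ta by (auto simp: bt_def)
  have fxb: "ALL i:R. finite (x i)" "ALL i:R. x i Int y = {}" using fx by blast+
  have "finite {1..<n}" "n ~: {1..<n}" by auto
  from good_cells[OF NIP distal inf this, unfolded R, OF fxb(1) dj fy fxb(2) f[folded R_def] ta bt(1)]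
  obtain z and K :: "nat => nat set" and h p sg where sg: "sg > 0" and yz: "y <= z" and H0: "ALL i:R. scheme (x i) z (K i) (h i) (p i)"
   and good: "ALL M mu b. small_submodel L U \<kappa> T M & (ALL i:R. mu i : keisler_measures L U (univ M) (x i)) &
    (ALL i:{1..<n}. generically_stable L U M (x i) (mu i)) & b : AS M -->
   (EX d:AS M. (ALL v:y. d v = b v) & (EX G<=PiE R K. (SUM g:PiE R K - G. mass M x mu R h d g) <= bt &
    (ALL g:G. (ALL i:R. sg <= small_submodel.mean L U M (x i) (mu i) (h i (g i)) d) &
     (ALL a:cell M z R h d g. ALL a':cell M z R h d g. \<bar>f a - f a'\<bar> <= ta))))" by (elim exE conjE) (rule that)
  have H: "scheme (x i) z (K i) (h i) (p i)" if "i : R" for i using H0 that by blast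
  define sel where "sel i Z te <-> finite Z & x i Int Z = {} & te : F0 L (x i Un Z) &
   (ALL M d. ALL k:K i. small_submodel L U \<kappa> T M & d : AS M -->
    (EX e:AS M. (ALL a:AS U. h i k (ov d a (x i)) > 0 <-> fval U (ov e a (x i)) te > 0) &
     (ALL mu:keisler_measures L U (univ M) (x i). rh * small_submodel.mean L U M (x i) mu (h i k) d <=
      (\<integral>q. pred_at_type L (x i) Z (%q. q te) (restrict e Z) q \<partial>mu))))" for i Z te
  have "ALL i:R. EX Z. EX te. sel i Z te" using selector[OF uv(1,2) rh fx(1) H] unfolding sel_def by blast
  from bchoice[OF this] obtain Z where "ALL i:R. EX te. sel i (Z i) te" by blast
  from bchoice[OF this] obtain te where Zte: "ALL i:R. sel i (Z i) (te i)" by blast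
  have Z: "finite (Z i)" "x i Int Z i = {}" "te i : F0 L (x i Un Z i)" if "i : R" for i using Zte that by (simp_all add: sel_def)
  have sel: "EX e:AS M. (ALL a:AS U. h i k (ov d a (x i)) > 0 <-> fval U (ov e a (x i)) (te i) > 0) &
     (ALL mu:keisler_measures L U (univ M) (x i). rh * small_submodel.mean L U M (x i) mu (h i k) d <=
      (\<integral>q. pred_at_type L (x i) (Z i) (%q. q (te i)) (restrict e (Z i)) q \<partial>mu))"
   if "i : R" "k : K i" "small_submodel L U \<kappa> T M" "d : AS M" for i k M d using bspec[OF Zte that(1)] that(2-) unfolding sel_def by blast
  show ?thesis
  proof (intro exI[of _ Z] exI[of _ "%i q. q (te i)"] exI[of _ "rh * sg"] conjI allI impI, goal_cases)
   case 1
   show ?case unfolding predicate_family_def using Z formula_predicate[OF Z(3)] by (auto simp: R_def)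
  next
   case 2
   show ?case using rh sg by simp
  next
   case (3 M mu b t)
   have "small_submodel L U \<kappa> T M" by (rule small_modelD) (use 3 in blast)
   then interpret S: small_submodel L U \<kappa> T M .
   obtain b' where b': "b' : AS M" "!!v. v : y ==> b' v = b v" using S.M.tuples_extend[of b y] 3 by blast
   have mu: "mu i : keisler_measures L U (univ M) (x i)" if "i : R" for i using 3 that by (auto simp: admissible_measures_def R_def)
   have "small_submodel L U \<kappa> T M & (ALL i:R. mu i : keisler_measures L U (univ M) (x i)) &
    (ALL i:{1..<n}. generically_stable L U M (x i) (mu i)) & b' : AS M"
    using 3 mu b'(1) S.small_submodel_axioms by (auto simp: admissible_measures_def)
   from good[rule_format, OF this] obtain d G where d: "d : AS M" "!!v. v : y ==> d v = b' v" and G: "G <= PiE R K"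
    and bad: "(SUM g:PiE R K - G. mass M x mu R h d g) <= bt"
    and large: "!!g i. g : G ==> i : R ==> sg <= S.mean (x i) (mu i) (h i (g i)) d"
    and hom: "!!g a a'. g : G ==> a : cell M z R h d g ==> a' : cell M z R h d g ==> \<bar>f a - f a'\<bar> <= ta" by blast
   have dU: "d : AS U" by (rule S.asg_sub[OF d(1)])
   have finR: "finite R" by (simp add: R_def)
   have finP: "finite (PiE R K)" using schemeD(3)[OF H] finR by (intro finite_PiE) auto
   have Xz: "x i Int z = {}" if "i : R" for i by (rule schemeD(2)[OF H[OF that]])
   hence XzU: "?X Int z = {}" unfolding R_def by blast
   have near: "\<bar>ph (tp L U no_params (?X Un y) (ov b a ?X)) - f (ov d a ?X)\<bar> <= ta" if a: "a : AS U" for a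
   proof -
    have "tp L U no_params (?X Un y) (ov b a ?X) = tp L U no_params (?X Un y) (ov d a ?X)"
     by (rule tp_cong) (insert d(2) b'(2), auto simp: override_on_def)
    thus ?thesis using tef(2)[OF asg_override[OF dU a]] by (simp add: f_def)
   qed
   have "EX g:G. t <= 0 | (ALL a:cell M z R h d g. t + ta <= f a)"
   proof (rule ccontr)
    assume no: "~ ?thesis"
    show False
    proof (cases "t <= 0")
     case True
     hence "G = {}" using no by blast
     thus False using bad bt(3) mass_total[OF S.small_submodel_axioms finR fx(1) mu H d(1)] by simp
    next
     case False
     then obtain \<omega> where pm: "product_measure L U M n x mu \<omega>" and ge: "(\<integral>p. pred_at_type L ?X y ph b p \<partial>\<omega>) >= t + 8 * ta" using 3 by blast
     have \<omega>: "\<omega> : keisler_measures L U (univ M) ?X" using pm by (simp add: product_measure_def)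
     interpret prob_space \<omega> by (rule keislerD(2)[OF \<omega>])
     define F where "F g a = (PROD i:R. h i (g i) a)" for g and a :: "'s var => 'a"
     have F: "F g : Def (?X Un z)" if "g : PiE R K" for g unfolding F_def[abs_def]
      by (intro Def_prod finR Def_mono[OF schemeD(4)[OF H]]) (insert that, auto simp: R_def)
     \<comment> \<open>The weight of the discarded cells as a definable function; under a product
       measure its mean is their total mass.\<close>
     define B where "B a = (SUM g:PiE R K - G. F g a)" for a
     have F1: "(SUM g:PiE R K. F g a) = 1" if a: "a : AS U" for a
     proof -
      have "(SUM g:PiE R K. F g a) = (PROD i:R. SUM k:K i. h i k a)"
       unfolding F_def using schemeD(3)[OF H] by (intro prod_sum_PiE[OF finR, symmetric]) auto
      also have "\<dots> = 1" using schemeD(6)[OF H a] by (intro prod.neutral) auto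
      finally show ?thesis .
     qed
     have F0: "0 <= F g a" if "g : PiE R K" "a : AS U" for g a by (rule Def_ge0[OF F[OF that(1)] that(2)])
     have "B a <= 1" if "a : AS U" for a unfolding B_def F1[OF that, symmetric] using F0[OF _ that] finP by (intro sum_mono2) auto
     hence B: "B : Def (?X Un z)" unfolding B_def[abs_def] using F finP by (intro Def_sum) auto
     have fz: "f : Def (?X Un z)" by (rule Def_mono[OF f]) (use yz in blast)
     have le: "f (ov d a ?X) - B (ov d a ?X) <= t + 2 * ta" if a: "a : AS M" for a
     proof -
      define c where "c = ov d a ?X"
      have c: "c : AS M" unfolding c_def by (rule asg_override[OF d(1) a])
      have cU: "c : AS U" by (rule S.asg_sub[OF c])
      have cd: "c v = d v" if "v : z" for v using that XzU by (auto simp: c_def override_on_def)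
      have f01: "0 <= f c" "f c <= 1" using Def_01[OF f cU] by auto
      have "F g c * f c <= F g c * (t + 2 * ta)" if g: "g : G" for g
      proof (cases "F g c = 0")
       case False
       have gP: "g : PiE R K" using g G by blast
       have "h i (g i) c > 0" if i: "i : R" for i
       proof -
        have "0 <= h i (g i) c" by (rule scheme_nonneg[OF H[OF i] _ cU]) (use gP i in blast)
        moreover have "h i (g i) c ~= 0" using False i finR by (auto simp: F_def)
        ultimately show ?thesis by simp
       qed
       hence cc: "c : cell M z R h d g" using c cd by (simp add: cell_def)
       obtain a' where a': "a' : cell M z R h d g" "f a' < t + ta" using no g by (meson not_le)
       hence "f c <= t + 2 * ta" using hom[OF g cc a'(1)] by linarith
       thus ?thesis using F0[OF gP cU] by (rule mult_left_mono)
      qed simp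
      hence "(SUM g:G. F g c * f c) <= (SUM g:G. F g c * (t + 2 * ta))" by (rule sum_mono)
      also have "\<dots> = (SUM g:G. F g c) * (t + 2 * ta)" by (simp add: sum_distrib_right)
      also have "\<dots> <= 1 * (t + 2 * ta)" unfolding F1[OF cU, symmetric] using F0[OF _ cU] finP G False ta by (intro mult_right_mono sum_mono2) auto
      finally have "(SUM g:G. F g c * f c) <= t + 2 * ta" by simp
      moreover have "(SUM g:PiE R K - G. F g c * f c) <= B c" unfolding B_def using F0[OF _ cU] f01 by (intro sum_mono mult_left_le) auto
      moreover have "f c = (SUM g:PiE R K - G. F g c * f c) + (SUM g:G. F g c * f c)"
       using sum.subset_diff[OF G finP, of "%g. F g c * f c"] F1[OF cU] by (simp flip: sum_distrib_right)
      ultimately show ?thesis by (simp add: c_def)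
     qed
     \<comment> \<open>Cells consist of tuples from \<open>M\<close>, whereas types are evaluated at
       realizations in \<open>U\<close>; elementarity carries the inequality over.\<close>
     have leU: "f (ov d a ?X) <= t + 2 * ta + B (ov d a ?X)" if a: "a : AS U" for a
     proof -
      have "1 - (t + 2 * ta) <= 1 - max 0 (f (ov d a ?X) - B (ov d a ?X))"
      proof (rule S.model_dense[OF finX Def_compl[OF Def_diff0[OF fz B]] d(1) _ a])
       fix a assume "a : AS M"
       from le[OF this] show "1 - (t + 2 * ta) <= 1 - max 0 (f (ov d a ?X) - B (ov d a ?X))" using False ta by linarith
      qed
      thus ?thesis by simp
     qed
     have "S.mean ?X \<omega> (%a. SUM g:PiE R K - G. 1 * F g a) d = (SUM g:PiE R K - G. 1 * S.mean ?X \<omega> (F g) d)"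
      by (rule S.mean_sum[OF finX \<omega> F d(1)]) auto
     also have "\<dots> = (SUM g:PiE R K - G. mass M x mu R h d g)"
     proof (rule sum.cong[OF refl])
      fix g assume g: "g : PiE R K - G"
      show "1 * S.mean ?X \<omega> (F g) d = mass M x mu R h d g" unfolding F_def[abs_def] mass_def R_def mult_1
       by (rule S.product_mean[OF pm fx(1) mu schemeD(4)[OF H] Xz d(1)]) (insert g, auto simp: R_def)
     qed
     finally have mB: "S.mean ?X \<omega> B d <= bt" using bad by (simp add: B_def[abs_def])
     let ?r = "%p. ov d (S.realizer ?X p) ?X"
     have int: "integrable \<omega> (%p. f (?r p))" "integrable \<omega> (%p. B (?r p))"
      using S.integrable_at_realizer[OF finX \<omega> fz d(1)] S.integrable_at_realizer[OF finX \<omega> B d(1)] by auto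
     have rU: "S.realizer ?X p : AS U" if "p : space \<omega>" for p using that by (intro S.realizer(1)[OF finX]) (simp add: keislerD(4)[OF \<omega>])
     have "(\<integral>p. f (?r p) \<partial>\<omega>) <= (\<integral>p. (t + 2 * ta) + B (?r p) \<partial>\<omega>)"
      by (rule integral_mono) (use int leU rU in auto)
     also have "\<dots> <= t + 3 * ta" using mB int bt(2) by (simp add: S.mean_def prob_space)
     finally have f3: "(\<integral>p. f (?r p) \<partial>\<omega>) <= t + 3 * ta" .
     have pt: "pred_at_type L ?X y ph b p <= f (?r p) + ta" if p: "p : space \<omega>" for p
     proof -
      have pT: "p : types L U (univ M) ?X" using p by (simp add: keislerD(4)[OF \<omega>])
      have "pred_at_type L ?X y ph b p = pred_at L U ?X y ph (S.realizer ?X p) b"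
       using pred_at_type_tp[OF Xy, of b "univ M" L ph U "S.realizer ?X p"] 3 S.realizer(2)[OF finX pT] by (auto simp: tuples_def)
      thus ?thesis using near[OF rU[OF p]] by (simp add: pred_at_def abs_le_iff)
     qed
     show False
     proof (cases "integrable \<omega> (%p. pred_at_type L ?X y ph b p)")
      case True
      have "(\<integral>p. pred_at_type L ?X y ph b p \<partial>\<omega>) <= (\<integral>p. f (?r p) + ta \<partial>\<omega>)"
       by (rule integral_mono[OF True]) (use int pt in auto)
      also have "\<dots> = (\<integral>p. f (?r p) \<partial>\<omega>) + ta" using int by (simp add: prob_space)
      finally show False using ge f3 ta by simp
     next
      \<comment> \<open>The integral of a non-integrable function is 0 by convention, which is below
        t + 8 ta.\<close>
      case F: False
      thus False using ge False ta by (simp add: not_integrable_integral_eq)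
     qed
    qed
   qed
   then obtain g where g: "g : G" and tg: "t <= 0 | (ALL a:cell M z R h d g. t + ta <= f a)" by blast
   have gK: "g i : K i" if "i : R" for i using g G that by blast
   have "ALL i:R. EX e. e : AS M & (ALL a:AS U. h i (g i) (ov d a (x i)) > 0 <-> fval U (ov e a (x i)) (te i) > 0) &
     (ALL mu:keisler_measures L U (univ M) (x i). rh * S.mean (x i) mu (h i (g i)) d <=
      (\<integral>q. pred_at_type L (x i) (Z i) (%q. q (te i)) (restrict e (Z i)) q \<partial>mu))"
    using sel[OF _ gK S.small_submodel_axioms d(1)] by blast
   from bchoice[OF this] obtain e where e: "ALL i:R. e i : AS M & (ALL a:AS U. h i (g i) (ov d a (x i)) > 0 <-> fval U (ov (e i) a (x i)) (te i) > 0) &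
     (ALL mu:keisler_measures L U (univ M) (x i). rh * S.mean (x i) mu (h i (g i)) d <=
      (\<integral>q. pred_at_type L (x i) (Z i) (%q. q (te i)) (restrict (e i) (Z i)) q \<partial>mu))" by (elim exE) (rule that)
   have supp: "EX c:cell M z R h d g. \<bar>pred_at L U ?X y ph a b - f c\<bar> <= ta"
    if a: "a : tuples M ?X" and pos: "ALL i:{1..n}. pred_at L U (x i) (Z i) (%q. q (te i)) (restrict a (x i)) (restrict (e i) (Z i)) > 0" for a
   proof -
    obtain a' where a': "a' : AS M" "!!v. v : ?X ==> a' v = a v" using S.M.tuples_extend[OF a] by blast
    have aU: "a' : AS U" by (rule S.asg_sub[OF a'(1)])
    have "h i (g i) (ov d a' ?X) > 0" if i: "i : R" for i
    proof -
     have "restrict a (x i) = restrict a' (x i)" by (rule restrict_ext, rule a'(2)[symmetric]) (insert i, auto simp: R_def)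
     hence "fval U (ov (e i) a' (x i)) (te i) > 0"
      using bspec[OF pos, of i] i pred_at_formula[OF Z(3)[OF i] aU S.asg_sub[OF bspec[OF e i, THEN conjunct1]]] by (simp add: R_def)
     hence "h i (g i) (ov d a' (x i)) > 0" using e i aU by blast
     moreover have "h i (g i) (ov d a' ?X) = h i (g i) (ov d a' (x i))"
      by (rule Def_cong[OF schemeD(4)[OF H[OF i] gK[OF i]] asg_override[OF dU aU] asg_override[OF dU aU]]) (insert i XzU, auto simp: override_on_def R_def)
     ultimately show ?thesis by simp
    qed
    moreover have "ov d a' ?X v = d v" if "v : z" for v using that XzU by (auto simp: override_on_def)
    ultimately have "ov d a' ?X : cell M z R h d g" using asg_override[OF d(1) a'(1)] by (simp add: cell_def)
    moreover have "pred_at L U ?X y ph a b = ph (tp L U no_params (?X Un y) (ov b a' ?X))"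
     unfolding pred_at_def by (intro arg_cong[of _ _ ph] tp_cong) (insert a'(2), auto simp: override_on_def)
    ultimately show ?thesis using near[OF aU] by auto
   qed
   have nonneg: "0 <= pred_at L U ?X y ph a b" if a: "a : tuples M ?X" for a
   proof -
    obtain a' where a': "a' : AS M" "!!v. v : ?X ==> a' v = a v" using S.M.tuples_extend[OF a] by blast
    have "pred_at L U ?X y ph a b = ph (tp L U no_params (?X Un y) (ov b' a' ?X))"
     unfolding pred_at_def by (intro arg_cong[of _ _ ph] tp_cong) (insert a'(2) b'(2), auto simp: override_on_def)
    thus ?thesis using pha[OF asg_override[OF S.asg_sub[OF b'(1)] S.asg_sub[OF a'(1)]]] by simp
   qed
   show ?case
   proof (intro exI[of _ "%i. restrict (e i) (Z i)"] conjI ballI impI)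
    fix i assume "i : {1..n}"
    hence i: "i : R" by (simp add: R_def)
    show "restrict (e i) (Z i) : tuples M (Z i)" using e i restrict_tuples[of "e i" "univ M" M] by blast
    have "rh * sg <= rh * S.mean (x i) (mu i) (h i (g i)) d" using large[OF g i] rh(1) by simp
    also have "\<dots> <= (\<integral>q. pred_at_type L (x i) (Z i) (%q. q (te i)) (restrict (e i) (Z i)) q \<partial>mu i)" using e i mu[OF i] by blast
    finally show "rh * sg <= (\<integral>q. pred_at_type L (x i) (Z i) (%q. q (te i)) (restrict (e i) (Z i)) q \<partial>mu i)" .
   next
    fix a assume a: "a : tuples M ?X" "ALL i:{1..n}. 0 < pred_at L U (x i) (Z i) (%q. q (te i)) (restrict a (x i)) (restrict (e i) (Z i))"
    from supp[OF a] obtain c where c: "c : cell M z R h d g" "\<bar>pred_at L U ?X y ph a b - f c\<bar> <= ta" by blast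
    show "t <= pred_at L U ?X y ph a b" using tg
    proof
     assume "t <= 0"
     thus ?thesis using nonneg[OF a(1)] by simp
    next
     assume "ALL a:cell M z R h d g. t + ta <= f a"
     hence "t + ta <= f c" using c(1) by blast
     thus ?thesis using c(2) by linarith
    qed
   next
    show "homogeneous M n x (%a. pred_at L U ?X y ph a b) (4 * ta) (%i a. pred_at L U (x i) (Z i) (%q. q (te i)) a (restrict (e i) (Z i)))"
     unfolding homogeneous_def
    proof (intro ballI impI)
     fix a a' assume a: "a : tuples M ?X" "a' : tuples M ?X" and pos: "ALL i:{1..n}. 0 < pred_at L U (x i) (Z i) (%q. q (te i)) (restrict a (x i)) (restrict (e i) (Z i)) &
      0 < pred_at L U (x i) (Z i) (%q. q (te i)) (restrict a' (x i)) (restrict (e i) (Z i))"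
     obtain c where c: "c : cell M z R h d g" "\<bar>pred_at L U ?X y ph a b - f c\<bar> <= ta" using supp[OF a(1)] pos by blast
     obtain c' where c': "c' : cell M z R h d g" "\<bar>pred_at L U ?X y ph a' b - f c'\<bar> <= ta" using supp[OF a(2)] pos by blast
     show "\<bar>pred_at L U ?X y ph a b - pred_at L U ?X y ph a' b\<bar> <= 4 * ta" using c(2) c'(2) hom[OF g c(1) c'(1)] ta by linarith
    qed
   qed
  qed
 qed
qed

end

section \<open>Small elementary submodels\<close>

text \<open>A function into subsets of \<open>W\<close> is a subset of the product of a countable
  set with \<open>W\<close>, and this product injects into the infinite set
  \<open>W\<close>.\<close>

lemma card_functions_le:
 assumes "infinite W" "countable (UNIV :: 'c set)" "|X| <=o |Pow W|"
 shows "|{h :: 'c => 'x. range h <= X}| <=o |Pow W|"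
proof -
 obtain g where g: "inj_on g X" "g ` X <= Pow W" using assms(3) unfolding card_of_ordLeq[symmetric] by blast
 have "|UNIV :: 'c set| <=o |W|" using assms(1,2) infinite_iff_card_of_nat[of W] card_of_ordLeq[of "UNIV :: 'c set" "UNIV :: nat set"] ordLeq_transitive
  unfolding countable_def by blast
 from card_of_Times_ordLeq_infinite_Field[OF _ this ordLeq_refl[OF card_of_Card_order] card_of_Card_order] assms(1)
 have "|(UNIV :: 'c set) \<times> W| <=o |W|" by (simp add: Field_card_of)
 then obtain e where e: "inj_on e ((UNIV :: 'c set) \<times> W)" "e ` (UNIV \<times> W) <= W" unfolding card_of_ordLeq[symmetric] by blast
 define S where "S h = (SIGMA c:UNIV. g (h c))" for h :: "'c => 'x"
 have S: "S h <= UNIV \<times> W" if "range h <= X" for h using g(2) that by (auto simp: S_def)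
 show ?thesis unfolding card_of_ordLeq[symmetric]
 proof (intro exI[of _ "%h. e ` S h"] conjI inj_onI)
  fix h h' assume h: "h : {h. range h <= X}" "h' : {h. range h <= X}" "e ` S h = e ` S h'"
  hence "S h = S h'" using inj_on_image_eq_iff[OF e(1)] S by blast
  hence "g (h c) = g (h' c)" for c by (auto simp: S_def)
  thus "h = h'" using h g(1) by (auto simp: inj_on_def image_subset_iff)
 next
  show "(%h. e ` S h) ` {h. range h <= X} <= Pow W" using S e(2) by blast
 qed
qed

text \<open>The elements generated from \<open>B\<close> by operations of countable arity, with codes: the term tree is
  coded by the labels of its nodes, which are indexed by paths.\<close>

inductive_set generated :: "('l => 'x) => ('l => (nat => 'x) => 'x) => 'l set => ((nat list => 'l + 'l) \<times> 'x) set"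
 for b op \<Lambda> where "l : \<Lambda> ==> (%_. Inl l, b l) : generated b op \<Lambda>"
| "l : \<Lambda> ==> (!!n. (h n, f n) : generated b op \<Lambda>) ==>
  (%p. case p of [] => Inr l | n # q => h n q, op l f) : generated b op \<Lambda>"

lemma generated_unique: "(h, m) : generated b op \<Lambda> ==> (h, m') : generated b op \<Lambda> ==> m = m'"
proof (induction arbitrary: m' rule: generated.induct)
 case (1 l)
 from 1(2) show ?case
 proof cases
  case 2: (2 l' h' f')
  thus ?thesis by (auto dest: fun_cong[of _ _ "[]"])
 qed (auto dest: fun_cong)
next
 case (2 l h f)
 from 2(4) show ?case
 proof cases
  case 1: (1 l')
  thus ?thesis by (auto dest: fun_cong[of _ _ "[]"])
 next
  case *: (2 l' h' f')
  have "l = l'" using fun_cong[OF *(1), of "[]"] by simp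
  moreover have "h n = h' n" for n
  proof
   fix q show "h n q = h' n q" using fun_cong[OF *(1), of "n # q"] by simp
  qed
  hence "f = f'" using 2(3) *(4) by (intro ext) metis
  ultimately show ?thesis using *(2) by simp
 qed
qed

text \<open>The closure is an image of the set of codes. A code is a function from finite paths to
  labels, and there are at most |Pow W| of these although the operations have countable
  arity.\<close>

lemma closure_card:
 fixes B :: "'x set" and Ops :: "((nat => 'x) => 'x) set"
 assumes W: "infinite W" and B: "|B| <=o |Pow W|" "B ~= {}" and Ops: "|Ops| <=o |Pow W|"
 shows "EX S. B <= S & (ALL q:Ops. ALL f. range f <= S --> q f : S) & |S| <=o |Pow W| &
  (ALL Q. B <= Q & (ALL q:Ops. ALL f. range f <= Q --> q f : Q) --> S <= Q)"
proof -
 obtain b where b: "b ` Pow W = B" using B card_of_ordLeq2[of B "Pow W"] by blast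
 \<comment> \<open>A projection makes the set of operations nonempty, so that it can be enumerated;
   every set is closed under it.\<close>
 define Ops' where "Ops' = insert (%f. f 0) Ops"
 have "|{%f :: nat => 'x. f 0}| <=o |Pow W|" by (rule card_of_singl_ordLeq) auto
 from card_of_Un_ordLeq_infinite_Field[OF _ this Ops card_of_Card_order] W
 have "|{%f. f 0} Un Ops| <=o |Pow W|" by (simp add: Field_card_of)
 then obtain op where op: "op ` Pow W = Ops'" using card_of_ordLeq2[of Ops' "Pow W"] by (auto simp: Ops'_def)
 define G where "G = generated b op (Pow W)"
 have labels: "range h <= Pow W <+> Pow W" if "(h, m) : G" for h m using that unfolding G_def
 proof (induction rule: generated.induct)
  case (2 l h f)
  have "(case p of [] => Inr l | n # q => h n q) : Pow W <+> Pow W" for p using 2 by (cases p) (auto simp: image_subset_iff)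
  thus ?case by blast
 qed auto
 show ?thesis
 proof (intro exI[of _ "snd ` G"] conjI ballI allI impI)
  show "B <= snd ` G"
  proof
   fix c assume "c : B"
   then obtain l where "l : Pow W" "c = b l" using b by blast
   hence "(%_. Inl l, c) : G" unfolding G_def by (metis generated.intros(1))
   thus "c : snd ` G" by force
  qed
 next
  fix q and f :: "nat => 'x" assume q: "q : Ops" and f: "range f <= snd ` G"
  hence "ALL n. EX h. (h, f n) : G" by (force simp: image_subset_iff)
  then obtain h where h: "!!n. (h n, f n) : G" by metis
  obtain l where "l : Pow W" "q = op l" using q op unfolding Ops'_def by blast
  thus "q f : snd ` G" using generated.intros(2)[of l "Pow W" h f b op] h unfolding G_def by force
 next
  have "|Pow W <+> Pow W| <=o |Pow W|"
   by (rule card_of_Plus_ordLeq_infinite_Field[OF _ ordLeq_refl[OF card_of_Card_order] ordLeq_refl[OF card_of_Card_order] card_of_Card_order]) (simp add: Field_card_of W)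
  from card_functions_le[where 'c = "nat list", OF W _ this]
  have "|{h :: nat list => _. range h <= Pow W <+> Pow W}| <=o |Pow W|" by simp
  moreover have "|fst ` G| <=o |{h :: nat list => _. range h <= Pow W <+> Pow W}|"
  proof (rule card_of_mono1, rule subsetI)
   fix h assume "h : fst ` G"
   then obtain m where "(h, m) : G" by auto
   thus "h : {h. range h <= Pow W <+> Pow W}" using labels by simp
  qed
  moreover have "snd ` G = (%h. THE m. (h, m) : G) ` fst ` G" unfolding image_image
  proof (rule image_cong[OF refl])
   fix x assume x: "x : G"
   hence "(THE m. (fst x, m) : G) = snd x" using generated_unique[of "fst x" _ b op "Pow W"] by (intro the_equality) (simp_all add: G_def)
   thus "snd x = (THE m. (fst x, m) : G)" by simp
  qed
  ultimately show "|snd ` G| <=o |Pow W|" using card_of_image ordLeq_transitive by metis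
 next
  fix Q assume Q: "B <= Q & (ALL q:Ops. ALL f. range f <= Q --> q f : Q)"
  have "m : Q" if "(h, m) : G" for h m using that unfolding G_def
  proof (induction rule: generated.induct)
   case (1 l)
   thus ?case using b Q by blast
  next
   case (2 l h f)
   hence "range f <= Q" "op l : Ops'" using op by auto
   thus ?case using Q unfolding Ops'_def by auto
  qed
  thus "snd ` G <= Q" by auto
 qed
qed

text \<open>Connectives only matter on the cube, where they are determined by their values at finitely
  supported rational sequences.\<close>

lemma card_connectives:
 assumes "infinite W"
 shows "|{%v. u (%i. max 0 (min 1 (v i))) | u. connective u}| <=o |Pow W|" (is "|?C| <=o _")
proof -
 define cl where "cl v i = max 0 (min 1 (v i :: real))" for v and i :: nat
 define sq where "sq l = cl (nth_default 0 (map real_of_rat l))" for l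
 have cube: "cl v : {v. ALL i. v i : {0..1}}" for v by (simp add: cl_def)
 have det: "u (cl v) = u' (cl v)" if u: "connective u" "connective u'" and eq: "!!l. u (sq l) = u' (sq l)" for u u' v
 proof -
  have "EX q. \<bar>real_of_rat q - cl v i\<bar> < 1 / Suc n" for n i
  proof -
   have "cl v i - 1 / Suc n < cl v i" by simp
   from of_rat_dense[OF this] obtain q where "cl v i - 1 / Suc n < real_of_rat q" "real_of_rat q < cl v i" by blast
   hence "\<bar>real_of_rat q - cl v i\<bar> < 1 / Suc n" by linarith
   thus ?thesis by blast
  qed
  note ex = this
  define q where "q n i = (SOME q. \<bar>real_of_rat q - cl v i\<bar> < 1 / Suc n)" for n i
  have q: "\<bar>real_of_rat (q n i) - cl v i\<bar> < 1 / Suc n" for n i unfolding q_def by (rule someI_ex[OF ex])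
  define L where "L n = map (q n) [0..<Suc n]" for n
  have "(%n. sq (L n) i) \<longlonglongrightarrow> cl v i" for i
  proof (rule metric_LIMSEQ_I)
   fix e :: real assume "e > 0"
   then obtain N where N: "1 / real (Suc N) < e" using nat_approx_posE by blast
   have "dist (sq (L n) i) (cl v i) < e" if n: "n >= max N i" for n
   proof -
    have c01: "0 <= cl v i" "cl v i <= 1" using cube[of v] by auto
    have "sq (L n) i = max 0 (min 1 (real_of_rat (q n i)))" using n by (simp add: sq_def cl_def L_def nth_default_def del: upt_Suc)
    hence "\<bar>sq (L n) i - cl v i\<bar> <= \<bar>real_of_rat (q n i) - cl v i\<bar>" using c01 by linarith
    also have "\<dots> < 1 / Suc n" by (rule q)
    also have "\<dots> <= 1 / Suc N" using n by (simp add: frac_le)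
    finally show ?thesis using N by (simp add: dist_real_def)
   qed
   thus "EX no. ALL n>=no. dist (sq (L n) i) (cl v i) < e" by blast
  qed
  hence lim: "(%n. sq (L n)) \<longlonglongrightarrow> cl v"
   using limitin_componentwise[of "%_. euclideanreal" UNIV "%n. sq (L n)" "cl v" sequentially] by (simp add: euclidean_product_topology)
  have "(%n. w (sq (L n))) \<longlonglongrightarrow> w (cl v)" if "connective w" for w
   by (rule continuous_on_tendsto_compose[OF _ lim]) (insert that cube, auto simp: connective_def sq_def)
  from this[OF u(1)] this[OF u(2)] show ?thesis unfolding eq by (rule LIMSEQ_unique)
 qed
 \<comment> \<open>A real value is recorded by the rationals above it, which turns a connective into
   a subset of a countable set.\<close>
 define g where "g c = {(l, q :: rat). c (sq l) < real_of_rat q}" for c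
 have clsq: "cl (sq l) = sq l" for l by (simp add: sq_def cl_def fun_eq_iff)
 have "inj_on g ?C"
 proof (rule inj_onI)
  fix c c' assume "c : ?C" "c' : ?C" and gg: "g c = g c'"
  then obtain u u' where c: "c = (%v. u (cl v))" "c' = (%v. u' (cl v))" and u: "connective u" "connective u'" unfolding cl_def[abs_def] by blast
  have "u (sq l) = u' (sq l)" for l
  proof (rule ccontr)
   assume ne: "u (sq l) ~= u' (sq l)"
   have "c (sq l) < real_of_rat q <-> c' (sq l) < real_of_rat q" for q using gg by (auto simp: g_def set_eq_iff)
   thus False using ne of_rat_dense[of "u (sq l)" "u' (sq l)"] of_rat_dense[of "u' (sq l)" "u (sq l)"]
    unfolding c clsq by (meson linorder_neqE_linordered_idom less_asym)
  qed
  from det[OF u this] show "c = c'" unfolding c by (rule ext)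
 qed
 hence "|?C| <=o |UNIV :: (rat list \<times> rat) set set|" unfolding card_of_ordLeq[symmetric] by blast
 also have "|UNIV :: (rat list \<times> rat) set set| <=o |Pow W|"
 proof -
  have "countable (UNIV :: (rat list \<times> rat) set)" by simp
  then obtain to :: "rat list \<times> rat => nat" where "inj to" unfolding countable_def by blast
  moreover obtain e :: "nat => _" where "inj e" "range e <= W" using infinite_countable_subset[OF assms] by blast
  ultimately have "inj (e o to)" "range (e o to) <= W" by (auto intro: inj_compose)
  thus ?thesis unfolding card_of_ordLeq[symmetric] by (intro exI[of _ "image (e o to)"]) (auto simp: inj_def inj_image_eq_iff)
 qed
 finally show ?thesis .
qed

section \<open>A Loewenheim-Skolem argument\<close>

context monster
begin

definition symbols :: "('s var + ('f + 'r)) set" where "symbols = UNIV <+> (funs L <+> rels L)"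

text \<open>This size is below \<kappa> and is preserved by passing to countable sequences.\<close>

abbreviation "tiny X == |X| <=o |Pow symbols|"

lemma infinite_symbols: "infinite symbols"
proof
 assume "finite symbols"
 hence "finite (UNIV :: 's var set)" by (simp add: symbols_def)
 moreover obtain s0 :: 's where True by simp
 ultimately have "finite ((%n :: nat. (s0, n)) ` UNIV)" using finite_subset[OF subset_UNIV] by blast
 thus False by (simp add: finite_image_iff inj_on_def)
qed

lemma tiny_Un: "tiny X ==> tiny Y ==> tiny (X Un Y)"
 using card_of_Un_ordLeq_infinite_Field[of "|Pow symbols|" X Y, OF _ _ _ card_of_Card_order] infinite_symbols by (simp add: Field_card_of)

lemma tiny_Times: "tiny X ==> tiny Y ==> tiny (X \<times> Y)"
 using card_of_Times_ordLeq_infinite_Field[of "|Pow symbols|" X Y, OF _ _ _ card_of_Card_order] infinite_symbols by (simp add: Field_card_of)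

lemma tiny_image: "tiny X ==> tiny (f ` X)" using card_of_image ordLeq_transitive by blast

lemma tiny_seqs: "tiny X ==> tiny {f :: nat => _. range f <= X}" by (rule card_functions_le[OF infinite_symbols]) simp_all

lemma tiny_inj: "inj_on f X ==> f ` X <= symbols ==> tiny X"
 using card_of_ordLeq[of X symbols] ordLeq_transitive[OF _ ordLess_imp_ordLeq[OF card_of_Pow]] by blast

lemma tiny_basic: "tiny (UNIV :: 's var set)" "tiny (funs L)" "tiny (rels L)" "tiny (UNIV :: nat set)" "tiny (UNIV :: 's set)"
proof -
 show "tiny (UNIV :: 's var set)" by (rule tiny_inj[of Inl]) (auto simp: symbols_def)
 show "tiny (funs L)" by (rule tiny_inj[of "Inr o Inl"]) (auto simp: symbols_def inj_on_def)
 show "tiny (rels L)" by (rule tiny_inj[of "Inr o Inr"]) (auto simp: symbols_def inj_on_def)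
 show "tiny (UNIV :: nat set)" by (rule tiny_inj[of "%n. Inl (undefined, n)"]) (auto simp: symbols_def inj_on_def)
 show "tiny (UNIV :: 's set)" by (rule tiny_inj[of "%s. Inl (s, 0)"]) (auto simp: symbols_def inj_on_def)
qed

lemma tiny_closure:
 fixes B :: "'x set" and Ops :: "((nat => 'x) => 'x) set"
 assumes "tiny B" "B ~= {}" "tiny Ops"
 shows "EX S. B <= S & (ALL q:Ops. ALL f. range f <= S --> q f : S) & tiny S &
  (ALL Q. B <= Q & (ALL q:Ops. ALL f. range f <= Q --> q f : Q) --> S <= Q)"
 by (rule closure_card[OF infinite_symbols assms])

text \<open>Formulas themselves can be too numerous, as a connective is arbitrary outside the cube.
  Their value functions on \<open>AS U\<close>, however, lie in a set generated by
  \<open>tiny\<close> many operations, which read finitely supported argument lists from countable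
  sequences.\<close>

lemma formula_functions:
 "EX \<D>. tiny \<D> & (ALL ph. wf_fml L no_params ph --> (EX F:\<D>. ALL a:AS U. F a = fval U a ph))"
proof -
 let ?B = "(%v a. a v) ` (UNIV :: 's var set)" and ?O = "(%f g a. ifun U f (map (%i. g i a) [0..<length (fargs L f)])) ` funs L"
 have "tiny ?B" "tiny ?O" by (intro tiny_image tiny_basic)+
 from tiny_closure[OF this(1) _ this(2)] obtain \<T> where T: "?B <= \<T>" "ALL q:?O. ALL f. range f <= \<T> --> q f : \<T>" "tiny \<T>" by auto
 have tm: "(%a. tval U a t) : \<T>" if "wf_trm L no_params t s" for t s using that
 proof (induction rule: wf_trm.induct)
  case (1 v)
  thus ?case using T(1) by auto
 next
  case (3 f ts)
  hence len: "length ts = length (fargs L f)" and ts: "!!i. i < length ts ==> (%a. tval U a (ts ! i)) : \<T>"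
   by (auto simp: list_all2_conv_all_nth)
  define g where "g i = (if i < length ts then (%a. tval U a (ts ! i)) else (%a. a undefined))" for i
  have "range g <= \<T>" using ts T(1) by (auto simp: g_def)
  with bspec[OF T(2) imageI[OF 3(1)]] have "(%a. ifun U f (map (%i. g i a) [0..<length (fargs L f)])) : \<T>" by simp
  moreover have "map (%i. g i a) [0..<length (fargs L f)] = map (tval U a) ts" for a by (rule nth_equalityI) (auto simp: len g_def)
  ultimately show ?case by simp
 qed simp
 \<comment> \<open>Clipping forgets the values of a connective outside the cube and leaves the
   values of formulas unchanged.\<close>
 define cl where "cl v i = max 0 (min 1 (v i :: real))" for v and i :: nat
 define B2 where "B2 = {%a. 0 :: real} Un ((%(s, t, u) a. sdist U s (t a) (u a)) ` (UNIV \<times> \<T> \<times> \<T>) Un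
  (%(r, g) a. irel U r (map (%i. g i a) [0..<length (rargs L r)])) ` (rels L \<times> {g. range g <= \<T>}))"
 define O2 where "O2 = (%u g a. u (%i. g i a)) ` {%v. u (cl v) | u. connective u} Un
  ((%(w :: 's var) g a. SUP u\<in>univ U (fst w). g (0 :: nat) (a(w := u))) ` UNIV Un (%(w :: 's var) g a. INF u\<in>univ U (fst w). g (0 :: nat) (a(w := u))) ` UNIV)"
 have "tiny {%v. u (cl v) | u. connective u}" using card_connectives[OF infinite_symbols] by (simp add: cl_def[abs_def])
 note C = this
 have O: "tiny O2" unfolding O2_def by (intro tiny_Un tiny_image tiny_basic C)
 have "tiny B2" unfolding B2_def by (intro tiny_Un tiny_image tiny_Times tiny_basic T(3) tiny_seqs card_of_singl_ordLeq) auto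
 moreover have "B2 ~= {}" by (simp add: B2_def)
 ultimately obtain \<D> where D: "B2 <= \<D>" "ALL q:O2. ALL f. range f <= \<D> --> q f : \<D>" "tiny \<D>"
  using tiny_closure[of B2 O2] O by blast
 have "EX F:\<D>. ALL a:AS U. F a = fval U a ph" if "wf_fml L no_params ph" for ph using that
 proof (induction ph)
  case (Dst s t u)
  hence "(%a. sdist U s (tval U a t) (tval U a u)) : B2" unfolding B2_def using tm[of t s] tm[of u s] by force
  thus ?case using D(1) by (intro bexI[of _ "%a. sdist U s (tval U a t) (tval U a u)"]) auto
 next
  case (Rel r ts)
  hence len: "length ts = length (rargs L r)" and ts: "!!i. i < length ts ==> (%a. tval U a (ts ! i)) : \<T>"
   using tm by (auto simp: list_all2_conv_all_nth)
  define g where "g i = (if i < length ts then (%a. tval U a (ts ! i)) else (%a. a undefined))" for i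
  have g: "range g <= \<T>" using ts T(1) by (auto simp: g_def)
  have "(%a. irel U r (map (%i. g i a) [0..<length (rargs L r)])) : B2" unfolding B2_def using Rel g by (intro UnI2 image_eqI[of _ _ "(r, g)"]) auto
  moreover have "map (%i. g i a) [0..<length (rargs L r)] = map (tval U a) ts" for a by (rule nth_equalityI) (auto simp: len g_def)
  ultimately show ?case using D(1) by (intro bexI[of _ "%a. irel U r (map (tval U a) ts)"]) auto
 next
  case (Conn u phs)
  have "ALL ph:set phs. EX F. F : \<D> & (ALL a:AS U. F a = fval U a ph)"
  proof
   fix ph assume ph: "ph : set phs"
   hence "wf_fml L no_params ph" using Conn.prems by simp
   from Conn.IH[OF ph this] show "EX F. F : \<D> & (ALL a:AS U. F a = fval U a ph)" by blast
  qed
  from bchoice[OF this] obtain G where G: "ALL ph:set phs. G ph : \<D> & (ALL a:AS U. G ph a = fval U a ph)" by blast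
  define g where "g i = (if i < length phs then G (phs ! i) else (%a. 0))" for i
  have "range g <= \<D>" using G D(1) by (auto simp: g_def B2_def)
  moreover have q: "(%g a. u (cl (%i. g i a))) : O2" unfolding O2_def using Conn.prems by (intro UnI1 image_eqI[of _ _ "%v. u (cl v)"]) auto
  ultimately have "(%a. u (cl (%i. g i a))) : \<D>" using bspec[OF D(2) q] by (auto dest: spec[of _ g])
  moreover have "u (cl (%i. g i a)) = fval U a (Conn u phs)" if a: "a : AS U" for a
  proof -
   have "cl (%i. g i a) i = nth_default 0 (map (fval U a) phs) i" for i
   proof (cases "i < length phs")
    case True
    hence "fval U a (phs ! i) : {0..1}" using Conn.prems by (intro fval_01[OF _ _ a]) auto
    thus ?thesis using True G a by (simp add: cl_def g_def nth_default_def)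
   qed (simp add: cl_def g_def nth_default_def)
   hence "cl (%i. g i a) = nth_default 0 (map (fval U a) phs)" by (rule ext)
   thus ?thesis by simp
  qed
  ultimately show ?case by (intro bexI[of _ "%a. u (cl (%i. g i a))"]) auto
 next
  case (SupQ w ph)
  then obtain F where F: "F : \<D>" "ALL a:AS U. F a = fval U a ph" by auto
  have q: "(%g a. SUP u\<in>univ U (fst w). g (0 :: nat) (a(w := u))) : O2" unfolding O2_def by blast
  hence "(%a. SUP u\<in>univ U (fst w). F (a(w := u))) : \<D>" using bspec[OF D(2) q] F(1) by (auto dest: spec[of _ "%_. F"])
  thus ?case by (rule bexI[rotated]) (auto intro!: SUP_cong F(2)[rule_format] asg_upd)
 next
  case (InfQ w ph)
  then obtain F where F: "F : \<D>" "ALL a:AS U. F a = fval U a ph" by auto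
  have q: "(%g a. INF u\<in>univ U (fst w). g (0 :: nat) (a(w := u))) : O2" unfolding O2_def by blast
  hence "(%a. INF u\<in>univ U (fst w). F (a(w := u))) : \<D>" using bspec[OF D(2) q] F(1) by (auto dest: spec[of _ "%_. F"])
  thus ?case by (rule bexI[rotated]) (auto intro!: INF_cong F(2)[rule_format] asg_upd)
 qed
 thus ?thesis using D(3) by blast
qed

text \<open>A sequence of elements tagged by sorts, read as an assignment along an enumeration
  \<open>e\<close> of variables; \<open>a0\<close> supplies the value where the variable is not
  enumerated or the sorts disagree.\<close>

definition decode :: "('s var => 'a) => (nat => 's var) => (nat => 's \<times> 'a) => 's var => 'a" where
 "decode a0 e g v = (if v : range e & fst (g (inv e v)) = fst v then snd (g (inv e v)) else a0 v)"

text \<open>Skolem operations that solve countably many conditions exactly. A single exact condition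
  gives closure under function symbols and the same attained values of formulas; countably many at
  once give limits of Cauchy sequences.\<close>

theorem small_submodel_exists:
 assumes C: "countable C" "!!s a. (s, a) : C ==> a : univ U s"
 shows "EX M. small_model L \<kappa> T U M & (ALL (s, a):C. a : univ M s)"
proof -
 obtain a0 where a0: "a0 : AS U" using asg_ne by blast
 obtain \<D> where D: "tiny \<D>" "!!ph. wf_fml L no_params ph ==> EX F:\<D>. ALL a:AS U. F a = fval U a ph"
  using formula_functions by blast
 define wit where "wit = (%(Fs, w, e) g u. u : univ U (fst w) & (ALL n :: nat. Fs n ((decode a0 e g)(w := u)) = (0 :: real)))"
 \<comment> \<open>Without a witness the operation returns an element that is already
   present.\<close>
 define ops where "ops = (%(Fs, w, e) g. if EX u. wit (Fs, w, e) g u then (fst w, SOME u. wit (Fs, w, e) g u) else g 0)"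
 let ?B = "C Un (%s. (s, a0 (s, 0))) ` UNIV" and ?O = "ops ` ({Fs. range Fs <= \<D>} \<times> UNIV \<times> {e. range e <= UNIV})"
 have tC: "tiny C"
 proof -
  obtain f :: "'s \<times> 'a => nat" where "inj_on f C" using C(1) unfolding countable_def by blast
  thus ?thesis by (intro tiny_inj[of "%c. Inl (undefined, f c)"]) (auto simp: symbols_def inj_on_def)
 qed
 have B: "tiny ?B" by (intro tiny_Un tiny_image tiny_basic tC)
 have O: "tiny ?O" by (intro tiny_image tiny_Times tiny_basic tiny_seqs D(1))
 have "?B ~= {}" by blast
 from tiny_closure[OF B this O] obtain S where S: "?B <= S" "tiny S"
  and clo: "ALL q:?O. ALL f. range f <= S --> q f : S"
  and min: "ALL Q. ?B <= Q & (ALL q:?O. ALL f. range f <= Q --> q f : Q) --> S <= Q"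
  by (elim exE conjE) (rule that)
 define M where "M = U\<lparr>univ := %s. {a. (s, a) : S}\<rparr>"
 have M: "a : univ M s <-> (s, a) : S" "sdist M = sdist U" "ifun M = ifun U" "irel M = irel U" for a s by (simp_all add: M_def)
 \<comment> \<open>Minimality of the closure confines it to elements tagged with their own
   sorts.\<close>
 have "S <= {(s, a). a : univ U s}"
 proof (rule min[rule_format], intro conjI ballI allI impI)
  show "?B <= {(s, a). a : univ U s}" using C(2) asgD[OF a0, of "(_, 0)"] by auto
  fix q and g :: "nat => 's \<times> 'a" assume q: "q : ?O" and g: "range g <= {(s, a). a : univ U s}"
  obtain Fs w e where l: "q = ops (Fs, w, e)" using q by auto
  have "(SOME u. wit (Fs, w, e) g u) : univ U (fst w)" if "EX u. wit (Fs, w, e) g u" using someI_ex[OF that] by (simp add: wit_def)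
  thus "q g : {(s, a). a : univ U s}" using g by (auto simp: l ops_def image_subset_iff)
 qed
 hence sub: "univ M s <= univ U s" for s using M(1) by blast
 have MU: "a : AS U" if "a : AS M" for a using asg_mono[of "univ M" "univ U"] sub that by blast
 define a1 where "a1 v = a0 (fst v, 0)" for v :: "'s var"
 have a1: "a1 : AS M" using S(1) M(1) by (intro asgI) (auto simp: a1_def)
 have realize: "EX u':univ M (fst w). ALL n. Fs n (a(w := u')) = 0"
  if Fs: "!!n :: nat. Fs n : Def UNIV" and a: "a : AS M" and u: "u : univ U (fst w)" "!!n. Fs n (a(w := u)) = 0" for Fs w a u
 proof -
  have "ALL n. EX V. finite V & Fs n : Def V" using Def_finite_support[OF Fs] by metis
  then obtain V where V: "!!n. finite (V n)" "!!n. Fs n : Def (V n)" by metis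
  have "EX F:\<D>. ALL a:AS U. F a = Fs n a" for n
  proof -
   obtain ph where "ph : F0 L (V n)" "ALL a:AS U. Fs n a = fval U a ph" using V(2) unfolding Def_def by blast
   thus ?thesis using D(2)[of ph] by (auto simp: Fml_def)
  qed
  then obtain Gs where Gs: "!!n. Gs n : \<D>" "!!n a. a : AS U ==> Gs n a = Fs n a" by metis
  define e where "e = from_nat_into (insert w (UN n. V n))"
  have re: "range e = insert w (UN n. V n)" unfolding e_def by (rule range_from_nat_into) (insert V(1), auto intro: countable_finite)
  define g where "g n = (fst (e n), a (e n))" for n
  have "(fst v, a v) : S" for v using asgD[OF a, of v] M(1) by blast
  hence g: "range g <= S" unfolding g_def by blast
  have dec: "decode a0 e g v = a v" if "v : insert w (UN n. V n)" for v using f_inv_into_f[of v e UNIV] that re by (simp add: decode_def g_def)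
  have dU: "decode a0 e g : AS U" by (rule asgI) (insert asgD[OF a0] asgD[OF MU[OF a]], auto simp: decode_def g_def f_inv_into_f)
  have Gd: "Gs n ((decode a0 e g)(w := u)) = Fs n (a(w := u))" if "u : univ U (fst w)" for u n unfolding Gs(2)[OF asg_upd[OF dU that]]
   by (rule Def_cong[OF V(2) asg_upd[OF dU that] asg_upd[OF MU[OF a] that]]) (use dec in auto)
  have "wit (Gs, w, e) g u" using u Gd by (simp add: wit_def)
  hence wi: "wit (Gs, w, e) g (SOME u. wit (Gs, w, e) g u)" (is "wit _ _ ?u") by (rule someI)
  have "ops (Gs, w, e) : ?O" using Gs(1) by blast
  with clo g have "ops (Gs, w, e) g : S" by blast
  hence "?u : univ M (fst w)" using wi unfolding M(1) ops_def prod.case by (simp only: exI[of "wit (Gs, w, e) g"] if_True)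
  moreover have "Fs n (a(w := ?u)) = 0" for n using wi Gd[of ?u n] by (simp add: wit_def)
  ultimately show ?thesis by blast
 qed
 have realize1: "EX u':univ M (fst w). F (a(w := u')) = F (a(w := u))"
  if F: "F : Def UNIV" and a: "a : AS M" and u: "u : univ U (fst w)" for F w a u
  using realize[of "%_ a'. \<bar>F a' - F (a(w := u))\<bar>", OF Def_absdiff[OF F Def_const[OF Def_01[OF F asg_upd[OF MU[OF a] u]]]] a u] by auto
 have fn: "ifun U f as : univ M (fres L f)" if f: "f : funs L" "sorted_tuple M (fargs L f) as" for f as
 proof -
  let ?n = "length (fargs L f)" and ?s = "fres L f"
  have as: "length as = ?n" "!!i. i < ?n ==> as ! i : univ M (fargs L f ! i)" using f(2) by (auto simp: list_all2_conv_all_nth)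
  define a where "a v = (if snd v < ?n & fst v = fargs L f ! snd v then as ! snd v else a1 v)" for v
  have a: "a : AS M" by (rule asgI) (insert as(2) asgD[OF a1], auto simp: a_def)
  let ?t = "Fn f (map (%i. Var (fargs L f ! i, i)) [0..<?n]) :: ('s, 'f, 'a) trm"
  have V: "wf_trm L no_params (Var (s, i)) s" for s i using wf_trm.intros(1)[of L no_params "(s, i)"] by simp
  have "Dst ?s (Var (?s, ?n)) ?t : F0 L UNIV" unfolding Fml_def by (auto intro!: wf_trm.intros(3)[OF f(1)] simp: list_all2_conv_all_nth V)
  from Def_fval[OF this] have F: "(%a. fval U a (Dst ?s (Var (?s, ?n)) ?t)) : Def UNIV" .
  have fU: "ifun U f as : univ U ?s" by (rule ifun_in[OF f(1)]) (insert as sub, auto simp: list_all2_conv_all_nth)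
  have val: "fval U (a((?s, ?n) := u)) (Dst ?s (Var (?s, ?n)) ?t) = sdist U ?s u (ifun U f as)" for u
  proof -
   have "map (tval U (a((?s, ?n) := u))) (map (%i. Var (fargs L f ! i, i)) [0..<?n]) = as" by (rule nth_equalityI) (auto simp: as(1) a_def)
   thus ?thesis by (simp del: map_map)
  qed
  obtain u where u: "u : univ M ?s" "sdist U ?s u (ifun U f as) = sdist U ?s (ifun U f as) (ifun U f as)"
   using realize1[OF F a, of "ifun U f as" "(?s, ?n)"] fU unfolding val by auto
  hence "u = ifun U f as" using Metric_space.zero[OF metric_space_U] sub fU by (metis subsetD)
  thus ?thesis using u(1) by simp
 qed
 have "Metric_space.mcomplete (univ M s) (sdist U s)" for s
 proof -
  interpret X: Metric_space "univ U s" "sdist U s" by (rule metric_space_U)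
  interpret Y: Metric_space "univ M s" "sdist U s" by (rule X.subspace[OF sub])
  have comp: "X.mcomplete" using metric unfolding metric_structure_def by blast
  show ?thesis unfolding Y.mcomplete_def
  proof (intro allI impI)
   fix sg assume sg: "Y.MCauchy sg"
   hence "X.MCauchy sg" using sub unfolding Y.MCauchy_def X.MCauchy_def by blast
   then obtain l where "limitin X.mtopology sg l sequentially" using comp unfolding X.mcomplete_def by blast
   hence l: "l : univ U s" "ALL ep>0. EX N. ALL n>=N. sg n : univ U s & sdist U s (sg n) l < ep" unfolding X.limit_metric_sequentially by auto
   have sgM: "sg n : univ M s" for n using sg unfolding Y.MCauchy_def by auto
   define a where "a v = (if fst v = s & 0 < snd v then sg (snd v - 1) else a1 v)" for v
   have a: "a : AS M" by (rule asgI) (insert sgM asgD[OF a1], auto simp: a_def)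
   \<comment> \<open>The conditions ask that \<open>u\<close> be at least as close as
     \<open>l\<close> to every \<open>sg n\<close>, which makes \<open>u\<close> a limit inside
     \<open>M\<close>.\<close>
   have "EX u:univ M (fst (s, 0 :: nat)). ALL n. max 0 (sdist U s ((a((s, 0) := u)) (s, Suc n)) ((a((s, 0) := u)) (s, 0)) - sdist U s (sg n) l) = 0"
   proof (rule realize[OF _ a])
    show "(%a. max 0 (sdist U s (a (s, Suc n)) (a (s, 0)) - sdist U s (sg n) l)) : Def UNIV" for n
     using Def_dist[of "(s, 0)" "(s, Suc n)" UNIV] sdist_01[OF subsetD[OF sub sgM] l(1)] by (intro Def_diff0 Def_const) auto
   qed (insert l(1), auto simp: a_def)
   then obtain u where u: "u : univ M s" and "ALL n. max 0 (sdist U s (sg n) u - sdist U s (sg n) l) = 0" by (auto simp: a_def)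
   hence "sdist U s (sg n) u <= sdist U s (sg n) l" for n by (metis max.cobounded2 diff_le_0_iff_le)
   hence "limitin Y.mtopology sg u sequentially" unfolding Y.limit_metric_sequentially using u l(2) sgM by (meson le_less_trans)
   thus "EX l. limitin Y.mtopology sg l sequentially" ..
  qed
 qed
 note complete = this
 have sU: "sorted_tuple U ss as" if "sorted_tuple M ss as" for ss as using that sub unfolding list_all2_conv_all_nth by blast
 have mM: "metric_structure L M" unfolding metric_structure_def M(2-4)
 proof (intro conjI allI ballI impI)
  fix s
  show "univ M s ~= {}" using asgD[OF a1, of "(s, 0)"] by auto
  show "Metric_space (univ M s) (sdist U s)" by (rule Metric_space.subspace[OF metric_space_U sub])
  show "Metric_space.mcomplete (univ M s) (sdist U s)" by (rule complete)
  show "sdist U s a b <= 1" if "a : univ M s" "b : univ M s" for a b using sdist_01[of a s b] that sub by auto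
 next
  fix f as assume f: "f : funs L" "sorted_tuple M (fargs L f) as"
  show "ifun U f as : univ M (fres L f)" by (rule fn[OF f])
  fix ep :: real and bs
  assume "0 < ep" "sorted_tuple M (fargs L f) bs & close_tuples U (fargs L f) (fmod L f ep) as bs"
  thus "sdist U (fres L f) (ifun U f as) (ifun U f bs) <= ep"
   using metric[unfolded metric_structure_def, THEN conjunct2, THEN conjunct1, rule_format, OF f(1) sU[OF f(2)], THEN conjunct2, rule_format] sU unfolding M(2) by blast
 next
  fix r as assume r: "r : rels L" "sorted_tuple M (rargs L r) as"
  show "irel U r as : {0..1}" by (rule irel_01[OF r(1) sU[OF r(2)]])
  fix ep :: real and bs
  assume "0 < ep" "sorted_tuple M (rargs L r) bs & close_tuples U (rargs L r) (rmod L r ep) as bs"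
  thus "\<bar>irel U r as - irel U r bs\<bar> <= ep"
   using metric[unfolded metric_structure_def, THEN conjunct2, THEN conjunct2, rule_format, OF r(1) sU[OF r(2)], THEN conjunct2, rule_format] sU unfolding M(2) by blast
 qed
 have tv: "tval M a t = tval U a t" for a t by (induction t) (simp_all add: M(3) cong: map_cong)
 have el: "fval M a ph = fval U a ph" if "wf_fml L no_params ph" "a : AS M" for ph a using that
 proof (induction ph arbitrary: a)
  case (Conn u phs)
  hence "map (fval M a) phs = map (fval U a) phs" by auto
  thus ?case by (simp del: map_eq_conv)
 next
  \<comment> \<open>A quantifier ranges over the same set of values in both structures, since every
    value attained in \<open>U\<close> is attained in \<open>M\<close>.\<close>
  have im: "(%u. fval M (a(w := u)) ph) ` univ M (fst w) = (%u. fval U (a(w := u)) ph) ` univ U (fst w)"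
   if ph: "wf_fml L no_params ph" and a: "a : AS M" and IH: "!!a. a : AS M ==> fval M a ph = fval U a ph" for ph w a
  proof -
   have F: "(%a. fval U a ph) : Def UNIV" using ph by (intro Def_fval) (simp add: Fml_def)
   have "(%u. fval M (a(w := u)) ph) ` univ M (fst w) = (%u. fval U (a(w := u)) ph) ` univ M (fst w)" by (intro image_cong refl IH asg_upd a)
   also have "\<dots> = (%u. fval U (a(w := u)) ph) ` univ U (fst w)"
   proof (intro equalityI image_mono[OF sub] image_subsetI)
    fix u assume "u : univ U (fst w)"
    thus "fval U (a(w := u)) ph : (%u. fval U (a(w := u)) ph) ` univ M (fst w)" using realize1[OF F a] by (metis imageI)
   qed
   finally show ?thesis .
  qed
  {
   case (SupQ w ph)
   thus ?case using im[of ph a w] by simp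
  next
   case (InfQ w ph)
   thus ?case using im[of ph a w] by simp
  }
 qed (simp_all add: M(2,4) tv cong: map_cong)
 interpret MM: metric_model L M by unfold_locales (rule mM)
 have el': "fval M a ph = fval U a ph" if f: "ph : F0 L x" and at: "a : tuples M x" for x a and ph :: "('s, 'f, 'r, 'a) fml"
 proof -
  obtain b where b: "b : AS M" "!!v. v : x ==> b v = a v" using MM.tuples_extend[OF at] by blast
  have "fval N a ph = fval N b ph" for N :: "('s, 'f, 'r, 'a) mstruct" by (rule fval_cong) (insert f b(2), auto simp: Fml_def)
  thus ?thesis using el[OF _ b(1), of ph] f by (simp add: Fml_def)
 qed
 have "elementary_substructure L M U" unfolding elementary_substructure_def using mM metric sub M el' by auto
 moreover have "models L T M" unfolding models_def
 proof (intro conjI ballI mM)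
  fix sg assume "sg : T"
  hence sg: "sg : F0 L {}" "fval U undefined sg = 0" using monster by (auto simp: monster_model_def Th_def)
  have "fval N undefined sg = fval N (%_. undefined) sg" for N :: "('s, 'f, 'r, 'a) mstruct" by (rule fval_cong) (insert sg(1), auto simp: Fml_def)
  thus "fval M undefined sg = 0" using el'[OF sg(1), of "%_. undefined"] sg(2) by (simp add: tuples_def)
 qed
 moreover have "small \<kappa> (univ M)"
 proof -
  have "(SIGMA s:UNIV. univ M s) = S" using M(1) by auto
  moreover have "|Pow symbols| <o \<kappa>" using monster unfolding monster_model_def symbols_def by blast
  ultimately show ?thesis unfolding small_def using S(2) ordLeq_ordLess_trans by metis
 qed
 ultimately have "small_model L \<kappa> T U M" by (simp add: small_model_def)
 moreover have "ALL (s, a):C. a : univ M s" using S(1) M(1) by auto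
 ultimately show ?thesis by blast
qed

end

section \<open>Averages of finitely many points\<close>

text \<open>An image of the uniform distribution on indices, so points are counted with
  multiplicity.\<close>

definition average :: "'b topology => nat => (nat => 'b) => 'b measure" where
 "average X N q = distr (measure_pmf (pmf_of_set {..<N})) (borel_of_space X) q"

lemma
 assumes q: "!!j. q j : topspace X" and N: "0 < N"
 shows sets_average: "sets (average X N q) = sets (borel_of_space X)"
  and average_measurable: "q : measurable (measure_pmf (pmf_of_set {..<N})) (borel_of_space X)"
  and prob_space_average: "prob_space (average X N q)"
  and integral_average: "integrable (average X N q) f ==> (\<integral>p. f p \<partial>average X N q) = (SUM j<N. f (q j)) / N"
  and measure_average: "B : sets (borel_of_space X) ==> measure (average X N q) B = (SUM j<N. indicator B (q j)) / N"
proof -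
 let ?P = "measure_pmf (pmf_of_set {..<N})"
 show m: "q : measurable ?P (borel_of_space X)" using q by (auto simp: space_borel_of_space)
 show s: "sets (average X N q) = sets (borel_of_space X)" by (simp add: average_def)
 show P: "prob_space (average X N q)" unfolding average_def by (rule prob_space.prob_space_distr[OF measure_pmf.prob_space_axioms m])
 have ne: "{..<N} ~= {}" using N by auto
 show I: "(\<integral>p. f p \<partial>average X N q) = (SUM j<N. f (q j)) / N" if "integrable (average X N q) f" for f
 proof -
  have "f : borel_measurable (borel_of_space X)" using borel_measurable_integrable[OF that] measurable_cong_sets[OF s refl] by blast
  thus ?thesis unfolding average_def by (simp add: integral_distr[OF m] integral_pmf_of_set ne)
 qed
 fix B assume B: "B : sets (borel_of_space X)"
 interpret A: prob_space "average X N q" by (rule P)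
 have "measure (average X N q) B = (\<integral>p. indicator B p \<partial>average X N q)"
  using sets.sets_into_space[OF B] sets_eq_imp_space_eq[OF s] by (simp add: Int_absorb2)
 also have "\<dots> = (SUM j<N. indicator B (q j)) / N" by (rule I) (insert B s, auto simp: less_top[symmetric])
 finally show "measure (average X N q) B = (SUM j<N. indicator B (q j)) / N" .
qed

text \<open>Finite sets are closed and compact here. Removing the points outside \<open>B\<close>
  from the space gives \<open>V\<close>, and taking the points inside \<open>B\<close> gives
  \<open>K\<close>; the difference contains none of the points.\<close>

lemma regular_average:
 assumes q: "!!j. q j : topspace X" and N: "0 < N" and X: "t1_space X"
 shows "regular_borel_probability X (average X N q)" unfolding regular_borel_probability_def
proof (intro conjI ballI allI impI prob_space_average sets_average q N)
 fix B and ep :: real assume B: "B : sets (average X N q)" and ep: "0 < ep"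
 let ?K = "q ` {j:{..<N}. q j : B}" and ?C = "q ` {j:{..<N}. q j ~: B}"
 have BX: "B <= topspace X" using sets.sets_into_space[OF B[unfolded sets_average[OF q N]]] by (simp add: space_borel_of_space)
 have K: "compactin X ?K" by (rule finite_imp_compactin) (use q in auto)
 have C: "closedin X ?K" "closedin X ?C" by (intro t1_space_closedin_finite[THEN iffD1, OF X, rule_format] conjI; use q in auto)+
 hence V: "openin X (topspace X - ?C)" by (simp add: openin_diff)
 have "openin X (topspace X - ?C - ?K)" by (rule openin_diff[OF V C(1)])
 hence "topspace X - ?C - ?K : sets (borel_of_space X)" unfolding sets_borel_of_space by (intro sigma_sets.Basic) simp
 hence "measure (average X N q) (topspace X - ?C - ?K) = (SUM j<N. indicator (topspace X - ?C - ?K) (q j)) / N" by (rule measure_average[OF q N])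
 also have "(SUM j<N. indicator (topspace X - ?C - ?K) (q j)) = (0 :: real)" by (rule sum.neutral) (auto simp: indicator_def)
 finally show "EX K V. compactin X K & openin X V & K <= B & B <= V & measure (average X N q) (V - K) < ep"
  using K V BX ep by (intro exI[of _ ?K] exI[of _ "topspace X - ?C"]) auto
qed

lemma wf_finst_params:
 assumes "wf_fml L A ph" "ALL v:z. d v : A (fst v)"
 shows "wf_fml L A (finst z d ph)"
proof -
 have "wf_trm L A (tinst z d t) s" if "wf_trm L A t s" "ALL v:z. d v : A (fst v)" for t s z
  using that by (induction rule: wf_trm.induct) (auto intro!: wf_trm.intros simp: list_all2_conv_all_nth)
 thus ?thesis using assms by (induction ph arbitrary: z) (auto simp: list_all2_conv_all_nth)
qed

context small_submodel
begin

lemma t1_type_space: "t1_space (type_space L U A x)" unfolding type_space_def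
 by (intro Hausdorff_imp_t1_space Hausdorff_space_subtopology) (simp add: Hausdorff_space_product_topology Hausdorff_space_euclidean)

lemma average_keisler:
 assumes "!!j. a j : AS U" "!!s. A s <= univ U s" "0 < N"
 shows "average (type_space L U A x) N (%j. tp L U A x (a j)) : keisler_measures L U A x" unfolding keisler_measures_def
 by (intro CollectI regular_average assms(3) t1_type_space) (simp add: topspace_type_space tp_in_types assms)

text \<open>The same average over \<open>U\<close> is the global extension. Its integrals are finite
  averages of formulas over \<open>M\<close> in the parameter, whence definability and invariance,
  and it is itself a convex combination of Dirac measures.\<close>

lemma average_generically_stable:
 assumes a: "!!j. a j : AS M" and N: "0 < N" and x: "finite x"
 shows "generically_stable L U M x (average (type_space L U (univ M) x) N (%j. tp L U (univ M) x (a j)))"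
proof -
 let ?X = "type_space L U (univ U) x" and ?Y = "type_space L U (univ M) x"
 let ?q = "%j. tp L U (univ U) x (a j)"
 define nu where "nu = average ?X N ?q"
 have nu: "nu : keisler_measures L U (univ U) x" unfolding nu_def by (rule average_keisler[OF asg_sub[OF a] subset_refl N])
 have q: "?q j : topspace ?X" for j by (simp add: topspace_type_space tp_in_types asg_sub[OF a])
 have le: "univ M <= univ U" using univ_sub by (simp add: le_fun_def)
 have "restrict (?q j) (Fml L (univ M) x) = tp L U (univ M) x (a j)" for j
  unfolding tp_def using Fml_mono[of _ L "univ M" x "univ U" x] univ_sub by (intro ext) (simp add: restrict_def)
 hence "restrict_measure L U (univ M) x nu = average ?Y N (%j. tp L U (univ M) x (a j))" unfolding restrict_measure_def nu_def average_def
  by (subst distr_distr[OF measurable_of_continuous_map[OF continuous_map_restrict_types[OF le subset_refl]] average_measurable[OF q N]]) (simp add: comp_def)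
 moreover have F: "EX F. continuous_map (type_space L U (univ M) y) euclideanreal F &
   (ALL b:tuples U y. F (tp L U (univ M) y b) = (\<integral>p. p (finst y b ph) \<partial>nu))"
  if y: "finite y" "x Int y = {}" and ph: "ph : Fml L (univ M) (x Un y)" for y and ph :: "('s, 'f, 'r, 'a) fml"
 proof (intro exI[of _ "%p. (SUM j<N. p (finst x (a j) ph)) / N"] conjI ballI)
  have fx: "finst x (a j) ph : Fml L (univ M) y" for j
   using ph asgD[OF a, of j] wf_finst_params[of L "univ M" ph x "a j"] by (auto simp: Fml_def fvars_finst)
  thus "continuous_map (type_space L U (univ M) y) euclideanreal (%p. (SUM j<N. p (finst x (a j) ph)) / N)"
   by (intro continuous_intros continuous_map_real_divide continuous_map_sum continuous_map_eval) (use N in auto)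
  fix b assume b: "b : tuples U y"
  have fy: "finst y b ph : Fml L (univ U) x"
   using Fml_mono[OF ph univ_sub subset_refl] b wf_finst_params[of L "univ U" ph y b] by (auto simp: Fml_def fvars_finst tuples_def)
  have eq: "?q j (finst y b ph) = tp L U (univ M) y b (finst x (a j) ph)" for j unfolding tp_apply[OF fy] tp_apply[OF fx] fval_finst
   by (rule fval_cong) (insert ph y, auto simp: Fml_def override_on_def)
  have "(\<integral>p. p (finst y b ph) \<partial>nu) = (SUM j<N. ?q j (finst y b ph)) / N"
   unfolding nu_def by (rule integral_average[OF q N keisler_integrable[OF nu[unfolded nu_def] continuous_map_eval[OF fy]]])
  thus "(SUM j<N. tp L U (univ M) y b (finst x (a j) ph)) / N = (\<integral>p. p (finst y b ph) \<partial>nu)" by (simp only: eq)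
 qed
 hence "definable_measure L U (univ M) x nu" unfolding definable_measure_def by blast
 moreover have "invariant_measure L U (univ M) x nu" unfolding invariant_measure_def
 proof (intro allI impI ballI)
  fix y b b' and ph :: "('s, 'f, 'r, 'a) fml" assume "finite y & x Int y = {}" "ph : Fml L (univ M) (x Un y)"
   and b: "b : tuples U y" "b' : tuples U y" "tp L U (univ M) y b = tp L U (univ M) y b'"
  then obtain F where "ALL b:tuples U y. F (tp L U (univ M) y b) = (\<integral>p. p (finst y b ph) \<partial>nu)" using F[of y ph] by blast
  thus "(\<integral>p. p (finst y b ph) \<partial>nu) = (\<integral>p. p (finst y b' ph) \<partial>nu)" using b by metis
 qed
 moreover have "nu : weak_star_topology L U (univ U) x closure_of dirac_hull L U M x"
 proof -
  let ?r = "%j. restrict (a j) x"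
  \<comment> \<open>Different \<open>a j\<close> may have the same restriction to \<open>x\<close>,
    so the weights are collected for each tuple.\<close>
  let ?w = "%e. SUM j:{j:{..<N}. ?r j = e}. 1 / real N"
  have "measure nu B = (SUM e:?r ` {..<N}. ?w e * indicator B (tp L U (univ U) x e))" if B: "B : sets nu" for B
  proof -
   have "measure nu B = (SUM j<N. indicator B (?q j) / real N)"
    using measure_average[OF q N, of B] B sets_average[OF q N] by (simp add: nu_def sum_divide_distrib)
   also have "\<dots> = (SUM e:?r ` {..<N}. SUM j:{j:{..<N}. ?r j = e}. indicator B (?q j) / real N)" by (rule sum.image_gen) simp
   also have "\<dots> = (SUM e:?r ` {..<N}. ?w e * indicator B (tp L U (univ U) x e))" unfolding sum_distrib_right by (intro sum.cong refl) auto
   finally show ?thesis .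
  qed
  moreover have "sum ?w (?r ` {..<N}) = 1" using N by (subst sum.image_gen[symmetric]) simp_all
  moreover have "?r ` {..<N} <= tuples M x" using restrict_tuples[OF a] by blast
  ultimately have "nu : dirac_hull L U M x" unfolding dirac_hull_def using nu
   by (intro CollectI conjI exI[of _ "?r ` {..<N}"] exI[of _ ?w] ballI) (auto intro!: sum_nonneg)
  moreover have "keisler_measures L U (univ U) x <= topspace (weak_star_topology L U (univ U) x)"
  proof -
   have "{mu : keisler_measures L U (univ U) x. (\<integral>p. 0 \<partial>mu) : (UNIV :: real set)} :
     {{mu : keisler_measures L U (univ U) x. (\<integral>p. f p \<partial>mu) : V} | f V. continuous_map ?X euclideanreal f & open V}"
    by (intro CollectI exI[of _ "%_. 0"] exI[of _ UNIV]) simp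
   thus ?thesis unfolding weak_star_topology_def topology_generated_by_topspace by auto
  qed
  ultimately show ?thesis using nu closure_of_subset_Int by fastforce
 qed
 ultimately show ?thesis using nu unfolding generically_stable_def by metis
qed

end

section \<open>Non-distal theories\<close>

context monster
begin

definition gl :: "('s var => 'a) => ('s var => 'a) list => 's var => 'a" where
 "gl a0 ss = glue 0 (%i. if i < length ss then ss ! i else a0) a0"

definition copies :: "'s var set => nat => 's var set" where "copies x n = (UN i<n. cp 0 i ` x)"

text \<open>Equality of types of two lists of tuples. Working with lists instead of indexed
  sequences makes it easy to insert, drop and rearrange points.\<close>

definition eqv :: "'s var set => ('s var => 'a) => ('s var => 'a) list => ('s var => 'a) list => bool" where
 "eqv x a0 ss ks <-> length ss = length ks & set ss <= AS U & set ks <= AS U &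
   (ALL F:Def (copies x (length ss)). F (gl a0 ss) = F (gl a0 ks))"

lemma gl_cp: "i < length ss ==> gl a0 ss (cp 0 i v) = (ss ! i) v" by (simp add: gl_def)

lemma gl_asg: "a0 : asg B ==> set ss <= asg B ==> gl a0 ss : asg B" unfolding gl_def using nth_mem by (intro glue_asg) auto

lemma eqv_trans: "eqv x a0 ss ks ==> eqv x a0 ks ls ==> eqv x a0 ss ls"
 and eqv_sym: "eqv x a0 ss ks ==> eqv x a0 ks ss" unfolding eqv_def by metis+

lemma eqvD: "eqv x a0 ss ks ==> F : Def (copies x (length ss)) ==> F (gl a0 ss) = F (gl a0 ks)" by (simp add: eqv_def)

lemma copiesI: "i < n ==> u : x ==> cp 0 i u : copies x n" by (auto simp: copies_def)

lemma copiesE: "v : copies x n ==> (!!i u. v = cp 0 i u ==> i < n ==> u : x ==> P) ==> P"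
 by (auto simp: copies_def)

text \<open>Selecting entries, in any order and with repetitions, is a renaming of copies of
  \<open>x\<close>.\<close>

lemma eqv_map:
 assumes e: "eqv x a0 ss ks" and i: "set is <= {..<length ss}" and a0: "a0 : AS U"
 shows "eqv x a0 (map ((!) ss) is) (map ((!) ks) is)"
proof -
 have l: "length ks = length ss" and s: "set ss <= AS U" "set ks <= AS U"
  and F: "!!F. F : Def (copies x (length ss)) ==> F (gl a0 ss) = F (gl a0 ks)" using e by (auto simp: eqv_def)
 have sub: "set (map ((!) zs) is) <= AS U" if "length zs = length ss" "set zs <= AS U" for zs using i that nth_mem by fastforce
 define sg where "sg v = cp 0 (is ! fst (prod_decode (snd v))) (fst v, snd (prod_decode (snd v)))" for v :: "'s var"
 have sg: "sg (cp 0 i u) = cp 0 (is ! i) u" "fst (sg v) = fst v" for i u v by (simp_all add: sg_def cp_def)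
 have "G (gl a0 (map ((!) ss) is)) = G (gl a0 (map ((!) ks) is))" if G: "G : Def (copies x (length is))" for G
 proof -
  have bd: "is ! i < length ss" if "i < length is" for i using i that nth_mem by blast
  have "sg ` copies x (length is) <= copies x (length ss)" using bd by (auto elim!: copiesE simp: sg intro!: copiesI)
  from F[OF Def_rename[OF G sg(2) this]] have "G (gl a0 ss o sg) = G (gl a0 ks o sg)" .
  moreover have "G (gl a0 zs o sg) = G (gl a0 (map ((!) zs) is))" if "length zs = length ss" "set zs <= AS U" for zs
   by (rule Def_cong[OF G asg_comp[OF gl_asg[OF a0 that(2)] sg(2)] gl_asg[OF a0 sub[OF that]]])
    (insert bd that(1), auto elim!: copiesE simp: sg gl_cp)
  ultimately show ?thesis using s l by simp
 qed
 thus ?thesis using sub l s by (auto simp: eqv_def)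
qed

lemma eqv_blocks:
 assumes e: "eqv x a0 (concat Xs) (concat Ys)" and l: "map length Xs = map length Ys"
  and js: "set js <= {..<length Xs}" and a0: "a0 : AS U"
 shows "eqv x a0 (concat (map ((!) Xs) js)) (concat (map ((!) Ys) js))"
proof -
 define off where "off j = length (concat (take j Xs))" for j
 have offY: "off j = length (concat (take j Ys))" for j unfolding off_def length_concat take_map[symmetric] l by (rule refl)
 have lY: "length Ys = length Xs" using l map_eq_imp_length_eq by metis
 have blk: "map ((!) (concat Zs)) [length (concat (take j Zs))..<length (concat (take (Suc j) Zs))] = Zs ! j"
  and le: "length (concat (take (Suc j) Zs)) <= length (concat Zs)" if "j < length Zs" for j and Zs :: "('s var => 'a) list list"
 proof -
  have *: "concat Zs = concat (take j Zs) @ Zs ! j @ concat (drop (Suc j) Zs)" using id_take_nth_drop[OF that] by (metis concat.simps(2) concat_append)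
  have **: "concat (take (Suc j) Zs) = concat (take j Zs) @ Zs ! j" using that by (simp add: take_Suc_conv_app_nth)
  show "map ((!) (concat Zs)) [length (concat (take j Zs))..<length (concat (take (Suc j) Zs))] = Zs ! j"
   unfolding * ** by (rule nth_equalityI) (simp_all add: nth_append)
  show "length (concat (take (Suc j) Zs)) <= length (concat Zs)" unfolding * ** by simp
 qed
 let ?is = "concat (map (%j. [off j..<off (Suc j)]) js)"
 have "set ?is <= {..<length (concat Xs)}" using js le[of _ Xs] by (fastforce simp: off_def)
 moreover have "map ((!) (concat Xs)) ?is = concat (map ((!) Xs) js)"
  unfolding map_concat map_map using js by (intro arg_cong[where f = concat] map_cong refl) (auto simp: off_def blk)
 moreover have "map ((!) (concat Ys)) ?is = concat (map ((!) Ys) js)"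
  unfolding map_concat map_map using js by (intro arg_cong[where f = concat] map_cong refl) (auto simp: offY blk lY)
 ultimately show ?thesis using eqv_map[OF e _ a0, of ?is] by simp
qed

lemma override_on_restrict [simp]: "ov a (restrict b x) x = ov a b x" by (auto simp: override_on_def)

lemma indiscernible_eqv:
 fixes I :: "('i, 's var => 'a) sequence"
 assumes ind: "indiscernible L U x I" and a0: "a0 : AS U"
  and s: "set is <= idx I" "set js <= idx I" "length is = length js"
   "sorted_wrt (%i j. (i, j) : lt I) is" "sorted_wrt (%i j. (i, j) : lt I) js"
 shows "eqv x a0 (map (%i. ov a0 (entry I i) x) is) (map (%i. ov a0 (entry I i) x) js)"
proof -
 let ?e = "%i. ov a0 (entry I i) x"
 have eU: "?e i : AS U" if "i : idx I" for i
 proof (rule asgI)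
  have "entry I i : tuples U x" using ind that by (auto simp: indiscernible_def)
  thus "?e i v : univ U (fst v)" for v using asgD[OF a0, of v] by (auto simp: tuples_def override_on_def)
 qed
 have sU: "set (map ?e ks) <= AS U" if "set ks <= idx I" for ks using eU that by auto
 have "F (gl a0 (map ?e is)) = F (gl a0 (map ?e js))" if F: "F : Def (copies x (length is))" for F
 proof -
  obtain ph where ph: "ph : F0 L (copies x (length is))" "!!a. a : AS U ==> F a = fval U a ph"
   using F unfolding Def_def by blast
  define rh where "rh v = (fst (prod_decode (snd v)), (fst v, snd (prod_decode (snd v))))" for v :: "'s var"
  have rh: "rh (cp 0 i u) = (i, u)" for i u by (simp add: rh_def cp_def)
  have "copies x (length is) <= positions rh (length is) x" by (intro subsetI, erule copiesE) (simp add: positions_def rh)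
  hence "ph : F0 L (positions rh (length is) x)" using ph(1) by (auto simp: Fml_def)
  from indiscernibleD[OF ind s this]
  have "fval U (%v. entry I (is ! fst (rh v)) (snd (rh v))) ph = fval U (%v. entry I (js ! fst (rh v)) (snd (rh v))) ph" .
  moreover have "fval U (gl a0 (map ?e ks)) ph = fval U (%v. entry I (ks ! fst (rh v)) (snd (rh v))) ph"
   if "length ks = length is" for ks
  proof (rule fval_cong)
   fix v assume "v : fvars ph"
   hence "v : copies x (length is)" using ph(1) by (auto simp: Fml_def)
   thus "gl a0 (map ?e ks) v = entry I (ks ! fst (rh v)) (snd (rh v))" by (rule copiesE) (insert that, simp add: rh gl_cp)
  qed
  ultimately show ?thesis using ph(2)[OF gl_asg[OF a0 sU[OF s(1)]]] ph(2)[OF gl_asg[OF a0 sU[OF s(2)]]] s(3) by simp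
 qed
 thus ?thesis using sU s by (simp add: eqv_def)
qed

lemma indiscernible_eqvI:
 fixes I :: "('i, 's var => 'a) sequence"
 assumes lin: "strict_linear_order I" and ent: "entry I ` idx I <= tuples U x"
  and eqv: "!!is js. set is <= idx I ==> set js <= idx I ==> length is = length js ==>
   sorted_wrt (%i j. (i, j) : lt I) is ==> sorted_wrt (%i j. (i, j) : lt I) js ==>
   eqv x a0 (map (%i. ov a0 (entry I i) x) is) (map (%i. ov a0 (entry I i) x) js)"
 shows "indiscernible L U x I" unfolding indiscernible_def
proof (intro conjI allI impI lin ent)
 let ?e = "%i. ov a0 (entry I i) x"
 fix "is" js rh and ph :: "('s, 'f, 'r, 'a) fml"
 assume H: "set is <= idx I & set js <= idx I & length is = length js &
  sorted_wrt (%i j. (i, j) : lt I) is & sorted_wrt (%i j. (i, j) : lt I) js &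
  ph : F0 L {v. fst (rh v) < length is & snd (rh v) : x & fst (snd (rh v)) = fst v}"
 let ?V = "positions rh (length is) x"
 have ph: "ph : F0 L ?V" using H unfolding positions_def by blast
 have e: "eqv x a0 (map ?e is) (map ?e js)" using eqv H by blast
 define ta where "ta v = (if v : ?V then cp 0 (fst (rh v)) (snd (rh v)) else v)" for v
 have ta: "fst (ta v) = fst v" for v using positionsD(3)[of v] by (simp add: ta_def)
 have "ta ` ?V <= copies x (length (map ?e is))" using positionsD[of _ rh "length is" x] by (intro image_subsetI) (simp add: ta_def copiesI)
 from eqvD[OF e Def_rename[OF Def_fval[OF ph] ta this]]
 have "fval U (gl a0 (map ?e is) o ta) ph = fval U (gl a0 (map ?e js) o ta) ph" .
 moreover have "fval U (gl a0 (map ?e ks) o ta) ph = fval U (%v. entry I (ks ! fst (rh v)) (snd (rh v))) ph"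
  if "length ks = length is" for ks
 proof (rule fval_cong)
  fix v assume "v : fvars ph"
  hence "v : ?V" using ph unfolding Fml_def by blast
  thus "(gl a0 (map ?e ks) o ta) v = entry I (ks ! fst (rh v)) (snd (rh v))"
   using positionsD[of v rh "length is" x] that by (simp add: ta_def gl_cp)
 qed
 ultimately show "fval U (%v. entry I (is ! fst (rh v)) (snd (rh v))) ph = fval U (%v. entry I (js ! fst (rh v)) (snd (rh v))) ph"
  using H by simp
qed

end

section \<open>Ehrenfeucht-Mostowski types, insertion and alternation\<close>

locale em_sequence = monster L U \<kappa> T
 for L :: "('s, 'f, 'r) language" and U :: "('s, 'f, 'r, 'a) mstruct" and \<kappa> :: "'k rel"
  and T :: "('s, 'f, 'r, 'a) fml set" +
 fixes x :: "'s var set" and a0 :: "'s var => 'a" and c :: "nat => 's var => 'a"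
 assumes finite_x: "finite x" and a0: "a0 : AS U"
  and c_ind: "sorted_wrt (<) is ==> eqv x a0 (map c is) (map c [0..<length is])"
begin

definition em :: "('s var => 'a) list => bool" where "em ss <-> eqv x a0 ss (map c [0..<length ss])"

lemma em_asg: "em ss ==> set ss <= AS U" by (auto simp: em_def eqv_def)

lemma em_eqv: "em ss ==> em ks ==> length ss = length ks ==> eqv x a0 ss ks" unfolding em_def using eqv_trans eqv_sym by metis

lemma eqv_em: "eqv x a0 ss ks ==> em ks ==> em ss" unfolding em_def using eqv_trans by (metis eqv_def)

text \<open>An increasing subsequence of \<open>c\<close> has the same type as an initial
  segment.\<close>

lemma em_drop:
 assumes "em (A @ B @ C)"
 shows "em (A @ C)"
proof -
 let ?a = "length A" and ?b = "length B" and ?n = "length (A @ B @ C)"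
 have "[0..<?n] = [0..<?a] @ [?a..<?a + ?b] @ [?a + ?b..<?n]" by (simp add: upt_add_eq_append[of 0, simplified] flip: add.assoc)
 hence "eqv x a0 (concat [A, B, C]) (concat [map c [0..<?a], map c [?a..<?a + ?b], map c [?a + ?b..<?n]])" using assms by (simp add: em_def)
 from eqv_blocks[OF this _ _ a0, of "[0, 2]"]
 have "eqv x a0 (A @ C) (map c ([0..<?a] @ [?a + ?b..<?n]))" by simp
 moreover have "sorted_wrt (<) ([0..<?a] @ [?a + ?b..<?n])" by (auto simp: sorted_wrt_append)
 from c_ind[OF this] have "em (map c ([0..<?a] @ [?a + ?b..<?n]))" by (simp add: em_def)
 ultimately show ?thesis by (rule eqv_em)
qed

text \<open>Without the points \<open>b\<close> and \<open>b'\<close> the two lists have the same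
  type, so homogeneity supplies \<open>u\<close> and \<open>u'\<close> simultaneously. Their joint
  type with \<open>D1\<close>, \<open>D2\<close>, \<open>D3\<close> is then that of the original
  configuration.\<close>

lemma insertion:
 assumes em: "em (D1 @ A1 @ A2 @ D2 @ B1 @ B2 @ D3)"
  and l: "length D1 = length E1" "length D2 = length E2" "length D3 = length E3"
   "length A1 = length P" "length A2 = length Q" "length B1 = length R" "length B2 = length S"
  and r: "em (E1 @ P @ [b] @ Q @ E2 @ R @ S @ E3)" "em (E1 @ P @ Q @ E2 @ R @ [b'] @ S @ E3)"
 shows "EX u u'. em (D1 @ A1 @ [u] @ A2 @ D2 @ B1 @ B2 @ D3) & em (D1 @ A1 @ A2 @ D2 @ B1 @ [u'] @ B2 @ D3) &
  eqv x a0 (D1 @ [u] @ D2 @ [u'] @ D3) (E1 @ [b] @ E2 @ [b'] @ E3)"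
proof -
 define ss where "ss = D1 @ A1 @ A2 @ D2 @ B1 @ B2 @ D3"
 define ks where "ks = E1 @ P @ Q @ E2 @ R @ S @ E3"
 have ln: "length ks = length ss" by (simp add: ss_def ks_def l)
 have "em ks" using em_drop[of "E1 @ P" "[b]"] r(1) by (simp add: ks_def)
 hence e: "eqv x a0 ks ss" and ssU: "set ss <= AS U" and ksU: "set ks <= AS U"
  using em_eqv[OF _ em[folded ss_def] ln] em_asg em[folded ss_def] by blast+
 have bU: "b : AS U" "b' : AS U" using em_asg[OF r(1)] em_asg[OF r(2)] by auto
 let ?n = "length ss" and ?y = "cp 0 (length ss) ` x Un cp 0 (Suc (length ss)) ` x"
 define f where "f = glue 0 (%i. if i = length ss then b else b') a0"
 have fU: "f : AS U" unfolding f_def by (rule glue_asg) (use bU a0 in auto)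
 have "?y Int copies x ?n = {}" by (auto simp: copies_def cp_def)
 from extend_equivalent[OF _ _ this gl_asg[OF a0 ksU] gl_asg[OF a0 ssU] fU] e ln finite_x
 obtain g where g: "g : AS U" "ALL F:Def (copies x ?n Un ?y). F (ov (gl a0 ss) g ?y) = F (ov (gl a0 ks) f ?y)" by (auto simp: eqv_def copies_def)
 define u where "u v = g (cp 0 ?n v)" for v
 define u' where "u' v = g (cp 0 (Suc ?n) v)" for v
 have uU: "u : AS U" "u' : AS U" using asgD[OF g(1), of "cp 0 _ _"] by (auto intro!: asgI simp: u_def u'_def)
 have copies_Suc: "copies x (Suc (Suc ?n)) = copies x ?n Un ?y" by (simp add: copies_def lessThan_Suc Un_ac)
 have ov: "F (gl a0 (zs @ [w, w'])) = F (ov (gl a0 zs) h ?y)"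
  if "F : Def (copies x (Suc (Suc ?n)))" "length zs = ?n" "set zs <= AS U" "w : AS U" "w' : AS U" "h : AS U"
   "!!v. w v = h (cp 0 ?n v)" "!!v. w' v = h (cp 0 (Suc ?n) v)" for F zs w w' h
 proof (rule Def_cong[OF that(1)])
  show "gl a0 (zs @ [w, w']) : AS U" "ov (gl a0 zs) h ?y : AS U" using that by (auto intro!: gl_asg asg_override a0)
  fix v assume "v : copies x (Suc (Suc ?n))"
  then obtain i t where v: "v = cp 0 i t" "i < Suc (Suc ?n)" "t : x" by (elim copiesE) (rule that)
  have inj: "cp 0 i t = cp 0 j t' <-> i = j & t = t'" for j t' by (auto simp: cp_def prod_eq_iff)
  consider "i < ?n" | "i = ?n" | "i = Suc ?n" using v(2) by linarith
  thus "gl a0 (zs @ [w, w']) v = ov (gl a0 zs) h ?y v"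
   by cases (insert v(3) that(2,7,8), auto simp: v(1) gl_cp override_on_def nth_append image_iff inj)
 qed
 have "eqv x a0 (ss @ [u, u']) (ks @ [b, b'])" unfolding eqv_def
 proof (intro conjI ballI)
  fix F assume "F : Def (copies x (length (ss @ [u, u'])))"
  hence F: "F : Def (copies x (Suc (Suc ?n)))" by simp
  show "F (gl a0 (ss @ [u, u'])) = F (gl a0 (ks @ [b, b']))" using ov[OF F refl ssU uU g(1) u_def u'_def] ov[OF F ln ksU bU fU] g(2) F by (simp add: copies_Suc f_def)
 qed (use ln uU bU ssU ksU in auto)
 \<comment> \<open>The new points sit at the end of both lists; rearranging the nine blocks gives
   the three claims.\<close>
 hence all: "eqv x a0 (concat [D1, A1, A2, D2, B1, B2, D3, [u], [u']]) (concat [E1, P, Q, E2, R, S, E3, [b], [b']])" by (simp add: ss_def ks_def)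
 note B = eqv_blocks[OF all _ _ a0]
 have "eqv x a0 (D1 @ A1 @ [u] @ A2 @ D2 @ B1 @ B2 @ D3) (E1 @ P @ [b] @ Q @ E2 @ R @ S @ E3)"
  "eqv x a0 (D1 @ A1 @ A2 @ D2 @ B1 @ [u'] @ B2 @ D3) (E1 @ P @ Q @ E2 @ R @ [b'] @ S @ E3)" "eqv x a0 (D1 @ [u] @ D2 @ [u'] @ D3) (E1 @ [b] @ E2 @ [b'] @ E3)"
  using B[of "[0, 1, 7, 2, 3, 4, 5, 6]"] B[of "[0, 1, 2, 3, 4, 8, 5, 6]"] B[of "[0, 7, 3, 8, 6]"] l by simp_all
 thus ?thesis using eqv_em r by blast
qed

abbreviation "pairs ps == concat (map (%(u, v). [u, v]) ps)"

text \<open>The insertions take place right after the next entries \<open>a\<close> of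
  \<open>al\<close> and \<open>a'\<close> of \<open>al'\<close>. One inserted point has its property
  and is kept beside its partner, while the next entry of the other list is dropped, so each step
  completes exactly one pair.\<close>

lemma alternation:
 assumes ins: "!!A1 A2 B1 B2. em (D1 @ A1 @ A2 @ D2 @ B1 @ B2 @ D3) ==>
   EX u u'. em (D1 @ A1 @ [u] @ A2 @ D2 @ B1 @ B2 @ D3) & em (D1 @ A1 @ A2 @ D2 @ B1 @ [u'] @ B2 @ D3) & (h u | h' u')"
  and l: "length al = length al'" and em: "em (D1 @ pairs ps @ al @ D2 @ pairs qs @ al' @ D3)"
  and g: "ALL a:set al. g a" "ALL a:set al'. g' a" "ALL (u, v):set ps. g u & h v" "ALL (u, v):set qs. g' u & h' v"
 shows "EX ps' qs'. em (pairs ps') & em (pairs qs') & length ps' + length qs' = length ps + length qs + length al &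
  (ALL (u, v):set ps'. g u & h v) & (ALL (u, v):set qs'. g' u & h' v)" using l em g
proof (induction al al' arbitrary: ps qs rule: list_induct2)
 case Nil
 have "em (pairs ps @ D2 @ pairs qs @ D3)" using em_drop[of "[]" D1 "pairs ps @ D2 @ pairs qs @ D3"] Nil by simp
 hence "em (pairs ps)" "em (D2 @ pairs qs @ D3)" using em_drop[of "pairs ps" "D2 @ pairs qs @ D3" "[]"] em_drop[of "[]" "pairs ps" "D2 @ pairs qs @ D3"] by simp_all
 moreover from this(2) have "em (pairs qs)" using em_drop[of "[]" D2 "pairs qs @ D3"] em_drop[of "pairs qs" D3 "[]"] by simp
 ultimately show ?case using Nil by (intro exI[of _ ps] exI[of _ qs]) simp
next
 case (Cons a al a' al')
 obtain u u' where u: "em (D1 @ (pairs ps @ [a]) @ [u] @ al @ D2 @ (pairs qs @ [a']) @ al' @ D3)"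
  "em (D1 @ (pairs ps @ [a]) @ al @ D2 @ (pairs qs @ [a']) @ [u'] @ al' @ D3)" "h u | h' u'"
  using ins[of "pairs ps @ [a]" al "pairs qs @ [a']" al'] Cons.prems(1) by auto
 from u(3) show ?case
 proof
  assume h: "h u"
  have "em (D1 @ pairs (ps @ [(a, u)]) @ al @ D2 @ pairs qs @ al' @ D3)"
   using em_drop[of "D1 @ pairs ps @ [a, u] @ al @ D2 @ pairs qs" "[a']" "al' @ D3"] u(1) by simp
  from Cons.IH[OF this] show ?thesis using Cons.prems(2-) h by simp
 next
  assume h: "h' u'"
  have "em (D1 @ pairs ps @ al @ D2 @ pairs (qs @ [(a', u')]) @ al' @ D3)"
   using em_drop[of "D1 @ pairs ps" "[a]" "al @ D2 @ pairs qs @ [a', u'] @ al' @ D3"] u(2) by simp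
  from Cons.IH[OF this] show ?thesis using Cons.prems(2-) h by simp
 qed
qed

lemma em_indiscernible:
 assumes em: "!!n. em (map e [0..<n])" and e: "!!i. ov a0 (e i) x = e i"
 shows "indiscernible L U x (seq_on UNIV (%i::nat. restrict (e i) x))"
proof (rule indiscernible_eqvI[of _ x a0])
 have eU: "e i : AS U" for i using em_asg[OF em[of "Suc i"]] by simp
 thus "entry (seq_on UNIV (%i. restrict (e i) x)) ` idx (seq_on UNIV (%i. restrict (e i) x)) <= tuples U x"
  using restrict_tuples[OF eU, where N = U and x = x] by auto
 have emi: "em (map e is)" if s: "sorted_wrt (<) is" for "is"
 proof -
  obtain n where n: "set is <= {..<n}" using finite_nat_iff_bounded[of "set is"] by auto
  have *: "map ((!) (map f [0..<n])) is = map f is" for f :: "nat => 's var => 'a" using n by auto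
  have "eqv x a0 (map e is) (map c is)" using eqv_map[OF em[of n, unfolded em_def], of "is"] n a0 by (simp add: *)
  thus ?thesis using eqv_em c_ind[OF s] by (simp add: em_def) (metis eqv_trans)
 qed
 show "eqv x a0 (map (%i. ov a0 (entry (seq_on UNIV (%i. restrict (e i) x)) i) x) is)
   (map (%i. ov a0 (entry (seq_on UNIV (%i. restrict (e i) x)) i) x) js)"
  if "length is = length js" "sorted_wrt (%i j. (i, j) : lt (seq_on UNIV (%i. restrict (e i) x))) is"
   "sorted_wrt (%i j. (i, j) : lt (seq_on UNIV (%i. restrict (e i) x))) js" for "is" js using em_eqv[OF emi[of "is"] emi[of js]] that by (simp add: e)
qed simp

text \<open>Compactness turns alternations of unbounded length into an infinite indiscernible
  sequence and one parameter for which \<open>f\<close> is at least \<open>s\<close> at even places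
  and at most \<open>r\<close> at odd ones, against NIP.\<close>

lemma no_long_alternation:
 assumes NIP: "NIP L U" and z: "finite z" "x Int z = {}" and f: "f : Def (x Un z)" and rs: "r < s" "r : {0..1}" "s : {0..1}"
  and alt: "!!n. EX d:AS U. EX ps. em (pairs ps) & n <= length ps &
   (ALL (u, v):set ps. s <= f (ov d u x) & f (ov d v x) <= r)"
 shows False
proof -
 obtain b where b: "!!v. v : x Un z ==> snd v < b" using var_index_bound[of "x Un z"] z finite_x by auto
 define sg where "sg v = (fst v, b + snd v)" for v :: "'s var"
 have sg: "fst (sg v) = fst v" "sg (cp 0 i v) = cp b i v" for v i by (simp_all add: sg_def cp_def)
 define ta where "ta k v = (if v : x then cp b k v else v)" for k and v :: "'s var"
 have ta: "fst (ta k v) = fst v" for k v by (simp add: ta_def)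
 define V where "V = z Un (UN i. cp b i ` x)"
 have cV: "countable V" unfolding V_def by (intro countable_Un countable_UN countableI_type countable_image countable_finite[OF z(1)] countable_finite[OF finite_x])
 define \<Gamma> where "\<Gamma> = (UN n. (%F a. \<bar>F (a o sg) - F (gl a0 (map c [0..<n]))\<bar>) ` Def (copies x n)) Un
  range (%k a. max 0 (s - f (a o ta (2 * k)))) Un range (%k a. max 0 (f (a o ta (2 * k + 1)) - r))"
 have cU: "c i : AS U" for i using c_ind[of "[i]"] by (auto simp: eqv_def)
 have cgU: "gl a0 (map c [0..<n]) : AS U" for n by (rule gl_asg[OF a0]) (use cU in auto)
 have taV: "ta k ` (x Un z) <= V" for k using z(2) by (auto simp: ta_def V_def)
 have sgV: "sg ` copies x n <= V" for n by (intro image_subsetI, erule copiesE) (simp add: sg V_def, blast)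
 obtain d ps where dU: "!!n. d n : AS U" and ps: "!!n. em (pairs (ps n))" "!!n. n <= length (ps n)"
  "!!n u v. (u, v) : set (ps n) ==> s <= f (ov (d n) u x) & f (ov (d n) v x) <= r"
 proof -
  have "ALL n. EX d ps. d : AS U & em (pairs ps) & n <= length ps &
   (ALL (u, v):set ps. s <= f (ov d u x) & f (ov d v x) <= r)" (is "ALL n. EX d ps. ?P n d ps") using alt by blast
  from choice[OF this] obtain d where "ALL n. EX ps. ?P n (d n) ps" by (rule exE)
  from choice[OF this] obtain ps where *: "ALL n. ?P n (d n) (ps n)" by (rule exE)
  show thesis by (rule that[of d ps]) (insert *, blast dest: bspec)+
 qed
 let ?ss = "%n. pairs (ps n)"
 have len: "length (pairs qs) = 2 * length qs" for qs :: "(('s var => 'a) \<times> ('s var => 'a)) list" by (induction qs) auto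
 have nth: "pairs qs ! (2 * k) = fst (qs ! k)" "pairs qs ! Suc (2 * k) = snd (qs ! k)" if "k < length qs"
  for k and qs :: "(('s var => 'a) \<times> ('s var => 'a)) list" using that by (induction qs arbitrary: k) (auto simp: less_Suc_eq_0_disj)
 define A where "A n = glue b (%i. if i < length (?ss n) then ?ss n ! i else a0) (d n)" for n
 have ssU: "?ss n ! i : AS U" if "i < length (?ss n)" for n i using em_asg[OF ps(1)[of n]] nth_mem[OF that] by blast
 have AU: "A n : AS U" for n unfolding A_def by (intro glue_asg dU) (simp add: ssU a0)
 have Ata: "f (A n o ta k) = f (ov (d n) (?ss n ! k) x)" if "k < length (?ss n)" for n k
 proof (rule Def_cong[OF f asg_comp[OF AU ta] asg_override[OF dU ssU[OF that]]])
  fix v assume "v : x Un z"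
  from b[OF this] show "(A n o ta k) v = ov (d n) (?ss n ! k) x v" using that by (simp add: ta_def A_def glue_low override_on_def)
 qed
 \<comment> \<open>Each condition holds exactly as soon as the alternation is long enough, so
   finitely many hold together.\<close>
 have "G : Def V & eventually (%n. G (A n) = 0) sequentially" if "G : \<Gamma>" for G
 proof -
  note R = Def_rename[OF f ta taV]
  consider m F where "F : Def (copies x m)" "G = (%a. \<bar>F (a o sg) - F (gl a0 (map c [0..<m]))\<bar>)"
   | k where "G = (%a. max 0 (s - f (a o ta (2 * k))))" | k where "G = (%a. max 0 (f (a o ta (2 * k + 1)) - r))"
   using `G : \<Gamma>` unfolding \<Gamma>_def by blast
  thus ?thesis
  proof cases
   case 1
   have "G (A n) = 0" if n: "m <= n" for n
   proof -
    have lm: "m <= length (?ss n)" using ps(2)[of n] n by (simp add: len)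
    have "em (take m (?ss n))" using em_drop[of "take m (?ss n)" "drop m (?ss n)" "[]"] ps(1)[of n] by simp
    moreover have lt: "length (take m (?ss n)) = m" using lm by simp
    ultimately have eq: "eqv x a0 (take m (?ss n)) (map c [0..<m])" by (simp only: em_def)
    have "F (gl a0 (take m (?ss n))) = F (gl a0 (map c [0..<m]))" by (rule eqvD[OF eq]) (simp only: lt 1(1))
    moreover have tU: "set (take m (?ss n)) <= AS U" using eq by (simp add: eqv_def)
    moreover have "F (A n o sg) = F (gl a0 (take m (?ss n)))" by (rule Def_cong[OF 1(1) asg_comp[OF AU sg(1)] gl_asg[OF a0 tU]])
      (insert lm, auto elim!: copiesE simp: sg A_def gl_cp)
    ultimately show ?thesis by (simp add: 1(2))
   qed
   moreover have "G : Def V" unfolding 1(2) by (rule Def_absdiff[OF Def_rename[OF 1(1) sg(1) sgV] Def_const[OF Def_01[OF 1(1) cgU]]])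
   ultimately show ?thesis unfolding eventually_sequentially by blast
  next
   case 2
   have "G (A n) = 0" if "Suc k <= n" for n
   proof -
    have k: "k < length (ps n)" using ps(2)[of n] that by simp
    hence "(fst (ps n ! k), snd (ps n ! k)) : set (ps n)" by simp
    from ps(3)[OF this] show ?thesis using Ata[of "2 * k" n] nth[OF k] k by (simp add: 2 len)
   qed
   moreover have "G : Def V" unfolding 2 by (rule Def_diff0[OF Def_const[OF rs(3)] R])
   ultimately show ?thesis unfolding eventually_sequentially by blast
  next
   case 3
   have "G (A n) = 0" if "Suc k <= n" for n
   proof -
    have k: "k < length (ps n)" using ps(2)[of n] that by simp
    hence "(fst (ps n ! k), snd (ps n ! k)) : set (ps n)" by simp
    from ps(3)[OF this] show ?thesis using Ata[of "Suc (2 * k)" n] nth[OF k] k by (simp add: 3 len)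
   qed
   moreover have "G : Def V" unfolding 3 by (rule Def_diff0[OF R Def_const[OF rs(2)]])
   ultimately show ?thesis unfolding eventually_sequentially by blast
  qed
 qed
 note ev = this
 have "EX a:AS U. ALL G:\<Gamma>. G a = 0"
 proof (rule compactness[OF cV])
  show "G : Def V" if "G : \<Gamma>" for G using ev[OF that] by blast
  fix \<Gamma>0 and et :: real assume \<Gamma>0: "finite \<Gamma>0" "\<Gamma>0 <= \<Gamma>" "et > 0"
  hence "eventually (%n. ALL G:\<Gamma>0. G (A n) = 0) sequentially" using ev by (intro eventually_ball_finite ballI) blast+
  then obtain n where "ALL G:\<Gamma>0. G (A n) = 0" unfolding eventually_sequentially by blast
  thus "EX a:AS U. ALL G:\<Gamma>0. G a <= et" using AU \<Gamma>0(3) by (intro bexI[of _ "A n"]) auto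
 qed
 then obtain a where a: "a : AS U" "!!G. G : \<Gamma> ==> G a = 0" by blast
 define e where "e i v = (if v : x then a (cp b i v) else a0 v)" for i v
 have eU: "e i : AS U" for i using asgD[OF a(1), of "cp b i _"] asgD[OF a0] by (auto intro!: asgI simp: e_def)
 have "em (map e [0..<n])" for n unfolding em_def eqv_def
 proof (intro conjI ballI)
  fix F assume "F : Def (copies x (length (map e [0..<n])))"
  hence F: "F : Def (copies x n)" by simp
  have "(%a. \<bar>F (a o sg) - F (gl a0 (map c [0..<n]))\<bar>) : \<Gamma>" unfolding \<Gamma>_def using F by blast
  from a(2)[OF this] have "F (a o sg) = F (gl a0 (map c [0..<n]))" by simp
  moreover have "F (a o sg) = F (gl a0 (map e [0..<n]))"
   by (rule Def_cong[OF F asg_comp[OF a(1) sg(1)] gl_asg[OF a0]]) (insert eU, auto elim!: copiesE simp: sg gl_cp e_def)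
  ultimately show "F (gl a0 (map e [0..<n])) = F (gl a0 (map c [0..<length (map e [0..<n])]))" by simp
 qed (use eU cU in auto)
 moreover have "ov a0 (e i) x = e i" for i by (auto simp: e_def override_on_def)
 ultimately have "indiscernible L U x (seq_on UNIV (%i. restrict (e i) x))" by (rule em_indiscernible)
 from NIP_convergent[OF NIP finite_x z f a(1) eU this]
 have cv: "convergent (%i. f (ov a (e i) x))" .
 have "f (a o ta k) = f (ov a (e k) x)" for k
  by (rule Def_cong[OF f asg_comp[OF a(1) ta] asg_override[OF a(1) eU]]) (auto simp: ta_def e_def override_on_def)
 hence "Cauchy (%i. f (a o ta i))" using convergent_Cauchy[OF cv] by presburger
 from metric_CauchyD[OF this, of "s - r"] rs(1) obtain N where N: "ALL m>=N. ALL n>=N. dist (f (a o ta m)) (f (a o ta n)) < s - r" by auto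
 have "(%a. max 0 (s - f (a o ta (2 * N)))) : \<Gamma>" "(%a. max 0 (f (a o ta (2 * N + 1)) - r)) : \<Gamma>" unfolding \<Gamma>_def by blast+
 from a(2)[OF this(1)] a(2)[OF this(2)] N[rule_format, of "2 * N" "2 * N + 1"] show False by (simp add: dist_real_def max_def split: if_splits)
qed

end

lemma dense_dominating:
 assumes I: "dense_without_endpoints I" and S: "finite S" "S <= idx I"
 shows "EX ls. length ls = n & set ls <= idx I & sorted_wrt (%i j. (i, j) : lt I) ls & (ALL i:S. ALL j:set ls. (i, j) : lt I)"
proof (induction n)
 case (Suc n)
 note o = I[unfolded dense_without_endpoints_def strict_linear_order_def]
 have sub: "lt I <= idx I \<times> idx I" and tr: "trans (lt I)" and tot: "total_on (idx I) (lt I)"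
  and ne: "idx I ~= {}" and up: "!!i. i : idx I ==> EX j. (i, j) : lt I" using o by blast+
 have bound: "EX m:idx I. ALL i:R. (i, m) : lt I" if "finite R" "R <= idx I" for R using that
 proof (induction R)
  case empty
  thus ?case using ne by blast
 next
  case (insert i R)
  then obtain m where m: "m : idx I" "ALL i:R. (i, m) : lt I" by blast
  obtain j j' where j: "(m, j) : lt I" "(i, j') : lt I" using up m(1) insert.prems by blast
  hence jI: "j : idx I" "j' : idx I" using sub by blast+
  have mj: "ALL i:R. (i, j) : lt I" using m(2) j(1) transD[OF tr] by blast
  consider "i = m" | "(i, m) : lt I" | "(m, i) : lt I" using tot m(1) insert.prems unfolding total_on_def by blast
  thus ?case
  proof cases
   case 1 thus ?thesis using mj j jI by blast
  next
   case 2 thus ?thesis using m by blast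
  next
   case 3
   have "ALL k:R. (k, j') : lt I" using m(2) 3 j(2) transD[OF tr] by blast
   thus ?thesis using j jI by blast
  qed
 qed
 from Suc obtain ls where ls: "length ls = n" "set ls <= idx I" "sorted_wrt (%i j. (i, j) : lt I) ls" "ALL i:S. ALL j:set ls. (i, j) : lt I" by blast
 obtain m where m: "m : idx I" "ALL i:S Un set ls. (i, m) : lt I" using bound[of "S Un set ls"] S ls by auto
 show ?case by (rule exI[of _ "ls @ [m]"]) (insert ls m, auto simp: sorted_wrt_append)
qed simp

lemma dense_dominated:
 assumes I: "dense_without_endpoints I" and S: "finite S" "S <= idx I"
 shows "EX ls. length ls = n & set ls <= idx I & sorted_wrt (%i j. (i, j) : lt I) ls & (ALL i:S. ALL j:set ls. (j, i) : lt I)"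
proof -
 let ?J = "I\<lparr>lt := (lt I)\<inverse>\<rparr>"
 have "dense_without_endpoints ?J" using I unfolding dense_without_endpoints_def strict_linear_order_def irrefl_def total_on_def by (auto simp: trans_on_converse) blast
 from dense_dominating[OF this S(1), of n] S(2) obtain ls where
  "length ls = n" "set ls <= idx I" "sorted_wrt (%i j. (j, i) : lt I) ls" "ALL i:S. ALL j:set ls. (j, i) : lt I" by auto
 thus ?thesis by (intro exI[of _ "rev ls"]) (simp add: sorted_wrt_rev)
qed

context monster
begin

text \<open>Some finite list fails to have the type of \<open>c\<close>. It uses both inserted
  points, since the sequence with one of them is indiscernible. Dense orders without endpoints leave
  room for any number of further entries next to each cut.\<close>

lemma nondistal_configuration:
 assumes nd: "~ distal TYPE('i) L U"
 shows "EX x a0 c E1 b1 E2 b2 E3. em_sequence L U \<kappa> T x a0 c &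
  (ALL p q r s. EX P Q R S. length P = p & length Q = q & length R = r & length S = s &
   em_sequence.em L U x a0 c (E1 @ P @ [b1] @ Q @ E2 @ R @ S @ E3) & em_sequence.em L U x a0 c (E1 @ P @ Q @ E2 @ R @ [b2] @ S @ E3)) &
  set (E1 @ [b1] @ E2 @ [b2] @ E3) <= AS U & ~ em_sequence.em L U x a0 c (E1 @ [b1] @ E2 @ [b2] @ E3)"
proof -
 obtain x and I1 I2 I3 :: "('i, 's var => 'a) sequence" and b1 b2 where x: "finite x"
  and D: "dense_without_endpoints I1" "dense_without_endpoints I2" "dense_without_endpoints I3"
  and ind: "indiscernible L U x (seq_sum [I1, I2, I3])" "indiscernible L U x (seq_sum [I1, single b1, I2, I3])" "indiscernible L U x (seq_sum [I1, I2, single b2, I3])"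
  and nind: "~ indiscernible L U x (seq_sum [I1, single b1, I2, single b2, I3])" using nd unfolding distal_def by blast
 obtain a0 where a0: "a0 : AS U" using asg_ne by blast
 let ?o = "%t. ov a0 t x" and ?a = "seq_sum [I1, single b1, I2, I3]" and ?b = "seq_sum [I1, I2, single b2, I3]"
  and ?J = "seq_sum [I1, single b1, I2, single b2, I3]"
 let ?so = "%I :: (nat \<times> 'i, 's var => 'a) sequence. sorted_wrt (%i j. (i, j) : lt I)"
 let ?si = "%I :: ('i, 's var => 'a) sequence. sorted_wrt (%i j. (i, j) : lt I)"
 have slo: "strict_linear_order I1" "strict_linear_order I2" "strict_linear_order I3" using D by (simp_all add: dense_without_endpoints_def)
 \<comment> \<open>An increasing sequence in \<open>I1\<close> that represents the
   Ehrenfeucht-Mostowski type.\<close>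
 have "EX \<gamma>. ALL n::nat. \<gamma> n : idx I1 & (\<gamma> n, \<gamma> (Suc n)) : lt I1"
 proof (rule dependent_nat_choice)
  show "EX i. i : idx I1" using D(1) by (auto simp: dense_without_endpoints_def)
  show "EX j. j : idx I1 & (i, j) : lt I1" if "i : idx I1" for i
   using D(1) that unfolding dense_without_endpoints_def strict_linear_order_def by blast
 qed
 then obtain \<gamma> :: "nat => 'i" where \<gamma>: "!!n. \<gamma> n : idx I1" "!!n. (\<gamma> n, \<gamma> (Suc n)) : lt I1" by blast
 have \<gamma>lt: "(\<gamma> i, \<gamma> j) : lt I1" if "i < j" for i j
  using that by (induction rule: less_Suc_induct) (insert \<gamma>(2) slo(1), auto simp: strict_linear_order_def dest: transD)
 define c where "c n = ?o (entry I1 (\<gamma> n))" for n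
 have srt: "?so (seq_sum (I1 # Is)) (map (%n. (0, \<gamma> n)) is)" if "sorted_wrt (<) is" for "is" Is
  unfolding sorted_wrt_map by (rule sorted_wrt_mono_rel[OF _ that]) (use \<gamma> \<gamma>lt in auto)
 have ix: "set (map (%n. (0, \<gamma> n)) is) <= idx (seq_sum (I1 # Is))" for "is" :: "nat list" and Is using \<gamma>(1) by auto
 have em_c: "map (%i. ?o (entry (seq_sum (I1 # Is)) i)) (map (%n. (0, \<gamma> n)) is) = map c is" for "is" Is by (simp add: c_def)
 have em_of: "eqv x a0 (map (%p. ?o (entry (seq_sum (I1 # Is)) p)) ls) (map c [0..<length ls])"
  if "indiscernible L U x (seq_sum (I1 # Is))" "set ls <= idx (seq_sum (I1 # Is))" "?so (seq_sum (I1 # Is)) ls" for Is ls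
  using indiscernible_eqv[OF that(1) a0 that(2) ix _ that(3) srt[of "[0..<length ls]"]] unfolding em_c by simp
 interpret E: em_sequence L U \<kappa> T x a0 c
 proof unfold_locales
  fix "is" :: "nat list" assume "sorted_wrt (<) is"
  from em_of[OF ind(1) ix srt[OF this]] show "eqv x a0 (map c is) (map c [0..<length is])" unfolding em_c by simp
 qed (rule x a0)+
 have em: "E.em (map (%p. ?o (entry (seq_sum (I1 # Is)) p)) ls)"
  if "indiscernible L U x (seq_sum (I1 # Is))" "set ls <= idx (seq_sum (I1 # Is))" "?so (seq_sum (I1 # Is)) ls" for Is ls
  using em_of[OF that] by (simp add: E.em_def)
 have ent: "entry ?J ` idx ?J <= tuples U x"
 proof -
  have "entry ?a p : tuples U x" if "p : idx ?a" for p using ind(2) that by (auto simp: indiscernible_def)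
  note t = this
  have "entry I1 i : tuples U x" if "i : idx I1" for i using t[of "(0, i)"] that by simp
  moreover have "b1 : tuples U x" using t[of "(1, undefined)"] by simp
  moreover have "entry I2 i : tuples U x" if "i : idx I2" for i using t[of "(2, i)"] that by simp
  moreover have "entry I3 i : tuples U x" if "i : idx I3" for i using t[of "(3, i)"] that by simp
  moreover have "b2 : tuples U x" using ind(3) unfolding indiscernible_def image_subset_iff by (elim conjE ballE[where x = "(2, undefined)"]) simp_all
  ultimately show ?thesis by (auto simp: less_Suc_eq numeral_eq_Suc)
 qed
 have slJ: "strict_linear_order ?J" by (rule strict_linear_order_seq_sum) (insert slo, auto simp: less_Suc_eq numeral_eq_Suc)
 have "EX ls. set ls <= idx ?J & ?so ?J ls & ~ E.em (map (%p. ?o (entry ?J p)) ls)"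
 proof (rule ccontr)
  assume no: "~ ?thesis"
  have "indiscernible L U x ?J" by (rule indiscernible_eqvI[OF slJ ent, of a0]) (rule E.em_eqv, use no in auto)
  thus False using nind by blast
 qed
 then obtain ls where ls: "set ls <= idx ?J" "?so ?J ls" "~ E.em (map (%p. ?o (entry ?J p)) ls)" by blast
 \<comment> \<open>Without the first inserted point the list embeds into the indiscernible sum of
   \<open>I1\<close>, \<open>I2\<close>, the second point and \<open>I3\<close>.\<close>
 have m1: "(1, undefined) : set ls"
 proof (rule ccontr)
  assume n: "(1, undefined) ~: set ls"
  let ?g = "%(k :: nat, i :: 'i). (if k = 0 then 0 else k - 1, i)"
  have k: "k = 0 | k = 2 | k = 3 | k = 4" "i : idx ([I1, single b1, I2, single b2, I3] ! k)" if "(k, i) : set ls" for k i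
   using subsetD[OF ls(1) that] that n by (auto simp: less_Suc_eq numeral_eq_Suc)
  have "E.em (map (%p. ?o (entry ?b p)) (map ?g ls))"
  proof (rule em[OF ind(3)])
   show "set (map ?g ls) <= idx ?b" using k by fastforce
   show "?so ?b (map ?g ls)" unfolding sorted_wrt_map
   proof (rule sorted_wrt_mono_rel[OF _ ls(2)])
    fix p q assume pq: "p : set ls" "q : set ls" "(p, q) : lt ?J"
    obtain m i l j where [simp]: "p = (m, i)" "q = (l, j)" by (metis surj_pair)
    have "m = 0 | m = 2 | m = 3 | m = 4" "l = 0 | l = 2 | l = 3 | l = 4" using k(1)[of m i] k(1)[of l j] pq by simp_all
    thus "(?g p, ?g q) : lt ?b" using pq(3) by (elim disjE) simp_all
   qed
  qed
  also have "map (%p. ?o (entry ?b p)) (map ?g ls) = map (%p. ?o (entry ?J p)) ls" using k by fastforce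
  finally show False using ls(3) by blast
 qed
 have "(3, undefined) : set ls"
 proof (rule ccontr)
  assume n: "(3, undefined) ~: set ls"
  let ?g = "%(k :: nat, i :: 'i). (if k = 4 then 3 else k, i)"
  have k: "k = 0 | k = 1 | k = 2 | k = 4" "i : idx ([I1, single b1, I2, single b2, I3] ! k)" if "(k, i) : set ls" for k i
   using subsetD[OF ls(1) that] that n by (auto simp: less_Suc_eq numeral_eq_Suc)
  have "E.em (map (%p. ?o (entry ?a p)) (map ?g ls))"
  proof (rule em[OF ind(2)])
   show "set (map ?g ls) <= idx ?a" using k by fastforce
   show "?so ?a (map ?g ls)" unfolding sorted_wrt_map
   proof (rule sorted_wrt_mono_rel[OF _ ls(2)])
    fix p q assume pq: "p : set ls" "q : set ls" "(p, q) : lt ?J"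
    obtain m i l j where [simp]: "p = (m, i)" "q = (l, j)" by (metis surj_pair)
    have "m = 0 | m = 1 | m = 2 | m = 4" "l = 0 | l = 1 | l = 2 | l = 4" using k(1)[of m i] k(1)[of l j] pq by simp_all
    thus "(?g p, ?g q) : lt ?a" using pq(3) by (elim disjE) simp_all
   qed
  qed
  also have "map (%p. ?o (entry ?a p)) (map ?g ls) = map (%p. ?o (entry ?J p)) ls" using k by fastforce
  finally show False using ls(3) by blast
 qed
 note m3 = this
 obtain l1 l' where l': "ls = l1 @ (1, undefined) # l'" using split_list[OF m1] by blast
 have lt1: "(p, (1, undefined)) : lt ?J" if "p : set l1" for p using ls(2) that unfolding l' by (simp add: sorted_wrt_append)
 have "(3, undefined) ~: set l1" using lt1 by force
 hence "(3, undefined) : set l'" using m3 by (simp add: l')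
 from split_list[OF this] obtain l2 l3 where l: "ls = l1 @ (1, undefined) # l2 @ (3, undefined) # l3" using l' by blast
 have so: "?so ?J l1" "?so ?J l2" "?so ?J l3" and lt: "!!p. p : set l2 ==> ((1, undefined), p) : lt ?J"
  "!!p. p : set l2 ==> (p, (3, undefined)) : lt ?J" "!!p. p : set l3 ==> ((3, undefined), p) : lt ?J"
  using ls(2) unfolding l by (simp_all add: sorted_wrt_append)
 define e1 e2 e3 where "e1 = map snd l1" and "e2 = map snd l2" and "e3 = map snd l3"
 have le: "l1 = map (Pair 0) e1" "l2 = map (Pair 2) e2" "l3 = map (Pair 4) e3"
 proof -
  have "p = (0, snd p)" if "p : set l1" for p using lt1[OF that] by (cases p) (auto simp: less_Suc_eq numeral_eq_Suc)
  moreover have "p = (2, snd p)" if "p : set l2" for p using lt(1)[OF that] lt(2)[OF that] by (cases p) (auto simp: less_Suc_eq numeral_eq_Suc)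
  moreover have "p = (4, snd p)" if "p : set l3" for p using lt(3)[OF that] by (cases p) (auto simp: less_Suc_eq numeral_eq_Suc)
  ultimately show "l1 = map (Pair 0) e1" "l2 = map (Pair 2) e2" "l3 = map (Pair 4) e3" by (simp_all add: e1_def e2_def e3_def comp_def map_idI)
 qed
 have ie: "set e1 <= idx I1" "set e2 <= idx I2" "set e3 <= idx I3" using ls(1) unfolding l le by (auto simp: image_subset_iff)
 have so1: "?si I1 e1" and so2: "?si I2 e2" and so3: "?si I3 e3" using so unfolding le sorted_wrt_map by (auto elim!: sorted_wrt_mono_rel[rotated])
 let ?m = "%I. map (%i. ?o (entry I i))"
 have eJ: "map (%p. ?o (entry ?J p)) ls = ?m I1 e1 @ [?o b1] @ ?m I2 e2 @ [?o b2] @ ?m I3 e3" unfolding l le by (simp add: comp_def)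
 \<comment> \<open>\<open>P\<close> is placed in \<open>I1\<close> above \<open>e1\<close>,
   \<open>Q\<close> and \<open>R\<close> in \<open>I2\<close> below and above \<open>e2\<close>, and
   \<open>S\<close> in \<open>I3\<close> below \<open>e3\<close>: on both sides of the two
   cuts.\<close>
 have ref: "EX P Q R S. length P = p & length Q = q & length R = r & length S = s &
   E.em (?m I1 e1 @ P @ [?o b1] @ Q @ ?m I2 e2 @ R @ S @ ?m I3 e3) & E.em (?m I1 e1 @ P @ Q @ ?m I2 e2 @ R @ [?o b2] @ S @ ?m I3 e3)" for p q r s
 proof -
  obtain P where P: "length P = p" "set P <= idx I1" "?si I1 P" "ALL i:set e1. ALL j:set P. (i, j) : lt I1"
   using dense_dominating[OF D(1) _ ie(1), of p] by auto
  obtain Q where Q: "length Q = q" "set Q <= idx I2" "?si I2 Q" "ALL i:set e2. ALL j:set Q. (j, i) : lt I2"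
   using dense_dominated[OF D(2) _ ie(2), of q] by auto
  obtain R where R: "length R = r" "set R <= idx I2" "?si I2 R" "ALL i:set e2 Un set Q. ALL j:set R. (i, j) : lt I2"
   using dense_dominating[OF D(2), of "set e2 Un set Q" r] ie(2) Q(2) by auto
  obtain S where S: "length S = s" "set S <= idx I3" "?si I3 S" "ALL i:set e3. ALL j:set S. (j, i) : lt I3"
   using dense_dominated[OF D(3) _ ie(3), of s] by auto
  have s1: "?si I1 (e1 @ P)" and s2: "?si I2 (Q @ e2 @ R)" and s3: "?si I3 (S @ e3)" using so1 so2 so3 P Q R S by (auto simp: sorted_wrt_append)
  have i: "set (e1 @ P) <= idx I1" "set (Q @ e2) <= idx I2" "set R <= idx I2" "set (Q @ e2 @ R) <= idx I2" "set (S @ e3) <= idx I3"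
   using ie P Q R S by auto
  let ?la = "map (Pair 0) (e1 @ P) @ (1, undefined) # map (Pair 2) (Q @ e2 @ R) @ map (Pair 3) (S @ e3)"
  let ?lb = "map (Pair 0) (e1 @ P) @ map (Pair 1) (Q @ e2 @ R) @ (2, undefined) # map (Pair 3) (S @ e3)"
  have sl: "?so (seq_sum Is) (map (Pair k) zs)" if "k < length Is" "?si (Is ! k) zs" "set zs <= idx (Is ! k)" for k Is zs
   unfolding sorted_wrt_map by (rule sorted_wrt_mono_rel[OF _ that(2)]) (use that in auto)
  have "?so ?a ?la" using sl[of 0 "[I1, single b1, I2, I3]" "e1 @ P"] sl[of 2 "[I1, single b1, I2, I3]" "Q @ e2 @ R"]
    sl[of 3 "[I1, single b1, I2, I3]" "S @ e3"] s1 s2 s3 i unfolding sorted_wrt_append sorted_wrt.simps by auto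
  moreover have "?so ?b ?lb" using sl[of 0 "[I1, I2, single b2, I3]" "e1 @ P"] sl[of 1 "[I1, I2, single b2, I3]" "Q @ e2 @ R"]
    sl[of 3 "[I1, I2, single b2, I3]" "S @ e3"] s1 s2 s3 i unfolding sorted_wrt_append sorted_wrt.simps by auto
  moreover have "set ?la <= idx ?a" "set ?lb <= idx ?b" using i by auto
  ultimately have "E.em (map (%p. ?o (entry ?a p)) ?la)" "E.em (map (%p. ?o (entry ?b p)) ?lb)" using em[OF ind(2)] em[OF ind(3)] by blast+
  hence "E.em (?m I1 e1 @ ?m I1 P @ [?o b1] @ ?m I2 Q @ ?m I2 e2 @ ?m I2 R @ ?m I3 S @ ?m I3 e3)"
   "E.em (?m I1 e1 @ ?m I1 P @ ?m I2 Q @ ?m I2 e2 @ ?m I2 R @ [?o b2] @ ?m I3 S @ ?m I3 e3)" by (simp_all add: comp_def)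
  moreover have "length (?m I1 P) = p" "length (?m I2 Q) = q" "length (?m I2 R) = r" "length (?m I3 S) = s" using P(1) Q(1) R(1) S(1) by simp_all
  ultimately show ?thesis by blast
 qed
 have mem: "set (?m I1 e1 @ [?o b1] @ ?m I2 e2 @ [?o b2] @ ?m I3 e3) <= AS U"
 proof -
  have "?o t : AS U" if "t : tuples U x" for t
  proof (rule asgI)
   show "?o t v : univ U (fst v)" for v using asgD[OF a0, of v] that by (auto simp: tuples_def override_on_def)
  qed
  hence "set (map (%p. ?o (entry ?J p)) ls) <= AS U" using ent ls(1) by (simp only: set_map) blast
  thus ?thesis unfolding eJ .
 qed
 show ?thesis by (rule exI[of _ x], rule exI[of _ a0], rule exI[of _ c], rule exI[of _ "?m I1 e1"], rule exI[of _ "?o b1"],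
    rule exI[of _ "?m I2 e2"], rule exI[of _ "?o b2"], rule exI[of _ "?m I3 e3"]) (intro conjI allI E.em_sequence_axioms ref mem ls(3)[unfolded eJ])
qed

text \<open>Homogeneity with the supports replaced by the definable conditions F > dl, and with
  points from all of \<open>U\<close> instead of a model.\<close>

definition "close_pairs x a0 te F dl ep d D1 D2 D3 <-> (ALL e:AS U. ALL e':AS U. ALL f:AS U. ALL f':AS U.
     dl < F 1 (ov (d 1) e x) & dl < F 2 (ov (d 2) e' x) & dl < F 1 (ov (d 1) f x) & dl < F 2 (ov (d 2) f' x) -->
     \<bar>fval U (gl a0 (D1 @ [e] @ D2 @ [e'] @ D3)) te - fval U (gl a0 (D1 @ [f] @ D2 @ [f'] @ D3)) te\<bar> <= ep)"

text \<open>A formula version of \<psi> whose first variables are moved from the \<open>r\<close>-th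
  copy back to \<open>x\<close>; parameters from \<open>A\<close> again correspond to parameters
  from \<open>A\<close>.\<close>

definition "approximates x r z \<psi> dl F Z <-> finite Z & x Int Z = {} & F : Def (x Un Z) &
  (ALL A d. (ALL s. A s <= univ U s) & d : asg A --> (EX d':asg A. ALL e:AS U.
   \<bar>pred_at L U (cp 0 r ` x) z \<psi> e d - F (ov d' (%v. e (cp 0 r v)) x)\<bar> <= dl))"

lemma predicate_function:
 assumes \<psi>: "\<psi> : definable_predicates L U no_params (cp 0 r ` x Un z)" and fin: "finite x" "finite z"
  and dj: "cp 0 r ` x Int z = {}" and dl: "0 < dl"
 shows "EX FZ. approximates x r z \<psi> dl (fst FZ) (snd FZ)"
proof -
 let ?X = "cp 0 r ` x"
 have c: "continuous_map (type_space L U no_params (?X Un z)) euclideanreal \<psi>"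
  and c01: "!!p. p : types L U no_params (?X Un z) ==> \<psi> p : {0..1}"
  using \<psi> unfolding definable_predicates_def continuous_map_in_subtopology by (auto simp: topspace_type_space)
 obtain f where f: "f : F0 L (?X Un z)"
  "!!a. a : AS U ==> \<bar>\<psi> (tp L U no_params (?X Un z) a) - fval U a f\<bar> <= dl"
  using continuous_approx_formula[OF _ c c01 dl] by auto
 obtain b where b: "!!v. v : x Un z ==> snd v < b" using var_index_bound[of "x Un z"] fin by auto
 define sg where "sg v = (if v : ?X then (fst v, snd (prod_decode (snd v))) else cp b 0 v)" for v :: "'s var"
 have sg: "fst (sg v) = fst v" for v by (simp add: sg_def)
 have sgX: "sg (cp 0 r u) = u" if "u : x" for u using that by (simp add: sg_def) (simp add: cp_def)
 have sgz: "sg v = cp b 0 v" if "v : z" for v using that dj by (auto simp: sg_def)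
 define F where "F a = fval U (a o sg) f" for a
 have "sg ` (?X Un z) <= x Un cp b 0 ` z" using sgX sgz by auto
 hence F: "F : Def (x Un cp b 0 ` z)" unfolding F_def[abs_def] by (rule Def_rename[OF Def_fval[OF f(1)] sg])
 have Z: "x Int cp b 0 ` z = {}" using b snd_cp[of b 0] by (fastforce simp: not_le[symmetric])
 have "EX d':asg A. ALL e:AS U. \<bar>pred_at L U ?X z \<psi> e d - F (ov d' (%v. e (cp 0 r v)) x)\<bar> <= dl"
  if A: "ALL s. A s <= univ U s" and d: "d : asg A" for A d
 proof (intro bexI ballI)
  have dU: "d : AS U" using asg_mono[of A "univ U"] A d by blast
  fix e assume e: "e : AS U"
  let ?d = "glue b (%_. d) d"
  have "F (ov ?d (%v. e (cp 0 r v)) x) = fval U (ov d e ?X) f" unfolding F_def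
  proof (rule fval_cong)
   fix v assume "v : fvars f"
   then consider u where "v = cp 0 r u" "u : x" | "v : z" using f(1) unfolding Fml_def by blast
   thus "(ov ?d (%v. e (cp 0 r v)) x o sg) v = ov d e ?X v"
   proof cases
    case 1
    thus ?thesis by (simp add: sgX override_on_def)
   next
    case 2
    hence "cp b 0 v ~: x" "v ~: ?X" using Z dj by blast+
    thus ?thesis using 2 by (simp add: sgz override_on_def)
   qed
  qed
  thus "\<bar>pred_at L U ?X z \<psi> e d - F (ov ?d (%v. e (cp 0 r v)) x)\<bar> <= dl"
   using f(2)[OF asg_override[OF dU e]] by (simp add: pred_at_def)
 qed (intro glue_asg d)
 hence "approximates x r z \<psi> dl F (cp b 0 ` z)" using F Z fin(2) unfolding approximates_def by blast
 thus ?thesis by (intro exI[of _ "(F, cp b 0 ` z)"]) simp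
qed

lemma pred_at_restrict: "x Int z = {} ==> pred_at L U x z P (restrict a x) (restrict d z) = pred_at L U x z P a d"
 unfolding pred_at_def by (rule arg_cong[where f = P], rule tp_cong) (auto simp: override_on_def)

text \<open>The property is applied to uniform averages over \<open>al 1\<close> and
  \<open>al 2\<close>, on a small model that contains the coordinates in \<open>x\<close> of all
  points involved. Integrals become sums, and homogeneity passes from the model to \<open>U\<close>
  by elementarity.\<close>

lemma EH_functions:
 fixes m1 m2 m3 :: nat and x :: "'s var set"
 defines "r1 == m1" and "r2 == Suc (m1 + m2)" and "k == m1 + m2 + m3 + 2"
 defines "X == %i :: nat. cp 0 (if i = 1 then r1 else r2) ` x"
 defines "y == copies x k - (UN i:{1..2}. X i)"
 assumes x: "finite x" and a0: "a0 : AS U" and te: "te : F0 L (copies x k)" and ep: "ep : {0..1}"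
  and EH: "uniformly_definable_strong_EH L \<kappa> T U 2 X y (%p. p te) ep"
 shows "EX F Z dl. 0 < dl & dl <= 1 / 8 & (ALL i:{1..2 :: nat}. finite (Z i) & x Int Z i = {} & F i : Def (x Un Z i)) &
  (ALL N D1 D2 D3 al. 0 < N & length D1 = m1 & length D2 = m2 & length D3 = m3 &
   (ALL i:{1..2}. length (al i) = N & set (al i) <= AS U) & set (D1 @ D2 @ D3) <= AS U -->
   (EX d. (ALL i:{1..2}. d i : AS U & 7 * dl * real N <= (SUM j<N. F i (ov (d i) (al i ! j) x))) &
    close_pairs x a0 te F dl ep d D1 D2 D3))"
proof -
 have rk: "r1 < k" "r2 < k" "r1 ~= r2" by (auto simp: r1_def r2_def k_def)
 have cpi: "cp 0 i u = cp 0 j t <-> i = j & u = t" for i j and u t :: "'s var" by (auto simp: cp_def prod_eq_iff)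
 have I2: "{1..2 :: nat} = {1, 2}" by auto
 have X: "X 1 = cp 0 r1 ` x" "X 2 = cp 0 r2 ` x" by (simp_all add: X_def)
 have i12: "i = 1 | i = 2" if "i : {1..2}" for i :: nat using that by auto
 have UX: "(UN i:{1..2}. X i) = cp 0 r1 ` x Un cp 0 r2 ` x" unfolding I2 UN_insert X by simp
 have Xy: "(UN i:{1..2}. X i) Un y = copies x k" "(UN i:{1..2}. X i) Int y = {}" unfolding y_def UX using rk by (auto intro!: copiesI)
 obtain z \<psi> dl0 where pf: "predicate_family L U 2 X z \<psi>" and dl0: "dl0 > 0"
  and M0: "!!M mu b. small_model L \<kappa> T U M ==> admissible_measures L U M 2 X mu ==> b : tuples M y ==>
      (EX d. (ALL i:{1..2}. d i : tuples M (z i)) &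
       homogeneous M 2 X (%a. pred_at L U (UN i:{1..2}. X i) y (%p. p te) a b) ep
        (%i a. pred_at L U (X i) (z i) (\<psi> i) a (d i)) &
       (ALL i:{1..2}. (\<integral>p. pred_at_type L (X i) (z i) (\<psi> i) (d i) p \<partial>mu i) >= dl0))"
  using EH unfolding uniformly_definable_strong_EH_def by (elim exE conjE) (rule that, assumption+, blast)
 \<comment> \<open>Integrals of at least 8 dl lose \<open>dl\<close> by approximation, and F > dl
   forces \<psi> > 0. The minimum with 1 keeps the later threshold 3 dl in [0,1].\<close>
 define dl where "dl = min 1 dl0 / 8"
 have dl: "0 < dl" "dl <= 1 / 8" "8 * dl <= dl0" using dl0 by (auto simp: dl_def)
 define r where "r i = (if i = 1 then r1 else r2)" for i :: nat
 have Xr: "X i = cp 0 (r i) ` x" for i by (simp add: X_def r_def)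
 have z: "finite (z i)" "X i Int z i = {}" "\<psi> i : definable_predicates L U no_params (X i Un z i)" if "i : {1..2}" for i
  using pf that unfolding predicate_family_def by blast+
 have "ALL i:{1..2}. EX FZ. approximates x (r i) (z i) (\<psi> i) dl (fst FZ) (snd FZ)"
 proof
  fix i :: nat assume i: "i : {1..2}"
  show "EX FZ. approximates x (r i) (z i) (\<psi> i) dl (fst FZ) (snd FZ)"
   by (rule predicate_function[OF z(3)[OF i, unfolded Xr] x z(1)[OF i] z(2)[OF i, unfolded Xr] dl(1)])
 qed
 from bchoice[OF this] obtain FZ where FZ: "ALL i:{1..2}. approximates x (r i) (z i) (\<psi> i) dl (fst (FZ i)) (snd (FZ i))" ..
 define F where "F i = fst (FZ i)" for i
 define Z where "Z i = snd (FZ i)" for i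
 have Z: "ALL i:{1..2}. finite (Z i) & x Int Z i = {} & F i : Def (x Un Z i)" using FZ unfolding F_def Z_def approximates_def by blast
 have FD: "F i : Def (x Un Z i)" if "i : {1..2}" for i using Z that by blast
 have app: "EX d':asg A. ALL e:AS U. \<bar>pred_at L U (X i) (z i) (\<psi> i) e d - F i (ov d' (%v. e (cp 0 (r i) v)) x)\<bar> <= dl"
  if "i : {1..2}" "!!s. A s <= univ U s" "d : asg A" for A d i using FZ that unfolding F_def approximates_def Xr by blast
 have "EX d. (ALL i:{1..2}. d i : AS U & 7 * dl * real N <= (SUM j<N. F i (ov (d i) (al i ! j) x))) &
    close_pairs x a0 te F dl ep d D1 D2 D3"
  if N: "0 < N" and lD: "length D1 = m1" "length D2 = m2" "length D3 = m3"
   and al: "ALL i:{1..2}. length (al i) = N & set (al i) <= AS U" and DU: "set (D1 @ D2 @ D3) <= AS U"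
  for N D1 D2 D3 al
 proof -
  let ?S = "set (D1 @ D2 @ D3) Un (set (al 1) Un set (al 2))"
  have SU: "?S <= AS U" using al DU by auto
  let ?C = "(%(s, v). (fst v, s v)) ` (?S \<times> x)"
  have cC: "countable ?C" using x by (intro countable_finite) auto
  have CU: "a : univ U s" if "(s, a) : ?C" for s a using asgD[OF subsetD[OF SU]] that by auto
  have "EX M. small_model L \<kappa> T U M & (ALL (s, a):?C. a : univ M s)" by (rule small_submodel_exists[OF cC CU])
  then obtain M where MM: "small_model L \<kappa> T U M & (ALL (s, a):?C. a : univ M s)" by (rule exE)
  note sm = MM[THEN conjunct1] and CM = MM[THEN conjunct2]
  have mem: "s v : univ M (fst v)" if "s : ?S" "v : x" for s v using bspec[OF CM, of "(fst v, s v)"] that by (auto simp: image_iff)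
  interpret S: small_submodel L U \<kappa> T M by (rule small_modelD[OF sm])
  obtain aM where aM: "aM : AS M" using S.M.asg_ne by blast
  let ?h = "%s. ov aM s x"
  have hM: "?h s : AS M" if "s : ?S" for s
  proof (rule asgI)
   show "?h s v : univ M (fst v)" for v using mem[OF that, of v] asgD[OF aM, of v] by (simp add: override_on_def)
  qed
  define q where "q i j = glue 0 (%_. if j < N then ?h (al i ! j) else aM) aM" for i j
  have q: "q i j : AS M" if "i : {1..2}" for i j
  proof -
   have "al i ! j : ?S" if "j < N" using nth_mem[of j "al i"] bspec[OF al `i : {1..2}`] that i12[OF `i : {1..2}`] by auto
   thus ?thesis unfolding q_def using hM aM by (intro glue_asg) auto
  qed
  define mu where "mu i = average (type_space L U (univ M) (X i)) N (%j. tp L U (univ M) (X i) (q i j))" for i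
  have mu: "mu i : keisler_measures L U (univ M) (X i)" if "i : {1..2}" for i
   unfolding mu_def by (rule S.average_keisler[OF S.asg_sub[OF q[OF that]] S.univ_sub N])
  have adm: "admissible_measures L U M 2 X mu" unfolding admissible_measures_def
  proof (intro conjI ballI mu)
   show "generically_stable L U M (X i) (mu i)" if "i : {1..<2}" for i
    unfolding mu_def by (rule S.average_generically_stable[OF q N]) (insert that x, auto simp: Xr)
  qed
  let ?L = "%e e'. D1 @ [e] @ D2 @ [e'] @ D3"
  have lL: "length (?L e e') = k" for e e' using lD by (simp add: k_def)
  have nthL: "?L e e' ! i = (if i = r1 then e else if i = r2 then e' else ?L t t' ! i)" if "i < k" for e e' t t' i
   using that lD by (auto simp: nth_append nth_Cons r1_def r2_def k_def split: nat.split)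
  have nthL_in: "?L e e' ! i : ?S" if "i < k" "i ~= r1" "i ~= r2" for e e' i
   using that lD by (auto simp: nth_append nth_Cons r1_def r2_def k_def split: nat.split)
  define b where "b = glue 0 (%i. if i < k & i ~= r1 & i ~= r2 then ?h (?L aM aM ! i) else aM) aM"
  have b: "b : AS M" unfolding b_def using hM[OF nthL_in] aM by (intro glue_asg) auto
  have "restrict b y : tuples M y" by (rule restrict_tuples[OF b]) simp
  from M0[OF sm adm this] obtain d0 where d0: "!!i. i : {1..2} ==> d0 i : tuples M (z i)"
   and hom: "homogeneous M 2 X (%a. pred_at L U (UN i:{1..2}. X i) y (%p. p te) a (restrict b y)) ep
        (%i a. pred_at L U (X i) (z i) (\<psi> i) a (d0 i))"
   and int: "!!i. i : {1..2} ==> (\<integral>p. pred_at_type L (X i) (z i) (\<psi> i) (d0 i) p \<partial>mu i) >= dl0" by blast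
  have "EX d:AS M. ALL e:AS U. \<bar>pred_at L U (X i) (z i) (\<psi> i) (restrict e (X i)) (d0 i) - F i (ov d (%v. e (cp 0 (r i) v)) x)\<bar> <= dl"
   if i: "i : {1..2}" for i
  proof -
   obtain d1 where d1: "d1 : AS M" "ALL v:z i. d1 v = d0 i v" using S.M.tuples_extend[OF d0[OF i]] by blast
   have "restrict d1 (z i) = d0 i" using d0[OF i] d1(2) by (auto simp: tuples_def restrict_def PiE_iff extensional_def)
   hence "pred_at L U (X i) (z i) (\<psi> i) (restrict e (X i)) (d0 i) = pred_at L U (X i) (z i) (\<psi> i) e d1" for e
    using pred_at_restrict[OF z(2)[OF i], of "\<psi> i" e d1] by simp
   thus ?thesis using app[OF i S.univ_sub d1(1)] by simp
  qed
  then obtain d where d: "!!i. i : {1..2} ==> d i : AS M"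
   and dF: "!!i e. i : {1..2} ==> e : AS U ==>
    \<bar>pred_at L U (X i) (z i) (\<psi> i) (restrict e (X i)) (d0 i) - F i (ov (d i) (%v. e (cp 0 (r i) v)) x)\<bar> <= dl" by metis
  have sum: "7 * dl * real N <= (SUM j<N. F i (ov (d i) (al i ! j) x))" if i: "i : {1..2}" for i
  proof -
   let ?f = "pred_at_type L (X i) (z i) (\<psi> i) (d0 i)"
   have "integrable (mu i) ?f" using int[OF i] dl0 not_integrable_integral_eq[of "mu i" ?f] by force
   from integral_average[OF _ N this[unfolded mu_def]]
   have avg: "(\<integral>p. ?f p \<partial>mu i) = (SUM j<N. ?f (tp L U (univ M) (X i) (q i j))) / N"
    using tp_in_types[OF S.univ_sub S.asg_sub[OF q[OF i]]] by (simp add: mu_def topspace_type_space)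
   have le: "?f (tp L U (univ M) (X i) (q i j)) <= F i (ov (d i) (al i ! j) x) + dl" if j: "j < N" for j
   proof -
    have "?f (tp L U (univ M) (X i) (restrict (q i j) (X i))) = pred_at L U (X i) (z i) (\<psi> i) (restrict (q i j) (X i)) (d0 i)"
     by (rule pred_at_type_tp[OF z(2)[OF i]]) (insert d0[OF i], auto simp: tuples_def PiE_iff)
    moreover have "ov (d i) (%v. q i j (cp 0 (r i) v)) x = ov (d i) (al i ! j) x" using j by (auto simp: q_def override_on_def)
    ultimately show ?thesis using dF[OF i S.asg_sub[OF q[OF i, of j]]] by simp
   qed
   have "(SUM j<N. ?f (tp L U (univ M) (X i) (q i j))) <= (SUM j<N. F i (ov (d i) (al i ! j) x) + dl)" by (intro sum_mono le) simp
   also have "\<dots> = (SUM j<N. F i (ov (d i) (al i ! j) x)) + N * dl" by (simp add: sum.distrib)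
   finally have s: "(SUM j<N. ?f (tp L U (univ M) (X i) (q i j))) <= (SUM j<N. F i (ov (d i) (al i ! j) x)) + N * dl" .
   have "8 * dl * N <= dl0 * N" using dl(3) by (intro mult_right_mono) auto
   moreover have "dl0 * N <= (SUM j<N. ?f (tp L U (univ M) (X i) (q i j)))" using int[OF i] N unfolding avg by (simp add: pos_le_divide_eq)
   ultimately show ?thesis using s by (simp add: algebra_simps)
  qed
  have thL: "fval U a te = fval U (gl a0 (?L e e')) te"
   if "!!i u. i < k ==> u : x ==> a (cp 0 i u) = (if i = r1 then e u else if i = r2 then e' u else (?L aM aM ! i) u)" for a e e'
  proof (rule fval_cong)
   fix v assume "v : fvars te"
   hence "v : copies x k" using te by (auto simp: Fml_def)
   thus "a v = gl a0 (?L e e') v" by (rule copiesE) (insert that nthL[of _ e e' aM aM] lL, simp add: gl_cp del: append.simps)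
  qed
  have hM4: "\<bar>fval U (gl a0 (?L e e')) te - fval U (gl a0 (?L f f')) te\<bar> <= ep"
   if e: "e : AS M" "e' : AS M" "f : AS M" "f' : AS M"
    and pos: "dl < F 1 (ov (d 1) e x)" "dl < F 2 (ov (d 2) e' x)" "dl < F 1 (ov (d 1) f x)" "dl < F 2 (ov (d 2) f' x)" for e e' f f'
  proof -
   let ?XX = "UN i:{1..2}. X i"
   define g where "g e e' = glue 0 (%i. if i = r1 then e else e') aM" for e e'
   have gM: "g e e' : AS M" if "e : AS M" "e' : AS M" for e e' unfolding g_def by (rule glue_asg[OF _ aM]) (use that in auto)
   have gt: "restrict (g e e') ?XX : tuples M ?XX" if "e : AS M" "e' : AS M" for e e' by (rule restrict_tuples[OF gM[OF that]]) simp
   have P: "0 < pred_at L U (X i) (z i) (\<psi> i) (restrict (restrict (g e e') ?XX) (X i)) (d0 i)"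
    if e: "e : AS M" "e' : AS M" and pos: "dl < F 1 (ov (d 1) e x)" "dl < F 2 (ov (d 2) e' x)"
     and i: "i : {1..2}" for e e' i
   proof -
    have "restrict (restrict (g e e') ?XX) (X i) = restrict (g e e') (X i)" using i by (auto simp: restrict_def)
    moreover have "dl < F i (ov (d i) (%v. g e e' (cp 0 (r i) v)) x)" using pos i12[OF i] rk(3) by (auto simp: r_def g_def)
    ultimately show ?thesis using dF[OF i S.asg_sub[OF gM[OF e]]] by simp
   qed
   have V: "pred_at L U ?XX y (%p. p te) (restrict (g e e') ?XX) (restrict b y) = fval U (gl a0 (?L e e')) te"
    if "e : AS M" "e' : AS M" for e e'
   proof -
    have "pred_at L U ?XX y (%p. p te) (restrict (g e e') ?XX) (restrict b y) = fval U (ov b (g e e') ?XX) te"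
     by (rule pred_at_formula) (use te Xy(1) S.asg_sub[OF gM[OF that]] S.asg_sub[OF b] in simp_all)
    also have "\<dots> = fval U (gl a0 (?L e e')) te"
    proof (rule thL)
     fix i u assume iu: "i < k" "u : x"
     have "cp 0 i u : ?XX <-> i = r1 | i = r2" unfolding UX using iu(2) by (auto simp: cpi)
     thus "ov b (g e e') ?XX (cp 0 i u) = (if i = r1 then e u else if i = r2 then e' u else (?L aM aM ! i) u)"
      using iu by (simp add: override_on_def g_def b_def del: append.simps)
    qed
    finally show ?thesis .
   qed
   show ?thesis using hom[unfolded homogeneous_def, rule_format, OF gt[OF e(1,2)] gt[OF e(3,4)]]
     P[OF e(1,2) pos(1,2)] P[OF e(3,4) pos(3,4)] V[OF e(1,2)] V[OF e(3,4)] by auto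
  qed
  have "\<bar>fval U (gl a0 (?L e e')) te - fval U (gl a0 (?L f f')) te\<bar> <= ep"
   if e: "e : AS U" "e' : AS U" "f : AS U" "f' : AS U"
    and pos: "dl < F 1 (ov (d 1) e x)" "dl < F 2 (ov (d 2) e' x)" "dl < F 1 (ov (d 1) f x)" "dl < F 2 (ov (d 2) f' x)" for e e' f f'
  proof (rule ccontr)
   assume no: "~ ?thesis"
   define ta where "ta p j v = (if v : x then cp 0 p v else cp 0 j v)" for p j and v :: "'s var"
   define rh where "rh p j v = (let i = fst (prod_decode (snd v)); u = (fst v, snd (prod_decode (snd v))) in
     cp 0 (if i = r1 then p else if i = r2 then j else 6 + i) u)" for p j and v :: "'s var"
   have fs: "fst (ta p j v) = fst v" "fst (rh p j v) = fst v" for p j v by (simp_all add: ta_def rh_def Let_def)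
   have rh: "rh p j (cp 0 i u) = cp 0 (if i = r1 then p else if i = r2 then j else 6 + i) u" for p j i u by (simp add: rh_def Let_def) (simp add: cp_def)
   \<comment> \<open>Copies 4 and 5 hold the two parameters \<open>d\<close>, copies from 6 on the
     fixed entries of the list; copies 0 to 3 are left for the four points.\<close>
   define Q where "Q = glue 0 (%i. if i = 4 then d 1 else if i = 5 then d 2 else
    if i - 6 < k & i - 6 ~= r1 & i - 6 ~= r2 then ?h (?L aM aM ! (i - 6)) else aM) aM"
   have Q: "Q : AS M" unfolding Q_def by (rule glue_asg[OF _ aM]) (use d[of 1] d[of 2] aM hM[OF nthL_in] in auto)
   let ?Y = "copies x 4"
   let ?a = "ov Q"
   have ev1: "F i (?a g ?Y o ta p (3 + i)) = F i (ov (d i) (%v. g (cp 0 p v)) x)"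
    if "i : {1..2}" "p < 4" "g : AS U" for g i p
   proof (rule Def_cong[OF FD[OF that(1)] asg_comp[OF asg_override[OF S.asg_sub[OF Q] that(3)] fs(1)]])
    show "ov (d i) (%v. g (cp 0 p v)) x : AS U"
     by (rule asg_override[OF S.asg_sub[OF d[OF that(1)]]]) (insert asgD[OF that(3), of "cp 0 p _"], auto intro!: asgI)
    fix v
    have "cp 0 (3 + i) v ~: ?Y" using that(1) by (auto elim!: copiesE simp: cpi)
    thus "(?a g ?Y o ta p (3 + i)) v = ov (d i) (%v. g (cp 0 p v)) x v"
     using i12[OF that(1)] that(2) copiesI[of p 4 v x] by (elim disjE) (simp_all add: ta_def override_on_def Q_def)
   qed
   have ev2: "fval U (?a g ?Y o rh p j) te = fval U (gl a0 (?L (%v. g (cp 0 p v)) (%v. g (cp 0 j v)))) te"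
    if "p < 4" "j < 4" for g p j
   proof (rule thL)
    fix i u assume iu: "i < k" "u : x"
    have "cp 0 (6 + i) u ~: ?Y" by (auto elim!: copiesE simp: cpi)
    thus "(?a g ?Y o rh p j) (cp 0 i u) = (if i = r1 then g (cp 0 p u) else if i = r2 then g (cp 0 j u) else (?L aM aM ! i) u)"
     using iu that copiesI[of p 4 u x] copiesI[of j 4 u x] by (simp add: rh override_on_def Q_def)
   qed
   \<comment> \<open>Below 1 exactly at a violation, so a violation in \<open>U\<close> produces one
     in \<open>M\<close> by \<open>elem_witness\<close>.\<close>
   define H where "H a = 1 - max 0 (F 1 (a o ta 0 4) - dl) * (max 0 (F 2 (a o ta 1 5) - dl) * (max 0 (F 1 (a o ta 2 4) - dl) *
    (max 0 (F 2 (a o ta 3 5) - dl) * max 0 (\<bar>fval U (a o rh 0 1) te - fval U (a o rh 2 3) te\<bar> - ep))))" for a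
   have H: "H : Def UNIV" unfolding H_def[abs_def]
    by (rule Def_compl, intro Def_mult Def_diff0 Def_const Def_absdiff Def_rename[OF FD fs(1)] Def_rename[OF Def_fval[OF te] fs(2)])
     (use dl ep in auto)
   have H1: "H (?a g ?Y) < 1 <-> dl < F 1 (ov (d 1) (%v. g (cp 0 0 v)) x) & dl < F 2 (ov (d 2) (%v. g (cp 0 1 v)) x) &
     dl < F 1 (ov (d 1) (%v. g (cp 0 2 v)) x) & dl < F 2 (ov (d 2) (%v. g (cp 0 3 v)) x) &
     ~ \<bar>fval U (gl a0 (?L (%v. g (cp 0 0 v)) (%v. g (cp 0 1 v)))) te - fval U (gl a0 (?L (%v. g (cp 0 2 v)) (%v. g (cp 0 3 v)))) te\<bar> <= ep"
    if "g : AS U" for g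
   proof -
    have m: "(1 - max 0 a * (max 0 b * (max 0 c * (max 0 e * max 0 f))) < 1) <-> 0 < a & 0 < b & 0 < c & 0 < e & 0 < f" for a b c e f :: real
     by (auto simp: max_def zero_less_mult_iff)
    show ?thesis using ev1[of 1 _ g] ev1[of 2 _ g] that ev2[of _ _ g] unfolding H_def m by (simp add: not_le)
   qed
   define G where "G = glue 0 (%i. if i = 0 then e else if i = 1 then e' else if i = 2 then f else f') a0"
   have G: "G : AS U" unfolding G_def by (rule glue_asg[OF _ a0]) (use e in auto)
   have "H (?a G ?Y) < 1" unfolding H1[OF G] using pos no by (simp add: G_def)
   from S.elem_witness[OF _ H S.asg_sub[OF Q] _ G this] asgD[OF Q] x
   obtain g where g: "g : AS M" "H (?a g ?Y) < 1" by (auto simp: copies_def)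
   have gp: "(%v. g (cp 0 p v)) : AS M" for p using asgD[OF g(1), of "cp 0 p _"] by (auto intro!: asgI)
   from g(2)[unfolded H1[OF S.asg_sub[OF g(1)]]] hM4[OF gp gp gp gp, of 0 1 2 3] show False by blast
  qed
  thus ?thesis using sum d S.asg_sub unfolding close_pairs_def by (intro exI[of _ d] conjI ballI impI) auto
 qed
 thus ?thesis using dl(1,2) Z by (intro exI[of _ F] exI[of _ Z] exI[of _ dl] conjI allI impI) (assumption | blast)+
qed

end

text \<open>A term is either below 3 dl or counted, and a counted one is at most 1.\<close>

lemma many_large:
 fixes h :: "nat => real"
 assumes "!!j. h j <= 1" "0 < dl"
 shows "(SUM j<N. h (a + j)) <= 3 * dl * real N + real (length (filter (%j. 3 * dl <= h j) [a..<a + N]))"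
proof (induction N)
 case (Suc N)
 have "h (a + N) <= 3 * dl + (if 3 * dl <= h (a + N) then 1 else 0)" using assms(1)[of "a + N"] assms(2) by auto
 with Suc show ?case by (auto simp: algebra_simps)
qed simp

section \<open>Distality from the Erdos-Hajnal property\<close>

context monster
begin

text \<open>A formula \<open>te\<close> tells the configuration with both inserted points from the
  Ehrenfeucht-Mostowski type. Homogeneity at half the difference keeps the inserted points from
  exceeding \<open>dl\<close> in both predicates. Hence one of them is small next to a point of
  value at least 3 dl, and repeated insertion gives alternations of every length.\<close>

lemma EH_imp_distal:
 assumes NIP: "NIP L U"
  and EH: "!!x y ph ep. variable_tuples 2 x y ==> ph : definable_predicates L U no_params ((UN i:{1..2}. x i) Un y) ==>
   0 < ep ==> uniformly_definable_strong_EH L \<kappa> T U 2 x y ph ep"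
 shows "distal TYPE('i) L U"
proof (rule ccontr)
 assume "~ distal TYPE('i) L U"
 from nondistal_configuration[OF this] obtain x a0 c E1 b1 E2 b2 E3 where em: "em_sequence L U \<kappa> T x a0 c"
  and ref: "ALL p q r s. EX P Q R S. length P = p & length Q = q & length R = r & length S = s &
   em_sequence.em L U x a0 c (E1 @ P @ [b1] @ Q @ E2 @ R @ S @ E3) & em_sequence.em L U x a0 c (E1 @ P @ Q @ E2 @ R @ [b2] @ S @ E3)"
  and KU: "set (E1 @ [b1] @ E2 @ [b2] @ E3) <= AS U"
  and nem: "~ em_sequence.em L U x a0 c (E1 @ [b1] @ E2 @ [b2] @ E3)" by (elim exE conjE) (rule that)
 interpret E: em_sequence L U \<kappa> T x a0 c by (rule em)
 let ?K = "E1 @ [b1] @ E2 @ [b2] @ E3"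
 define m1 m2 m3 where "m1 = length E1" and "m2 = length E2" and "m3 = length E3"
 define k where "k = m1 + m2 + m3 + 2"
 have lK: "length ?K = k" by (simp add: k_def m1_def m2_def m3_def)
 have cU: "c i : AS U" for i using E.c_ind[of "[i]"] by (auto simp: eqv_def)
 obtain \<Theta> where \<Theta>: "\<Theta> : Def (copies x k)" "\<Theta> (gl a0 ?K) ~= \<Theta> (gl a0 (map c [0..<k]))"
  using nem KU cU lK unfolding E.em_def eqv_def by auto
 obtain te where te: "te : F0 L (copies x k)" "!!a. a : AS U ==> \<Theta> a = fval U a te"
  using \<Theta>(1) unfolding Def_def by blast
 have K: "gl a0 ?K : AS U" "gl a0 (map c [0..<k]) : AS U" using KU cU by (auto intro!: gl_asg E.a0)
 define ep0 where "ep0 = \<bar>fval U (gl a0 ?K) te - fval U (gl a0 (map c [0..<k])) te\<bar>"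
 have ep0: "0 < ep0" "ep0 <= 1"
  using \<Theta>(2) Def_01[OF \<Theta>(1) K(1)] Def_01[OF \<Theta>(1) K(2)] K by (auto simp: ep0_def te(2))
 define X where "X i = cp 0 (if i = 1 then m1 else Suc (m1 + m2)) ` x" for i :: nat
 define y where "y = copies x k - (UN i:{1..2}. X i)"
 have "{1..2 :: nat} = {1, 2}" by auto
 hence UX: "(UN i:{1..2}. X i) = cp 0 m1 ` x Un cp 0 (Suc (m1 + m2)) ` x" by (simp add: X_def)
 have Xy: "(UN i:{1..2}. X i) Un y = copies x k" unfolding y_def UX by (auto intro!: copiesI simp: k_def)
 have "variable_tuples 2 X y" unfolding variable_tuples_def
 proof (intro conjI ballI)
  show "finite (X i)" for i using E.finite_x by (simp add: X_def)
  show "finite y" using E.finite_x by (simp add: y_def copies_def)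
  show "disjoint_family_on X {1..2}" by (auto simp: disjoint_family_on_def X_def cp_def)
  show "X i Int y = {}" if "i : {1..2}" for i using that by (auto simp: y_def)
 qed
 moreover have "(%p. p te) : definable_predicates L U no_params ((UN i:{1..2}. X i) Un y)"
  unfolding Xy by (rule formula_predicate[OF te(1)]) simp
 ultimately have "uniformly_definable_strong_EH L \<kappa> T U 2 X y (%p. p te) (ep0 / 2)" using EH ep0(1) by simp
 note * = EH_functions[where ?m1.0 = m1 and ?m2.0 = m2 and ?m3.0 = m3 and ?x = x, OF E.finite_x E.a0 _ _ this[unfolded y_def X_def k_def]]
 have "te : F0 L (copies x (m1 + m2 + m3 + 2))" "ep0 / 2 : {0..1}" using te(1) ep0 by (auto simp: k_def)
 from *[OF this] obtain F Z dl where dl: "0 < dl" "dl <= 1 / 8"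
  and FZ: "ALL i:{1..2 :: nat}. finite (Z i) & x Int Z i = {} & F i : Def (x Un Z i)"
  and main: "ALL N D1 D2 D3 al. 0 < N & length D1 = m1 & length D2 = m2 & length D3 = m3 &
   (ALL i:{1..2}. length (al i) = N & set (al i) <= AS U) & set (D1 @ D2 @ D3) <= AS U -->
   (EX d. (ALL i:{1..2}. d i : AS U & 7 * dl * real N <= (SUM j<N. F i (ov (d i) (al i ! j) x))) &
    close_pairs x a0 te F dl (ep0 / 2) d D1 D2 D3)" by (elim exE conjE) (rule that)
 define alt where "alt i n <-> (EX d:AS U. EX ps. E.em (E.pairs ps) & n <= length ps &
   (ALL (u, v):set ps. 3 * dl <= F i (ov d u x) & F i (ov d v x) <= dl))" for i n
 have mono: "alt i m" if "alt i n" "m <= n" for i m n using that unfolding alt_def by (meson order_trans)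
 have step: "alt 1 n | alt 2 n" if n: "0 < n" for n
 proof -
  \<comment> \<open>An average of at least 7 dl leaves at least 4 dl N terms with value at least 3
    dl; \<open>N\<close> makes their number at least 2 n.\<close>
  obtain N0 :: nat where N0: "real (2 * n) / (4 * dl) <= N0" using real_arch_simple by blast
  define N where "N = Suc N0"
  have N: "real (2 * n) <= 4 * dl * N" "0 < N" using N0 dl(1) by (auto simp: N_def field_simps)
  define s where "s i = (if i = 1 then m1 else m1 + N + m2)" for i :: nat
  let ?m = "%i j. map c [i..<j]"
  let ?D1 = "?m 0 m1" and ?D2 = "?m (m1 + N) (m1 + N + m2)" and ?D3 = "?m (m1 + N + m2 + N) (m1 + N + m2 + N + m3)"
  have "0 < N & length ?D1 = m1 & length ?D2 = m2 & length ?D3 = m3 &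
   (ALL i:{1..2}. length (?m (s i) (s i + N)) = N & set (?m (s i) (s i + N)) <= AS U) & set (?D1 @ ?D2 @ ?D3) <= AS U"
   using N(2) cU by auto
  from main[rule_format, OF this] obtain d where d: "!!i. i : {1..2} ==> d i : AS U"
   and sum: "!!i. i : {1..2} ==> 7 * dl * real N <= (SUM j<N. F i (ov (d i) (?m (s i) (s i + N) ! j) x))"
   and hom: "close_pairs x a0 te F dl (ep0 / 2) d ?D1 ?D2 ?D3" by blast
  define J where "J i = take (2 * n) (filter (%j. 3 * dl <= F i (ov (d i) (c j) x)) [s i..<s i + N])" for i
  have J: "length (J i) = 2 * n" "set (J i) <= {s i..<s i + N}" "sorted_wrt (<) (J i)"
   "!!j. j : set (J i) ==> 3 * dl <= F i (ov (d i) (c j) x)" if i: "i : {1..2}" for i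
  proof -
   have "F i (ov (d i) (c j) x) <= 1" for j using FZ i by (intro Def_le1 asg_override d cU) blast+
   from many_large[where h = "%j. F i (ov (d i) (c j) x)" and a = "s i" and N = N, OF this dl(1)] sum[OF i]
   have "2 * n <= real (length (filter (%j. 3 * dl <= F i (ov (d i) (c j) x)) [s i..<s i + N]))" using N(1) by simp
   thus "length (J i) = 2 * n" by (simp add: J_def)
   show "set (J i) <= {s i..<s i + N}" "!!j. j : set (J i) ==> 3 * dl <= F i (ov (d i) (c j) x)"
    unfolding J_def by (auto dest!: in_set_takeD)
   show "sorted_wrt (<) (J i)" unfolding J_def by (intro sorted_wrt_take sorted_wrt_filter) simp
  qed
  note J1 = J[of 1, simplified] and J2 = J[of 2, simplified]
  have em0: "E.em (map c is)" if "sorted_wrt (<) is" for "is" using E.c_ind[OF that] by (simp add: E.em_def)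
  have "E.em (map c ([0..<m1] @ J 1 @ [m1 + N..<m1 + N + m2] @ J 2 @ [m1 + N + m2 + N..<m1 + N + m2 + N + m3]))"
   by (rule em0) (insert J(2,3)[of 1] J(2,3)[of 2], fastforce simp: sorted_wrt_append s_def)
  hence em: "E.em (?D1 @ E.pairs [] @ map c (J 1) @ ?D2 @ E.pairs [] @ map c (J 2) @ ?D3)" by simp
  have l: "length (map c (J 1)) = length (map c (J 2))" using J(1) by simp
  have "EX ps' qs'. E.em (E.pairs ps') & E.em (E.pairs qs') &
    length ps' + length qs' = length ([] :: (('s var => 'a) \<times> ('s var => 'a)) list) +
     length ([] :: (('s var => 'a) \<times> ('s var => 'a)) list) + length (map c (J 1)) &
   (ALL (u, v):set ps'. 3 * dl <= F 1 (ov (d 1) u x) & F 1 (ov (d 1) v x) <= dl) &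
   (ALL (u, v):set qs'. 3 * dl <= F 2 (ov (d 2) u x) & F 2 (ov (d 2) v x) <= dl)"
  proof (rule E.alternation[OF _ l em])
   fix A1 A2 B1 B2 assume a: "E.em (?D1 @ A1 @ A2 @ ?D2 @ B1 @ B2 @ ?D3)"
   obtain P Q R S where P: "length A1 = length P" "length A2 = length Q" "length B1 = length R" "length B2 = length S"
    and r: "E.em (E1 @ P @ [b1] @ Q @ E2 @ R @ S @ E3)" "E.em (E1 @ P @ Q @ E2 @ R @ [b2] @ S @ E3)"
    using ref[rule_format, of "length A1" "length A2" "length B1" "length B2"] by (elim exE conjE) (rule that, auto)
   obtain u u' where u: "E.em (?D1 @ A1 @ [u] @ A2 @ ?D2 @ B1 @ B2 @ ?D3)" "E.em (?D1 @ A1 @ A2 @ ?D2 @ B1 @ [u'] @ B2 @ ?D3)"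
    and e: "eqv x a0 (?D1 @ [u] @ ?D2 @ [u'] @ ?D3) ?K" using E.insertion[OF a _ _ _ P r] by (auto simp: m1_def m2_def m3_def)
   have "F 1 (ov (d 1) u x) <= dl | F 2 (ov (d 2) u' x) <= dl"
   proof (rule ccontr)
    assume no: "~ ?thesis"
    have "J i ~= []" if "i : {1..2}" for i using J(1)[OF that] n by auto
    then obtain j j' where j: "j : set (J 1)" "j' : set (J 2)" using list.set_sel(1) by force
    have uU: "u : AS U" "u' : AS U" using e by (auto simp: eqv_def)
    have g: "dl < F 1 (ov (d 1) (c j) x)" "dl < F 2 (ov (d 2) (c j') x)" using J(4)[of 1 j] J(4)[of 2 j'] j dl(1) by auto
    have F: "(%a. fval U a te) : Def (copies x (length (?D1 @ [c j] @ ?D2 @ [c j'] @ ?D3)))"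
     and G: "(%a. fval U a te) : Def (copies x (length (?D1 @ [u] @ ?D2 @ [u'] @ ?D3)))" using Def_fval[OF te(1)] by (simp_all add: k_def add_ac)
    have "E.em (map c ([0..<m1] @ [j] @ [m1 + N..<m1 + N + m2] @ [j'] @ [m1 + N + m2 + N..<m1 + N + m2 + N + m3]))"
     by (rule em0) (insert J(2)[of 1] J(2)[of 2] j, fastforce simp: sorted_wrt_append s_def)
    hence "eqv x a0 (?D1 @ [c j] @ ?D2 @ [c j'] @ ?D3) (map c [0..<k])" by (simp add: E.em_def k_def add_ac)
    from eqvD[OF this F] have 1: "fval U (gl a0 (?D1 @ [c j] @ ?D2 @ [c j'] @ ?D3)) te = fval U (gl a0 (map c [0..<k])) te" .
    from eqvD[OF e G] have 2: "fval U (gl a0 (?D1 @ [u] @ ?D2 @ [u'] @ ?D3)) te = fval U (gl a0 ?K) te" .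
    \<comment> \<open>Both pairs would exceed the threshold, while their values under
      \<open>te\<close> are those of the configuration and of the Ehrenfeucht-Mostowski type, which
      differ by \<open>ep0\<close>.\<close>
    have "ep0 <= ep0 / 2"
     using hom[unfolded close_pairs_def, rule_format, OF uU cU cU, of j j'] no g unfolding 1 2 ep0_def by (simp add: not_le)
    thus False using ep0(1) by simp
   qed
   thus "EX u u'. E.em (?D1 @ A1 @ [u] @ A2 @ ?D2 @ B1 @ B2 @ ?D3) & E.em (?D1 @ A1 @ A2 @ ?D2 @ B1 @ [u'] @ B2 @ ?D3) &
     (F 1 (ov (d 1) u x) <= dl | F 2 (ov (d 2) u' x) <= dl)" using u by blast
  qed (use J(4)[of 1] J(4)[of 2] in auto)
  then obtain ps qs where ps: "E.em (E.pairs ps)" "ALL (u, v):set ps. 3 * dl <= F 1 (ov (d 1) u x) & F 1 (ov (d 1) v x) <= dl"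
   and qs: "E.em (E.pairs qs)" "ALL (u, v):set qs. 3 * dl <= F 2 (ov (d 2) u x) & F 2 (ov (d 2) v x) <= dl"
   and len: "length ps + length qs = 2 * n" using J1(1) by auto
  have "n <= length ps | n <= length qs" using len by linarith
  moreover have "d 1 : AS U" "d 2 : AS U" using d by auto
  ultimately show ?thesis unfolding alt_def using ps qs by blast
 qed
 \<comment> \<open>Long alternations include the shorter bounds, so one of the two predicates serves
   all \<open>n\<close>.\<close>
 have "(ALL n. alt 1 n) | (ALL n. alt 2 n)"
 proof (rule ccontr)
  assume "~ ?thesis"
  then obtain n n' where "~ alt 1 n" "~ alt 2 n'" by blast
  thus False using step[of "Suc (max n n')"] mono[of 1 "Suc (max n n')" n] mono[of 2 "Suc (max n n')" n'] by fastforce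
 qed
 then obtain i where "i = 1 | i = 2" "ALL n. alt i n" by blast
 hence "i : {1..2}" "!!n. alt i n" by auto
 thus False using E.no_long_alternation[OF NIP, of "Z i" "F i" dl "3 * dl"] FZ dl unfolding alt_def by auto
qed

end

theorem corollary5p7:
  fixes L :: "('s, 'f, 'r) language"
    and \<kappa> :: "'k rel"
    and T :: "('s, 'f, 'r, 'a) fml set"
    and U :: "('s, 'f, 'r, 'a) mstruct"
  assumes "wf_language L"
    and "monster_model L \<kappa> T U"
    and "NIP L U"
    and "infinite (UNIV :: 'i set)"
  shows "(distal TYPE('i) L U \<longleftrightarrow>
            (\<forall>n\<ge>1. \<forall>x y. variable_tuples n x y \<longrightarrow>
               (\<forall>\<phi>\<in>definable_predicates L U no_params ((\<Union>i\<in>{1..n}. x i) \<union> y). \<forall>\<epsilon>>0.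
                  uniformly_definable_strong_EH L \<kappa> T U n x y \<phi> \<epsilon>))) \<and>
         (distal TYPE('i) L U \<longrightarrow>
            (\<forall>n\<ge>1. \<forall>x y. variable_tuples n x y \<longrightarrow>
               (\<forall>\<phi>\<in>definable_predicates L U no_params ((\<Union>i\<in>{1..n}. x i) \<union> y). \<forall>\<epsilon> \<gamma>.
                  0 \<le> \<gamma> \<and> \<gamma> < \<epsilon> \<longrightarrow>
                  (\<exists>z \<psi> \<delta>. predicate_family L U n x z \<psi> \<and> \<delta> > 0 \<and>
                     (\<forall>M \<mu> b \<omega>.
                        small_model L \<kappa> T U M \<and> admissible_measures L U M n x \<mu> \<and>
                        b \<in> tuples M y \<and> product_measure L U M n x \<mu> \<omega> \<and>
                        (\<integral>p. pred_at_type L (\<Union>i\<in>{1..n}. x i) y \<phi> b p \<partial>\<omega>) \<ge> \<epsilon> \<longrightarrow>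
                        (\<exists>d. (\<forall>i\<in>{1..n}. d i \<in> tuples M (z i)) \<and>
                           (\<forall>a\<in>tuples M (\<Union>i\<in>{1..n}. x i).
                              (\<forall>i\<in>{1..n}. pred_at L U (x i) (z i) (\<psi> i) (restrict a (x i)) (d i) > 0) \<longrightarrow>
                              pred_at L U (\<Union>i\<in>{1..n}. x i) y \<phi> a b \<ge> \<gamma>) \<and>
                           (\<forall>i\<in>{1..n}.
                              (\<integral>p. pred_at_type L (x i) (z i) (\<psi> i) (d i) p \<partial>\<mu> i) \<ge> \<delta>)))))))"
proof -
 interpret monster L U \<kappa> T by unfold_locales (insert assms(2), simp_all add: monster_model_def)
 show ?thesis
 proof (intro conjI impI iffI allI ballI)
  fix n x y ph and ep :: real
  assume d: "distal TYPE('i) L U" and n: "1 <= n" and vt: "variable_tuples n x y"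
   and ph: "ph : definable_predicates L U no_params ((UN i:{1..n}. x i) Un y)" and ep: "0 < ep"
  \<comment> \<open>\<open>strong_EH\<close> yields homogeneity up to four times its parameter; it
    is used with \<open>t\<close> = 0.\<close>
  have "0 < ep / 4" using ep by simp
  from strong_EH[OF assms(3) d assms(4) n vt ph this]
  show "uniformly_definable_strong_EH L \<kappa> T U n x y ph ep" unfolding uniformly_definable_strong_EH_def
  proof (elim ex_forward, goal_cases)
   case S: (1 z \<psi> dl)
   show ?case
   proof (intro conjI allI impI, goal_cases)
    case (3 M mu b)
    thus ?case using S[THEN conjunct2, THEN conjunct2, rule_format, of M mu b 0] by auto
   qed (use S in blast)+
  qed
 next
  assume "ALL n>=1. ALL x y. variable_tuples n x y -->
        (ALL ph:definable_predicates L U no_params ((UN i:{1..n}. x i) Un y). ALL ep>0.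
         uniformly_definable_strong_EH L \<kappa> T U n x y ph ep)"
  \<comment> \<open>Two tuples of variables suffice, one for each of the two cuts.\<close>
  from this[rule_format, of 2] show "distal TYPE('i) L U" by (intro EH_imp_distal assms(3)) simp
 next
  fix n x y ph and ep \<gamma> :: real
  assume d: "distal TYPE('i) L U" and n: "1 <= n" and vt: "variable_tuples n x y"
   and ph: "ph : definable_predicates L U no_params ((UN i:{1..n}. x i) Un y)" and \<gamma>: "0 <= \<gamma> & \<gamma> < ep"
  \<comment> \<open>Eight times this parameter is the gap between \<gamma> and
    \<open>ep\<close>.\<close>
  have "0 < (ep - \<gamma>) / 8" using \<gamma> by simp
  from strong_EH[OF assms(3) d assms(4) n vt ph this]
  show "EX z \<psi> dl. predicate_family L U n x z \<psi> & dl > 0 & (ALL M mu b \<omega>.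
            small_model L \<kappa> T U M & admissible_measures L U M n x mu & b : tuples M y & product_measure L U M n x mu \<omega> &
            (\<integral>p. pred_at_type L (UN i:{1..n}. x i) y ph b p \<partial>\<omega>) >= ep -->
            (EX d. (ALL i:{1..n}. d i : tuples M (z i)) & (ALL a:tuples M (UN i:{1..n}. x i).
               (ALL i:{1..n}. pred_at L U (x i) (z i) (\<psi> i) (restrict a (x i)) (d i) > 0) -->
               pred_at L U (UN i:{1..n}. x i) y ph a b >= \<gamma>) & (ALL i:{1..n}.
               (\<integral>p. pred_at_type L (x i) (z i) (\<psi> i) (d i) p \<partial>mu i) >= dl)))"
  proof (elim ex_forward, goal_cases)
   case S: (1 z \<psi> dl)
   show ?case
   proof (intro conjI allI impI, goal_cases)
    case (3 M mu b \<omega>)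
    have "\<gamma> + 8 * ((ep - \<gamma>) / 8) = ep" by (simp add: field_simps)
    from S[THEN conjunct2, THEN conjunct2, THEN spec, THEN spec, THEN spec, THEN spec, of M mu b \<gamma>, unfolded this] 3
    show ?case by blast
   qed (use S in blast)+
  qed
 qed
qed

end
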